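(* The following two statements are equivalent. (A) For every $n\geq 2$, every convex body $K\subset\mathbb{R}^n$ with smooth boundary and positive curvature, every integer $p\geq1$, and every choice of non-negative integers $k_0,\dots,k_p$ with $k_0+\cdots+k_p=n$, the Alesker product of the valuations $\phi_i=V(\,\cdot\,[k_i],K[n-k_i])$, $i=0,\dots,p$, satisfies $$\phi_0\cdots\phi_p\leq \mathrm{vol}_n(K)^p\,\mathrm{vol}_n .$$ (B) For every $n\geq2$, every convex body $K\subset\mathbb{R}^n$, every integer $p\geq1$, and all integers $0\leq k\leq n$ and $0\leq k_i\leq n$, $i=1,\dots,p$, with $k_1+\cdots+k_p=k$, one has $$V(-\Delta_pK[k],\iota_1K[n-k_1],\dots,\iota_pK[n-k_p])\leq \binom{n}{k}\binom{k}{k_1,\dots,k_p}\frac{(n!)^p}{(pn)!}\,\mathrm{vol}_n(K)^p .$$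
   Context: A convex body in $\mathbb{R}^n$ is a (non-empty) compact convex subset. $\mathrm{vol}_m$ is Lebesgue measure on $\mathbb{R}^m$. The mixed volume of convex bodies $K_1,\dots,K_m\subset\mathbb{R}^m$ is $$V(K_1,\dots,K_m)=\frac{1}{m!}\frac{\partial^m}{\partial\lambda_1\cdots\partial\lambda_m}\mathrm{vol}_m(\lambda_1K_1+\cdots+\lambda_mK_m),$$ where $+$ is Minkowski sum and the volume is a homogeneous polynomial in $\lambda_i>0$; $K[j]$ means that $K$ is repeated $j$ times. In (A) the mixed volume is in $\mathbb{R}^n$ and $V(\,\cdot\,[k],K_1,\dots,K_{n-k})$ is the function $L\mapsto V(L[k],K_1,\dots,K_{n-k})$ of convex bodies $L\subset\mathbb{R}^n$; in (B) it is in $\mathbb{R}^{pn}=(\mathbb{R}^n)^p$. $\Delta_p:\mathbb{R}^n\to(\mathbb{R}^n)^p$ is the diagonal embedding $x\mapsto(x,\dots,x)$, $\iota_j:\mathbb{R}^n\to(\mathbb{R}^n)^p$ is the inclusion into the $j$-th factor, and $-A=\{-a\mid a\in A\}$. $\binom{k}{k_1,\dots,k_p}=\frac{k!}{k_1!\cdots k_p!}$. A valuation is a complex-valued function $\phi$ on convex bodies in $\mathbb{R}^n$ with $\phi(K\cup L)=\phi(K)+\phi(L)-\phi(K\cap L)$ whenever $K,L,K\cup L$ are convex bodies. Let $\mathcal{K}_+^\infty(\mathbb{R}^n)$ be the set of convex bodies in $\mathbb{R}^n$ with smooth boundary and positive curvature. The space of smooth, translation invariant valuations is $$\mathrm{Val}^\infty(\mathbb{R}^n)=\mathrm{span}\{V(\,\cdot\,[k],K_1,\dots,K_{n-k})\mid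 0\leq k\leq n,\ K_1,\dots,K_{n-k}\in\mathcal{K}_+^\infty(\mathbb{R}^n)\}.$$ The Alesker product is the bilinear product on $\mathrm{Val}^\infty(\mathbb{R}^n)$ uniquely determined as follows: for $K_1,K_2\in\mathcal{K}^\infty_+(\mathbb{R}^n)$ and $\phi_i(K)=\mathrm{vol}_n(K+K_i)$, $i=1,2$, $$(\phi_1\cdot\phi_2)(K)=\mathrm{vol}_{2n}\big(\Delta_2(K)+K_1\times K_2\big).$$ With it, $\mathrm{Val}^\infty(\mathbb{R}^n)$ is an associative, commutative algebra graded by degree of homogeneity, and its subspace of $n$-homogeneous valuations is spanned by $\mathrm{vol}_n$. The product $\phi_0\cdots\phi_p$ in (A) is $n$-homogeneous, hence a multiple of $\mathrm{vol}_n$, and the inequality is between functions on convex bodies (equivalently, between the coefficients of $\mathrm{vol}_n$). *)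

theory Defs
  imports
    "HOL-Analysis.Analysis"
    "HOL-Library.Function_Algebras"
    "HOL-Library.Set_Algebras"
    "HOL-Library.Complex_Order"
begin

text \<open>
  The dimension is quantified inside the statements below, and bodies in dimensions
  \<open>n\<close> and \<open>p * n\<close> occur together. Hence the space of dimension \<open>n\<close> is the library's
  \<^const>\<open>Euclidean_space\<close> \<open>n\<close>, whose points are the functions \<open>x :: nat \<Rightarrow> real\<close> with
  \<open>x i = 0\<close> for \<open>i \<ge> n\<close>. The sum \<open>A + B\<close> of two sets is the Minkowski sum of
  \<^theory>\<open>HOL-Library.Set_Algebras\<close>; note that \<open>- A\<close> is the complement of a set, so the
  reflected body is written \<open>uminus ` A\<close>.
\<close>

instantiation "fun" :: (type, scaleR) scaleR
begin

definition scaleR_fun :: "real \<Rightarrow> ('a \<Rightarrow> 'b) \<Rightarrow> 'a \<Rightarrow> 'b"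
  where "scaleR_fun c f = (\<lambda>x. c *\<^sub>R f x)"

instance ..

end

instance "fun" :: (type, real_vector) real_vector
  by standard (simp_all add: scaleR_fun_def fun_eq_iff scaleR_add_right scaleR_add_left)

definition vol :: "nat \<Rightarrow> (nat \<Rightarrow> real) set \<Rightarrow> real"
  where "vol n A = measure (\<Pi>\<^sub>M i\<in>{..<n}. lborel) ((\<lambda>x. restrict x {..<n}) ` A)"

definition convex_body :: "nat \<Rightarrow> (nat \<Rightarrow> real) set \<Rightarrow> bool"
  where "convex_body n K \<longleftrightarrow> K \<noteq> {} \<and> convex K \<and> compactin (Euclidean_space n) K"


subsection \<open>Mixed volumes\<close>

definition partial_deriv :: "nat \<Rightarrow> ((nat \<Rightarrow> real) \<Rightarrow> real) \<Rightarrow> (nat \<Rightarrow> real) \<Rightarrow> real"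
  where "partial_deriv i f x = deriv (\<lambda>t. f (x(i := t))) (x i)"

text \<open>
  The bodies are listed with repetitions. For \<open>m\<close> convex bodies in dimension \<open>m\<close> the volume
  is a homogeneous polynomial of degree \<open>m\<close> in the positive parameters \<open>c i\<close>, so its mixed
  partial derivative is constant there; it is evaluated at \<open>(1, \<dots>, 1)\<close>.
\<close>

definition mixed_volume :: "nat \<Rightarrow> (nat \<Rightarrow> real) set list \<Rightarrow> real"
  where "mixed_volume m Ks =
    1 / fact m *
    foldr partial_deriv [0..<m] (\<lambda>c. vol m (\<Sum>i<m. (\<lambda>x. c i *\<^sub>R x) ` (Ks ! i))) (\<lambda>_. 1)"


subsection \<open>Bodies with smooth boundary and positive curvature\<close>

primrec Ck_on :: "nat \<Rightarrow> nat \<Rightarrow> (nat \<Rightarrow> real) set \<Rightarrow> ((nat \<Rightarrow> real) \<Rightarrow> real) \<Rightarrow> bool"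
  where
    "Ck_on n 0 U f \<longleftrightarrow> continuous_map (subtopology (Euclidean_space n) U) euclideanreal f"
  | "Ck_on n (Suc k) U f \<longleftrightarrow>
       continuous_map (subtopology (Euclidean_space n) U) euclideanreal f \<and>
       (\<forall>i<n. (\<forall>x\<in>U. (\<lambda>t. f (x(i := t))) field_differentiable (at (x i))) \<and>
              Ck_on n k U (partial_deriv i f))"

definition smooth_on :: "nat \<Rightarrow> (nat \<Rightarrow> real) set \<Rightarrow> ((nat \<Rightarrow> real) \<Rightarrow> real) \<Rightarrow> bool"
  where "smooth_on n U f \<longleftrightarrow> (\<forall>k. Ck_on n k U f)"

definition gradient_norm :: "nat \<Rightarrow> ((nat \<Rightarrow> real) \<Rightarrow> real) \<Rightarrow> (nat \<Rightarrow> real) \<Rightarrow> real"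
  where "gradient_norm n f x = sqrt (\<Sum>i<n. (partial_deriv i f x)\<^sup>2)"

definition level_tangent_space ::
    "nat \<Rightarrow> ((nat \<Rightarrow> real) \<Rightarrow> real) \<Rightarrow> (nat \<Rightarrow> real) \<Rightarrow> (nat \<Rightarrow> real) set"
  where "level_tangent_space n f x =
    {v \<in> topspace (Euclidean_space n). (\<Sum>i<n. partial_deriv i f x * v i) = 0}"

text \<open>
  The second fundamental form at \<open>x\<close> of the level hypersurface of \<open>f\<close> through \<open>x\<close>, with the
  sign for which it is positive on spheres bounding \<open>{y. f y \<le> 0}\<close>: differentiating the unit
  normal \<open>\<nabla>f / |\<nabla>f|\<close> along tangent vectors gives the Hessian of \<open>f\<close> divided by \<open>|\<nabla>f|\<close>.
\<close>

definition second_fundamental_form ::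
    "nat \<Rightarrow> ((nat \<Rightarrow> real) \<Rightarrow> real) \<Rightarrow> (nat \<Rightarrow> real) \<Rightarrow> (nat \<Rightarrow> real) \<Rightarrow> (nat \<Rightarrow> real) \<Rightarrow> real"
  where "second_fundamental_form n f x v w =
    (\<Sum>i<n. \<Sum>j<n. partial_deriv i (partial_deriv j f) x * v i * w j) / gradient_norm n f x"

text \<open>
  Near each boundary point the body is a regular sublevel set of a smooth function (so it is a
  domain with smooth boundary), and all principal curvatures, i.e. the eigenvalues of the
  second fundamental form on the tangent space, are positive.
\<close>

definition smooth_convex_bodies :: "nat \<Rightarrow> (nat \<Rightarrow> real) set set"
  where "smooth_convex_bodies n =
    {K. convex_body n K \<and>
        (\<forall>x \<in> Euclidean_space n frontier_of K. \<exists>U f.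
           openin (Euclidean_space n) U \<and> x \<in> U \<and> smooth_on n U f \<and>
           K \<inter> U = {y \<in> U. f y \<le> 0} \<and>
           gradient_norm n f x \<noteq> 0 \<and>
           (\<forall>v \<in> level_tangent_space n f x. v \<noteq> 0 \<longrightarrow> second_fundamental_form n f x v v > 0))}"


subsection \<open>The diagonal embedding and the inclusions of the factors\<close>

text \<open>
  The \<open>p\<close>-th power of the \<open>n\<close>-dimensional space is the space of dimension \<open>p * n\<close>, where
  coordinate \<open>i < n\<close> of the \<open>j\<close>-th factor, \<open>1 \<le> j \<le> p\<close>, is coordinate \<open>(j - 1) * n + i\<close>.
\<close>

definition diag_embed :: "nat \<Rightarrow> nat \<Rightarrow> (nat \<Rightarrow> real) \<Rightarrow> nat \<Rightarrow> real"
  where "diag_embed n p x = (\<lambda>i. if i < p * n then x (i mod n) else 0)"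

definition factor_incl :: "nat \<Rightarrow> nat \<Rightarrow> (nat \<Rightarrow> real) \<Rightarrow> nat \<Rightarrow> real"
  where "factor_incl n j x =
    (\<lambda>i. if (j - 1) * n \<le> i \<and> i < j * n then x (i - (j - 1) * n) else 0)"

definition body_product :: "nat \<Rightarrow> (nat \<Rightarrow> real) set \<Rightarrow> (nat \<Rightarrow> real) set \<Rightarrow> (nat \<Rightarrow> real) set"
  where "body_product n K L = {factor_incl n 1 x + factor_incl n 2 y | x y. x \<in> K \<and> y \<in> L}"


subsection \<open>Smooth valuations and the Alesker product\<close>

text \<open>
  A function on convex bodies is represented by its extension by \<open>0\<close> to all sets, so that
  equality of representatives is equality as functions on convex bodies.
\<close>

definition on_bodies ::
    "nat \<Rightarrow> ((nat \<Rightarrow> real) set \<Rightarrow> complex) \<Rightarrow> (nat \<Rightarrow> real) set \<Rightarrow> complex"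
  where "on_bodies n \<phi> = (\<lambda>L. if convex_body n L then \<phi> L else 0)"

definition mixed_valuation ::
    "nat \<Rightarrow> nat \<Rightarrow> (nat \<Rightarrow> real) set list \<Rightarrow> (nat \<Rightarrow> real) set \<Rightarrow> complex"
  where "mixed_valuation n k Ks =
    on_bodies n (\<lambda>L. complex_of_real (mixed_volume n (replicate k L @ Ks)))"

definition scale_val ::
    "complex \<Rightarrow> ((nat \<Rightarrow> real) set \<Rightarrow> complex) \<Rightarrow> (nat \<Rightarrow> real) set \<Rightarrow> complex"
  where "scale_val c \<phi> = (\<lambda>L. c * \<phi> L)"

lemma vector_space_scale_val: "vector_space scale_val"
  by unfold_locales (simp_all add: scale_val_def fun_eq_iff algebra_simps)

definition smooth_valuations :: "nat \<Rightarrow> ((nat \<Rightarrow> real) set \<Rightarrow> complex) set"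
  where "smooth_valuations n = module.span scale_val
    {mixed_valuation n k Ks | k Ks.
       k \<le> n \<and> length Ks = n - k \<and> set Ks \<subseteq> smooth_convex_bodies n}"

text \<open>
  The Alesker product is characterized as in its definition: it is the bilinear product on the
  smooth valuations with the prescribed values on the valuations \<open>K \<mapsto> vol (K + K\<^sub>i)\<close>. Arguments
  outside of the smooth valuations are irrelevant.
\<close>

definition is_alesker_product ::
    "nat \<Rightarrow> (((nat \<Rightarrow> real) set \<Rightarrow> complex) \<Rightarrow> ((nat \<Rightarrow> real) set \<Rightarrow> complex) \<Rightarrow>
            ((nat \<Rightarrow> real) set \<Rightarrow> complex)) \<Rightarrow> bool"
  where "is_alesker_product n P \<longleftrightarrow>
    (\<forall>\<phi>\<in>smooth_valuations n. \<forall>\<psi>\<in>smooth_valuations n. P \<phi> \<psi> \<in> smooth_valuations n) \<and>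
    (\<forall>\<phi>\<in>smooth_valuations n. \<forall>\<phi>'\<in>smooth_valuations n. \<forall>\<psi>\<in>smooth_valuations n.
       P (\<phi> + \<phi>') \<psi> = P \<phi> \<psi> + P \<phi>' \<psi> \<and> P \<psi> (\<phi> + \<phi>') = P \<psi> \<phi> + P \<psi> \<phi>') \<and>
    (\<forall>c. \<forall>\<phi>\<in>smooth_valuations n. \<forall>\<psi>\<in>smooth_valuations n.
       P (scale_val c \<phi>) \<psi> = scale_val c (P \<phi> \<psi>) \<and>
       P \<phi> (scale_val c \<psi>) = scale_val c (P \<phi> \<psi>)) \<and>
    (\<forall>K1\<in>smooth_convex_bodies n. \<forall>K2\<in>smooth_convex_bodies n.
       P (on_bodies n (\<lambda>K. complex_of_real (vol n (K + K1))))
         (on_bodies n (\<lambda>K. complex_of_real (vol n (K + K2)))) =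
       on_bodies n (\<lambda>K. complex_of_real (vol (2 * n) (diag_embed n 2 ` K + body_product n K1 K2))))"

end

theory Submission
  imports Defs
begin

text \<open>
  Let \<open>K\<close> be smooth. By Fubini, the product of the valuations \<open>L \<mapsto> vol (L + M\<^sub>i)\<close> has the value
  \<open>vol (\<Delta> L + M\<^sub>0 \<times> \<dots> \<times> M\<^sub>p)\<close> at \<open>L\<close>. Since the factors in (A) are combinations of
  \<open>L \<mapsto> vol (L + t K)\<close> by Steiner's formula, their product is a multiple of a coefficient of the polynomial
  \<open>Q(c) = vol (\<Delta> L + c\<^sub>0 K \<times> \<dots> \<times> c\<^sub>p K)\<close>. A shear shows that \<open>Q(c)\<close> lies between \<open>vol L \<cdot> V(c)\<close> and
  \<open>vol (L + c\<^sub>0 K) \<cdot> V(c)\<close>, where \<open>V(c)\<close> is the volume of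
  \<open>- c\<^sub>0 \<Delta> K + c\<^sub>1 \<iota>\<^sub>1 K + \<dots> + c\<^sub>p \<iota>\<^sub>p K\<close>. As \<open>V\<close> is homogeneous of degree \<open>p n\<close>, letting \<open>c\<close> tend to \<open>0\<close>
  shows that the coefficients of degree \<open>p n\<close> of \<open>Q\<close> are those of \<open>vol L \<cdot> V\<close>, that is, the mixed volumes
  in (B) up to factorials. So (A) and (B) agree for smooth bodies, and (B) extends to all convex
  bodies by outer approximation.
\<close>

text \<open>The product is prescribed only on the valuations \<open>vol_sum n M\<close> with
  \<open>M\<close> smooth, while \<open>smooth_valuations\<close> is spanned by mixed volumes with
  several different bodies. Polarization reduces the latter to the former, but the bodies it
  produces are Minkowski combinations of the given ones. Hence smoothness with positive curvature
  must be stable under Minkowski sums; the implicit function theorem and the elimination of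
  variables by minimization serve this purpose. Coefficients of polynomials are always read off by
  Lagrange interpolation, so that linear operations and limits pass to them from finitely many
  values. The constants: put \<alpha>_i = n - k_i. The factor phi_i is the coefficient of
  t^\<alpha>_i in vol (L + t K) divided by \<open>n choose \<alpha>_i\<close>, and a mixed volume in
  dimension p n is a coefficient times the product of all \<alpha>_i! divided by (p n)!. As
  \<alpha>_i! times \<open>n choose \<alpha>_i\<close> is n! / k_i!, the bound in (A) becomes
  n!^(p+1) / ((p n)! k_0! ... k_p!). This is the constant in (B) for k_0 = n - k, so the reflected
  diagonal, repeated k = \<alpha>_0 times, takes the place of the factor phi_0.\<close>

definition Rn :: "nat \<Rightarrow> (nat \<Rightarrow> real) set"
  where "Rn n = {x. \<forall>i\<ge>n. x i = 0}"

text \<open>Lebesgue measure of the subspace \<open>Rn n\<close>, pushed forward to the Borel sets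
  of the type of all sequences, where the complement of \<open>Rn n\<close> is a null set. Bodies of
  all dimensions thus live in one topological type.\<close>

definition lm :: "nat \<Rightarrow> (nat \<Rightarrow> real) measure"
  where "lm n = distr (\<Pi>\<^sub>M i\<in>{..<n}. lborel) borel (\<lambda>x i. if i < n then x i else 0)"

text \<open>Balls of the maximum norm serve as balls throughout: they are rectangles for the
  measure, polytopes for the approximation, and their radii add under Minkowski sums.\<close>

definition Box :: "nat \<Rightarrow> real \<Rightarrow> (nat \<Rightarrow> real) set"
  where "Box n r = {x \<in> Rn n. \<forall>i<n. \<bar>x i\<bar> \<le> r}"

definition dil :: "real \<Rightarrow> (nat \<Rightarrow> real) set \<Rightarrow> (nat \<Rightarrow> real) set"
  where "dil c A = (\<lambda>x. c *\<^sub>R x) ` A"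

definition trl :: "(nat \<Rightarrow> real) \<Rightarrow> (nat \<Rightarrow> real) set \<Rightarrow> (nat \<Rightarrow> real) set"
  where "trl a A = (\<lambda>x. x + a) ` A"

section \<open>Lebesgue measure and compact sets in the coordinate subspaces\<close>

lemma Euclidean_space_Rn: "Euclidean_space n = top_of_set (Rn n)"
  by (simp add: Euclidean_space_def Rn_def euclidean_product_topology)

lemma topspace_Rn [simp]: "topspace (Euclidean_space n) = Rn n"
  by (simp add: Euclidean_space_Rn)

lemma convex_body_iff:
  "convex_body n K \<longleftrightarrow> K \<noteq> {} \<and> convex K \<and> compact K \<and> K \<subseteq> Rn n"
  by (auto simp: convex_body_def Euclidean_space_Rn compactin_subtopology)

lemma scaleR_fun_apply: "(c *\<^sub>R x) i = c *\<^sub>R x i"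
  by (simp add: scaleR_fun_def)

lemma zero_in_Rn [simp]: "0 \<in> Rn n"
  by (simp add: Rn_def)

lemma Rn_add: "x \<in> Rn n \<Longrightarrow> y \<in> Rn n \<Longrightarrow> x + y \<in> Rn n"
  by (simp add: Rn_def)

lemma Rn_diff: "x \<in> Rn n \<Longrightarrow> y \<in> Rn n \<Longrightarrow> x - y \<in> Rn n"
  by (simp add: Rn_def)

lemma Rn_minus: "x \<in> Rn n \<Longrightarrow> - x \<in> Rn n"
  by (simp add: Rn_def)

lemma Rn_scale: "x \<in> Rn n \<Longrightarrow> c *\<^sub>R x \<in> Rn n"
  by (simp add: Rn_def scaleR_fun_apply)

lemma closed_Rn: "closed (Rn n)"
  using closedin_Euclidean_imp_closed[of n "Rn n"] by (metis closedin_topspace topspace_Rn)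

lemma continuous_on_fun_iff:
  fixes f :: "'a::topological_space \<Rightarrow> nat \<Rightarrow> real"
  shows "continuous_on S f \<longleftrightarrow> (\<forall>i. continuous_on S (\<lambda>x. f x i))"
  using continuous_on_coordinatewise_then_product[of S f] continuous_on_product_then_coordinatewise[of S f]
  by auto

lemma continuous_coord [continuous_intros, simp]:
  "continuous_on S (\<lambda>x::nat \<Rightarrow> real. x i)"
  by (rule continuous_on_subset[OF continuous_on_product_coordinates]) simp

lemma measurable_coord: "(\<lambda>x::nat \<Rightarrow> real. x i) \<in> borel_measurable borel"
  by (intro borel_measurable_continuous_onI continuous_on_product_coordinates)

lemma measurable_extend:
  "(\<lambda>x (i::nat). if i < n then x i else 0 :: real) \<in> measurable (\<Pi>\<^sub>M i\<in>{..<n}. lborel) borel"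
proof (rule measurable_coordinatewise_then_product)
  fix i
  show "(\<lambda>x. if i < n then x i else 0 :: real) \<in> borel_measurable (\<Pi>\<^sub>M i\<in>{..<n}. lborel)"
    by (cases "i < n") (simp_all add: measurable_component_singleton)
qed

lemma sets_lm [simp]: "sets (lm n) = sets borel"
  by (simp add: lm_def)

lemma space_lm [simp]: "space (lm n) = UNIV"
  by (simp add: lm_def)

lemma emeasure_lm:
  assumes "A \<in> sets borel" "A \<subseteq> Rn n"
  shows "emeasure (lm n) A = emeasure (\<Pi>\<^sub>M i\<in>{..<n}. lborel) ((\<lambda>x. restrict x {..<n}) ` A)"
proof -
  let ?e = "\<lambda>x i. if i < n then x i else 0 :: real"
  let ?P = "\<Pi>\<^sub>M i\<in>{..<n}. (lborel :: real measure)"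
  have "?e -` A \<inter> space ?P = (\<lambda>x. restrict x {..<n}) ` A"
  proof (intro equalityI subsetI)
    fix x assume x: "x \<in> ?e -` A \<inter> space ?P"
    then have "x = restrict (?e x) {..<n}"
      by (auto simp: fun_eq_iff space_PiM PiE_def extensional_def)
    with x show "x \<in> (\<lambda>x. restrict x {..<n}) ` A" by auto
  next
    fix x assume "x \<in> (\<lambda>x. restrict x {..<n}) ` A"
    then obtain a where a: "a \<in> A" "x = restrict a {..<n}" by auto
    then have "?e x = a" using assms(2) by (auto simp: fun_eq_iff Rn_def)
    with a show "x \<in> ?e -` A \<inter> space ?P" by (auto simp: space_PiM)
  qed
  then show ?thesis using assms(1) by (simp add: lm_def emeasure_distr[OF measurable_extend])
qed

lemma vol_lm: "A \<in> sets borel \<Longrightarrow> A \<subseteq> Rn n \<Longrightarrow> vol n A = measure (lm n) A"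
  by (simp add: vol_def measure_def emeasure_lm)

lemma vol_compact: "compact A \<Longrightarrow> A \<subseteq> Rn n \<Longrightarrow> vol n A = measure (lm n) A"
  by (simp add: vol_lm borel_compact)

lemma vol_nonneg [simp]: "0 \<le> vol n A"
  by (simp add: vol_def)

lemma vol_empty [simp]: "vol n {} = 0"
  by (simp add: vol_def)

interpretation lborel_product: product_sigma_finite "\<lambda>_::nat. lborel :: real measure"
  by standard

lemma AE_lm_Rn: "emeasure (lm n) (- Rn n) = 0"
proof -
  have "- Rn n \<in> sets borel" using closed_Rn by auto
  moreover have "(\<lambda>x i. if i < n then x i else 0 :: real) -` (- Rn n) = {}"
    by (auto simp: Rn_def)
  ultimately show ?thesis by (simp add: lm_def emeasure_distr[OF measurable_extend])
qed

lemma rect_borel: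
  assumes "\<And>i. i < n \<Longrightarrow> B i \<in> sets borel"
  shows "{x::nat \<Rightarrow> real. \<forall>i<n. x i \<in> B i} \<in> sets borel"
  using assms
proof (induction n)
  case (Suc n)
  have 1: "{x::nat \<Rightarrow> real. \<forall>i<n. x i \<in> B i} \<in> sets borel"
    by (rule Suc.IH) (rule Suc.prems, simp)
  have 2: "(\<lambda>x::nat \<Rightarrow> real. x n) -` B n \<in> sets borel"
    by (rule measurable_sets_borel[OF measurable_coord]) (rule Suc.prems, simp)
  have "{x::nat \<Rightarrow> real. \<forall>i<Suc n. x i \<in> B i} = {x. \<forall>i<n. x i \<in> B i} \<inter> (\<lambda>x. x n) -` B n"
    by (auto simp: less_Suc_eq)
  then show ?case using sets.Int[OF 1 2] by (rule ssubst)
qed simp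

lemma emeasure_lm_rect:
  assumes "\<And>i. i < n \<Longrightarrow> A i \<in> sets borel"
  shows "emeasure (lm n) {x \<in> Rn n. \<forall>i<n. x i \<in> A i} = (\<Prod>i<n. emeasure lborel (A i))"
proof -
  have b: "{x \<in> Rn n. \<forall>i<n. x i \<in> A i} \<in> sets borel"
  proof -
    have "{x. \<forall>i<n. x i \<in> A i} \<in> sets borel" by (rule rect_borel) (rule assms)
    from sets.Int[OF borel_closed[OF closed_Rn[of n]] this]
    have "Rn n \<inter> {x. \<forall>i<n. x i \<in> A i} \<in> sets borel" .
    moreover have "Rn n \<inter> {x. \<forall>i<n. x i \<in> A i} = {x \<in> Rn n. \<forall>i<n. x i \<in> A i}" by blast
    ultimately show ?thesis by (rule subst[of _ _ "\<lambda>X. X \<in> sets borel", rotated])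
  qed
  have "(\<lambda>x. restrict x {..<n}) ` {x \<in> Rn n. \<forall>i<n. x i \<in> A i} = PiE {..<n} A"
  proof (intro equalityI subsetI)
    fix y assume y: "y \<in> PiE {..<n} A"
    then have "y = restrict (\<lambda>i. if i < n then y i else 0) {..<n}"
      by (auto simp: fun_eq_iff PiE_def extensional_def)
    then show "y \<in> (\<lambda>x. restrict x {..<n}) ` {x \<in> Rn n. \<forall>i<n. x i \<in> A i}"
      by (rule image_eqI[of _ "\<lambda>x. restrict x {..<n}"]) (use y in \<open>auto simp: Rn_def PiE_iff\<close>)
  qed (auto simp: PiE_iff extensional_def restrict_def)
  then show ?thesis
    using emeasure_lm[OF b, of n] lborel_product.emeasure_PiM[of "{..<n}" A] assms by auto
qed

lemma compact_coord_bounded: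
  fixes A :: "(nat \<Rightarrow> real) set"
  assumes "compact A"
  obtains R where "R > 0" "\<And>x i. x \<in> A \<Longrightarrow> i < n \<Longrightarrow> \<bar>x i\<bar> \<le> R"
proof -
  have "\<exists>R. \<forall>x\<in>A. \<bar>x i\<bar> \<le> R" for i
  proof -
    have "compact ((\<lambda>x. x i) ` A)"
      by (intro compact_continuous_image assms continuous_coord)
    then show ?thesis by (auto dest!: compact_imp_bounded simp: bounded_iff)
  qed
  then obtain R where R: "\<And>i x. x \<in> A \<Longrightarrow> \<bar>x i\<bar> \<le> R i" by metis
  show ?thesis
  proof (rule that[of "1 + (\<Sum>i<n. \<bar>R i\<bar>)"])
    show "0 < 1 + (\<Sum>i<n. \<bar>R i\<bar>)" by (smt (verit) sum_nonneg abs_ge_zero)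
    fix x i assume xi: "x \<in> A" "i < n"
    have "\<bar>R i\<bar> \<le> (\<Sum>i<n. \<bar>R i\<bar>)" by (rule member_le_sum) (use xi in auto)
    then show "\<bar>x i\<bar> \<le> 1 + (\<Sum>i<n. \<bar>R i\<bar>)" using R[OF xi(1), of i] by linarith
  qed
qed

lemma emeasure_Box: "0 \<le> r \<Longrightarrow> emeasure (lm n) (Box n r) = ennreal ((2 * r) ^ n)"
proof -
  assume r: "0 \<le> r"
  have "Box n r = {x \<in> Rn n. \<forall>i<n. x i \<in> {-r..r}}"
    by (auto simp: Box_def abs_le_iff)
  then show ?thesis using emeasure_lm_rect[of n "\<lambda>_. {-r..r}"] r
    by (simp add: ennreal_power)
qed

lemma Box_subset: "Box n r \<subseteq> Rn n"
  by (auto simp: Box_def)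

lemma closed_Box: "closed (Box n r)"
proof -
  have "closed {x::nat\<Rightarrow>real. i < n \<longrightarrow> \<bar>x i\<bar> \<le> r}" for i
    by (cases "i < n") (auto intro!: closed_Collect_le continuous_on_rabs continuous_coord)
  then have "closed {x::nat\<Rightarrow>real. \<forall>i. i < n \<longrightarrow> \<bar>x i\<bar> \<le> r}"
    by (rule closed_Collect_all)
  moreover have "Box n r = Rn n \<inter> {x::nat\<Rightarrow>real. \<forall>i. i < n \<longrightarrow> \<bar>x i\<bar> \<le> r}" by (auto simp: Box_def)
  ultimately show ?thesis using closed_Rn by auto
qed

lemma compact_Box: "compact (Box n r)"
proof -
  let ?B = "\<lambda>i. if i < n then {-r..r} else {0::real}"
  have "compactin (product_topology (\<lambda>_. euclidean) UNIV) (PiE UNIV ?B)"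
    by (subst compactin_PiE) auto
  then have "compact (PiE UNIV ?B)" by (simp add: euclidean_product_topology)
  moreover have "PiE UNIV ?B = Box n r"
  proof (intro equalityI subsetI)
    fix x assume x: "x \<in> PiE UNIV ?B"
    have "x i \<in> ?B i" for i using PiE_mem[OF x, of i] by simp
    then show "x \<in> Box n r" unfolding Box_def Rn_def by (smt (verit, best) abs_le_iff atLeastAtMost_iff linorder_not_less mem_Collect_eq singletonD)
  next
    fix x assume "x \<in> Box n r"
    then show "x \<in> PiE UNIV ?B" by (auto simp: Box_def Rn_def abs_le_iff)
  qed
  ultimately show ?thesis by simp
qed

lemma compact_subset_Box:
  assumes "compact A" "A \<subseteq> Rn n"
  obtains R where "R > 0" "A \<subseteq> Box n R"
proof -
  obtain R where "R > 0" "\<And>x i. x \<in> A \<Longrightarrow> i < n \<Longrightarrow> \<bar>x i\<bar> \<le> R"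
    using compact_coord_bounded[OF assms(1), of n] by metis
  then show ?thesis using that[of R] assms(2) by (auto simp: Box_def)
qed

lemma emeasure_compact_finite:
  assumes "compact A" "A \<subseteq> Rn n"
  shows "emeasure (lm n) A < \<infinity>"
proof -
  obtain R where R: "R > 0" "A \<subseteq> Box n R" using compact_subset_Box[OF assms] by metis
  have "emeasure (lm n) A \<le> emeasure (lm n) (Box n R)"
    by (rule emeasure_mono) (use R closed_Box in auto)
  also have "\<dots> < \<infinity>" using R by (simp add: emeasure_Box)
  finally show ?thesis .
qed

lemma fmeasurable_compact:
  "compact A \<Longrightarrow> A \<subseteq> Rn n \<Longrightarrow> A \<in> fmeasurable (lm n)"
  by (auto intro!: fmeasurableI emeasure_compact_finite borel_compact)

lemma emeasure_vol:
  "compact A \<Longrightarrow> A \<subseteq> Rn n \<Longrightarrow> emeasure (lm n) A = ennreal (vol n A)"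
  using emeasure_compact_finite[of A n] by (simp add: vol_compact emeasure_eq_ennreal_measure)

lemma vol_mono:
  "compact A \<Longrightarrow> compact B \<Longrightarrow> B \<subseteq> Rn n \<Longrightarrow> A \<subseteq> B \<Longrightarrow> vol n A \<le> vol n B"
  using measure_mono_fmeasurable[of A B "lm n"]
  by (auto simp: vol_compact fmeasurable_compact borel_compact)

lemma vol_Box: "0 \<le> r \<Longrightarrow> vol n (Box n r) = (2 * r) ^ n"
  using emeasure_Box[of r n] vol_compact[OF compact_Box[of n r]] by (simp add: measure_def Box_subset)

subsection \<open>Translations and dilations\<close>

text \<open>Uniqueness of product measures. It reduces translation invariance, scaling and the
  splitting into blocks of coordinates to a computation on rectangles.\<close>

lemma lm_eqI:
  assumes T: "T \<in> measurable M borel" "\<And>x. x \<in> space M \<Longrightarrow> T x \<in> Rn n"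
  assumes e: "\<And>A. (\<And>i. i < n \<Longrightarrow> A i \<in> sets borel) \<Longrightarrow>
    emeasure M {x \<in> space M. \<forall>i<n. T x i \<in> A i} = (\<Prod>i<n. emeasure lborel (A i))"
  shows "lm n = distr M borel T"
proof -
  let ?P = "\<Pi>\<^sub>M i\<in>{..<n}. (lborel :: real measure)"
  let ?e = "\<lambda>x i. if i < n then x i else 0 :: real"
  have r: "(\<lambda>x. restrict (T x) {..<n}) \<in> measurable M ?P"
    by (intro measurable_restrict) (use measurable_compose[OF T(1) measurable_coord] in auto)
  have "distr M ?P (\<lambda>x. restrict (T x) {..<n}) = ?P"
  proof (rule lborel_product.PiM_eqI)
    fix A :: "nat \<Rightarrow> real set" assume A: "\<And>i. i \<in> {..<n} \<Longrightarrow> A i \<in> sets lborel"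
    have "(\<lambda>x. restrict (T x) {..<n}) -` (PiE {..<n} A) \<inter> space M = {x \<in> space M. \<forall>i<n. T x i \<in> A i}"
      by (auto simp: PiE_def Pi_def)
    moreover have "PiE {..<n} A \<in> sets ?P" by (rule sets_PiM_I_finite) (use A in auto)
    ultimately show "emeasure (distr M ?P (\<lambda>x. restrict (T x) {..<n})) (PiE {..<n} A) =
        (\<Prod>i\<in>{..<n}. emeasure lborel (A i))"
      using e[of A] A by (simp add: emeasure_distr[OF r])
  qed auto
  then have "lm n = distr (distr M ?P (\<lambda>x. restrict (T x) {..<n})) borel ?e"
    by (simp add: lm_def)
  also have "\<dots> = distr M borel (?e \<circ> (\<lambda>x. restrict (T x) {..<n}))"
    by (rule distr_distr[OF measurable_extend r])
  also have "\<dots> = distr M borel T"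
    by (rule distr_cong) (use T(2) in \<open>auto simp: fun_eq_iff Rn_def\<close>)
  finally show ?thesis .
qed


lemma continuous_on_fun_add [continuous_intros]:
  fixes f g :: "'a::topological_space \<Rightarrow> nat \<Rightarrow> real"
  shows "continuous_on S f \<Longrightarrow> continuous_on S g \<Longrightarrow> continuous_on S (\<lambda>x. f x + g x)"
  by (simp add: continuous_on_fun_iff continuous_on_add)

lemma continuous_on_fun_diff [continuous_intros]:
  fixes f g :: "'a::topological_space \<Rightarrow> nat \<Rightarrow> real"
  shows "continuous_on S f \<Longrightarrow> continuous_on S g \<Longrightarrow> continuous_on S (\<lambda>x. f x - g x)"
  by (simp add: continuous_on_fun_iff continuous_on_diff)

lemma continuous_on_fun_minus [continuous_intros]:
  fixes f :: "'a::topological_space \<Rightarrow> nat \<Rightarrow> real"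
  shows "continuous_on S f \<Longrightarrow> continuous_on S (\<lambda>x. - f x)"
  by (simp add: continuous_on_fun_iff continuous_on_minus)

lemma continuous_on_fun_scaleR [continuous_intros]:
  fixes f :: "'a::topological_space \<Rightarrow> nat \<Rightarrow> real"
  shows "continuous_on S c \<Longrightarrow> continuous_on S f \<Longrightarrow> continuous_on S (\<lambda>x. c x *\<^sub>R f x)"
  by (simp add: continuous_on_fun_iff continuous_on_mult scaleR_fun_apply)

abbreviation PiL :: "nat \<Rightarrow> (nat \<Rightarrow> real) measure"
  where "PiL n \<equiv> \<Pi>\<^sub>M i\<in>{..<n}. lborel"

lemma emeasure_PiL_rect:
  assumes "\<And>i. i < n \<Longrightarrow> B i \<in> sets borel"
  shows "emeasure (PiL n) {x \<in> space (PiL n). \<forall>i<n. x i \<in> B i} = (\<Prod>i<n. emeasure lborel (B i))"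
proof -
  have "emeasure (PiL n) (PiE {..<n} B) = (\<Prod>i\<in>{..<n}. emeasure lborel (B i))"
    by (rule lborel_product.emeasure_PiM) (use assms in auto)
  moreover
  have "{x \<in> space (PiL n). \<forall>i<n. x i \<in> B i} = PiE {..<n} B"
    by (auto simp: space_PiM PiE_def)
  ultimately show ?thesis by simp
qed

lemma lm_translate:
  assumes "a \<in> Rn n"
  shows "lm n = distr (lm n) borel (\<lambda>x. x + a)"
proof -
  let ?T = "\<lambda>x i. if i < n then x i + a i else 0"
  have T: "?T \<in> measurable (PiL n) borel"
  proof (rule measurable_coordinatewise_then_product)
    fix i
    show "(\<lambda>x. if i < n then x i + a i else 0 :: real) \<in> borel_measurable (PiL n)"
      by (cases "i < n") (auto intro!: borel_measurable_add measurable_component_singleton[of i "{..<n}" "\<lambda>_. lborel", simplified])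
  qed
  have "lm n = distr (PiL n) borel ?T"
  proof (rule lm_eqI[OF T])
    fix A :: "nat \<Rightarrow> real set" assume A: "\<And>i. i < n \<Longrightarrow> A i \<in> sets borel"
    have B: "(\<lambda>t. a i + t) -` A i \<in> sets borel" if "i < n" for i
      by (rule measurable_sets_borel[of "\<lambda>t. a i + t" borel]) (use A that in auto)
    have "emeasure (PiL n) {x \<in> space (PiL n). \<forall>i<n. ?T x i \<in> A i}
      = emeasure (PiL n) {x \<in> space (PiL n). \<forall>i<n. x i \<in> (\<lambda>t. a i + t) -` A i}"
      by (rule arg_cong[of _ _ "emeasure _"]) (auto simp: add.commute)
    also have "\<dots> = (\<Prod>i<n. emeasure lborel ((\<lambda>t. a i + t) -` A i))"
      using emeasure_PiL_rect[OF B] .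
    also have "\<dots> = (\<Prod>i<n. emeasure lborel (A i))"
    proof (rule prod.cong)
      fix i assume i: "i \<in> {..<n}"
      have "emeasure lborel (A i) = emeasure (distr lborel borel ((+) (a i))) (A i)"
        using lborel_distr_plus[of "a i"] by simp
      also have "\<dots> = emeasure lborel ((\<lambda>t. a i + t) -` A i)"
        using A i by (subst emeasure_distr) auto
      finally show "emeasure lborel ((\<lambda>t. a i + t) -` A i) = emeasure lborel (A i)" by simp
    qed simp
    finally show "emeasure (PiL n) {x \<in> space (PiL n). \<forall>i<n. ?T x i \<in> A i} = (\<Prod>i<n. emeasure lborel (A i))" .
  qed (auto simp: Rn_def)
  also have "\<dots> = distr (PiL n) borel ((\<lambda>x. x + a) \<circ> (\<lambda>x i. if i < n then x i else 0))"
    by (rule arg_cong[of _ _ "distr _ _"]) (use assms in \<open>auto simp: fun_eq_iff Rn_def\<close>)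
  also have "\<dots> = distr (lm n) borel (\<lambda>x. x + a)"
    unfolding lm_def
    by (rule distr_distr[OF _ measurable_extend, symmetric])
       (intro borel_measurable_continuous_onI continuous_intros)
  finally show ?thesis .
qed

lemma compact_fun_plus:
  fixes A B :: "(nat \<Rightarrow> real) set"
  assumes "compact A" "compact B" shows "compact (A + B)"
proof -
  have "continuous_on (A \<times> B) (\<lambda>z. fst z + snd z)"
    by (intro continuous_on_fun_add continuous_on_fst continuous_on_snd continuous_on_id)
  then show ?thesis
    using compact_continuous_image[OF _ compact_Times[OF assms]]
    by (simp add: set_plus_image case_prod_unfold)
qed

lemma compact_dil:
  fixes A :: "(nat \<Rightarrow> real) set"
  assumes "compact A" shows "compact (dil c A)"
proof -
  have "continuous_on A (\<lambda>x. c *\<^sub>R x)"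
    by (rule continuous_on_fun_scaleR) (rule continuous_on_const, rule continuous_on_id)
  from compact_continuous_image[OF this assms] show ?thesis unfolding dil_def .
qed

lemma compact_trl:
  fixes A :: "(nat \<Rightarrow> real) set"
  assumes "compact A" shows "compact (trl a A)"
proof -
  have "continuous_on A (\<lambda>x. x + a)"
    by (rule continuous_on_fun_add) (rule continuous_on_id, rule continuous_on_const)
  from compact_continuous_image[OF this assms(1)] show ?thesis unfolding trl_def .
qed

lemma Rn_set_plus: "A \<subseteq> Rn n \<Longrightarrow> B \<subseteq> Rn n \<Longrightarrow> A + B \<subseteq> Rn n"
  by (auto simp: set_plus_def Rn_add subset_eq)

lemma Rn_dil: "A \<subseteq> Rn n \<Longrightarrow> dil c A \<subseteq> Rn n"
  by (auto simp: dil_def Rn_scale)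

lemma vol_translate:
  assumes "compact A" "A \<subseteq> Rn n" "a \<in> Rn n"
  shows "vol n (trl a A) = vol n A"
proof -
  have c: "compact (trl a A)"
    by (rule compact_trl) (rule assms)
  have s: "trl a A \<subseteq> Rn n" using assms by (auto simp: trl_def Rn_add)
  have m: "(\<lambda>x. x + a) \<in> measurable (lm n) borel"
    unfolding measurable_cong_sets[OF sets_lm refl]
    by (intro borel_measurable_continuous_onI continuous_intros)
  have "measure (lm n) (trl a A) = measure (distr (lm n) borel (\<lambda>x. x + a)) (trl a A)"
    using lm_translate[OF assms(3)] by simp
  also have "\<dots> = measure (lm n) ((\<lambda>x. x + a) -` (trl a A) \<inter> space (lm n))"
    by (rule measure_distr)
      (use c in \<open>auto intro!: borel_compact m\<close>)
  also have "(\<lambda>x. x + a) -` (trl a A) \<inter> space (lm n) = A"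
    by (auto simp: trl_def)
  finally show ?thesis using assms c s by (simp add: vol_compact)
qed

lemma vol_scale:
  assumes "compact A" "A \<subseteq> Rn n" "c > 0"
  shows "vol n (dil c A) = c ^ n * vol n A"
proof -
  let ?T = "\<lambda>x i. if i < n then c * x i else 0"
  \<comment> \<open>Lebesgue measure is the image of \<open>c ^ n\<close> times itself under
    multiplication by \<open>c\<close>. Evaluating this image at \<open>dil c A\<close>, whose
    preimage is \<open>A\<close>, gives the factor.\<close>
  let ?M = "scale_measure (ennreal (c ^ n)) (PiL n)"
  have T: "?T \<in> measurable (PiL n) borel"
  proof (rule measurable_coordinatewise_then_product)
    fix i
    show "(\<lambda>x. if i < n then c * x i else 0 :: real) \<in> borel_measurable (PiL n)"
      by (cases "i < n") (auto intro!: borel_measurable_times measurable_component_singleton[of i "{..<n}" "\<lambda>_. lborel", simplified])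
  qed
  then have TM: "?T \<in> measurable ?M borel"
    by (simp add: measurable_def space_scale_measure)
  have L: "lm n = distr ?M borel ?T"
  proof (rule lm_eqI[OF TM])
    fix A :: "nat \<Rightarrow> real set" assume A: "\<And>i. i < n \<Longrightarrow> A i \<in> sets borel"
    have B: "(\<lambda>t. c * t) -` A i \<in> sets borel" if "i < n" for i
      by (rule measurable_sets_borel[of "\<lambda>t. c * t" borel]) (use A that in auto)
    have "emeasure ?M {x \<in> space ?M. \<forall>i<n. ?T x i \<in> A i}
      = ennreal (c ^ n) * emeasure (PiL n) {x \<in> space (PiL n). \<forall>i<n. x i \<in> (\<lambda>t. c * t) -` A i}"
      by (simp add: space_scale_measure)
    also have "\<dots> = ennreal (c ^ n) * (\<Prod>i<n. emeasure lborel ((\<lambda>t. c * t) -` A i))"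
      using emeasure_PiL_rect[OF B] by simp
    also have "\<dots> = (\<Prod>i<n. ennreal c * emeasure lborel ((\<lambda>t. c * t) -` A i))"
      using assms(3) by (simp add: prod.distrib ennreal_power)
    also have "\<dots> = (\<Prod>i<n. emeasure lborel (A i))"
    proof (rule prod.cong)
      fix i assume i: "i \<in> {..<n}"
      have "emeasure lborel ((\<lambda>t. c * t) -` A i) = emeasure (distr lborel borel ((*) c)) (A i)"
        using A i by (subst emeasure_distr) auto
      also have "\<dots> = emeasure (density lborel (\<lambda>_. ennreal (inverse \<bar>c\<bar>))) (A i)"
        using lborel_distr_mult[of c] assms(3) by simp
      also have "\<dots> = ennreal (inverse c) * emeasure lborel (A i)"
        using A i assms(3) by (simp add: emeasure_density nn_integral_cmult_indicator)
      finally show "ennreal c * emeasure lborel ((\<lambda>t. c * t) -` A i) = emeasure lborel (A i)"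
        using assms(3) by (simp add: mult.assoc[symmetric] ennreal_mult[symmetric])
    qed simp
    finally show "emeasure ?M {x \<in> space ?M. \<forall>i<n. ?T x i \<in> A i} = (\<Prod>i<n. emeasure lborel (A i))" .
  qed (auto simp: Rn_def)
  let ?e = "\<lambda>x i. if i < n then x i else 0 :: real"
  have c: "compact (dil c A)" by (rule compact_dil) fact
  have b: "dil c A \<in> sets borel" using borel_compact c by blast
  have "emeasure (lm n) (dil c A) = emeasure (distr ?M borel ?T) (dil c A)"
    using L by simp
  also have "\<dots> = emeasure ?M (?T -` (dil c A) \<inter> space ?M)"
    by (rule emeasure_distr[OF TM b])
  also have "?T -` (dil c A) \<inter> space ?M = ?e -` A \<inter> space (PiL n)"
  proof -
    have eq: "?T x = c *\<^sub>R ?e x" for x by (auto simp: scaleR_fun_apply)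
    have "?T x \<in> dil c A \<longleftrightarrow> ?e x \<in> A" for x
      unfolding eq using assms(3) by (auto simp: dil_def image_iff)
    then show ?thesis by (auto simp: space_scale_measure)
  qed
  also have "emeasure ?M (?e -` A \<inter> space (PiL n)) = ennreal (c ^ n) * emeasure (lm n) A"
    unfolding lm_def by (simp add: emeasure_distr[OF measurable_extend] borel_compact assms(1))
  finally have "measure (lm n) (dil c A) = c ^ n * measure (lm n) A"
    unfolding measure_def using assms(3) by (metis enn2real_mult enn2real_ennreal zero_le_power less_imp_le)
  then show ?thesis using assms c Rn_dil[OF assms(2)] by (simp add: vol_compact)
qed

subsection \<open>Slicing\<close>

definition app :: "nat \<Rightarrow> (nat \<Rightarrow> real) \<Rightarrow> (nat \<Rightarrow> real) \<Rightarrow> nat \<Rightarrow> real"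
  where "app m x y = (\<lambda>i. if i < m then x i else y (i - m))"

lemma sigma_finite_lm: "sigma_finite_measure (lm n)"
proof
  \<comment> \<open>The cubes cover only the subspace; its complement, a null set, completes the
    cover of the whole type.\<close>
  let ?A = "insert (- Rn n) (range (\<lambda>k::nat. Box n (real k)))"
  have "x \<in> \<Union>?A" for x
  proof (cases "x \<in> Rn n")
    case True
    obtain k :: nat where k: "(\<Sum>i<n. \<bar>x i\<bar>) \<le> real k" using real_arch_simple by blast
    have "\<bar>x i\<bar> \<le> real k" if "i < n" for i
      using member_le_sum[of i "{..<n}" "\<lambda>i. \<bar>x i\<bar>"] that k by auto
    with True show ?thesis by (auto simp: Box_def)
  qed auto
  then have "\<Union>?A = space (lm n)" by (simp only: space_lm) blast
  moreover have "?A \<subseteq> sets (lm n)" using closed_Rn closed_Box by auto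
  moreover have "\<forall>a\<in>?A. emeasure (lm n) a \<noteq> \<infinity>"
    using AE_lm_Rn[of n] by (auto simp: emeasure_Box)
  moreover have "countable ?A" by auto
  ultimately show "\<exists>A. countable A \<and> A \<subseteq> sets (lm n) \<and> \<Union> A = space (lm n) \<and> (\<forall>a\<in>A. emeasure (lm n) a \<noteq> \<infinity>)"
    by blast
qed

text \<open>The cut-off at \<open>m + n\<close> makes every pair land in \<open>Rn (m + n)\<close>,
  as \<open>lm_eqI\<close> requires. On pairs from \<open>Rn m\<close> and \<open>Rn n\<close>, that
  is almost everywhere, the map is \<open>app m\<close>.\<close>

lemma lm_append:
  "lm (m + n) = distr (lm m \<Otimes>\<^sub>M lm n) borel
     (\<lambda>(x, y) i. if i < m then x i else if i < m + n then y (i - m) else 0)" (is "_ = distr _ _ ?T")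
proof (rule lm_eqI)
  interpret pair_sigma_finite "lm m" "lm n"
    by (simp add: pair_sigma_finite_def sigma_finite_lm)
  show T: "?T \<in> measurable (lm m \<Otimes>\<^sub>M lm n) borel"
    unfolding case_prod_unfold
  proof (rule measurable_coordinatewise_then_product)
    fix i
    have 1: "(\<lambda>x. fst x i) \<in> borel_measurable (lm m \<Otimes>\<^sub>M lm n)"
      by (rule measurable_compose[OF measurable_fst[of "lm m"]]) (simp add: measurable_cong_sets[OF sets_lm refl])
    have 2: "(\<lambda>x. snd x (i - m)) \<in> borel_measurable (lm m \<Otimes>\<^sub>M lm n)"
      by (rule measurable_compose[OF measurable_snd[of _ "lm n"]]) (simp add: measurable_cong_sets[OF sets_lm refl])
    show "(\<lambda>x. if i < m then fst x i else if i < m + n then snd x (i - m) else 0)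
         \<in> borel_measurable (lm m \<Otimes>\<^sub>M lm n)"
      using 1 2 by (cases "i < m"; cases "i < m + n") auto
  qed
  show "?T z \<in> Rn (m + n)" for z by (auto simp: Rn_def split: prod.split)
  fix A :: "nat \<Rightarrow> real set" assume A: "\<And>i. i < m + n \<Longrightarrow> A i \<in> sets borel"
  let ?X = "{x \<in> Rn m. \<forall>i<m. x i \<in> A i}" and ?Y = "{x \<in> Rn n. \<forall>i<n. x i \<in> A (m + i)}"
  let ?X' = "{x. \<forall>i<m. x i \<in> A i}" and ?Y' = "{x. \<forall>i<n. x i \<in> A (m + i)}"
  have XY: "?X' \<in> sets borel" "?Y' \<in> sets borel" by (rule rect_borel; use A in simp)+
  have null: "emeasure (lm k) (S \<inter> Rn k) = emeasure (lm k) S" if "S \<in> sets borel" for S k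
  proof (rule emeasure_eq_AE)
    show "AE x in lm k. (x \<in> S \<inter> Rn k) = (x \<in> S)"
      by (rule AE_I[OF _ AE_lm_Rn]) (use closed_Rn in auto)
  qed (use that closed_Rn in auto)
  have eq: "?X' \<inter> Rn m = ?X" "?Y' \<inter> Rn n = ?Y" by auto
  have "{z \<in> space (lm m \<Otimes>\<^sub>M lm n). \<forall>i<m + n. ?T z i \<in> A i} = ?X' \<times> ?Y'"
  proof (intro equalityI subsetI)
    fix z assume z: "z \<in> {z \<in> space (lm m \<Otimes>\<^sub>M lm n). \<forall>i<m + n. ?T z i \<in> A i}"
    obtain x y where [simp]: "z = (x, y)" by (cases z)
    have "x i \<in> A i" if "i < m" for i using z that by (auto dest: spec[of _ i])
    moreover have "y i \<in> A (m + i)" if "i < n" for i using z that by (auto dest: spec[of _ "m + i"])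
    ultimately show "z \<in> ?X' \<times> ?Y'" by simp
  next
    fix z assume "z \<in> ?X' \<times> ?Y'"
    then obtain x y where [simp]: "z = (x, y)" and xy: "\<forall>i<m. x i \<in> A i" "\<forall>i<n. y i \<in> A (m + i)" by auto
    have "?T z i \<in> A i" if "i < m + n" for i
      using xy that by (auto dest: spec[of _ "i - m"])
    then show "z \<in> {z \<in> space (lm m \<Otimes>\<^sub>M lm n). \<forall>i<m + n. ?T z i \<in> A i}"
      by (auto simp: space_pair_measure)
  qed
  then have "emeasure (lm m \<Otimes>\<^sub>M lm n) {z \<in> space (lm m \<Otimes>\<^sub>M lm n). \<forall>i<m + n. ?T z i \<in> A i} =
      emeasure (lm m) ?X' * emeasure (lm n) ?Y'"
    using M2.emeasure_pair_measure_Times[of ?X' "lm m" ?Y'] XY by (simp only: sets_lm)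
  also have "\<dots> = emeasure (lm m) ?X * emeasure (lm n) ?Y"
    using null[OF XY(1), of m] null[OF XY(2), of n] eq by simp
  also have "\<dots> = (\<Prod>i<m. emeasure lborel (A i)) * (\<Prod>i<n. emeasure lborel (A (m + i)))"
    using A by (simp add: emeasure_lm_rect)
  also have "\<dots> = (\<Prod>i<m + n. emeasure lborel (A i))"
    by (induction n) (simp_all add: mult.assoc[symmetric])
  finally show "emeasure (lm m \<Otimes>\<^sub>M lm n) {z \<in> space (lm m \<Otimes>\<^sub>M lm n). \<forall>i<m + n. ?T z i \<in> A i} =
    (\<Prod>i<m + n. emeasure lborel (A i))" .
qed


lemma continuous_app1: "continuous_on S (\<lambda>x. app m x y)"
  unfolding continuous_on_fun_iff app_def
  by (intro allI; rename_tac i; case_tac "i < m"; simp)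

lemma continuous_app2: "continuous_on S (\<lambda>y. app m x y)"
  unfolding continuous_on_fun_iff app_def
  by (intro allI; rename_tac i; case_tac "i < m"; simp)

lemma app_Rn: "x \<in> Rn m \<Longrightarrow> y \<in> Rn n \<Longrightarrow> app m x y \<in> Rn (m + n)"
  by (auto simp: Rn_def app_def)

lemma compact_slice1:
  assumes "compact S" "S \<subseteq> Rn (m + n)"
  shows "compact {x \<in> Rn m. app m x y \<in> S}"
proof -
  obtain R where R: "S \<subseteq> Box (m + n) R" using compact_subset_Box[OF assms] by metis
  have "{x \<in> Rn m. app m x y \<in> S} = Box m R \<inter> (\<lambda>x. app m x y) -` S"
  proof (intro equalityI subsetI)
    fix x assume x: "x \<in> {x \<in> Rn m. app m x y \<in> S}"
    then have b: "app m x y \<in> Box (m + n) R" using R by auto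
    have "\<bar>x i\<bar> \<le> R" if "i < m" for i
    proof -
      have "\<bar>app m x y i\<bar> \<le> R" using b that by (simp add: Box_def)
      then show ?thesis using that by (simp add: app_def)
    qed
    with x show "x \<in> Box m R \<inter> (\<lambda>x. app m x y) -` S" by (auto simp: Box_def)
  qed (auto simp: Box_def)
  moreover have "closed ((\<lambda>x. app m x y) -` S)"
    using continuous_closed_vimage[of S "\<lambda>x. app m x y"] compact_imp_closed[OF assms(1)]
      continuous_app1[of UNIV m y] by (simp add: continuous_on_eq_continuous_at)
  ultimately show ?thesis using compact_Box compact_Int_closed by metis
qed

lemma compact_slice2:
  assumes "compact S" "S \<subseteq> Rn (m + n)"
  shows "compact {y \<in> Rn n. app m x y \<in> S}"
proof -
  obtain R where R: "S \<subseteq> Box (m + n) R" using compact_subset_Box[OF assms] by metis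
  have "{y \<in> Rn n. app m x y \<in> S} = Box n R \<inter> (\<lambda>y. app m x y) -` S"
  proof (intro equalityI subsetI)
    fix y assume y: "y \<in> {y \<in> Rn n. app m x y \<in> S}"
    then have b: "app m x y \<in> Box (m + n) R" using R by auto
    have "\<bar>y i\<bar> \<le> R" if "i < n" for i
    proof -
      have "\<bar>app m x y (m + i)\<bar> \<le> R" using b that by (simp add: Box_def)
      then show ?thesis by (simp add: app_def)
    qed
    with y show "y \<in> Box n R \<inter> (\<lambda>y. app m x y) -` S" by (auto simp: Box_def)
  qed (auto simp: Box_def)
  moreover have "closed ((\<lambda>y. app m x y) -` S)"
    using continuous_closed_vimage[of S "\<lambda>y. app m x y"] compact_imp_closed[OF assms(1)]
      continuous_app2[of UNIV m x] by (simp add: continuous_on_eq_continuous_at)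
  ultimately show ?thesis using compact_Box compact_Int_closed by metis
qed

lemma AE_in_Rn: "AE x in lm n. x \<in> Rn n"
  by (rule AE_I[OF _ AE_lm_Rn]) (use closed_Rn in auto)

lemma emeasure_lm_Int_Rn:
  assumes "S \<in> sets borel" "S \<inter> Rn n = S'"
  shows "emeasure (lm n) S = emeasure (lm n) S'"
proof (rule emeasure_eq_AE)
  show "AE x in lm n. (x \<in> S) = (x \<in> S')"
    using AE_in_Rn by eventually_elim (use assms(2) in auto)
  show "S' \<in> sets (lm n)"
    using sets.Int[OF assms(1) borel_closed[OF closed_Rn[of n]]] assms(2) by simp
qed (simp add: assms)

context
  fixes S :: "(nat \<Rightarrow> real) set" and m n :: nat
  assumes S: "compact S" "S \<subseteq> Rn (m + n)"
begin

private definition T where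
  "T = (\<lambda>(x, y) i. if i < m then x i else if i < m + n then y (i - m) else 0 :: real)"

private lemma T_app: "x \<in> Rn m \<Longrightarrow> y \<in> Rn n \<Longrightarrow> T (x, y) = app m x y"
  by (auto simp: T_def app_def Rn_def fun_eq_iff)

private lemma T_meas: "T \<in> measurable (lm m \<Otimes>\<^sub>M lm n) borel"
  unfolding T_def case_prod_unfold
proof (rule measurable_coordinatewise_then_product)
  fix i
  have 1: "(\<lambda>x. fst x i) \<in> borel_measurable (lm m \<Otimes>\<^sub>M lm n)"
    by (rule measurable_compose[OF measurable_fst[of "lm m"]])
      (simp add: measurable_cong_sets[OF sets_lm refl] measurable_coord)
  have 2: "(\<lambda>x. snd x (i - m)) \<in> borel_measurable (lm m \<Otimes>\<^sub>M lm n)"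
    by (rule measurable_compose[OF measurable_snd[of _ "lm n"]])
      (simp add: measurable_cong_sets[OF sets_lm refl] measurable_coord)
  show "(\<lambda>x. if i < m then fst x i else if i < m + n then snd x (i - m) else 0)
       \<in> borel_measurable (lm m \<Otimes>\<^sub>M lm n)"
    using 1 2 by (cases "i < m"; cases "i < m + n") auto
qed

private lemma slice_sets: "T -` S \<inter> space (lm m \<Otimes>\<^sub>M lm n) \<in> sets (lm m \<Otimes>\<^sub>M lm n)"
  by (rule measurable_sets[OF T_meas borel_compact[OF S(1)]])

private lemma emeasure_slices:
  "emeasure (lm (m + n)) S = emeasure (lm m \<Otimes>\<^sub>M lm n) (T -` S \<inter> space (lm m \<Otimes>\<^sub>M lm n))"
  unfolding lm_append T_def[symmetric]
  by (rule emeasure_distr[OF T_meas borel_compact[OF S(1)]])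

lemma vol_slices1:
  "ennreal (vol (m + n) S) = (\<integral>\<^sup>+ x. ennreal (vol n {y \<in> Rn n. app m x y \<in> S}) \<partial>lm m)"
proof -
  interpret sigma_finite_measure "lm n" by (rule sigma_finite_lm)
  have "ennreal (vol (m + n) S) = emeasure (lm (m + n)) S"
    using emeasure_vol[OF S] by simp
  also have "\<dots> = (\<integral>\<^sup>+ x. emeasure (lm n) (Pair x -` (T -` S \<inter> space (lm m \<Otimes>\<^sub>M lm n))) \<partial>lm m)"
    unfolding emeasure_slices by (rule emeasure_pair_measure_alt[OF slice_sets])
  also have "\<dots> = (\<integral>\<^sup>+ x. ennreal (vol n {y \<in> Rn n. app m x y \<in> S}) \<partial>lm m)"
  proof (rule nn_integral_cong_AE, rule AE_mp[OF AE_in_Rn], rule AE_I2, rule impI)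
    fix x assume x: "x \<in> Rn m"
    have 1: "Pair x -` (T -` S \<inter> space (lm m \<Otimes>\<^sub>M lm n)) \<in> sets borel"
      using sets_Pair1[OF slice_sets] by simp
    have "emeasure (lm n) (Pair x -` (T -` S \<inter> space (lm m \<Otimes>\<^sub>M lm n))) =
        emeasure (lm n) {y \<in> Rn n. app m x y \<in> S}"
      by (rule emeasure_lm_Int_Rn[OF 1]) (use x T_app in \<open>auto simp: space_pair_measure\<close>)
    also have "\<dots> = ennreal (vol n {y \<in> Rn n. app m x y \<in> S})"
      by (rule emeasure_vol[OF compact_slice2[OF S]]) auto
    finally show "emeasure (lm n) (Pair x -` (T -` S \<inter> space (lm m \<Otimes>\<^sub>M lm n))) =
        ennreal (vol n {y \<in> Rn n. app m x y \<in> S})" .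
  qed
  finally show ?thesis .
qed

lemma vol_slices2:
  "ennreal (vol (m + n) S) = (\<integral>\<^sup>+ y. ennreal (vol m {x \<in> Rn m. app m x y \<in> S}) \<partial>lm n)"
proof -
  interpret pair_sigma_finite "lm m" "lm n"
    by (simp add: pair_sigma_finite_def sigma_finite_lm)
  have "ennreal (vol (m + n) S) = emeasure (lm (m + n)) S"
    using emeasure_vol[OF S] by simp
  also have "\<dots> = (\<integral>\<^sup>+ y. emeasure (lm m) ((\<lambda>x. (x, y)) -` (T -` S \<inter> space (lm m \<Otimes>\<^sub>M lm n))) \<partial>lm n)"
    unfolding emeasure_slices by (rule emeasure_pair_measure_alt2[OF slice_sets])
  also have "\<dots> = (\<integral>\<^sup>+ y. ennreal (vol m {x \<in> Rn m. app m x y \<in> S}) \<partial>lm n)"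
  proof (rule nn_integral_cong_AE, rule AE_mp[OF AE_in_Rn], rule AE_I2, rule impI)
    fix y assume y: "y \<in> Rn n"
    have 1: "(\<lambda>x. (x, y)) -` (T -` S \<inter> space (lm m \<Otimes>\<^sub>M lm n)) \<in> sets borel"
      using sets_Pair2[OF slice_sets] by simp
    have "emeasure (lm m) ((\<lambda>x. (x, y)) -` (T -` S \<inter> space (lm m \<Otimes>\<^sub>M lm n))) =
        emeasure (lm m) {x \<in> Rn m. app m x y \<in> S}"
      by (rule emeasure_lm_Int_Rn[OF 1]) (use y T_app in \<open>auto simp: space_pair_measure\<close>)
    also have "\<dots> = ennreal (vol m {x \<in> Rn m. app m x y \<in> S})"
      by (rule emeasure_vol[OF compact_slice1[OF S]]) auto
    finally show "emeasure (lm m) ((\<lambda>x. (x, y)) -` (T -` S \<inter> space (lm m \<Otimes>\<^sub>M lm n))) =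
        ennreal (vol m {x \<in> Rn m. app m x y \<in> S})" .
  qed
  finally show ?thesis .
qed

text \<open>A Bochner integral in place of the nonnegative integral of \<open>vol_slices2\<close>,
  because slice volumes will enter combinations with complex coefficients.\<close>

lemma has_integral_slices:
  "has_bochner_integral (lm n) (\<lambda>y. indicator (Rn n) y * vol m {x \<in> Rn m. app m x y \<in> S}) (vol (m + n) S)"
proof -
  interpret pair_sigma_finite "lm m" "lm n"
    by (simp add: pair_sigma_finite_def sigma_finite_lm)
  let ?e = "\<lambda>y. emeasure (lm m) ((\<lambda>x. (x, y)) -` (T -` S \<inter> space (lm m \<Otimes>\<^sub>M lm n)))"
  let ?v = "\<lambda>y. vol m {x \<in> Rn m. app m x y \<in> S}"
  have e: "?e y = ennreal (?v y)" if y: "y \<in> Rn n" for y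
  proof -
    have 1: "(\<lambda>x. (x, y)) -` (T -` S \<inter> space (lm m \<Otimes>\<^sub>M lm n)) \<in> sets borel"
      using sets_Pair2[OF slice_sets] by simp
    have "?e y = emeasure (lm m) {x \<in> Rn m. app m x y \<in> S}"
      by (rule emeasure_lm_Int_Rn[OF 1]) (use y T_app in \<open>auto simp: space_pair_measure\<close>)
    also have "\<dots> = ennreal (?v y)" by (rule emeasure_vol[OF compact_slice1[OF S]]) auto
    finally show ?thesis .
  qed
  have eq: "indicator (Rn n) y * ?v y = indicator (Rn n) y * enn2real (?e y)" for y
    using e[of y] by (cases "y \<in> Rn n") simp_all
  have "?e \<in> borel_measurable (lm n)" by (rule measurable_emeasure_Pair2[OF slice_sets])
  then have "(\<lambda>y. enn2real (?e y)) \<in> borel_measurable (lm n)" by (rule measurable_compose) simp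
  moreover have "indicator (Rn n) \<in> borel_measurable (lm n)"
    by (rule borel_measurable_indicator) (simp add: borel_closed closed_Rn)
  ultimately have m: "(\<lambda>y. indicator (Rn n) y * ?v y) \<in> borel_measurable (lm n)"
    unfolding eq by (intro borel_measurable_times)
  show ?thesis
  proof (rule has_bochner_integral_nn_integral[OF m])
    have "(\<integral>\<^sup>+ y. ennreal (indicator (Rn n) y * ?v y) \<partial>lm n) = (\<integral>\<^sup>+ y. ennreal (?v y) \<partial>lm n)"
      by (rule nn_integral_cong_AE, rule AE_mp[OF AE_in_Rn], rule AE_I2) simp
    then show "(\<integral>\<^sup>+ y. ennreal (indicator (Rn n) y * ?v y) \<partial>lm n) = ennreal (vol (m + n) S)"
      using vol_slices2 by simp
  qed simp_all
qed

end

text \<open>The neighbourhoods decrease to \<open>D\<close> because \<open>D\<close> is closed, and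
  all have finite measure, so the measure is continuous from above. Every approximation argument
  below squeezes a volume between its limit and this sequence.\<close>

lemma vol_plus_Box_tendsto:
  assumes D: "compact D" "D \<subseteq> Rn n" and c: "0 \<le> c"
  shows "(\<lambda>k. vol n (D + Box n (c / real (Suc k)))) \<longlonglongrightarrow> vol n D"
proof -
  define d where "d k = \<bar>c\<bar> / real (Suc k)" for k
  let ?E = "\<lambda>k. D + Box n (d k)"
  have cE: "compact (?E k)" for k by (intro compact_fun_plus D compact_Box)
  have sE: "?E k \<subseteq> Rn n" for k by (intro Rn_set_plus D Box_subset)
  have d0: "d \<longlonglongrightarrow> 0" unfolding d_def
    using tendsto_mult[OF tendsto_const[of "\<bar>c\<bar>"] LIMSEQ_inverse_real_of_nat] by (simp add: field_simps)
  have sub: "D \<subseteq> ?E k" for k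
  proof
    fix x assume "x \<in> D"
    moreover have "0 \<in> Box n (d k)" by (simp add: Box_def d_def)
    ultimately have "x + 0 \<in> ?E k" by (rule set_plus_intro)
    then show "x \<in> ?E k" by simp
  qed
  have int: "(\<Inter>k. ?E k) = D"
  proof (intro equalityI subsetI)
    fix x assume x: "x \<in> (\<Inter>k. ?E k)"
    have "\<exists>a. a \<in> D \<and> x - a \<in> Box n (d k)" for k
    proof -
      have "x \<in> ?E k" using x by blast
      then obtain a b where ab: "a \<in> D" "b \<in> Box n (d k)" "x = a + b" by (rule set_plus_elim)
      have "x - a = b" using ab(3) by simp
      then show ?thesis using ab by metis
    qed
    then obtain a where a: "\<And>k. a k \<in> D" "\<And>k. x - a k \<in> Box n (d k)" by metis
    have xR: "x \<in> Rn n" using x sE by blast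
    have "(\<lambda>k. a k i) \<longlonglongrightarrow> x i" for i
    proof (cases "i < n")
      case True
      have "\<bar>a k i - x i\<bar> \<le> d k" for k
        using a(2)[of k] True unfolding Box_def by (auto simp: abs_minus_commute)
      then have "(\<lambda>k. a k i - x i) \<longlonglongrightarrow> 0"
        by (intro Lim_null_comparison[OF always_eventually d0]) simp
      then show ?thesis using LIM_zero_iff by blast
    next
      case False
      have "a k i = 0" for k using a(1)[of k] D(2) False unfolding Rn_def by auto
      moreover have "x i = 0" using xR False by (simp add: Rn_def)
      ultimately show ?thesis by simp
    qed
    then have "a \<longlonglongrightarrow> x"
      using limitin_componentwise[of "\<lambda>_. euclidean" UNIV a x sequentially]
      by (simp add: euclidean_product_topology)
    then show "x \<in> D"
      using closed_sequentially[OF compact_imp_closed[OF D(1)], of a x] a(1) by blast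
  qed (use sub in blast)
  have dec: "decseq ?E"
  proof (rule decseq_SucI)
    fix k
    have "d (Suc k) \<le> d k" by (auto simp: d_def intro!: divide_left_mono)
    then have "Box n (d (Suc k)) \<subseteq> Box n (d k)" by (force simp: Box_def)
    then show "?E (Suc k) \<subseteq> ?E k" by (intro set_plus_mono2) auto
  qed
  have "(\<lambda>k. measure (lm n) (?E k)) \<longlonglongrightarrow> measure (lm n) (\<Inter>k. ?E k)"
    by (rule Lim_measure_decseq)
       (use cE sE emeasure_compact_finite[OF cE sE] in \<open>auto simp: borel_compact less_top[symmetric] intro: dec\<close>)
  then have "(\<lambda>k. vol n (?E k)) \<longlonglongrightarrow> vol n D"
    using cE sE int D by (simp add: vol_compact)
  then show ?thesis using c by (simp add: d_def)
qed

subsection \<open>Functions that are polynomial on the nonnegative reals\<close>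

text \<open>The restriction to \<open>s \<ge> 0\<close> is essential for volumes of
  \<open>L + dil s K\<close>, since a negative factor reflects the body.\<close>

definition pol :: "nat \<Rightarrow> (real \<Rightarrow> real) \<Rightarrow> bool"
  where "pol d f \<longleftrightarrow> (\<exists>q. degree q \<le> d \<and> (\<forall>s\<ge>0. f s = poly q s))"

text \<open>
  The Lagrange basis polynomials for the nodes \<open>1, \<dots>, d + 1\<close>. Positive nodes are used because
  mixed volumes and smooth bodies are only dilated by positive factors.
\<close>

definition lag :: "nat \<Rightarrow> nat \<Rightarrow> real poly"
  where "lag d g = (\<Prod>k\<in>{..d} - {g}. smult (1 / (real g - real k)) [:- (real k + 1), 1:])"

lemma poly_lag:
  assumes "g \<le> d" "h \<le> d"
  shows "poly (lag d g) (real h + 1) = (if g = h then 1 else 0)"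
proof (cases "g = h")
  case True
  have "poly (lag d g) (real h + 1) = (\<Prod>k\<in>{..d} - {g}. 1)"
    unfolding lag_def poly_prod by (rule prod.cong) (use True in \<open>auto simp: divide_simps\<close>)
  with True show ?thesis by simp
next
  case False
  have "\<exists>k\<in>{..d} - {g}. poly (smult (1 / (real g - real k)) [:- (real k + 1), 1:]) (real h + 1) = 0"
    by (rule bexI[of _ h]) (use False assms in \<open>auto simp: add_divide_distrib[symmetric]\<close>)
  then show ?thesis using False unfolding lag_def poly_prod by (auto intro!: prod_zero)
qed

lemma degree_lag: assumes "g \<le> d" shows "degree (lag d g) \<le> d"
proof -
  have "degree (lag d g) \<le> (\<Sum>k\<in>{..d} - {g}. degree (smult (1 / (real g - real k)) [:- (real k + 1), 1:]))"
    unfolding lag_def by (rule degree_prod_sum_le[unfolded comp_def]) simp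
  also have "\<dots> \<le> (\<Sum>k\<in>{..d} - {g}. 1)"
    by (rule sum_mono) (auto simp: degree_smult_eq)
  also have "\<dots> = d" using assms by (simp add: card_Diff_singleton)
  finally show ?thesis .
qed

lemma poly_lagrange:
  fixes q :: "real poly"
  assumes "degree q \<le> d"
  shows "q = (\<Sum>g\<le>d. smult (poly q (real g + 1)) (lag d g))" (is "_ = ?r")
proof (rule poly_eqI_degree[of "(\<lambda>g. real g + 1) ` {..d}"])
  have c: "card ((\<lambda>g. real g + 1) ` {..d}) = Suc d"
    by (subst card_image) (auto simp: inj_on_def)
  then show "degree q < card ((\<lambda>g. real g + 1) ` {..d})" using assms by simp
  have "degree ?r \<le> d"
    by (rule degree_sum_le) (use degree_lag order_trans[OF degree_smult_le] in blast)+
  then show "degree ?r < card ((\<lambda>g. real g + 1) ` {..d})" using c by simp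
  fix x assume "x \<in> (\<lambda>g. real g + 1) ` {..d}"
  then obtain h where h: "h \<le> d" "x = real h + 1" by auto
  have "poly ?r x = (\<Sum>g\<le>d. poly q (real g + 1) * (if g = h then 1 else 0))"
    unfolding poly_sum h by (rule sum.cong) (use h(1) poly_lag in auto)
  also have "\<dots> = poly q x" using h by (simp add: if_distrib[of "(*) _"] sum.delta cong: if_cong)
  finally show "poly q x = poly ?r x" by simp
qed

text \<open>Being a polynomial of degree at most \<open>d\<close> becomes a family of linear
  identities between values of \<open>f\<close>. Such identities survive pointwise limits, which
  gives \<open>pol_limit\<close>.\<close>

lemma pol_lagrange:
  "pol d f \<longleftrightarrow> (\<forall>s\<ge>0. f s = (\<Sum>g\<le>d. f (real g + 1) * poly (lag d g) s))"
proof
  assume "pol d f"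
  then obtain q where q: "degree q \<le> d" "\<And>s. s \<ge> 0 \<Longrightarrow> f s = poly q s" by (auto simp: pol_def)
  have e: "poly q s = (\<Sum>g\<le>d. poly q (real g + 1) * poly (lag d g) s)" for s
  proof -
    have "poly q s = poly (\<Sum>g\<le>d. smult (poly q (real g + 1)) (lag d g)) s"
      by (rule arg_cong[OF poly_lagrange[OF q(1)]])
    also have "\<dots> = (\<Sum>g\<le>d. poly q (real g + 1) * poly (lag d g) s)" by (simp only: poly_sum poly_smult)
    finally show ?thesis .
  qed
  show "\<forall>s\<ge>0. f s = (\<Sum>g\<le>d. f (real g + 1) * poly (lag d g) s)"
  proof (intro allI impI)
    fix s :: real assume "0 \<le> s"
    then have "f s = poly q s" by (rule q(2))
    also have "\<dots> = (\<Sum>g\<le>d. poly q (real g + 1) * poly (lag d g) s)" by (rule e)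
    also have "\<dots> = (\<Sum>g\<le>d. f (real g + 1) * poly (lag d g) s)" by (rule sum.cong) (simp_all add: q(2))
    finally show "f s = (\<Sum>g\<le>d. f (real g + 1) * poly (lag d g) s)" .
  qed
next
  assume a: "\<forall>s\<ge>0. f s = (\<Sum>g\<le>d. f (real g + 1) * poly (lag d g) s)"
  have "degree (\<Sum>g\<le>d. smult (f (real g + 1)) (lag d g)) \<le> d"
    by (rule degree_sum_le) (use degree_lag order_trans[OF degree_smult_le] in blast)+
  with a show "pol d f" unfolding pol_def by (intro exI[of _ "\<Sum>g\<le>d. smult (f (real g + 1)) (lag d g)"])
    (simp add: poly_sum)
qed

lemma pol_limit:
  assumes p: "\<And>k::nat. pol d (F k)" and l: "\<And>s. s \<ge> 0 \<Longrightarrow> (\<lambda>k. F k s) \<longlonglongrightarrow> f s"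
  shows "pol d f"
  unfolding pol_lagrange
proof (intro allI impI)
  fix s :: real assume s: "0 \<le> s"
  have "(\<lambda>k. \<Sum>g\<le>d. F k (real g + 1) * poly (lag d g) s) \<longlonglongrightarrow> (\<Sum>g\<le>d. f (real g + 1) * poly (lag d g) s)"
    by (intro tendsto_sum tendsto_mult l tendsto_const) simp
  moreover have "(\<Sum>g\<le>d. F k (real g + 1) * poly (lag d g) s) = F k s" for k
    using p[of k] s unfolding pol_lagrange by simp
  ultimately have "(\<lambda>k. F k s) \<longlonglongrightarrow> (\<Sum>g\<le>d. f (real g + 1) * poly (lag d g) s)" by simp
  then show "f s = (\<Sum>g\<le>d. f (real g + 1) * poly (lag d g) s)"
    using LIMSEQ_unique l[OF s] by blast
qed

text \<open>The difference of x^(d+1) is (d+1) x^d plus lower powers, and the lower powers are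
  differences by induction.\<close>

lemma antidifference_monom:
  "\<exists>G::real poly. \<forall>x. poly G (x + 1) - poly G x = x ^ d"
proof (induction d rule: less_induct)
  case (less d)
  then obtain G :: "nat \<Rightarrow> real poly" where G: "\<And>k x. k < d \<Longrightarrow> poly (G k) (x + 1) - poly (G k) x = x ^ k"
    by metis
  let ?G = "smult (1 / real (Suc d)) (monom 1 (Suc d) - (\<Sum>k<d. smult (real (Suc d choose k)) (G k)))"
  have "poly ?G (x + 1) - poly ?G x = x ^ d" for x
  proof -
    have "(x + 1) ^ Suc d = (\<Sum>k\<le>Suc d. real (Suc d choose k) * x ^ k)"
      using binomial_ring[of x 1 "Suc d"] by (simp only: power_one mult_1_right)
    also have "\<dots> = (\<Sum>k<d. real (Suc d choose k) * x ^ k) + real (Suc d) * x ^ d + x ^ Suc d"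
      unfolding lessThan_Suc_atMost[symmetric] sum.lessThan_Suc by (simp del: power_Suc)
    finally have e: "(x + 1) ^ Suc d - x ^ Suc d = (\<Sum>k<d. real (Suc d choose k) * x ^ k) + real (Suc d) * x ^ d"
      by simp
    have "real (Suc d) * (poly ?G (x + 1) - poly ?G x) = ((x + 1) ^ Suc d - x ^ Suc d)
       - (\<Sum>k<d. real (Suc d choose k) * (poly (G k) (x + 1) - poly (G k) x))"
    proof -
      have "poly ?G z = (z ^ Suc d - (\<Sum>k<d. real (Suc d choose k) * poly (G k) z)) / real (Suc d)" for z
        by (simp add: poly_monom poly_sum del: power_Suc)
      moreover have "D * ((a - b) / D - (a' - b') / D) = a - a' - (b - b')" if "D \<noteq> 0" for D a b a' b' :: real
        using that by (simp add: field_simps)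
      moreover have "(\<Sum>k<d. real (Suc d choose k) * (poly (G k) (x + 1) - poly (G k) x)) =
          (\<Sum>k<d. real (Suc d choose k) * poly (G k) (x + 1)) - (\<Sum>k<d. real (Suc d choose k) * poly (G k) x)"
        by (simp add: right_diff_distrib sum_subtractf)
      ultimately show ?thesis
        by (simp only: of_nat_eq_0_iff nat.distinct not_False_eq_True)
    qed
    also have "(\<Sum>k<d. real (Suc d choose k) * (poly (G k) (x + 1) - poly (G k) x)) =
        (\<Sum>k<d. real (Suc d choose k) * x ^ k)"
      using G by (intro sum.cong) auto
    finally show ?thesis using e by simp
  qed
  then show ?case by blast
qed

lemma antidifference:
  fixes q :: "real poly"
  obtains G where "\<And>x. poly G (x + 1) - poly G x = poly q x"
proof -
  obtain G :: "nat \<Rightarrow> real poly" where G: "\<And>k x. poly (G k) (x + 1) - poly (G k) x = x ^ k"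
    using antidifference_monom by metis
  have "poly (\<Sum>k\<le>degree q. smult (coeff q k) (G k)) (x + 1) -
      poly (\<Sum>k\<le>degree q. smult (coeff q k) (G k)) x = poly q x" for x
    using G by (simp add: poly_sum sum_subtractf[symmetric] right_diff_distrib[symmetric] poly_altdef[of q])
  then show ?thesis by (rule that)
qed

text \<open>
  After subtraction of a polynomial, \<open>f\<close> has period \<open>1\<close>. Then its differences are constant, since
  they are polynomials with a period, so \<open>f\<close> is additive up to a constant and bounded.
\<close>

lemma polynomial_of_differences:
  fixes f :: "real \<Rightarrow> real"
  assumes diff: "\<And>u. u \<ge> 0 \<Longrightarrow> \<exists>q. \<forall>s\<ge>0. f (s + u) - f s = poly q s"
    and bnd: "\<And>s. 0 \<le> s \<Longrightarrow> s \<le> 1 \<Longrightarrow> \<bar>f s\<bar> \<le> B"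
  shows "\<exists>q. \<forall>s\<ge>0. f s = poly q s"
proof -
  obtain q where q: "\<And>s. s \<ge> 0 \<Longrightarrow> f (s + 1) - f s = poly q s" using diff[of 1] by auto
  obtain G where G: "\<And>x. poly G (x + 1) - poly G x = poly q x" using antidifference[of q] by blast
  define r where "r s = f s - poly G s" for s
  have per: "r (s + 1) = r s" if "s \<ge> 0" for s using q[OF that] G[of s] by (simp add: r_def)
  have pern: "r (s + real k) = r s" if "s \<ge> 0" for s k
  proof (induction k)
    case (Suc k)
    then show ?case using per[of "s + real k"] that by (simp add: add_ac)
  qed simp
  have inc: "r (s + u) - r s = r u - r 0" if su: "s \<ge> 0" "u \<ge> 0" for s u
  proof -
    obtain p where p: "\<And>s. s \<ge> 0 \<Longrightarrow> f (s + u) - f s = poly p s" using diff su by blast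
    \<comment> \<open>On \<open>s \<ge> 0\<close> the increment of \<open>r\<close> by
      \<open>u\<close> is a polynomial. By periodicity it takes the value \<open>r u - r 0\<close>
      at all natural numbers, so it is constant.\<close>
    define h where "h = p - (pcompose G [:u, 1:] - G) - [:r u - r 0:]"
    have h: "poly h s = r (s + u) - r s - (r u - r 0)" if "s \<ge> 0" for s
      using p[OF that] by (simp add: h_def r_def poly_pcompose add_ac)
    have "poly h (real k) = 0" for k
      using h[of "real k"] pern[of u k] pern[of 0 k] su by (simp add: add.commute)
    then have "range real \<subseteq> {x. poly h x = 0}" by auto
    moreover have "infinite (range real)" using inj_of_nat range_inj_infinite by blast
    ultimately have "h = 0" using poly_roots_finite finite_subset by blast
    then show ?thesis using h[OF su(1)] by simp
  qed
  have "compact (poly G ` {0..1})" by (intro compact_continuous_image continuous_intros) auto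
  then have "\<exists>C. \<forall>s\<in>{0..1}. \<bar>poly G s\<bar> \<le> C"
    by (auto dest!: compact_imp_bounded simp: bounded_iff)
  then obtain C where C: "\<And>s. 0 \<le> s \<Longrightarrow> s \<le> 1 \<Longrightarrow> \<bar>poly G s\<bar> \<le> C" by (metis atLeastAtMost_iff)
  have rb: "\<bar>r s\<bar> \<le> B + C" if "s \<ge> 0" for s
  proof -
    have e: "s = frac s + real (nat \<lfloor>s\<rfloor>)" using that by (simp add: frac_def)
    have "r s = r (frac s)" using pern[of "frac s" "nat \<lfloor>s\<rfloor>"] e by simp
    moreover have "\<bar>r (frac s)\<bar> \<le> B + C"
      using bnd[of "frac s"] C[of "frac s"] frac_lt_1[of s] by (simp add: r_def)
    ultimately show ?thesis by simp
  qed
  have rc: "r u = r 0" if u: "u \<ge> 0" for u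
  proof (rule ccontr)
    assume ne: "r u \<noteq> r 0"
    have k: "r (real k * u) - r 0 = real k * (r u - r 0)" for k
    proof (induction k)
      case (Suc k)
      then show ?case using inc[of "real k * u" u] u by (simp add: algebra_simps)
    qed simp
    obtain k where "2 * (B + C) < real k * \<bar>r u - r 0\<bar>"
      using reals_Archimedean3[of "\<bar>r u - r 0\<bar>"] ne by auto
    moreover have "real k * \<bar>r u - r 0\<bar> = \<bar>r (real k * u) - r 0\<bar>" by (simp add: k abs_mult)
    ultimately show False using rb[of "real k * u"] rb[of 0] u by (simp add: abs_if split: if_splits)
  qed
  have "f s = poly (G + [:r 0:]) s" if "s \<ge> 0" for s
    using rc[OF that] unfolding r_def by simp
  then show ?thesis by blast
qed

text \<open>For a larger degree, the quotient of \<open>poly q x\<close> by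
  \<open>x ^ degree q\<close> would tend to 0, but its limit is the leading coefficient.\<close>

lemma degree_le_of_growth:
  fixes q :: "real poly"
  assumes "\<And>s. s \<ge> 1 \<Longrightarrow> \<bar>poly q s\<bar> \<le> C * s ^ n"
  shows "degree q \<le> n"
proof (rule ccontr)
  assume d: "\<not> degree q \<le> n"
  have C: "C \<ge> 0" using assms[of 1] by simp
  have "((\<lambda>x. poly q x / x ^ degree q) \<longlongrightarrow> 0) at_top"
  proof (rule Lim_null_comparison)
    show "\<forall>\<^sub>F x in at_top. norm (poly q x / x ^ degree q) \<le> C / x"
    proof (rule eventually_mono[OF eventually_ge_at_top[of 1]])
      fix x :: real assume x: "x \<ge> 1"
      have "\<bar>poly q x\<bar> * x \<le> C * x ^ Suc n"
        using mult_right_mono[OF assms[OF x], of x] x by (simp add: mult_ac)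
      also have "\<dots> \<le> C * x ^ degree q"
        using d x C by (intro mult_left_mono power_increasing) auto
      finally show "norm (poly q x / x ^ degree q) \<le> C / x" using x by (simp add: field_simps abs_mult)
    qed
    show "((\<lambda>x. C / x) \<longlongrightarrow> 0) at_top" by (rule tendsto_divide_0[OF tendsto_const]) (simp add: filterlim_ident filterlim_at_top_imp_at_infinity)
  qed
  moreover have "((\<lambda>x. poly q x / x ^ degree q) \<longlongrightarrow> lead_coeff q) at_top"
    using poly_divide_tendsto_aux[of q] by (rule tendsto_mono[rotated]) (simp add: at_top_le_at_infinity)
  ultimately have "lead_coeff q = 0" using tendsto_unique trivial_limit_at_top_linorder by blast
  with d show False by simp
qed

subsection \<open>Minkowski combinations of convex bodies\<close>

lemma dil_dil: "dil a (dil b A) = dil (a * b) A"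
  by (simp add: dil_def image_image)

lemma dil_1 [simp]: "dil 1 A = A"
  by (simp add: dil_def)

lemma dil_mono: "A \<subseteq> B \<Longrightarrow> dil c A \<subseteq> dil c B"
  by (auto simp: dil_def)

lemma dil_0: "A \<noteq> {} \<Longrightarrow> dil 0 A = {0}"
  by (auto simp: dil_def)

lemma dil_set_plus: "dil c (A + B) = dil c A + dil c B"
  by (force simp: dil_def set_plus_def scaleR_add_right)

text \<open>Convexity enters for sums of multiples of two different points: \<open>a k + b l\<close>
  is \<open>a + b\<close> times a convex combination of \<open>k\<close> and
  \<open>l\<close>.\<close>

lemma dil_add:
  assumes "convex K" "a \<ge> 0" "b \<ge> 0"
  shows "dil (a + b) K = dil a K + dil b K"
proof (intro equalityI subsetI)
  fix x assume "x \<in> dil (a + b) K"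
  then obtain k where "k \<in> K" "x = a *\<^sub>R k + b *\<^sub>R k" by (auto simp: dil_def scaleR_add_left)
  then show "x \<in> dil a K + dil b K" by (auto simp: dil_def set_plus_def)
next
  fix x assume "x \<in> dil a K + dil b K"
  then obtain k l where kl: "k \<in> K" "l \<in> K" "x = a *\<^sub>R k + b *\<^sub>R l" by (auto simp: dil_def set_plus_def)
  show "x \<in> dil (a + b) K"
  proof (cases "a + b = 0")
    case True
    then show ?thesis using kl assms by (auto simp: dil_def add_nonneg_eq_0_iff)
  next
    case False
    then have ab: "a + b > 0" using assms by auto
    have "(a / (a + b)) *\<^sub>R k + (b / (a + b)) *\<^sub>R l \<in> K"
      using assms kl ab by (intro convexD) (auto simp: add_divide_distrib[symmetric])
    moreover have "x = (a + b) *\<^sub>R ((a / (a + b)) *\<^sub>R k + (b / (a + b)) *\<^sub>R l)"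
      using ab kl(3) by (simp add: scaleR_add_right)
    ultimately show ?thesis by (auto simp: dil_def)
  qed
qed

lemma body_ne: "convex_body n K \<Longrightarrow> K \<noteq> {}"
  and body_convex: "convex_body n K \<Longrightarrow> convex K"
  and body_compact: "convex_body n K \<Longrightarrow> compact K"
  and body_Rn: "convex_body n K \<Longrightarrow> K \<subseteq> Rn n"
  by (auto simp: convex_body_iff)

lemma body_plus: "convex_body n A \<Longrightarrow> convex_body n B \<Longrightarrow> convex_body n (A + B)"
  unfolding convex_body_iff
  by (intro conjI convex_set_plus compact_fun_plus Rn_set_plus)
     (auto simp: set_plus_def ex_in_conv[symmetric])

lemma body_dil: "convex_body n A \<Longrightarrow> convex_body n (dil c A)"
  unfolding convex_body_iff
  by (intro conjI compact_dil Rn_dil) (auto simp: dil_def convex_scaling)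

lemma trl_plus: "trl a A = A + {a}"
  by (auto simp: trl_def set_plus_def)

lemma body_sing: "a \<in> Rn n \<Longrightarrow> convex_body n {a}"
  by (auto simp: convex_body_iff)

lemma vol_trl_body: "convex_body n A \<Longrightarrow> a \<in> Rn n \<Longrightarrow> vol n (A + {a}) = vol n A"
  using vol_translate[of A n a] by (simp add: convex_body_iff trl_plus)

lemma body_zero: "convex_body n 0"
  by (simp add: body_sing)

lemma body_sum: "finite I \<Longrightarrow> (\<And>i. i \<in> I \<Longrightarrow> convex_body n (A i)) \<Longrightarrow> convex_body n (\<Sum>i\<in>I. A i)"
proof (induction I rule: finite_induct)
  case empty
  show ?case unfolding sum.empty by (rule body_zero)
qed (simp add: body_plus)

lemma body_Box: "r \<ge> 0 \<Longrightarrow> convex_body n (Box n r)"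
proof -
  assume r: "r \<ge> 0"
  have "convex (Box n r)"
  proof (rule convexI)
    fix x y u v assume a: "x \<in> Box n r" "y \<in> Box n r" "0 \<le> u" "0 \<le> v" "u + v = (1::real)"
    have "\<bar>u * x i + v * y i\<bar> \<le> r" if "i < n" for i
    proof -
      have "\<bar>u * x i + v * y i\<bar> \<le> u * \<bar>x i\<bar> + v * \<bar>y i\<bar>"
        using a by (intro order_trans[OF abs_triangle_ineq]) (simp add: abs_mult)
      also have "\<dots> \<le> u * r + v * r" using a that by (intro add_mono mult_left_mono) (auto simp: Box_def)
      finally show ?thesis using a by (simp add: distrib_right[symmetric])
    qed
    then show "u *\<^sub>R x + v *\<^sub>R y \<in> Box n r" using a by (auto simp: Box_def scaleR_fun_apply Rn_def)
  qed
  moreover have "0 \<in> Box n r" using r by (simp add: Box_def)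
  ultimately show ?thesis using compact_Box Box_subset by (auto simp: convex_body_iff)
qed

lemma dil_Box: "c \<ge> 0 \<Longrightarrow> r \<ge> 0 \<Longrightarrow> dil c (Box n r) \<subseteq> Box n (c * r)"
  by (auto simp: dil_def Box_def scaleR_fun_apply Rn_def abs_mult intro!: mult_left_mono)

lemma Box_plus: "Box n a + Box n b \<subseteq> Box n (a + b)"
  by (auto simp: Box_def set_plus_def Rn_def) (meson abs_triangle_ineq add_mono order_trans)

lemma vol_mono_body: "convex_body n A \<Longrightarrow> convex_body n B \<Longrightarrow> A \<subseteq> B \<Longrightarrow> vol n A \<le> vol n B"
  by (simp add: convex_body_iff vol_mono)

section \<open>Polynomiality of the volume of \<open>L + dil s K\<close> in \<open>s\<close>\<close>

lemma segment_meets_both: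
  assumes A: "closed A" "closed B" and x: "a \<in> A" "b \<in> B" and c: "convex (A \<union> B)"
  obtains t where "0 \<le> t" "t \<le> 1" "(1 - t) *\<^sub>R a + t *\<^sub>R b \<in> A \<inter> (B :: (nat \<Rightarrow> real) set)"
proof -
  define p where "p t = (1 - t) *\<^sub>R a + t *\<^sub>R b" for t :: real
  have cont: "continuous_on UNIV p" unfolding p_def by (intro continuous_intros)
  have cl: "closed (p -` A)" "closed (p -` B)"
    using cont A by (auto simp: continuous_on_closed_vimage)
  have meets: "X \<inter> Y \<inter> {0..1} \<noteq> {}" if "{0..1} \<subseteq> X \<union> Y" "0 \<in> X" "1 \<in> Y" "closed X" "closed Y" for X Y :: "real set"
  proof
    assume e: "X \<inter> Y \<inter> {0..1} = {}"
    have "X \<inter> {0..1} = {} \<or> Y \<inter> {0..1} = {}"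
      by (rule connected_closedD[OF connected_Icc e that(1)]) (use that in auto)
    moreover have "0 \<in> X \<inter> {0..1}" "1 \<in> Y \<inter> {0..1}" using that by auto
    ultimately show False by blast
  qed
  have "p t \<in> A \<union> B" if "t \<in> {0..1}" for t
    unfolding p_def by (rule convexD[OF c]) (use x that in auto)
  then have "{0..1} \<subseteq> p -` A \<union> p -` B" by blast
  moreover have "0 \<in> p -` A" "1 \<in> p -` B" using x by (auto simp: p_def)
  moreover note cl
  ultimately have "p -` A \<inter> p -` B \<inter> {0..1} \<noteq> {}"
    by (rule meets)
  then obtain t where "p t \<in> A" "p t \<in> B" "0 \<le> t" "t \<le> 1" by auto
  then show ?thesis using that[of t] unfolding p_def by blast
qed

text \<open>Convexity of the union makes addition of \<open>L\<close> commute with the intersection,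
  after which this is inclusion-exclusion for the measure. If x = a + l = b + l', some point of the
  segment from a to b lies in both sets, and the same convex combination of l and l' completes it to
  x.\<close>

lemma vol_plus_valuation:
  assumes A: "compact A" "A \<subseteq> Rn n" and B: "compact B" "B \<subseteq> Rn n" and AB: "convex (A \<union> B)"
    and L: "convex_body n L"
  shows "vol n (A \<union> B + L) + vol n (A \<inter> B + L) = vol n (A + L) + vol n (B + L)"
proof -
  have I: "A \<inter> B + L = (A + L) \<inter> (B + L)"
  proof (intro equalityI subsetI)
    fix x assume "x \<in> (A + L) \<inter> (B + L)"
    then obtain a l b l' where x: "a \<in> A" "l \<in> L" "x = a + l" "b \<in> B" "l' \<in> L" "x = b + l'"
      by (auto simp: set_plus_def)
    obtain t where t: "0 \<le> t" "t \<le> 1" "(1 - t) *\<^sub>R a + t *\<^sub>R b \<in> A \<inter> B"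
      using segment_meets_both[OF compact_imp_closed[OF A(1)] compact_imp_closed[OF B(1)] x(1) x(4) AB] .
    have "(1 - t) *\<^sub>R l + t *\<^sub>R l' \<in> L"
      by (rule convexD[OF body_convex[OF L]]) (use x t in auto)
    moreover have "x = ((1 - t) *\<^sub>R a + t *\<^sub>R b) + ((1 - t) *\<^sub>R l + t *\<^sub>R l')"
    proof -
      have "x = (1 - t) *\<^sub>R x + t *\<^sub>R x" by (simp add: scaleR_add_left[symmetric])
      also have "\<dots> = (1 - t) *\<^sub>R (a + l) + t *\<^sub>R (b + l')" using x by metis
      finally show ?thesis by (simp only: scaleR_add_right ac_simps)
    qed
    ultimately show "x \<in> A \<inter> B + L" using t(3) by (auto intro: set_plus_intro)
  qed (auto simp: set_plus_def)
  have c: "compact (A + L)" "compact (B + L)" "A + L \<subseteq> Rn n" "B + L \<subseteq> Rn n"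
    using A B L unfolding convex_body_iff by (blast intro: compact_fun_plus Rn_set_plus[THEN subsetD])+
  then have f: "A + L \<in> fmeasurable (lm n)" "B + L \<in> fmeasurable (lm n)"
    by (auto intro: fmeasurable_compact)
  have c': "compact ((A + L) \<union> (B + L))" "compact ((A + L) \<inter> (B + L))"
    using c by (auto intro: compact_Un compact_Int)
  show ?thesis unfolding I Un_set_plus
    using measure_Un3[OF f] c c' by (simp add: vol_compact le_infI1)
qed


text \<open>
  Every polytope arises from a point by translations and by passing to the hull with the origin.
  For the latter step, the valuation property of the volume gives
  \<open>vol (L + (s + u) Q) - vol (L + s Q) = vol (L + u Q + s K) - vol (L + s K)\<close> for the pyramid \<open>Q\<close>
  over \<open>K\<close>, which is a polynomial in \<open>s\<close> if the claim holds for \<open>K\<close>.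
\<close>

definition pyramid :: "(nat \<Rightarrow> real) set \<Rightarrow> (nat \<Rightarrow> real) set"
  where "pyramid K = (\<lambda>(t, x). t *\<^sub>R x) ` ({0..1} \<times> K)"

lemma mem_dil_pyramid:
  assumes "t \<ge> 0" "K \<noteq> {}"
  shows "x \<in> dil t (pyramid K) \<longleftrightarrow> (\<exists>v. 0 \<le> v \<and> v \<le> t \<and> x \<in> dil v K)"
proof
  assume "x \<in> dil t (pyramid K)"
  then obtain r k where "0 \<le> r" "r \<le> 1" "k \<in> K" "x = (t * r) *\<^sub>R k" by (auto simp: dil_def pyramid_def)
  then show "\<exists>v. 0 \<le> v \<and> v \<le> t \<and> x \<in> dil v K"
    using assms by (intro exI[of _ "t * r"]) (auto simp: dil_def mult_left_le)
next
  assume "\<exists>v. 0 \<le> v \<and> v \<le> t \<and> x \<in> dil v K"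
  then obtain v k where v: "0 \<le> v" "v \<le> t" "k \<in> K" "x = v *\<^sub>R k" by (auto simp: dil_def)
  show "x \<in> dil t (pyramid K)"
  proof (cases "t = 0")
    case True
    then show ?thesis using v by (auto simp: dil_def pyramid_def image_iff intro!: exI[of _ 0] bexI[of _ 0] bexI[of _ k])
  next
    case False
    then have "x = t *\<^sub>R ((v / t) *\<^sub>R k)" using v by simp
    moreover have "(v / t) *\<^sub>R k \<in> pyramid K" using v assms False
      by (auto simp: pyramid_def image_iff intro!: bexI[of _ "v / t"] bexI[of _ k])
    ultimately show ?thesis unfolding dil_def by (rule image_eqI)
  qed
qed

lemma dil_convex_between:
  assumes "convex K" "0 \<le> v" "v \<le> s" "s \<le> w" "x \<in> dil v K" "x \<in> dil w K"
  shows "x \<in> dil s K"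
proof (cases "v = w")
  case False
  define b where "b = (s - v) / (w - v)"
  have b: "0 \<le> b" "b \<le> 1" using assms False by (auto simp: b_def field_simps)
  have s: "(1 - b) * v + b * w = s"
  proof -
    have "b * (w - v) = s - v" using assms False by (simp add: b_def)
    then show ?thesis by (simp add: algebra_simps)
  qed
  have "x = (1 - b) *\<^sub>R x + b *\<^sub>R x" by (simp add: scaleR_add_left[symmetric])
  moreover have "(1 - b) *\<^sub>R x \<in> dil ((1 - b) * v) K" "b *\<^sub>R x \<in> dil (b * w) K"
    using imageI[OF assms(5), of "\<lambda>x. (1 - b) *\<^sub>R x"] imageI[OF assms(6), of "\<lambda>x. b *\<^sub>R x"]
    unfolding dil_def[symmetric] dil_dil by auto
  ultimately have "x \<in> dil ((1 - b) * v) K + dil (b * w) K" by (metis set_plus_intro)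
  also have "\<dots> = dil ((1 - b) * v + b * w) K"
    by (rule dil_add[symmetric]) (use assms b in auto)
  finally show ?thesis by (simp add: s)
qed (use assms in auto)

text \<open>A dilated pyramid is a union of slices \<open>dil v K\<close>. Cutting the range of
  \<open>v\<close> at \<open>s\<close> gives the two pieces. They overlap only in
  \<open>dil s K\<close>, because the scales \<open>v\<close> at which a given point lies in
  \<open>dil v K\<close> form an interval.\<close>

lemma dil_add_pyramid:
  assumes K: "convex K" "K \<noteq> {}" and su: "s \<ge> 0" "u \<ge> 0"
  shows "dil (s + u) (pyramid K) = dil s (pyramid K) \<union> (dil s K + dil u (pyramid K))"
    and "dil s (pyramid K) \<inter> (dil s K + dil u (pyramid K)) = dil s K"
proof -
  have m: "x \<in> dil s K + dil u (pyramid K) \<longleftrightarrow> (\<exists>v. s \<le> v \<and> v \<le> s + u \<and> x \<in> dil v K)" for x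
  proof
    assume "x \<in> dil s K + dil u (pyramid K)"
    then obtain a b where ab: "a \<in> dil s K" "b \<in> dil u (pyramid K)" "x = a + b" by (auto simp: set_plus_def)
    then obtain v where v: "0 \<le> v" "v \<le> u" "b \<in> dil v K" using mem_dil_pyramid su K by auto
    then have "x \<in> dil (s + v) K" using ab dil_add[OF K(1) su(1) v(1)] by (simp add: set_plus_intro)
    with v show "\<exists>v. s \<le> v \<and> v \<le> s + u \<and> x \<in> dil v K" by (intro exI[of _ "s + v"]) simp
  next
    assume "\<exists>v. s \<le> v \<and> v \<le> s + u \<and> x \<in> dil v K"
    then obtain v where v: "s \<le> v" "v \<le> s + u" "x \<in> dil v K" by auto
    then have "x \<in> dil s K + dil (v - s) K" using dil_add[OF K(1) su(1), of "v - s"] by simp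
    moreover have "dil (v - s) K \<subseteq> dil u (pyramid K)"
      using mem_dil_pyramid[OF su(2) K(2)] v by (auto intro!: exI[of _ "v - s"])
    ultimately show "x \<in> dil s K + dil u (pyramid K)" using set_plus_mono2 by blast
  qed
  show "dil (s + u) (pyramid K) = dil s (pyramid K) \<union> (dil s K + dil u (pyramid K))"
  proof (rule set_eqI)
    fix x
    have "x \<in> dil (s + u) (pyramid K) \<longleftrightarrow> (\<exists>v. 0 \<le> v \<and> v \<le> s + u \<and> x \<in> dil v K)"
      using mem_dil_pyramid[of "s + u" K x] su K by simp
    also have "\<dots> \<longleftrightarrow> x \<in> dil s (pyramid K) \<union> (dil s K + dil u (pyramid K))"
      unfolding Un_iff m mem_dil_pyramid[OF su(1) K(2)] using su by (meson add_increasing2 linear order_trans)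
    finally show "x \<in> dil (s + u) (pyramid K) \<longleftrightarrow> x \<in> dil s (pyramid K) \<union> (dil s K + dil u (pyramid K))" .
  qed
  show "dil s (pyramid K) \<inter> (dil s K + dil u (pyramid K)) = dil s K"
  proof (rule set_eqI)
    fix x
    show "x \<in> dil s (pyramid K) \<inter> (dil s K + dil u (pyramid K)) \<longleftrightarrow> x \<in> dil s K"
      unfolding Int_iff m mem_dil_pyramid[OF su(1) K(2)]
      using dil_convex_between[OF K(1)] su by (metis add.right_neutral add_left_mono order_refl)
  qed
qed

lemma compact_pyramid: "compact K \<Longrightarrow> compact (pyramid K)"
proof -
  assume "compact K"
  then have "compact ({0..1::real} \<times> K)" by (intro compact_Times) auto
  moreover have "continuous_on ({0..1} \<times> K) (\<lambda>z. fst z *\<^sub>R snd z)"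
    by (rule continuous_on_fun_scaleR) (rule continuous_on_fst continuous_on_snd, rule continuous_on_id)+
  ultimately show ?thesis using compact_continuous_image unfolding pyramid_def case_prod_unfold by blast
qed

lemma pyramid_hull:
  assumes "convex K" "K \<noteq> {}"
  shows "pyramid K = convex hull (insert 0 K)"
  using assms by (force simp: pyramid_def convex_hull_insert_alt hull_same)

lemma body_pyramid:
  assumes "convex_body n K" shows "convex_body n (pyramid K)"
proof -
  have "pyramid K \<subseteq> Rn n" using body_Rn[OF assms] by (auto simp: pyramid_def Rn_scale)
  moreover have "convex (pyramid K)" using pyramid_hull[OF body_convex body_ne, OF assms assms] by simp
  moreover have "pyramid K \<noteq> {}" using body_ne[OF assms] by (auto simp: pyramid_def)
  ultimately show ?thesis using compact_pyramid[OF body_compact[OF assms]] by (simp add: convex_body_iff)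
qed

text \<open>The body \<open>L\<close> is quantified inside so that it may grow: the step from
  \<open>K\<close> to its pyramid uses the claim for \<open>K\<close> with a dilate of the pyramid
  added to \<open>L\<close>.\<close>

definition good :: "nat \<Rightarrow> (nat \<Rightarrow> real) set \<Rightarrow> bool"
  where "good n K \<longleftrightarrow> convex_body n K \<and>
    (\<forall>L. convex_body n L \<longrightarrow> pol n (\<lambda>s. vol n (L + dil s K)))"

text \<open>Supplies the degree bound, which \<open>polynomial_of_differences\<close> leaves open:
  both bodies are enclosed in cubes.\<close>

lemma vol_dil_growth:
  assumes "convex_body n L" "convex_body n K"
  obtains C where "\<And>s. s \<ge> 1 \<Longrightarrow> vol n (L + dil s K) \<le> C * s ^ n"
proof -
  obtain a where a: "a > 0" "L \<subseteq> Box n a"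
    using compact_subset_Box[OF body_compact body_Rn, OF assms(1) assms(1)] .
  obtain b where b: "b > 0" "K \<subseteq> Box n b"
    using compact_subset_Box[OF body_compact body_Rn, OF assms(2) assms(2)] .
  have "vol n (L + dil s K) \<le> (2 * (a + b)) ^ n * s ^ n" if s: "s \<ge> 1" for s
  proof -
    have "L + dil s K \<subseteq> Box n a + Box n (s * b)"
      using a b s dil_mono[OF b(2), of s] dil_Box[of s b n] by (intro set_plus_mono2) auto
    also have "\<dots> \<subseteq> Box n (a + s * b)" by (rule Box_plus)
    also have "\<dots> \<subseteq> Box n (s * (a + b))"
    proof -
      have "a + s * b \<le> s * (a + b)" using a s by (simp add: distrib_left)
      then show ?thesis by (force simp: Box_def)
    qed
    finally have "vol n (L + dil s K) \<le> vol n (Box n (s * (a + b)))"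
      using s a b by (intro vol_mono_body body_plus body_dil assms body_Box) auto
    also have "\<dots> = (2 * (a + b)) ^ n * s ^ n"
      using s a b by (simp add: vol_Box power_mult_distrib[symmetric] mult_ac)
    finally show ?thesis .
  qed
  then show ?thesis by (rule that)
qed

lemma good_pyramid:
  assumes "good n K" shows "good n (pyramid K)"
proof -
  have K: "convex_body n K" and p: "\<And>L. convex_body n L \<Longrightarrow> pol n (\<lambda>s. vol n (L + dil s K))"
    using assms by (auto simp: good_def)
  note C = body_pyramid[OF K]
  have "pol n (\<lambda>s. vol n (L + dil s (pyramid K)))" if L: "convex_body n L" for L
  proof -
    let ?f = "\<lambda>s. vol n (L + dil s (pyramid K))"
    have d: "?f (s + u) - ?f s = vol n (L + dil u (pyramid K) + dil s K) - vol n (L + dil s K)"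
      if su: "s \<ge> 0" "u \<ge> 0" for s u
    proof -
      let ?A = "dil s (pyramid K)" and ?B = "dil s K + dil u (pyramid K)"
      note e = dil_add_pyramid[OF body_convex[OF K] body_ne[OF K] su]
      have b: "convex_body n ?A" "convex_body n ?B" "convex_body n (dil (s + u) (pyramid K))"
        by (intro body_plus body_dil C K)+
      have "vol n (?A \<union> ?B + L) + vol n (?A \<inter> ?B + L) = vol n (?A + L) + vol n (?B + L)"
        by (rule vol_plus_valuation)
           (use b e L in \<open>auto simp: convex_body_iff\<close>)
      then show ?thesis unfolding e(2) e(1)[symmetric] by (simp add: ac_simps)
    qed
    have "\<exists>q. \<forall>s\<ge>0. ?f s = poly q s"
    proof (rule polynomial_of_differences)
      fix u :: real assume u: "u \<ge> 0"
      obtain q where q: "\<forall>s\<ge>0. vol n (L + dil u (pyramid K) + dil s K) = poly q s"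
        using p[of "L + dil u (pyramid K)"] L C by (auto simp: pol_def body_plus body_dil)
      obtain q' where q': "\<forall>s\<ge>0. vol n (L + dil s K) = poly q' s"
        using p[OF L] by (auto simp: pol_def)
      show "\<exists>q. \<forall>s\<ge>0. ?f (s + u) - ?f s = poly q s"
        using d u q q' by (intro exI[of _ "q - q'"]) simp
    next
      fix s :: real assume s: "0 \<le> s" "s \<le> 1"
      \<comment> \<open>A pyramid is a union of segments from the origin, so its dilates increase
        with \<open>s\<close>, and the value at 1 bounds \<open>?f\<close> on the unit
        interval.\<close>
      have "dil s (pyramid K) \<subseteq> dil 1 (pyramid K)"
        using mem_dil_pyramid[OF s(1) body_ne[OF K]] mem_dil_pyramid[OF zero_le_one body_ne[OF K]] s(2)
        by (meson order_trans subsetI)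
      then have "?f s \<le> ?f 1"
        by (intro vol_mono_body body_plus body_dil C L set_plus_mono2) auto
      then show "\<bar>?f s\<bar> \<le> ?f 1" by simp
    qed
    then obtain q where q: "\<And>s. s \<ge> 0 \<Longrightarrow> ?f s = poly q s" by blast
    obtain c where c: "\<And>s. s \<ge> 1 \<Longrightarrow> ?f s \<le> c * s ^ n" using vol_dil_growth[OF L C] by blast
    have "degree q \<le> n"
    proof (rule degree_le_of_growth)
      fix s :: real assume s: "s \<ge> 1"
      have "poly q s = ?f s" using q[of s] s by simp
      moreover have "0 \<le> ?f s" by simp
      ultimately show "\<bar>poly q s\<bar> \<le> c * s ^ n" using c[OF s] by linarith
    qed
    with q show ?thesis by (auto simp: pol_def)
  qed
  with C show ?thesis by (simp add: good_def)
qed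

lemma dil_sing: "dil s {a} = {s *\<^sub>R a}"
  by (simp add: dil_def)

lemma good_trl:
  assumes "good n K" "a \<in> Rn n" shows "good n (K + {a})"
proof -
  have K: "convex_body n K" and p: "\<And>L. convex_body n L \<Longrightarrow> pol n (\<lambda>s. vol n (L + dil s K))"
    using assms by (auto simp: good_def)
  have "vol n (L + dil s (K + {a})) = vol n (L + dil s K)" if L: "convex_body n L" for L s
  proof -
    have "L + dil s (K + {a}) = (L + dil s K) + {s *\<^sub>R a}"
      by (simp only: dil_set_plus dil_sing ac_simps)
    then show ?thesis
      using vol_trl_body[OF body_plus[OF L body_dil[OF K]] Rn_scale[OF assms(2)]] by simp
  qed
  then show ?thesis using p body_plus[OF K body_sing[OF assms(2)]] unfolding good_def by simp
qed

lemma good_polytope: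
  assumes "finite S" "S \<noteq> {}" "S \<subseteq> Rn n"
  shows "good n (convex hull S)"
  using assms
proof (induction S rule: finite_ne_induct)
  case (singleton v)
  have "pol n (\<lambda>s. vol n (L + dil s {v}))" if "convex_body n L" for L
    using vol_trl_body[OF that] singleton
    by (auto simp: pol_def dil_sing Rn_scale intro!: exI[of _ "[:vol n L:]"])
  then show ?case using singleton by (simp add: good_def body_sing)
next
  case (insert v S)
  let ?H = "convex hull S"
  have v: "v \<in> Rn n" "- v \<in> Rn n" using insert.prems by (auto simp: Rn_minus)
  have "good n ?H" using insert by simp
  then have g: "good n (pyramid (?H + {- v}) + {v})" by (intro good_trl good_pyramid v)
  \<comment> \<open>Moving the new vertex \<open>v\<close> to the origin turns the hull with
    \<open>v\<close> into a pyramid over the translated old hull.\<close>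
  have "convex hull (insert v S) = pyramid (?H + {- v}) + {v}"
  proof (intro equalityI subsetI)
    fix x assume "x \<in> convex hull (insert v S)"
    then obtain u y where u: "0 \<le> u" "u \<le> 1" "y \<in> ?H" "x = (1 - u) *\<^sub>R v + u *\<^sub>R y"
      using insert.hyps by (auto simp: convex_hull_insert_alt)
    then have "x = u *\<^sub>R (y + - v) + v" by (simp add: algebra_simps)
    then show "x \<in> pyramid (?H + {- v}) + {v}"
    proof -
      have "y + - v \<in> ?H + {- v}" using u(3) by (intro set_plus_intro) auto
      then have "u *\<^sub>R (y + - v) \<in> pyramid (?H + {- v})"
        using u(1,2) unfolding pyramid_def by (intro image_eqI[of _ _ "(u, y + - v)"]) auto
      then show ?thesis using \<open>x = u *\<^sub>R (y + - v) + v\<close> by (metis set_plus_intro singletonI)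
    qed
  next
    fix x assume "x \<in> pyramid (?H + {- v}) + {v}"
    then obtain u y where u: "0 \<le> u" "u \<le> 1" "y \<in> ?H" "x = u *\<^sub>R (y + - v) + v"
      by (auto simp: pyramid_def set_plus_def)
    then have "x = (1 - u) *\<^sub>R v + u *\<^sub>R y" by (simp add: algebra_simps)
    then show "x \<in> convex hull (insert v S)"
      using u insert.hyps by (auto simp: convex_hull_insert_alt)
  qed
  with g show ?case by simp
qed

lemma Box_polytope:
  assumes "r > 0"
  obtains V where "finite V" "V \<noteq> {}" "V \<subseteq> Rn n" "Box n r = convex hull V"
proof
  define V where "V = {x \<in> Rn n. \<forall>i<n. x i \<in> {r, - r}}"
  show "V \<subseteq> Rn n" by (auto simp: V_def)
  have "V \<subseteq> (\<lambda>f i. if i < n then f i else 0) ` PiE {..<n} (\<lambda>_. {r, - r})"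
  proof
    fix x assume x: "x \<in> V"
    then have "x = (\<lambda>i. if i < n then restrict x {..<n} i else 0)"
      by (auto simp: V_def Rn_def fun_eq_iff)
    moreover have "restrict x {..<n} \<in> PiE {..<n} (\<lambda>_. {r, - r})" using x by (auto simp: V_def)
    ultimately show "x \<in> (\<lambda>f i. if i < n then f i else 0) ` PiE {..<n} (\<lambda>_. {r, - r})" by (rule image_eqI)
  qed
  moreover have "finite ((\<lambda>f i. if i < n then f i else 0) ` PiE {..<n} (\<lambda>_. {r, - r}))"
    by (intro finite_imageI finite_PiE) auto
  ultimately show "finite V" using finite_subset by blast
  have "(\<lambda>i. if i < n then r else 0) \<in> V" by (auto simp: V_def Rn_def)
  then show "V \<noteq> {}" by blast
  \<comment> \<open>Coordinates are pushed to extreme values one at a time: \<open>x\<close> is the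
    combination, with weights \<open>t\<close> and \<open>1 - t\<close>, of the two points that have
    \<open>r\<close> and \<open>- r\<close> as coordinate \<open>m\<close>.\<close>
  have "x \<in> convex hull V" if "m \<le> n" "x \<in> Box n r" "\<forall>i. m \<le> i \<and> i < n \<longrightarrow> x i \<in> {r, - r}" for m x
    using that
  proof (induction m arbitrary: x)
    case 0
    then have "x \<in> V" by (auto simp: V_def Box_def)
    then show ?case by (rule hull_inc)
  next
    case (Suc m)
    define t where "t = (r + x m) / (2 * r)"
    have xm: "\<bar>x m\<bar> \<le> r" using Suc.prems by (simp add: Box_def)
    have t: "0 \<le> t" "t \<le> 1" using xm assms by (auto simp: t_def field_simps abs_le_iff)
    have m: "x(m := c) \<in> convex hull V" if "c \<in> {r, - r}" for c
      by (rule Suc.IH) (use Suc.prems that assms in \<open>auto simp: Box_def Rn_def le_Suc_eq Suc_le_eq\<close>)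
    have "x = t *\<^sub>R x(m := r) + (1 - t) *\<^sub>R x(m := - r)"
    proof
      fix i
      have "t * r + (1 - t) * - r = x m" using assms by (simp add: t_def field_simps)
      then show "x i = (t *\<^sub>R x(m := r) + (1 - t) *\<^sub>R x(m := - r)) i"
        by (simp add: scaleR_fun_apply algebra_simps)
    qed
    moreover have "t *\<^sub>R x(m := r) + (1 - t) *\<^sub>R x(m := - r) \<in> convex hull V"
      by (rule convexD[OF convex_convex_hull]) (use m t in auto)
    ultimately show ?case by metis
  qed
  then have "Box n r \<subseteq> convex hull V" by (metis order_refl not_le subsetI)
  moreover have "convex hull V \<subseteq> Box n r"
    by (rule hull_minimal) (use body_convex[OF body_Box[of r n]] assms in \<open>auto simp: V_def Box_def\<close>)
  ultimately show "Box n r = convex hull V" by simp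
qed

lemma open_cube: "open {y. \<forall>i<n. \<bar>y i - x i\<bar> < (r::real)}" for x :: "nat \<Rightarrow> real"
proof -
  have "open {y. \<bar>y i - x i\<bar> < r}" for i
    by (intro open_Collect_less continuous_on_rabs continuous_on_diff continuous_coord continuous_on_const)
  then have "open (\<Inter>i\<in>{..<n}. {y. \<bar>y i - x i\<bar> < r})" by (intro open_INT) auto
  moreover have "{y. \<forall>i<n. \<bar>y i - x i\<bar> < r} = (\<Inter>i\<in>{..<n}. {y. \<bar>y i - x i\<bar> < r})" by auto
  ultimately show ?thesis by simp
qed

text \<open>A finite net of mesh \<open>r\<close> in \<open>K\<close>, enlarged by the vertices of
  the cube of radius \<open>r\<close>. The hull of the net alone would lie inside \<open>K\<close>;
  adding the cube makes the approximation an outer one.\<close>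

lemma polytope_approx:
  assumes K: "convex_body n K" and r: "r > 0"
  obtains S where "finite S" "S \<noteq> {}" "S \<subseteq> Rn n" "K \<subseteq> convex hull S" "convex hull S \<subseteq> K + Box n r"
proof -
  obtain V where V: "finite V" "V \<noteq> {}" "V \<subseteq> Rn n" "Box n r = convex hull V"
    using Box_polytope[OF r] .
  let ?U = "\<lambda>x. {y. \<forall>i<n. \<bar>y i - x i\<bar> < r}"
  have cov: "K \<subseteq> (\<Union>x\<in>K. ?U x)" using r by auto
  obtain C where C: "C \<subseteq> K" "finite C" "K \<subseteq> (\<Union>x\<in>C. ?U x)"
    using compactE_image[OF body_compact[OF K] open_cube cov] .
  have C0: "C \<noteq> {}" using C(3) body_ne[OF K] by auto
  have "K \<subseteq> convex hull C + Box n r"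
  proof
    fix y assume y: "y \<in> K"
    then obtain x where x: "x \<in> C" "\<forall>i<n. \<bar>y i - x i\<bar> < r" using C(3) by blast
    have "y - x \<in> Box n r"
      using x y C(1) body_Rn[OF K] by (auto simp: Box_def less_imp_le intro!: Rn_diff)
    moreover have "x \<in> convex hull C" using x by (simp add: hull_inc)
    moreover have "y = x + (y - x)" by simp
    ultimately show "y \<in> convex hull C + Box n r" by (metis set_plus_intro)
  qed
  moreover have "convex hull C \<subseteq> K" using C(1) body_convex[OF K] by (simp add: hull_minimal)
  then have "convex hull C + Box n r \<subseteq> K + Box n r" by (intro set_plus_mono2) auto
  moreover have "convex hull C + Box n r = convex hull (C + V)"
    by (simp add: V(4) convex_hull_set_plus)
  moreover have "finite (C + V)" using C(2) V(1) by (rule finite_set_plus)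
  moreover have "C + V \<noteq> {}" using C0 V(2) by (auto simp: set_plus_def)
  moreover have "C + V \<subseteq> Rn n" using C(1) body_Rn[OF K] V(3) by (intro Rn_set_plus) auto
  ultimately show ?thesis using that[of "C + V"] by simp
qed

text \<open>Outer polytopes approximate the volume for every fixed \<open>s\<close>, and all of them
  give polynomials with the same degree bound, so \<open>pol_limit\<close> applies.\<close>

theorem vol_plus_dil_pol:
  assumes L: "convex_body n L" and K: "convex_body n K"
  shows "pol n (\<lambda>s. vol n (L + dil s K))"
proof -
  have "\<exists>Q. good n Q \<and> K \<subseteq> Q \<and> Q \<subseteq> K + Box n (1 / real (Suc k))" for k
    using polytope_approx[OF K, of "1 / real (Suc k)"] good_polytope by (metis of_nat_0_less_iff zero_less_Suc zero_less_divide_1_iff)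
  then obtain Q where Q: "\<And>k. good n (Q k)" "\<And>k. K \<subseteq> Q k" "\<And>k. Q k \<subseteq> K + Box n (1 / real (Suc k))"
    by metis
  have QB: "convex_body n (Q k)" for k using Q(1) by (simp add: good_def)
  show ?thesis
  proof (rule pol_limit)
    show "pol n (\<lambda>s. vol n (L + dil s (Q k)))" for k using Q(1) L by (simp add: good_def)
    fix s :: real assume s: "s \<ge> 0"
    let ?D = "L + dil s K"
    have D: "convex_body n ?D" by (intro body_plus L body_dil K)
    show "(\<lambda>k. vol n (L + dil s (Q k))) \<longlonglongrightarrow> vol n ?D"
    proof (rule tendsto_sandwich)
      show "\<forall>\<^sub>F k in sequentially. vol n ?D \<le> vol n (L + dil s (Q k))"
        by (intro always_eventually allI vol_mono_body D body_plus L body_dil QB set_plus_mono2 dil_mono Q) auto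
      show "\<forall>\<^sub>F k in sequentially. vol n (L + dil s (Q k)) \<le> vol n (?D + Box n (s / real (Suc k)))"
      proof (intro always_eventually allI vol_mono_body D body_plus L body_dil QB body_Box)
        fix k
        have "dil s (Q k) \<subseteq> dil s K + dil s (Box n (1 / real (Suc k)))"
          using dil_mono[OF Q(3), of s k] by (simp only: dil_set_plus)
        also have "\<dots> \<subseteq> dil s K + Box n (s / real (Suc k))"
          using dil_Box[OF s, of "1 / real (Suc k)" n] by (intro set_plus_mono2) auto
        finally have "L + dil s (Q k) \<subseteq> L + (dil s K + Box n (s / real (Suc k)))"
          by (intro set_plus_mono2) auto
        then show "L + dil s (Q k) \<subseteq> ?D + Box n (s / real (Suc k))" by (simp only: add.assoc)
      qed (use s in auto)
      show "(\<lambda>k. vol n (?D + Box n (s / real (Suc k)))) \<longlonglongrightarrow> vol n ?D"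
        by (rule vol_plus_Box_tendsto[OF body_compact body_Rn s]) (rule D)+
    qed simp
  qed
qed

subsection \<open>Polynomials in several variables\<close>

lemma sum_PiE_Suc:
  "(\<Sum>g\<in>PiE {..<Suc q} B. h g) = (\<Sum>g\<in>PiE {..<q} B. \<Sum>x\<in>B q. h (g(q := x)))"
proof -
  have "(\<Sum>g\<in>PiE {..<Suc q} B. h g) = (\<Sum>(x, g)\<in>B q \<times> PiE {..<q} B. h (g(q := x)))"
    unfolding lessThan_Suc PiE_insert_eq
    by (subst sum.reindex[OF inj_combinator]) (auto simp: case_prod_unfold)
  also have "\<dots> = (\<Sum>x\<in>B q. \<Sum>g\<in>PiE {..<q} B. h (g(q := x)))"
    by (simp add: sum.cartesian_product)
  also have "\<dots> = (\<Sum>g\<in>PiE {..<q} B. \<Sum>x\<in>B q. h (g(q := x)))" by (rule sum.swap)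
  finally show ?thesis .
qed

abbreviation mindex :: "nat \<Rightarrow> nat \<Rightarrow> (nat \<Rightarrow> nat) set"
  where "mindex q d \<equiv> PiE {..<q} (\<lambda>_. {..d})"

text \<open>
  A polynomial \<open>Q\<close> of degree at most \<open>d\<close> in each of \<open>q\<close> variables is recovered from its values on
  the grid \<open>{1, \<dots>, d + 1}\<^sup>q\<close>; \<open>mcoeff d q Q a\<close> is its coefficient at the monomial with exponents \<open>a\<close>.
\<close>

definition nodes :: "(nat \<Rightarrow> nat) \<Rightarrow> nat \<Rightarrow> real"
  where "nodes g = (\<lambda>i. real (g i) + 1)"

definition mcoeff :: "nat \<Rightarrow> nat \<Rightarrow> ((nat \<Rightarrow> real) \<Rightarrow> real) \<Rightarrow> (nat \<Rightarrow> nat) \<Rightarrow> real"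
  where "mcoeff d q Q a = (\<Sum>g\<in>mindex q d. Q (nodes g) * (\<Prod>j<q. coeff (lag d (g j)) (a j)))"

lemma finite_mindex [simp]: "finite (mindex q d)"
  by (simp add: finite_PiE)

text \<open>Interpolation in one variable after the other. The variables from \<open>q\<close> on
  are left at \<open>c\<close>, which lets the induction on \<open>q\<close> go through.\<close>

lemma multi_lagrange:
  assumes "\<And>c j. j < q \<Longrightarrow> (\<forall>i. 0 \<le> c i) \<Longrightarrow> pol d (\<lambda>s. Q (c(j := s)))" "\<forall>i. 0 \<le> c i"
  shows "Q c = (\<Sum>g\<in>mindex q d. Q (\<lambda>i. if i < q then real (g i) + 1 else c i) *
    (\<Prod>j<q. poly (lag d (g j)) (c j)))"
  using assms
proof (induction q)
  case 0
  then show ?case by simp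
next
  case (Suc q)
  have "Q (\<lambda>i. if i < q then real (g i) + 1 else c i) =
      (\<Sum>x\<le>d. Q (\<lambda>i. if i < Suc q then real ((g(q := x)) i) + 1 else c i) * poly (lag d x) (c q))" for g
  proof -
    let ?c = "\<lambda>i. if i < q then real (g i) + 1 else c i"
    have "pol d (\<lambda>s. Q (?c(q := s)))" by (rule Suc.prems(1)) (use Suc.prems(2) in auto)
    then have A: "Q (?c(q := c q)) = (\<Sum>x\<le>d. Q (?c(q := real x + 1)) * poly (lag d x) (c q))"
      using Suc.prems(2) unfolding pol_lagrange by blast
    have B: "?c(q := c q) = ?c" by auto
    have C: "?c(q := real x + 1) = (\<lambda>i. if i < Suc q then real ((g(q := x)) i) + 1 else c i)" for x
      by (auto simp: fun_eq_iff less_Suc_eq)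
    show ?thesis using A unfolding B C .
  qed
  note step = this
  have "Q c = (\<Sum>g\<in>mindex q d. Q (\<lambda>i. if i < q then real (g i) + 1 else c i) *
      (\<Prod>j<q. poly (lag d (g j)) (c j)))"
    by (rule Suc.IH) (use Suc.prems in auto)
  also have "\<dots> = (\<Sum>g\<in>mindex q d. \<Sum>x\<le>d. Q (\<lambda>i. if i < Suc q then real ((g(q := x)) i) + 1 else c i) *
      (\<Prod>j<Suc q. poly (lag d ((g(q := x)) j)) (c j)))"
    unfolding step by (rule sum.cong) (simp_all add: sum_distrib_right sum_distrib_left mult_ac)
  finally show ?case unfolding sum_PiE_Suc .
qed

lemma poly_eq_sum_coeff:
  fixes p :: "real poly"
  assumes "degree p \<le> d" shows "poly p x = (\<Sum>a\<le>d. coeff p a * x ^ a)"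
proof -
  have "(\<Sum>a\<le>degree p. coeff p a * x ^ a) = (\<Sum>a\<le>d. coeff p a * x ^ a)"
    by (rule sum.mono_neutral_left) (use assms in \<open>auto simp: coeff_eq_0\<close>)
  then show ?thesis by (simp add: poly_altdef)
qed

lemma multi_expand:
  assumes pol: "\<And>c j. j < q \<Longrightarrow> (\<forall>i. 0 \<le> c i) \<Longrightarrow> pol d (\<lambda>s. Q (c(j := s)))" and c: "\<forall>i. 0 \<le> c i"
    and ind: "\<And>c c'. (\<And>i. i < q \<Longrightarrow> c i = c' i) \<Longrightarrow> Q c = Q c'"
  shows "Q c = (\<Sum>a\<in>mindex q d. mcoeff d q Q a * (\<Prod>j<q. c j ^ a j))"
proof -
  have "Q c = (\<Sum>g\<in>mindex q d. Q (\<lambda>i. if i < q then real (g i) + 1 else c i) *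
      (\<Prod>j<q. poly (lag d (g j)) (c j)))"
    by (rule multi_lagrange[OF pol c])
  also have "\<dots> = (\<Sum>g\<in>mindex q d. Q (nodes g) * (\<Sum>a\<in>mindex q d. \<Prod>j<q. coeff (lag d (g j)) (a j) * c j ^ a j))"
  proof (rule sum.cong)
    fix g assume g: "g \<in> mindex q d"
    have "(\<Prod>j<q. poly (lag d (g j)) (c j)) = (\<Prod>j<q. \<Sum>a\<le>d. coeff (lag d (g j)) a * c j ^ a)"
    proof (rule prod.cong)
      fix j assume "j \<in> {..<q}"
      then have "g j \<le> d" using g by auto
      then show "poly (lag d (g j)) (c j) = (\<Sum>a\<le>d. coeff (lag d (g j)) a * c j ^ a)"
        by (intro poly_eq_sum_coeff degree_lag)
    qed simp
    also have "\<dots> = (\<Sum>a\<in>mindex q d. \<Prod>j<q. coeff (lag d (g j)) (a j) * c j ^ a j)"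
      by (rule prod_sum_PiE) auto
    finally have 1: "(\<Prod>j<q. poly (lag d (g j)) (c j)) = (\<Sum>a\<in>mindex q d. \<Prod>j<q. coeff (lag d (g j)) (a j) * c j ^ a j)" .
    have 2: "Q (\<lambda>i. if i < q then real (g i) + 1 else c i) = Q (nodes g)"
      by (rule ind) (simp add: nodes_def)
    show "Q (\<lambda>i. if i < q then real (g i) + 1 else c i) * (\<Prod>j<q. poly (lag d (g j)) (c j)) =
      Q (nodes g) * (\<Sum>a\<in>mindex q d. \<Prod>j<q. coeff (lag d (g j)) (a j) * c j ^ a j)"
      unfolding 1 2 ..
  qed simp
  also have "\<dots> = (\<Sum>g\<in>mindex q d. \<Sum>a\<in>mindex q d. Q (nodes g) * (\<Prod>j<q. coeff (lag d (g j)) (a j)) * (\<Prod>j<q. c j ^ a j))"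
    by (simp add: sum_distrib_left prod.distrib mult.assoc)
  also have "\<dots> = (\<Sum>a\<in>mindex q d. \<Sum>g\<in>mindex q d. Q (nodes g) * (\<Prod>j<q. coeff (lag d (g j)) (a j)) * (\<Prod>j<q. c j ^ a j))"
    by (rule sum.swap)
  finally show ?thesis by (simp add: mcoeff_def sum_distrib_right)
qed

text \<open>Interpolate the monomial of degree \<open>b\<close> and compare coefficients at degree
  \<open>a\<close>: the matrix of Lagrange coefficients and the Vandermonde matrix of the nodes are
  inverse to each other.\<close>

lemma lag_biorthogonal:
  assumes "a \<le> d" "b \<le> d"
  shows "(\<Sum>g\<le>d. coeff (lag d g) a * (real g + 1) ^ b) = (if a = b then 1 else 0)"
proof -
  have "monom (1::real) b = (\<Sum>g\<le>d. smult (poly (monom 1 b) (real g + 1)) (lag d g))"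
    by (rule poly_lagrange) (use assms in \<open>simp add: degree_monom_eq\<close>)
  then have "coeff (monom (1::real) b) a = (\<Sum>g\<le>d. coeff (lag d g) a * (real g + 1) ^ b)"
    by (subst (asm) poly_eq_iff) (simp add: coeff_sum poly_monom mult.commute)
  then show ?thesis by (simp split: if_splits)
qed

lemma mcoeff_unique:
  assumes Q: "\<And>g. g \<in> mindex q d \<Longrightarrow> Q (nodes g) = (\<Sum>a\<in>mindex q d. b a * (\<Prod>j<q. nodes g j ^ a j))"
    and a: "a \<in> mindex q d"
  shows "mcoeff d q Q a = b a"
proof -
  have "mcoeff d q Q a = (\<Sum>g\<in>mindex q d. \<Sum>e\<in>mindex q d. b e * (\<Prod>j<q. coeff (lag d (g j)) (a j) * (real (g j) + 1) ^ e j))"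
    unfolding mcoeff_def
    by (rule sum.cong[OF refl], simp only: Q)
      (simp add: sum_distrib_left sum_distrib_right prod.distrib nodes_def mult_ac)
  also have "\<dots> = (\<Sum>e\<in>mindex q d. b e * (\<Sum>g\<in>mindex q d. \<Prod>j<q. coeff (lag d (g j)) (a j) * (real (g j) + 1) ^ e j))"
    by (subst sum.swap) (simp add: sum_distrib_left)
  also have "\<dots> = (\<Sum>e\<in>mindex q d. b e * (\<Prod>j<q. \<Sum>g\<le>d. coeff (lag d g) (a j) * (real g + 1) ^ e j))"
    by (simp only: prod_sum_PiE[OF finite_lessThan finite_atMost])
  also have "\<dots> = (\<Sum>e\<in>mindex q d. b e * (if e = a then 1 else 0))"
  proof (rule sum.cong)
    fix e assume e: "e \<in> mindex q d"
    have "(\<Prod>j<q. \<Sum>g\<le>d. coeff (lag d g) (a j) * (real g + 1) ^ e j) = (\<Prod>j<q. if a j = e j then 1 else 0)"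
    proof (rule prod.cong)
      fix j assume "j \<in> {..<q}"
      then have "a j \<le> d" "e j \<le> d" using a e by auto
      then show "(\<Sum>g\<le>d. coeff (lag d g) (a j) * (real g + 1) ^ e j) = (if a j = e j then 1 else 0)"
        by (rule lag_biorthogonal)
    qed simp
    also have "\<dots> = (if e = a then 1 else 0)"
    proof (cases "e = a")
      case False
      then obtain j where "j < q" "a j \<noteq> e j" using PiE_ext[OF e a] by (metis lessThan_iff)
      then show ?thesis using False by (auto intro!: prod_zero)
    qed simp
    finally show "b e * (\<Prod>j<q. \<Sum>g\<le>d. coeff (lag d g) (a j) * (real g + 1) ^ e j) = b e * (if e = a then 1 else 0)"
      by simp
  qed simp
  also have "\<dots> = b a" using a by (simp add: if_distrib[of "(*) _"] sum.delta cong: if_cong)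
  finally show ?thesis .
qed

text \<open>The single scaling factor 2 is enough: it multiplies the coefficient at \<open>a\<close>
  both by 2^m and by 2 to the total degree of \<open>a\<close>, and these differ.\<close>

lemma mcoeff_homogeneous:
  assumes pol: "\<And>c j. j < q \<Longrightarrow> (\<forall>i. 0 \<le> c i) \<Longrightarrow> pol d (\<lambda>s. Q (c(j := s)))"
    and ind: "\<And>c c'. (\<And>i. i < q \<Longrightarrow> c i = c' i) \<Longrightarrow> Q c = Q c'"
    and hom: "\<And>c. (\<forall>i. 0 \<le> c i) \<Longrightarrow> Q (\<lambda>i. 2 * c i) = 2 ^ m * Q c"
    and a: "a \<in> mindex q d" "(\<Sum>j<q. a j) \<noteq> m"
  shows "mcoeff d q Q a = 0"
proof -
  let ?Q = "\<lambda>c. Q (\<lambda>i. 2 * c i)"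
  have n: "0 \<le> nodes g i" for g i by (simp add: nodes_def)
  have "mcoeff d q ?Q a = 2 ^ m * mcoeff d q Q a"
    using hom n by (simp add: mcoeff_def sum_distrib_left mult.assoc)
  moreover have "mcoeff d q ?Q a = mcoeff d q Q a * 2 ^ (\<Sum>j<q. a j)"
  proof (rule mcoeff_unique[OF _ a(1)])
    fix g assume "g \<in> mindex q d"
    have "?Q (nodes g) = (\<Sum>a\<in>mindex q d. mcoeff d q Q a * (\<Prod>j<q. (2 * nodes g j) ^ a j))"
      by (rule multi_expand[OF pol _ ind]) (use n in auto)
    then show "?Q (nodes g) = (\<Sum>a\<in>mindex q d. mcoeff d q Q a * 2 ^ (\<Sum>j<q. a j) * (\<Prod>j<q. nodes g j ^ a j))"
      by (simp add: power_mult_distrib prod.distrib power_sum mult.assoc)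
  qed
  ultimately have "(2 ^ m - 2 ^ (\<Sum>j<q. a j)) * mcoeff d q Q a = 0" by (simp add: algebra_simps)
  moreover have "(2::real) ^ m \<noteq> 2 ^ (\<Sum>j<q. a j)" using a(2) by simp
  ultimately show ?thesis by simp
qed

subsection \<open>Iterated partial derivatives\<close>

text \<open>The falling factorial a (a - 1) ... (a - k + 1), left behind by \<open>k\<close>
  derivatives of x^a. With real subtraction it vanishes for \<open>a < k\<close>, where the
  truncated exponent \<open>a - k\<close> would otherwise leave a spurious constant.\<close>

definition ffact :: "nat \<Rightarrow> nat \<Rightarrow> real"
  where "ffact a k = (\<Prod>t<k. real a - real t)"

lemma ffact_zero: "a < k \<Longrightarrow> ffact a k = 0"
  unfolding ffact_def by (rule prod_zero) auto

lemma ffact_self: "ffact k k = fact k"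
proof -
  have "(\<Prod>t<k. real k - real t) = (\<Prod>t<k. real (k - t))"
    by (rule prod.cong) (auto simp: of_nat_diff)
  then show ?thesis by (simp add: ffact_def fact_prod_rev atLeast0LessThan)
qed

lemma ffact_Suc: "ffact a (Suc k) = ffact a k * (real a - real k)"
  by (simp add: ffact_def)

lemma partial_deriv_cong_pos:
  assumes eq: "\<And>c. (\<forall>i. 0 < c i) \<Longrightarrow> f c = g c" and c: "\<forall>i. 0 < (c i :: real)"
  shows "partial_deriv i f c = partial_deriv i g c"
  unfolding partial_deriv_def
proof (rule deriv_cong_ev[OF _ refl])
  have "\<forall>\<^sub>F t in nhds (c i). t > 0" using c by (intro order_tendstoD(1)[OF filterlim_ident]) auto
  then show "\<forall>\<^sub>F t in nhds (c i). f (c(i := t)) = g (c(i := t))"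
    by eventually_elim (rule eq, use c in auto)
qed

text \<open>The variables enter only through their block sums, so the derivative in variable
  \<open>i\<close> raises the order of differentiation of block \<open>blk i\<close> by one.\<close>

lemma partial_deriv_block:
  fixes blk :: "nat \<Rightarrow> nat" and m q :: nat
  defines "l \<equiv> \<lambda>c j. \<Sum>i | i < m \<and> blk i = j. (c i :: real)"
  assumes i: "i < m" "blk i < q" and A: "finite A"
  shows "partial_deriv i (\<lambda>c. \<Sum>a\<in>A. b a * (\<Prod>j<q. ffact (a j) (k j) * l c j ^ (a j - k j))) c =
    (\<Sum>a\<in>A. b a * (\<Prod>j<q. ffact (a j) ((k(blk i := Suc (k (blk i)))) j) *
       l c j ^ (a j - (k(blk i := Suc (k (blk i)))) j)))"
proof -
  let ?J = "{..<q} - {blk i}" and ?k = "k(blk i := Suc (k (blk i)))"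
  have l1: "l (c(i := t)) j = l c j" if "j \<noteq> blk i" for j t
    unfolding l_def by (rule sum.cong) (use that in auto)
  have l2: "l (c(i := t)) (blk i) = l c (blk i) - c i + t" for t
  proof -
    let ?B = "{x. x < m \<and> blk x = blk i}"
    have "l (c(i := t)) (blk i) = t + (\<Sum>x\<in>?B - {i}. c x)" for t
      unfolding l_def by (subst sum.remove[of _ i]) (use i in \<open>auto intro!: sum.cong\<close>)
    from this[of t] this[of "c i"] show ?thesis by simp
  qed
  have split: "(\<Prod>j<q. h j) = h (blk i) * (\<Prod>j\<in>?J. h j)" for h :: "nat \<Rightarrow> real"
    by (rule prod.remove) (use i in auto)
  have "((\<lambda>t. \<Sum>a\<in>A. b a * (\<Prod>j<q. ffact (a j) (k j) * l (c(i := t)) j ^ (a j - k j))) has_real_derivative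
     (\<Sum>a\<in>A. b a * (\<Prod>j<q. ffact (a j) (?k j) * l c j ^ (a j - ?k j)))) (at (c i))"
  proof (rule DERIV_sum, rule DERIV_cmult)
    fix a :: "nat \<Rightarrow> nat"
    let ?a = "a (blk i)" and ?kk = "k (blk i)"
    let ?C = "\<Prod>j\<in>?J. ffact (a j) (k j) * l c j ^ (a j - k j)"
    have e: "(\<lambda>t. \<Prod>j<q. ffact (a j) (k j) * l (c(i := t)) j ^ (a j - k j)) =
      (\<lambda>t. ffact ?a ?kk * (l c (blk i) - c i + t) ^ (?a - ?kk) * ?C)"
      unfolding split l2 by (rule ext) (simp add: l1)
    have r: "(\<Prod>j<q. ffact (a j) (?k j) * l c j ^ (a j - ?k j)) =
       ffact ?a (Suc ?kk) * l c (blk i) ^ (?a - Suc ?kk) * ?C"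
      unfolding split by simp
    have "((\<lambda>t. (l c (blk i) - c i + t) ^ (?a - ?kk)) has_real_derivative
        real (?a - ?kk) * l c (blk i) ^ (?a - Suc ?kk)) (at (c i))"
      by (auto intro!: derivative_eq_intros)
    then have "((\<lambda>t. ffact ?a ?kk * (l c (blk i) - c i + t) ^ (?a - ?kk) * ?C) has_real_derivative
        ffact ?a ?kk * (real (?a - ?kk) * l c (blk i) ^ (?a - Suc ?kk)) * ?C) (at (c i))"
      by (intro DERIV_cmult DERIV_cmult_right)
    moreover have "ffact ?a ?kk * real (?a - ?kk) = ffact ?a (Suc ?kk)"
      by (cases "?kk \<le> ?a") (simp_all add: ffact_Suc of_nat_diff ffact_zero)
    ultimately show "((\<lambda>t. \<Prod>j<q. ffact (a j) (k j) * l (c(i := t)) j ^ (a j - k j)) has_real_derivative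
       (\<Prod>j<q. ffact (a j) (?k j) * l c j ^ (a j - ?k j))) (at (c i))"
      unfolding e r by (simp add: mult.assoc[symmetric])
  qed
  then show ?thesis unfolding partial_deriv_def by (rule DERIV_imp_deriv)
qed

text \<open>Weights of equal bodies add up, so a polynomial in the block sums is differentiated once
  in each variable. Since \<open>foldr\<close> works from the right, the variables from
  \<open>e\<close> on are already done. The identity is kept at all positive points, not only at the
  final point, to allow the next derivative.\<close>

lemma foldr_partial_deriv_block:
  fixes blk :: "nat \<Rightarrow> nat" and m q d :: nat
  defines "l \<equiv> \<lambda>c j. \<Sum>i | i < m \<and> blk i = j. (c i :: real)"
  assumes Q: "\<And>c. (\<forall>i. 0 < c i) \<Longrightarrow> Q c = (\<Sum>a\<in>A. b a * (\<Prod>j<q. l c j ^ a j))"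
    and A: "finite A" and blk: "\<And>i. i < m \<Longrightarrow> blk i < q"
    and c: "\<forall>i. 0 < (c i :: real)" and e: "e \<le> m"
  shows "foldr partial_deriv [e..<m] Q c =
    (\<Sum>a\<in>A. b a * (\<Prod>j<q. ffact (a j) (card {i. e \<le> i \<and> i < m \<and> blk i = j}) *
        l c j ^ (a j - card {i. e \<le> i \<and> i < m \<and> blk i = j})))"
  using e c
proof (induction "m - e" arbitrary: e c)
  case 0
  then have "e = m" by simp
  have z: "card {i. m \<le> i \<and> i < m \<and> blk i = j} = 0" for j by auto
  show ?case unfolding \<open>e = m\<close> z using Q 0 by (simp add: ffact_def)
next
  case (Suc x)
  then have em: "e < m" by simp
  let ?k = "\<lambda>e j. card {i. e \<le> i \<and> i < m \<and> blk i = j}"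
  have k: "?k e = (?k (Suc e))(blk e := Suc (?k (Suc e) (blk e)))"
  proof
    fix j
    have "{i. e \<le> i \<and> i < m \<and> blk i = j} = (if j = blk e then insert e {i. Suc e \<le> i \<and> i < m \<and> blk i = j}
        else {i. Suc e \<le> i \<and> i < m \<and> blk i = j})"
      using em by (auto simp: Suc_le_eq) (metis le_neq_implies_less)+
    then show "?k e j = ((?k (Suc e))(blk e := Suc (?k (Suc e) (blk e)))) j" by simp
  qed
  have "foldr partial_deriv [e..<m] Q c = partial_deriv e (foldr partial_deriv [Suc e..<m] Q) c"
    using em by (simp add: upt_conv_Cons)
  also have "\<dots> = partial_deriv e (\<lambda>c. \<Sum>a\<in>A. b a * (\<Prod>j<q. ffact (a j) (?k (Suc e) j) *
        l c j ^ (a j - ?k (Suc e) j))) c"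
    by (rule partial_deriv_cong_pos) (use Suc in auto)
  also have "\<dots> = (\<Sum>a\<in>A. b a * (\<Prod>j<q. ffact (a j) (((?k (Suc e))(blk e := Suc (?k (Suc e) (blk e)))) j) *
       l c j ^ (a j - ((?k (Suc e))(blk e := Suc (?k (Suc e) (blk e)))) j)))"
    unfolding l_def by (rule partial_deriv_block) (use em blk A in auto)
  finally show ?case unfolding k[symmetric] .
qed

text \<open>Among exponents of total degree \<open>m\<close>, each one other than \<open>k\<close>
  falls below \<open>k\<close> in some block, where its falling factorial vanishes. For
  \<open>a = k\<close> no power is left, so the point of evaluation does not matter.\<close>

lemma foldr_partial_deriv_homogeneous:
  fixes blk :: "nat \<Rightarrow> nat" and m q d :: nat
  defines "l \<equiv> \<lambda>c j. \<Sum>i | i < m \<and> blk i = j. (c i :: real)"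
    and "k \<equiv> restrict (\<lambda>j. card {i. i < m \<and> blk i = j}) {..<q}"
  assumes Q: "\<And>c. (\<forall>i. 0 < c i) \<Longrightarrow> Q c = (\<Sum>a\<in>mindex q d. b a * (\<Prod>j<q. l c j ^ a j))"
    and blk: "\<And>i. i < m \<Longrightarrow> blk i < q" and md: "m \<le> d"
    and hom: "\<And>a. a \<in> mindex q d \<Longrightarrow> (\<Sum>j<q. a j) \<noteq> m \<Longrightarrow> b a = 0"
  shows "foldr partial_deriv [0..<m] Q (\<lambda>_. 1) = b k * (\<Prod>j<q. fact (k j))"
proof -
  have ks: "(\<Sum>j<q. k j) = m"
  proof -
    have "(\<Sum>j<q. \<Sum>i | i \<in> {..<m} \<and> blk i = j. 1::nat) = (\<Sum>i<m. 1)"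
      by (rule sum.group) (use blk in auto)
    then show ?thesis by (simp add: k_def)
  qed
  have kd: "k \<in> mindex q d"
  proof (rule PiE_I)
    fix j assume j: "j \<in> {..<q}"
    have "card {i. i < m \<and> blk i = j} \<le> card {..<m}" by (rule card_mono) auto
    then show "k j \<in> {..d}" using j md by (simp add: k_def)
  qed (simp add: k_def)
  have "foldr partial_deriv [0..<m] Q (\<lambda>_. 1) =
    (\<Sum>a\<in>mindex q d. b a * (\<Prod>j<q. ffact (a j) (k j) * l (\<lambda>_. 1) j ^ (a j - k j)))"
    using foldr_partial_deriv_block[where Q = Q and A = "mindex q d" and b = b and q = q and m = m and blk = blk
      and c = "\<lambda>_. 1" and e = 0] Q blk
    by (simp add: l_def k_def)
  also have "\<dots> = (\<Sum>a\<in>mindex q d. if a = k then b k * (\<Prod>j<q. fact (k j)) else 0)"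
  proof (rule sum.cong)
    fix a assume a: "a \<in> mindex q d"
    show "b a * (\<Prod>j<q. ffact (a j) (k j) * l (\<lambda>_. 1) j ^ (a j - k j)) =
        (if a = k then b k * (\<Prod>j<q. fact (k j)) else 0)"
    proof (cases "a = k")
      case True
      then show ?thesis by (simp add: ffact_self)
    next
      case False
      show ?thesis
      proof (cases "(\<Sum>j<q. a j) = m")
        case True
        have "\<exists>j<q. a j < k j"
        proof (rule ccontr)
          assume "\<not> (\<exists>j<q. a j < k j)"
          then have le: "k j \<le> a j" if "j \<in> {..<q}" for j using that by auto
          have "a j = k j" if "j \<in> {..<q}" for j
            using sum_strict_mono_ex1[of "{..<q}" k a] le True ks that
            by (metis finite_lessThan le_neq_implies_less less_irrefl)
          then show False using False PiE_ext[OF a kd] by blast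
        qed
        then obtain j where "j < q" "a j < k j" by blast
        then have "(\<Prod>j<q. ffact (a j) (k j) * l (\<lambda>_. 1) j ^ (a j - k j)) = 0"
          by (intro prod_zero bexI[of _ j]) (simp_all add: ffact_zero)
        then show ?thesis using False by simp
      qed (use hom a False in simp)
    qed
  qed simp
  also have "\<dots> = b k * (\<Prod>j<q. fact (k j))" using kd by (simp add: sum.delta)
  finally show ?thesis .
qed

subsection \<open>Mixed volumes as coefficients\<close>

definition mvol :: "nat \<Rightarrow> nat \<Rightarrow> (nat \<Rightarrow> (nat \<Rightarrow> real) set) \<Rightarrow> (nat \<Rightarrow> real) \<Rightarrow> real"
  where "mvol n q K c = vol n (\<Sum>j<q. dil (c j) (K j))"

lemma pol_mono: "pol d f \<Longrightarrow> d \<le> e \<Longrightarrow> pol e f"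
  unfolding pol_def using order_trans by blast

lemma dil_zero [simp]: "dil c 0 = 0"
  by (simp add: dil_sing)

lemma dil_sum: "dil c (\<Sum>i\<in>I. A i) = (\<Sum>i\<in>I. dil c (A i))"
proof (induction I rule: infinite_finite_induct)
  case (insert x F)
  then show ?case by (simp add: dil_set_plus)
qed (simp_all only: sum.infinite sum.empty dil_zero not_False_eq_True)

lemma vol_dil: "convex_body n A \<Longrightarrow> c > 0 \<Longrightarrow> vol n (dil c A) = c ^ n * vol n A"
  by (rule vol_scale[OF body_compact body_Rn])

lemma body_combination:
  "(\<And>j. j < q \<Longrightarrow> convex_body n (K j)) \<Longrightarrow> convex_body n (\<Sum>j<(q::nat). dil (c j) (K j))"
  by (rule body_sum[OF finite_lessThan]) (auto intro: body_dil)

text \<open>The degree bound \<open>d\<close> is kept free because these coefficients are later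
  compared with those of a polynomial of larger degree, on one common grid.\<close>

context
  fixes n q d :: nat and K :: "nat \<Rightarrow> (nat \<Rightarrow> real) set"
  assumes K: "\<And>j. j < q \<Longrightarrow> convex_body n (K j)" and d: "n \<le> d"
begin

lemma mvol_pol:
  assumes "j < q" "\<forall>i. 0 \<le> c i"
  shows "pol d (\<lambda>s. mvol n q K (c(j := s)))"
proof (rule pol_mono[OF _ d])
  have "(\<Sum>i<q. dil ((c(j := s)) i) (K i)) = (\<Sum>i\<in>{..<q} - {j}. dil (c i) (K i)) + dil s (K j)" for s
    using assms by (subst sum.remove[of _ j]) (auto simp: add.commute intro!: sum.cong arg_cong2[of _ _ _ _ "(+)"])
  moreover have "convex_body n (\<Sum>i\<in>{..<q} - {j}. dil (c i) (K i))"
    by (rule body_sum) (auto intro: body_dil K)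
  ultimately show "pol n (\<lambda>s. mvol n q K (c(j := s)))"
    unfolding mvol_def using vol_plus_dil_pol[OF _ K[OF assms(1)]] by simp
qed

lemma mvol_indep: "(\<And>i. i < q \<Longrightarrow> c i = c' i) \<Longrightarrow> mvol n q K c = mvol n q K c'"
  unfolding mvol_def by (rule arg_cong[of _ _ "vol n"]) (rule sum.cong, auto)

lemma mvol_scale: "t > 0 \<Longrightarrow> mvol n q K (\<lambda>i. t * c i) = t ^ n * mvol n q K c"
  unfolding mvol_def dil_dil[symmetric] dil_sum[symmetric]
  by (rule vol_dil[OF body_combination[OF K]])

lemma mvol_expand:
  "\<forall>i. 0 \<le> c i \<Longrightarrow> mvol n q K c = (\<Sum>a\<in>mindex q d. mcoeff d q (mvol n q K) a * (\<Prod>j<q. c j ^ a j))"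
  by (rule multi_expand[OF mvol_pol _ mvol_indep])

lemma mvol_homogeneous:
  "a \<in> mindex q d \<Longrightarrow> (\<Sum>j<q. a j) \<noteq> n \<Longrightarrow> mcoeff d q (mvol n q K) a = 0"
  by (rule mcoeff_homogeneous[OF mvol_pol mvol_indep mvol_scale]) auto

text \<open>For positive weights the dilates of equal bodies merge into one by
  \<open>dil_add\<close>. The mixed derivative then selects the coefficient whose exponents are the
  multiplicities.\<close>

lemma mixed_volume_mcoeff:
  assumes blk: "\<And>i. i < n \<Longrightarrow> blk i < q" and Ks: "\<And>i. i < n \<Longrightarrow> Ks ! i = K (blk i)"
  defines "k \<equiv> restrict (\<lambda>j. card {i. i < n \<and> blk i = j}) {..<q}"
  shows "mixed_volume n Ks = mcoeff d q (mvol n q K) k * (\<Prod>j<q. fact (k j)) / fact n"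
proof -
  let ?l = "\<lambda>c j. \<Sum>i | i < n \<and> blk i = j. (c i :: real)"
  have l0: "0 \<le> ?l c j" if "\<forall>i. 0 < c i" for c j
    using that by (intro sum_nonneg) (auto intro: less_imp_le)
  have dl: "dil (\<Sum>i\<in>I. c i) A = (\<Sum>i\<in>I. dil (c i) A)"
    if "finite I" "convex A" "A \<noteq> {}" "\<forall>i. 0 < c i" for I :: "nat set" and c A
    using that
  proof (induction I rule: finite_induct)
    case empty
    then show ?case by (simp add: dil_0)
  next
    case (insert x F)
    have "0 \<le> sum c F" using insert by (intro sum_nonneg) (auto intro: less_imp_le)
    then show ?case using insert dil_add[of A "c x" "sum c F"] by (simp add: less_imp_le)
  qed
  have "vol n (\<Sum>i<n. (\<lambda>x. c i *\<^sub>R x) ` (Ks ! i)) = mvol n q K (?l c)" if c: "\<forall>i. 0 < c i" for c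
  proof -
    have "(\<Sum>j<q. dil (?l c j) (K j)) = (\<Sum>j<q. \<Sum>i | i < n \<and> blk i = j. dil (c i) (K j))"
      using c K by (intro sum.cong refl dl) (auto simp: convex_body_iff)
    also have "\<dots> = (\<Sum>j<q. \<Sum>i\<in>{i \<in> {..<n}. blk i = j}. dil (c i) (K (blk i)))"
      by (intro sum.cong) auto
    also have "\<dots> = (\<Sum>i<n. dil (c i) (K (blk i)))"
      by (rule sum.group) (use blk in auto)
    also have "\<dots> = (\<Sum>i<n. (\<lambda>x. c i *\<^sub>R x) ` (Ks ! i))"
      by (rule sum.cong) (auto simp: Ks dil_def)
    finally show ?thesis by (simp add: mvol_def)
  qed
  then have "foldr partial_deriv [0..<n] (\<lambda>c. vol n (\<Sum>i<n. (\<lambda>x. c i *\<^sub>R x) ` (Ks ! i))) (\<lambda>_. 1) =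
     mcoeff d q (mvol n q K) k * (\<Prod>j<q. fact (k j))"
    unfolding k_def using l0 blk d mvol_homogeneous mvol_expand
    by (intro foldr_partial_deriv_homogeneous) auto
  then show ?thesis unfolding mixed_volume_def by simp
qed

end

subsection \<open>Calculus of \<open>C\<^sup>k\<close> functions\<close>

text \<open>Relatively open cubes: a basis of neighbourhoods in \<open>Rn n\<close> that is stable
  under changing one coordinate within its range, as partial derivatives require.\<close>

definition cube :: "nat \<Rightarrow> (nat \<Rightarrow> real) \<Rightarrow> real \<Rightarrow> (nat \<Rightarrow> real) set"
  where "cube n x e = {y \<in> Rn n. \<forall>i<n. \<bar>y i - x i\<bar> < e}"

abbreviation opn :: "nat \<Rightarrow> (nat \<Rightarrow> real) set \<Rightarrow> bool"
  where "opn n U \<equiv> openin (Euclidean_space n) U"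

lemma cube_Rn: "cube n x e \<subseteq> Rn n"
  by (auto simp: cube_def)

lemma cube_mono: "d \<le> e \<Longrightarrow> cube n x d \<subseteq> cube n x e"
  by (force simp: cube_def)

lemma centre_in_cube: "x \<in> Rn n \<Longrightarrow> 0 < e \<Longrightarrow> x \<in> cube n x e"
  by (simp add: cube_def)

lemma opn_cube: "opn n (cube n x e)"
proof -
  have "cube n x e = Rn n \<inter> {y. \<forall>i<n. \<bar>y i - x i\<bar> < e}" by (auto simp: cube_def)
  then show ?thesis unfolding Euclidean_space_Rn using open_cube by (simp add: openin_open_Int)
qed

lemma opn_Rn: "opn n U \<Longrightarrow> U \<subseteq> Rn n"
  using openin_subset[of "Euclidean_space n" U] by simp

lemma opn_contains_cube:
  assumes "opn n U" "x \<in> U"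
  obtains e where "e > 0" "cube n x e \<subseteq> U"
proof -
  obtain T where T: "open T" "U = Rn n \<inter> T"
    using assms(1) unfolding Euclidean_space_Rn openin_open by blast
  have "openin (product_topology (\<lambda>_. euclidean) UNIV) T" using T(1) by (simp add: euclidean_product_topology)
  then obtain X where X: "x \<in> PiE UNIV X" "\<And>i. open (X i)" "PiE UNIV X \<subseteq> T"
      "finite {i. X i \<noteq> UNIV}"
    using product_topology_open_contains_basis[of "\<lambda>_. euclidean" UNIV T x] assms(2) T(2) by auto
  have "\<exists>e>0. \<forall>t. \<bar>t - x i\<bar> < e \<longrightarrow> t \<in> X i" for i
  proof -
    have "x i \<in> X i" using PiE_mem[OF X(1)] by simp
    then obtain e where "e > 0" "ball (x i) e \<subseteq> X i" using openE[OF X(2)] by blast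
    then show ?thesis by (intro exI[of _ e]) (auto simp: dist_real_def abs_minus_commute subset_eq)
  qed
  then obtain e where e: "\<And>i. e i > 0" "\<And>i t. \<bar>t - x i\<bar> < e i \<Longrightarrow> t \<in> X i" by metis
  \<comment> \<open>Finitely many radii suffice, since beyond coordinate \<open>n\<close> all points
    of \<open>Rn n\<close> agree. The entry 1 keeps the minimum defined for
    \<open>n = 0\<close>.\<close>
  define d where "d = Min (insert 1 (e ` {..<n}))"
  have d: "d > 0" "\<And>i. i < n \<Longrightarrow> d \<le> e i" using e(1) by (auto simp: d_def)
  have xR: "x \<in> Rn n" using assms(2) T(2) by auto
  have "cube n x d \<subseteq> U"
  proof
    fix y assume y: "y \<in> cube n x d"
    have "y i \<in> X i" for i
    proof (cases "i < n")
      case True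
      then have "\<bar>y i - x i\<bar> < e i" using y d(2)[of i] by (fastforce simp: cube_def)
      then show ?thesis by (rule e(2))
    next
      case False
      then have "y i = x i" using y xR by (simp add: cube_def Rn_def)
      then show ?thesis using X(1) by auto
    qed
    then show "y \<in> U" using X(3) y T(2) by (auto simp: cube_def)
  qed
  with d(1) show ?thesis by (rule that)
qed

lemma upd_in_cube:
  "y \<in> cube n x e \<Longrightarrow> i < n \<Longrightarrow> \<bar>t - x i\<bar> < e \<Longrightarrow> y(i := t) \<in> cube n x e"
  by (auto simp: cube_def Rn_def)

lemma upd_in_Rn: "x \<in> Rn n \<Longrightarrow> i < n \<Longrightarrow> x(i := t) \<in> Rn n"
  by (auto simp: Rn_def)

lemma cubeD: "y \<in> cube n x e \<Longrightarrow> i < n \<Longrightarrow> \<bar>y i - x i\<bar> < e"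
  by (simp add: cube_def)

lemma eventually_upd:
  assumes "opn n U" "x \<in> U" "i < n"
  shows "\<forall>\<^sub>F t in nhds (x i). x(i := t) \<in> U"
proof -
  obtain e where e: "e > 0" "cube n x e \<subseteq> U" using opn_contains_cube assms by blast
  have x: "x \<in> cube n x e" using assms(2) e(1) opn_Rn[OF assms(1)] by (intro centre_in_cube) auto
  show ?thesis unfolding eventually_nhds_metric
    using e upd_in_cube[OF x assms(3)] by (auto simp: dist_real_def)
qed

lemma continuous_on_cubeD:
  assumes "continuous_on U f" "opn n U" "x \<in> U" "(e::real) > 0"
  obtains d where "d > 0" "cube n x d \<subseteq> U" "\<And>y. y \<in> cube n x d \<Longrightarrow> \<bar>f y - f x\<bar> < e"
proof -
  have "openin (top_of_set U) (U \<inter> f -` ball (f x) e)"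
    using assms(1) by (intro continuous_openin_preimage_gen) auto
  then have "opn n (U \<inter> f -` ball (f x) e)"
    using assms(2) unfolding Euclidean_space_Rn by (metis openin_trans)
  moreover have "x \<in> U \<inter> f -` ball (f x) e" using assms by simp
  ultimately obtain d where "d > 0" "cube n x d \<subseteq> U \<inter> f -` ball (f x) e"
    using opn_contains_cube by blast
  then show ?thesis using that[of d] by (force simp: dist_real_def)
qed

lemma continuous_on_cubeI:
  fixes f :: "(nat \<Rightarrow> real) \<Rightarrow> real"
  assumes "\<And>x e. x \<in> U \<Longrightarrow> e > 0 \<Longrightarrow> \<exists>d>0. \<forall>y\<in>cube n x d \<inter> U. \<bar>f y - f x\<bar> < e" "U \<subseteq> Rn n"
  shows "continuous_on U f"
  unfolding continuous_on_def
proof (intro ballI tendstoI)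
  fix x and e :: real assume x: "x \<in> U" "e > 0"
  then obtain d where d: "d > 0" "\<And>y. y \<in> cube n x d \<inter> U \<Longrightarrow> \<bar>f y - f x\<bar> < e" using assms(1) by metis
  show "\<forall>\<^sub>F y in at x within U. dist (f y) (f x) < e"
    unfolding eventually_at_topological
    using d open_cube[of n x d] assms(2)
    by (intro exI[of _ "{y. \<forall>i<n. \<bar>y i - x i\<bar> < d}"]) (auto simp: dist_real_def cube_def)
qed

lemma continuous_map_iff_on:
  "U \<subseteq> Rn n \<Longrightarrow> continuous_map (subtopology (Euclidean_space n) U) euclideanreal f \<longleftrightarrow> continuous_on U f"
  by (simp add: Euclidean_space_Rn subtopology_subtopology Int_absorb1)

lemma Ck_0: "U \<subseteq> Rn n \<Longrightarrow> Ck_on n 0 U f \<longleftrightarrow> continuous_on U f"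
  by (simp add: continuous_map_iff_on)

lemma Ck_Suc: "U \<subseteq> Rn n \<Longrightarrow> Ck_on n (Suc k) U f \<longleftrightarrow> continuous_on U f \<and>
    (\<forall>i<n. (\<forall>x\<in>U. (\<lambda>t. f (x(i := t))) field_differentiable (at (x i))) \<and> Ck_on n k U (partial_deriv i f))"
  by (simp add: continuous_map_iff_on)

declare Ck_on.simps [simp del]

lemma Ck_continuous: "Ck_on n k U f \<Longrightarrow> U \<subseteq> Rn n \<Longrightarrow> continuous_on U f"
  by (cases k) (simp_all add: Ck_0 Ck_Suc)

lemma Ck_partial: "Ck_on n (Suc k) U f \<Longrightarrow> i < n \<Longrightarrow> U \<subseteq> Rn n \<Longrightarrow> Ck_on n k U (partial_deriv i f)"
  by (simp add: Ck_Suc)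

lemma Ck_DERIV:
  assumes "Ck_on n (Suc k) U f" "i < n" "U \<subseteq> Rn n" "x(i := t) \<in> U"
  shows "((\<lambda>s. f (x(i := s))) has_real_derivative partial_deriv i f (x(i := t))) (at t)"
proof -
  have "(\<lambda>s. f ((x(i := t))(i := s))) field_differentiable (at ((x(i := t)) i))"
    using assms unfolding Ck_Suc[OF assms(3)] by blast
  then show ?thesis
    unfolding partial_deriv_def by (simp add: DERIV_deriv_iff_field_differentiable)
qed

lemma Ck_DERIV':
  assumes "Ck_on n (Suc k) U f" "i < n" "U \<subseteq> Rn n" "x \<in> U"
  shows "((\<lambda>s. f (x(i := s))) has_real_derivative partial_deriv i f x) (at (x i))"
  using Ck_DERIV[of n k U f i x "x i"] assms by simp

lemma partial_deriv_eqI: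
  "((\<lambda>s. f (x(i := s))) has_real_derivative D) (at (x i)) \<Longrightarrow> partial_deriv i f x = D"
  unfolding partial_deriv_def by (rule DERIV_imp_deriv)

lemma partial_deriv_cong_opn:
  assumes "opn n U" "\<And>x. x \<in> U \<Longrightarrow> f x = g x" "x \<in> U" "i < n"
  shows "partial_deriv i f x = partial_deriv i g x"
  unfolding partial_deriv_def
  by (rule deriv_cong_ev[OF _ refl]) (use eventually_upd[OF assms(1,3,4)] assms(2) in \<open>auto elim: eventually_mono\<close>)

lemma Ck_cong:
  assumes "opn n U" "\<And>x. x \<in> U \<Longrightarrow> f x = g x" "Ck_on n k U f"
  shows "Ck_on n k U g"
  using assms(2,3)
proof (induction k arbitrary: f g)
  case 0
  then show ?case using opn_Rn[OF assms(1)] by (simp add: Ck_0 cong: continuous_on_cong)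
next
  case (Suc k)
  note U = opn_Rn[OF assms(1)]
  have "continuous_on U g" using Suc.prems U by (simp add: Ck_Suc cong: continuous_on_cong)
  moreover have "(\<lambda>t. g (x(i := t))) field_differentiable (at (x i))" if "i < n" "x \<in> U" for i x
  proof -
    have "\<forall>\<^sub>F t in nhds (x i). f (x(i := t)) = g (x(i := t))"
      using eventually_upd[OF assms(1) that(2,1)] by (rule eventually_mono) (rule Suc.prems(1))
    then have "((\<lambda>t. f (x(i := t))) has_real_derivative D) (at (x i)) \<longleftrightarrow>
        ((\<lambda>t. g (x(i := t))) has_real_derivative D) (at (x i))" for D
      by (intro DERIV_cong_ev) auto
    then show ?thesis using Suc.prems(2) that U unfolding Ck_Suc[OF U] field_differentiable_def by blast
  qed
  moreover have "Ck_on n k U (partial_deriv i g)" if i: "i < n" for i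
    by (rule Suc.IH[OF partial_deriv_cong_opn[OF assms(1) Suc.prems(1) _ i]])
       (use Suc.prems(2) i U in \<open>auto simp: Ck_Suc\<close>)
  ultimately show ?case using U by (simp add: Ck_Suc)
qed

text \<open>The form in which smoothness is proved below: a formula valid on \<open>U\<close> may
  stand for \<open>partial_deriv\<close>, which makes recursive arguments on \<open>k\<close>
  possible.\<close>

lemma Ck_SucI:
  assumes U: "opn n U" and "continuous_on U f"
    and D: "\<And>i x. i < n \<Longrightarrow> x \<in> U \<Longrightarrow> ((\<lambda>t. f (x(i := t))) has_real_derivative D i x) (at (x i))"
    and "\<And>i. i < n \<Longrightarrow> Ck_on n k U (D i)"
  shows "Ck_on n (Suc k) U f"
proof -
  have "Ck_on n k U (partial_deriv i f)" if i: "i < n" for i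
    by (rule Ck_cong[OF U _ assms(4)[OF i]]) (rule sym, rule partial_deriv_eqI, rule D[OF i])
  then show ?thesis using assms opn_Rn[OF U] by (auto simp: Ck_Suc field_differentiable_def)
qed

lemma Ck_le: assumes "Ck_on n k U f" "l \<le> k" "U \<subseteq> Rn n" shows "Ck_on n l U f"
proof -
  have "Ck_on n (Suc k) U f \<Longrightarrow> Ck_on n k U f" for k f
  proof (induction k arbitrary: f)
    case 0
    then show ?case using assms(3) by (simp add: Ck_0 Ck_Suc)
  next
    case (Suc k)
    then show ?case using assms(3) by (simp add: Ck_Suc[of U n "Suc k"]) (simp add: Ck_Suc)
  qed
  then have "Ck_on n (l + j) U f \<Longrightarrow> Ck_on n l U f" for j
    by (induction j) auto
  then show ?thesis using assms(1,2) le_Suc_ex by blast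
qed

lemma Ck_subset:
  assumes "V \<subseteq> U" "U \<subseteq> Rn n" "Ck_on n k U f" shows "Ck_on n k V f"
  using assms(3)
proof (induction k arbitrary: f)
  case 0
  then show ?case using assms(1,2) by (auto simp: Ck_0 intro: continuous_on_subset)
next
  case (Suc k)
  have V: "V \<subseteq> Rn n" using assms by blast
  show ?case using Suc assms(1) unfolding Ck_Suc[OF assms(2)] Ck_Suc[OF V]
    by (blast intro: continuous_on_subset)
qed

lemma Ck_const: "opn n U \<Longrightarrow> Ck_on n k U (\<lambda>_. c)"
proof (induction k arbitrary: c)
  case 0
  then show ?case by (simp add: Ck_0 opn_Rn)
next
  case (Suc k)
  show ?case by (rule Ck_SucI[where D = "\<lambda>_ _. 0"]) (use Suc in auto)
qed

lemma Ck_coord: assumes "opn n U" shows "Ck_on n k U (\<lambda>x. x j)"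
proof (cases k)
  case 0
  then show ?thesis using assms by (simp add: Ck_0 opn_Rn)
next
  case (Suc l)
  show ?thesis unfolding Suc
  proof (rule Ck_SucI[where D = "\<lambda>i _. if i = j then 1 else 0"])
    show "((\<lambda>t. (x(i := t)) j) has_real_derivative (if i = j then 1 else 0)) (at (x i))" for i and x :: "nat \<Rightarrow> real"
      by (cases "i = j") auto
  qed (use assms Ck_const in auto)
qed

lemma Ck_add:
  assumes "opn n U" "Ck_on n k U f" "Ck_on n k U g"
  shows "Ck_on n k U (\<lambda>x. f x + g x)"
  using assms(2,3)
proof (induction k arbitrary: f g)
  case 0
  then show ?case using opn_Rn[OF assms(1)] by (auto simp: Ck_0 intro: continuous_on_add)
next
  case (Suc k)
  note U = opn_Rn[OF assms(1)]
  show ?case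
  proof (rule Ck_SucI[OF assms(1), where D = "\<lambda>i x. partial_deriv i f x + partial_deriv i g x"])
    show "continuous_on U (\<lambda>x. f x + g x)" using Suc.prems U by (auto simp: Ck_Suc intro: continuous_on_add)
    show "((\<lambda>t. f (x(i := t)) + g (x(i := t))) has_real_derivative partial_deriv i f x + partial_deriv i g x) (at (x i))"
      if "i < n" "x \<in> U" for i x
      using Suc.prems that U by (intro DERIV_add Ck_DERIV') auto
    show "Ck_on n k U (\<lambda>x. partial_deriv i f x + partial_deriv i g x)" if "i < n" for i
      using Suc.prems that U by (intro Suc.IH Ck_partial)
  qed
qed

lemma Ck_mult:
  assumes "opn n U" "Ck_on n k U f" "Ck_on n k U g"
  shows "Ck_on n k U (\<lambda>x. f x * g x)"
  using assms(2,3)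
proof (induction k arbitrary: f g)
  case 0
  then show ?case using opn_Rn[OF assms(1)] by (auto simp: Ck_0 intro: continuous_on_mult)
next
  case (Suc k)
  note U = opn_Rn[OF assms(1)]
  show ?case
  proof (rule Ck_SucI[OF assms(1), where D = "\<lambda>i x. partial_deriv i f x * g x + partial_deriv i g x * f x"])
    show "continuous_on U (\<lambda>x. f x * g x)" using Suc.prems U by (auto simp: Ck_Suc intro: continuous_on_mult)
    show "((\<lambda>t. f (x(i := t)) * g (x(i := t))) has_real_derivative
        partial_deriv i f x * g x + partial_deriv i g x * f x) (at (x i))"
      if "i < n" "x \<in> U" for i x
      by (rule DERIV_cong[OF DERIV_mult[OF Ck_DERIV'[OF Suc.prems(1) that(1) U that(2)] Ck_DERIV'[OF Suc.prems(2) that(1) U that(2)]]])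
        (simp only: fun_upd_triv)
    show "Ck_on n k U (\<lambda>x. partial_deriv i f x * g x + partial_deriv i g x * f x)" if "i < n" for i
      using Suc.prems that U by (intro Ck_add assms(1) Suc.IH Ck_partial) (auto intro: Ck_le)
  qed
qed

lemma Ck_sum:
  assumes "opn n U" "\<And>a. a \<in> A \<Longrightarrow> Ck_on n k U (f a)"
  shows "Ck_on n k U (\<lambda>x. \<Sum>a\<in>A. f a x)"
  using assms(2) by (induction A rule: infinite_finite_induct) (auto intro: Ck_const Ck_add assms(1))

lemma Ck_cmult: "opn n U \<Longrightarrow> Ck_on n k U f \<Longrightarrow> Ck_on n k U (\<lambda>x. c * f x)"
  by (intro Ck_mult Ck_const)

lemma Ck_inverse:
  assumes "opn n U" "Ck_on n k U f" "\<And>x. x \<in> U \<Longrightarrow> f x \<noteq> 0"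
  shows "Ck_on n k U (\<lambda>x. inverse (f x))"
  using assms(2)
proof (induction k)
  case 0
  then show ?case using opn_Rn[OF assms(1)] assms(3) by (auto simp: Ck_0 intro: continuous_on_inverse)
next
  case (Suc k)
  note U = opn_Rn[OF assms(1)]
  have k: "Ck_on n k U f" using Suc.prems U by (auto intro: Ck_le)
  show ?case
  proof (rule Ck_SucI[OF assms(1), where D = "\<lambda>i x. (-1) * (partial_deriv i f x * (inverse (f x) * inverse (f x)))"])
    show "continuous_on U (\<lambda>x. inverse (f x))"
      using Suc.prems U assms(3) by (auto simp: Ck_Suc intro: continuous_on_inverse)
    show "((\<lambda>t. inverse (f (x(i := t)))) has_real_derivative
        (-1) * (partial_deriv i f x * (inverse (f x) * inverse (f x)))) (at (x i))"
      if "i < n" "x \<in> U" for i x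
      by (rule DERIV_cong[OF DERIV_inverse_fun[OF Ck_DERIV'[OF Suc.prems that(1) U that(2)]]])
        (simp_all add: assms(3)[OF that(2)] mult_ac)
    show "Ck_on n k U (\<lambda>x. (-1) * (partial_deriv i f x * (inverse (f x) * inverse (f x))))" if "i < n" for i
      using Suc.prems that U k by (intro Ck_cmult Ck_mult assms(1) Suc.IH Ck_partial)
  qed
qed

text \<open>The closed segment covers both orders of the endpoints and their equality, so later
  arguments need no case distinction.\<close>

lemma MVT_segment:
  fixes g :: "real \<Rightarrow> real"
  assumes "\<And>s. s \<in> closed_segment a b \<Longrightarrow> (g has_real_derivative g' s) (at s)"
  obtains s where "s \<in> closed_segment a b" "g b - g a = (b - a) * g' s"
proof (cases a b rule: linorder_cases)
  case less
  then obtain s where "a < s" "s < b" "g b - g a = (b - a) * g' s"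
    using MVT2[of a b g g'] assms by (auto simp: closed_segment_eq_real_ivl)
  then show ?thesis using that[of s] less by (auto simp: closed_segment_eq_real_ivl)
next
  case equal
  then show ?thesis using that[of a] by simp
next
  case greater
  then obtain s where "b < s" "s < a" "g a - g b = (a - b) * g' s"
    using MVT2[of b a g g'] assms by (auto simp: closed_segment_eq_real_ivl)
  then show ?thesis using that[of s] greater by (auto simp: closed_segment_eq_real_ivl algebra_simps)
qed

text \<open>The error is compared with \<open>u t\<close> in product form, because \<open>u\<close>
  may vanish arbitrarily close to \<open>t0\<close>.\<close>

lemma DERIV_of_small_error:
  fixes G u :: "real \<Rightarrow> real"
  assumes u: "(u has_real_derivative u') (at t0)" "u t0 = 0" and "G t0 = 0"
    and small: "\<And>e. e > 0 \<Longrightarrow> \<forall>\<^sub>F t in at t0. \<bar>G t - a * u t\<bar> \<le> e * \<bar>u t\<bar>"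
  shows "(G has_real_derivative a * u') (at t0)"
proof -
  have q: "((\<lambda>t. u t / (t - t0)) \<longlongrightarrow> u') (at t0)"
    using u by (simp add: has_field_derivative_iff)
  have "((\<lambda>t. (G t - a * u t) / (t - t0)) \<longlongrightarrow> 0) (at t0)"
  proof (rule tendstoI)
    fix e :: real assume e: "e > 0"
    let ?d = "e / (2 * (\<bar>u'\<bar> + 1))"
    have d: "?d > 0" using e by (intro divide_pos_pos) auto
    have "((\<lambda>t. \<bar>u t / (t - t0)\<bar>) \<longlongrightarrow> \<bar>u'\<bar>) (at t0)" using q by (rule tendsto_rabs)
    then have "\<forall>\<^sub>F t in at t0. \<bar>u t / (t - t0)\<bar> < \<bar>u'\<bar> + 1"
      by (rule order_tendstoD(2)) simp
    with small[OF d] show "\<forall>\<^sub>F t in at t0. dist ((G t - a * u t) / (t - t0)) 0 < e"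
    proof eventually_elim
      case (elim t)
      have "\<bar>(G t - a * u t) / (t - t0)\<bar> \<le> ?d * \<bar>u t\<bar> / \<bar>t - t0\<bar>"
        unfolding abs_divide using elim(1) by (rule divide_right_mono) simp
      also have "\<dots> = ?d * \<bar>u t / (t - t0)\<bar>" by (simp add: abs_divide)
      also have "\<dots> \<le> ?d * (\<bar>u'\<bar> + 1)" using elim(2) d by (intro mult_left_mono) auto
      also have "\<dots> = e / 2"
      proof -
        have "\<bar>u'\<bar> + 1 \<noteq> 0" by linarith
        then show ?thesis by (simp add: field_simps)
      qed
      also have "\<dots> < e" using e by simp
      finally show ?case by (simp add: dist_real_def)
    qed
  qed
  then have "((\<lambda>t. (G t - a * u t) / (t - t0) + a * (u t / (t - t0))) \<longlongrightarrow> 0 + a * u') (at t0)"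
    by (intro tendsto_add tendsto_mult q tendsto_const)
  moreover have "(G t - a * u t) / (t - t0) + a * (u t / (t - t0)) = (G t - G t0) / (t - t0)" for t
    using assms(3) by (simp add: diff_divide_distrib)
  ultimately show ?thesis by (simp add: has_field_derivative_iff)
qed

text \<open>The increment of \<open>f\<close> is telescoped along a staircase: \<open>y i t\<close>
  has its first \<open>i\<close> coordinates moved. Each stair is a mean value theorem in one
  coordinate, and continuity of the partial derivative controls the intermediate point.\<close>

lemma chain_rule_curve:
  assumes U: "opn n U" and f: "Ck_on n (Suc k) U f" and g0: "g t0 \<in> U"
    and g: "\<And>i. i < n \<Longrightarrow> ((\<lambda>t. g t i) has_real_derivative g' i) (at t0)" and gR: "\<And>t. g t \<in> Rn n"
  shows "((\<lambda>t. f (g t)) has_real_derivative (\<Sum>i<n. partial_deriv i f (g t0) * g' i)) (at t0)"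
proof -
  note UR = opn_Rn[OF U]
  define y where "y k t = (\<lambda>i. if i < k then g t i else g t0 i)" for k t
  have ev: "\<forall>\<^sub>F t in at t0. \<forall>i<n. \<bar>g t i - g t0 i\<bar> < d" if "d > 0" for d
  proof -
    have "\<forall>i\<in>{..<n}. \<forall>\<^sub>F t in at t0. \<bar>g t i - g t0 i\<bar> < d"
    proof
      fix i assume "i \<in> {..<n}"
      then have "((\<lambda>t. g t i) \<longlongrightarrow> g t0 i) (at t0)"
        using DERIV_isCont[OF g] by (simp add: isCont_def)
      then show "\<forall>\<^sub>F t in at t0. \<bar>g t i - g t0 i\<bar> < d"
        using that by (auto dest: tendstoD simp: dist_real_def)
    qed
    then have "\<forall>\<^sub>F t in at t0. \<forall>i\<in>{..<n}. \<bar>g t i - g t0 i\<bar> < d"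
      by (simp add: eventually_ball_finite_distrib)
    then show ?thesis by (rule eventually_mono) auto
  qed
  have G: "((\<lambda>t. f (y (Suc i) t) - f (y i t)) has_real_derivative partial_deriv i f (g t0) * g' i) (at t0)"
    if i: "i < n" for i
  proof (rule DERIV_of_small_error[where u = "\<lambda>t. g t i - g t0 i"])
    show "((\<lambda>t. g t i - g t0 i) has_real_derivative g' i) (at t0)"
      using DERIV_diff[OF g[OF i] DERIV_const] by simp
    have "y k t0 = g t0" for k by (auto simp: y_def)
    then show "f (y (Suc i) t0) - f (y i t0) = 0" by simp
    fix e :: real assume e: "e > 0"
    have "continuous_on U (partial_deriv i f)" using Ck_partial[OF f i UR] UR by (rule Ck_continuous)
    then obtain d where d: "d > 0" "cube n (g t0) d \<subseteq> U"
      "\<And>z. z \<in> cube n (g t0) d \<Longrightarrow> \<bar>partial_deriv i f z - partial_deriv i f (g t0)\<bar> < e"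
      using continuous_on_cubeD[OF _ U g0 e] by metis
    show "\<forall>\<^sub>F t in at t0. \<bar>f (y (Suc i) t) - f (y i t) - partial_deriv i f (g t0) * (g t i - g t0 i)\<bar>
        \<le> e * \<bar>g t i - g t0 i\<bar>"
      using ev[OF d(1)]
    proof eventually_elim
      case (elim t)
      have yc: "y i t \<in> cube n (g t0) d"
        using elim d(1) gR[of t] gR[of t0] by (auto simp: cube_def y_def Rn_def)
      have seg: "(y i t)(i := s) \<in> cube n (g t0) d" if "s \<in> closed_segment (g t0 i) (g t i)" for s
      proof (rule upd_in_cube[OF yc i])
        have "\<bar>s - g t0 i\<bar> \<le> \<bar>g t i - g t0 i\<bar>"
          using that by (auto simp: closed_segment_eq_real_ivl split: if_splits)
        also have "\<dots> < d" using elim i by blast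
        finally show "\<bar>s - g t0 i\<bar> < d" .
      qed
      obtain s where s: "s \<in> closed_segment (g t0 i) (g t i)"
        "f ((y i t)(i := g t i)) - f ((y i t)(i := g t0 i)) =
          (g t i - g t0 i) * partial_deriv i f ((y i t)(i := s))"
        by (rule MVT_segment[of "g t0 i" "g t i" "\<lambda>s. f ((y i t)(i := s))" "\<lambda>s. partial_deriv i f ((y i t)(i := s))"])
           (use Ck_DERIV[OF f i UR] seg d(2) in blast)+
      have "(y i t)(i := g t i) = y (Suc i) t" "(y i t)(i := g t0 i) = y i t"
        by (auto simp: y_def fun_eq_iff less_Suc_eq)
      with s(2) have "f (y (Suc i) t) - f (y i t) - partial_deriv i f (g t0) * (g t i - g t0 i) =
         (partial_deriv i f ((y i t)(i := s)) - partial_deriv i f (g t0)) * (g t i - g t0 i)"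
        by (simp add: algebra_simps)
      also have "\<bar>\<dots>\<bar> \<le> e * \<bar>g t i - g t0 i\<bar>"
        unfolding abs_mult by (intro mult_right_mono less_imp_le[OF d(3)] seg s(1)) auto
      finally show ?case .
    qed
  qed simp
  have eq: "f (g t) = f (g t0) + (\<Sum>i<n. f (y (Suc i) t) - f (y i t))" for t
  proof -
    have yn: "y n t = g t" using gR[of t] gR[of t0] by (auto simp: y_def Rn_def fun_eq_iff)
    have y0: "y 0 t = g t0" by (simp add: y_def)
    have "(\<Sum>i<n. f (y (Suc i) t) - f (y i t)) = f (y n t) - f (y 0 t)"
      by (rule sum_lessThan_telescope)
    then show ?thesis unfolding yn y0 by simp
  qed
  have E: "(\<lambda>t. f (g t)) = (\<lambda>t. f (g t0) + (\<Sum>i<n. f (y (Suc i) t) - f (y i t)))"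
    by (rule ext) (rule eq)
  have D: "((\<lambda>t. f (g t0) + (\<Sum>i<n. f (y (Suc i) t) - f (y i t))) has_real_derivative
      0 + (\<Sum>i<n. partial_deriv i f (g t0) * g' i)) (at t0)"
    by (intro DERIV_add DERIV_const DERIV_sum G) auto
  show ?thesis by (subst E) (rule DERIV_cong[OF D add_0])
qed

subsection \<open>Substitutions\<close>

definition hess :: "nat \<Rightarrow> ((nat \<Rightarrow> real) \<Rightarrow> real) \<Rightarrow> (nat \<Rightarrow> real) \<Rightarrow> (nat \<Rightarrow> real) \<Rightarrow> real"
  where "hess n f x v = (\<Sum>i<n. \<Sum>j<n. partial_deriv i (partial_deriv j f) x * v i * v j)"

definition affine_map :: "nat \<Rightarrow> nat \<Rightarrow> (nat \<Rightarrow> real) \<Rightarrow> (nat \<Rightarrow> nat \<Rightarrow> real) \<Rightarrow> (nat \<Rightarrow> real) \<Rightarrow> nat \<Rightarrow> real"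
  where "affine_map N n a B w = (\<lambda>l. if l < n then a l + (\<Sum>k<N. B l k * w k) else 0)"

lemma affine_map_Rn: "affine_map N n a B w \<in> Rn n"
  by (simp add: affine_map_def Rn_def)

lemma affine_map_upd:
  assumes "i < N" "l < n"
  shows "affine_map N n a B (w(i := t)) l = affine_map N n a B w l + B l i * (t - w i)"
proof -
  have "(\<Sum>k<N. B l k * (w(i := t)) k) = B l i * t + (\<Sum>k\<in>{..<N} - {i}. B l k * w k)"
    by (subst sum.remove[of _ i]) (use assms in \<open>auto intro!: sum.cong\<close>)
  moreover have "(\<Sum>k<N. B l k * w k) = B l i * w i + (\<Sum>k\<in>{..<N} - {i}. B l k * w k)"
    by (subst sum.remove[of _ i]) (use assms in auto)
  ultimately show ?thesis using assms by (simp add: affine_map_def algebra_simps)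
qed

lemma continuous_on_affine_map: "continuous_on S (affine_map N n a B)"
  unfolding continuous_on_fun_iff
proof
  fix l
  show "continuous_on S (\<lambda>x. affine_map N n a B x l)"
    unfolding affine_map_def
    by (cases "l < n") (simp_all, intro continuous_on_add continuous_on_const continuous_on_sum continuous_on_mult continuous_coord)
qed

context
  fixes n N :: nat and U W :: "(nat \<Rightarrow> real) set" and a :: "nat \<Rightarrow> real" and B :: "nat \<Rightarrow> nat \<Rightarrow> real"
  assumes U: "opn n U" and W: "opn N W" and WU: "\<And>w. w \<in> W \<Longrightarrow> affine_map N n a B w \<in> U"
begin

lemma DERIV_affine:
  assumes "Ck_on n (Suc k) U f" "w \<in> W" "i < N"
  shows "((\<lambda>t. f (affine_map N n a B (w(i := t)))) has_real_derivative
    (\<Sum>l<n. partial_deriv l f (affine_map N n a B w) * B l i)) (at (w i))"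
proof -
  have "((\<lambda>t. f (affine_map N n a B (w(i := t)))) has_real_derivative
    (\<Sum>l<n. partial_deriv l f (affine_map N n a B (w(i := w i))) * B l i)) (at (w i))"
  proof (rule chain_rule_curve[OF U assms(1)])
    fix l assume "l < n"
    from this show "((\<lambda>t. affine_map N n a B (w(i := t)) l) has_real_derivative B l i) (at (w i))"
    proof -
      assume l: "l < n"
      have "(\<lambda>t. affine_map N n a B (w(i := t)) l) = (\<lambda>t. affine_map N n a B w l + B l i * (t - w i))"
        by (rule ext) (rule affine_map_upd[OF assms(3) l])
      moreover have "((\<lambda>t. affine_map N n a B w l + B l i * (t - w i)) has_real_derivative B l i) (at (w i))"
        by (auto intro!: derivative_eq_intros)
      ultimately show ?thesis by simp
    qed
  qed (use WU assms(2) affine_map_Rn in auto)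
  then show ?thesis by simp
qed

lemma partial_deriv_affine:
  assumes "Ck_on n (Suc k) U f" "w \<in> W" "i < N"
  shows "partial_deriv i (\<lambda>w. f (affine_map N n a B w)) w = (\<Sum>l<n. partial_deriv l f (affine_map N n a B w) * B l i)"
  by (rule partial_deriv_eqI) (rule DERIV_affine[OF assms])

lemma Ck_affine:
  assumes "Ck_on n k U f"
  shows "Ck_on N k W (\<lambda>w. f (affine_map N n a B w))"
  using assms
proof (induction k arbitrary: f)
  case 0
  then have "continuous_on U f" using opn_Rn[OF U] by (simp add: Ck_0)
  then have "continuous_on W (\<lambda>w. f (affine_map N n a B w))"
    by (rule continuous_on_compose2[OF _ continuous_on_affine_map]) (use WU in auto)
  then show ?case using opn_Rn[OF W] by (simp add: Ck_0)
next
  case (Suc k)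
  show ?case
  proof (rule Ck_SucI[OF W, where D = "\<lambda>i w. \<Sum>l<n. B l i * partial_deriv l f (affine_map N n a B w)"])
    have "continuous_on U f" using Suc.prems opn_Rn[OF U] by (rule Ck_continuous)
    then show "continuous_on W (\<lambda>w. f (affine_map N n a B w))"
      by (rule continuous_on_compose2[OF _ continuous_on_affine_map]) (use WU in auto)
    show "Ck_on N k W (\<lambda>w. \<Sum>l<n. B l i * partial_deriv l f (affine_map N n a B w))" for i
      using Ck_partial[OF Suc.prems _ opn_Rn[OF U]] by (intro Ck_sum Ck_cmult W Suc.IH) auto
    show "((\<lambda>t. f (affine_map N n a B (x(i := t)))) has_real_derivative
        (\<Sum>l<n. B l i * partial_deriv l f (affine_map N n a B x))) (at (x i))" if "i < N" "x \<in> W" for i x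
      by (rule DERIV_cong[OF DERIV_affine[OF Suc.prems that(2,1)]]) (simp add: mult.commute)
  qed
qed

lemma hess_affine:
  assumes f: "Ck_on n (Suc (Suc k)) U f" and w: "w \<in> W"
  shows "hess N (\<lambda>w. f (affine_map N n a B w)) w v =
    hess n f (affine_map N n a B w) (\<lambda>l. \<Sum>i<N. B l i * v i)"
proof -
  have d2: "partial_deriv i (partial_deriv j (\<lambda>w. f (affine_map N n a B w))) w =
      (\<Sum>l<n. (\<Sum>m<n. partial_deriv m (partial_deriv l f) (affine_map N n a B w) * B m i) * B l j)"
    if ij: "i < N" "j < N" for i j
  proof -
    have "partial_deriv i (partial_deriv j (\<lambda>w. f (affine_map N n a B w))) w =
        partial_deriv i (\<lambda>w. \<Sum>l<n. partial_deriv l f (affine_map N n a B w) * B l j) w"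
      by (rule partial_deriv_cong_opn[OF W _ w ij(1)]) (rule partial_deriv_affine[OF f _ ij(2)])
    also have "\<dots> = (\<Sum>l<n. (\<Sum>m<n. partial_deriv m (partial_deriv l f) (affine_map N n a B w) * B m i) * B l j)"
      using Ck_partial[OF f _ opn_Rn[OF U]]
      by (intro partial_deriv_eqI DERIV_sum DERIV_cmult_right DERIV_affine w ij) auto
    finally show ?thesis .
  qed
  let ?H = "\<lambda>m l. partial_deriv m (partial_deriv l f) (affine_map N n a B w)"
  have "hess N (\<lambda>w. f (affine_map N n a B w)) w v =
      (\<Sum>i<N. \<Sum>j<N. \<Sum>l<n. \<Sum>m<n. ?H m l * (B m i * v i) * (B l j * v j))"
    unfolding hess_def by (simp add: d2 sum_distrib_right sum_distrib_left mult_ac)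
  also have "\<dots> = (\<Sum>i<N. \<Sum>l<n. \<Sum>j<N. \<Sum>m<n. ?H m l * (B m i * v i) * (B l j * v j))"
    by (rule sum.cong[OF refl], rule sum.swap)
  also have "\<dots> = (\<Sum>l<n. \<Sum>i<N. \<Sum>j<N. \<Sum>m<n. ?H m l * (B m i * v i) * (B l j * v j))"
    by (rule sum.swap)
  also have "\<dots> = (\<Sum>l<n. \<Sum>i<N. \<Sum>m<n. \<Sum>j<N. ?H m l * (B m i * v i) * (B l j * v j))"
    by (rule sum.cong[OF refl], rule sum.cong[OF refl], rule sum.swap)
  also have "\<dots> = (\<Sum>l<n. \<Sum>m<n. \<Sum>i<N. \<Sum>j<N. ?H m l * (B m i * v i) * (B l j * v j))"
    by (rule sum.cong[OF refl], rule sum.swap)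
  also have "\<dots> = (\<Sum>m<n. \<Sum>l<n. \<Sum>i<N. \<Sum>j<N. ?H m l * (B m i * v i) * (B l j * v j))"
    by (rule sum.swap)
  also have "\<dots> = hess n f (affine_map N n a B w) (\<lambda>l. \<Sum>i<N. B l i * v i)"
    unfolding hess_def by (simp add: sum_distrib_left sum_distrib_right mult_ac)
  finally show ?thesis .
qed

end

text \<open>Replacing coordinate \<open>j\<close> by a function of the others: the situation after
  solving an equation for this coordinate, and after minimizing over it.\<close>

context
  fixes N j :: nat and U W :: "(nat \<Rightarrow> real) set" and xi :: "(nat \<Rightarrow> real) \<Rightarrow> real"
  assumes U: "opn N U" and W: "opn N W" and j: "j < N"
    and WU: "\<And>w. w \<in> W \<Longrightarrow> w(j := xi w) \<in> U" and xi: "\<And>w t. xi (w(j := t)) = xi w"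
begin

lemma DERIV_subst:
  assumes f: "Ck_on N (Suc k) U f" and x: "Ck_on N (Suc l) W xi" and w: "w \<in> W" "i < N"
  shows "((\<lambda>t. f ((w(i := t))(j := xi (w(i := t))))) has_real_derivative
    (if i = j then 0 else partial_deriv i f (w(j := xi w))) +
      partial_deriv j f (w(j := xi w)) * partial_deriv i xi w) (at (w i))"
proof (cases "i = j")
  case True
  have "partial_deriv j xi w = 0" by (rule partial_deriv_eqI) (simp add: xi)
  with True show ?thesis by (simp add: xi)
next
  case False
  define g' where "g' l = (if l = i then 1 else if l = j then partial_deriv i xi w else 0)" for l
  have "((\<lambda>t. f ((w(i := t))(j := xi (w(i := t))))) has_real_derivative
    (\<Sum>l<N. partial_deriv l f ((w(i := w i))(j := xi (w(i := w i)))) * g' l)) (at (w i))"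
  proof (rule chain_rule_curve[OF U f])
    show "((\<lambda>t. ((w(i := t))(j := xi (w(i := t)))) l) has_real_derivative g' l) (at (w i))" for l
      using Ck_DERIV'[OF x w(2) opn_Rn[OF W] w(1)] False by (cases "l = j"; cases "l = i") (auto simp: g'_def)
    show "(w(i := t))(j := xi (w(i := t))) \<in> Rn N" for t
      using opn_Rn[OF W] w j by (auto intro!: upd_in_Rn)
  qed (use WU w in auto)
  moreover have "(\<Sum>l<N. partial_deriv l f (w(j := xi w)) * g' l) =
      (\<Sum>l<N. (if l = i then partial_deriv i f (w(j := xi w)) else 0) +
        (if l = j then partial_deriv j f (w(j := xi w)) * partial_deriv i xi w else 0))"
    by (rule sum.cong) (use False in \<open>auto simp: g'_def\<close>)
  moreover have "\<dots> = partial_deriv i f (w(j := xi w)) + partial_deriv j f (w(j := xi w)) * partial_deriv i xi w"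
    using w j by (simp add: sum.distrib)
  ultimately show ?thesis using False by simp
qed

lemma partial_deriv_subst:
  assumes "Ck_on N (Suc k) U f" "Ck_on N (Suc l) W xi" "w \<in> W" "i < N"
  shows "partial_deriv i (\<lambda>w. f (w(j := xi w))) w =
    (if i = j then 0 else partial_deriv i f (w(j := xi w))) +
      partial_deriv j f (w(j := xi w)) * partial_deriv i xi w"
  by (rule partial_deriv_eqI) (rule DERIV_subst[OF assms])

lemma continuous_on_subst:
  assumes "continuous_on U f" "continuous_on W xi"
  shows "continuous_on W (\<lambda>w. f (w(j := xi w)))"
proof (rule continuous_on_compose2[OF assms(1)])
  show "continuous_on W (\<lambda>w. w(j := xi w))"
    unfolding continuous_on_fun_iff using assms(2)
    by (intro allI; rename_tac i; case_tac "i = j"; simp)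
qed (use WU in auto)

lemma Ck_subst:
  assumes "Ck_on N k U f" "Ck_on N k W xi"
  shows "Ck_on N k W (\<lambda>w. f (w(j := xi w)))"
  using assms
proof (induction k arbitrary: f)
  case 0
  then show ?case using continuous_on_subst[of f]
    unfolding Ck_0[OF opn_Rn[OF U]] Ck_0[OF opn_Rn[OF W]] by blast
next
  case (Suc k)
  have k: "Ck_on N k W xi" using Suc.prems opn_Rn[OF W] by (auto intro: Ck_le)
  have p: "Ck_on N k U (partial_deriv i f)" if "i < N" for i
    using Suc.prems(1) that opn_Rn[OF U] by (rule Ck_partial)
  show ?case
  proof (rule Ck_SucI[OF W, where D = "\<lambda>i w. (if i = j then 0 else partial_deriv i f (w(j := xi w))) +
      partial_deriv j f (w(j := xi w)) * partial_deriv i xi w"])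
    show "continuous_on W (\<lambda>w. f (w(j := xi w)))"
      by (rule continuous_on_subst[OF Ck_continuous[OF Suc.prems(1) opn_Rn[OF U]] Ck_continuous[OF Suc.prems(2) opn_Rn[OF W]]])
    show "Ck_on N k W (\<lambda>w. (if i = j then 0 else partial_deriv i f (w(j := xi w))) +
      partial_deriv j f (w(j := xi w)) * partial_deriv i xi w)" if i: "i < N" for i
    proof (rule Ck_add[OF W])
      show "Ck_on N k W (\<lambda>w. if i = j then 0 else partial_deriv i f (w(j := xi w)))"
        using Suc.IH[OF p[OF i] k] Ck_const[OF W, of k 0] by (cases "i = j") (simp_all only: if_True if_False simp_thms)
      show "Ck_on N k W (\<lambda>w. partial_deriv j f (w(j := xi w)) * partial_deriv i xi w)"
        by (intro Ck_mult W Suc.IH[OF p[OF j] k] Ck_partial[OF Suc.prems(2) i opn_Rn[OF W]])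
    qed
  qed (rule DERIV_subst[OF Suc.prems])
qed

text \<open>Second-order chain rule. The direction acquires the derivative of \<open>xi\<close>
  along \<open>v\<close> as its entry \<open>j\<close>, and the Hessian of \<open>xi\<close> is
  weighted by the derivative of \<open>f\<close> in coordinate \<open>j\<close>. This last term
  vanishes at a critical point; on a constraint surface it yields the Lagrange multiplier.\<close>

lemma hess_subst:
  assumes f: "Ck_on N (Suc (Suc k)) U f" and x: "Ck_on N (Suc (Suc l)) W xi" and w: "w \<in> W"
  shows "hess N (\<lambda>w. f (w(j := xi w))) w v =
    hess N f (w(j := xi w)) (v(j := \<Sum>i<N. partial_deriv i xi w * v i)) +
    partial_deriv j f (w(j := xi w)) * hess N xi w v"
proof -
  let ?w = "w(j := xi w)"
  let ?x = "\<lambda>i. partial_deriv i xi w" and ?H = "\<lambda>i m. partial_deriv i (partial_deriv m f) ?w"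
  let ?e = "\<lambda>i. if i = j then 0 else 1 :: real"
  have p: "Ck_on N (Suc k) U (partial_deriv i f)" if "i < N" for i
    using f that opn_Rn[OF U] by (rule Ck_partial)
  have px: "Ck_on N (Suc l) W (partial_deriv i xi)" if "i < N" for i
    using x that opn_Rn[OF W] by (rule Ck_partial)
  have x1: "Ck_on N (Suc l) W xi" using x opn_Rn[OF W] by (auto intro: Ck_le)
  have d2: "partial_deriv i (partial_deriv m (\<lambda>w. f (w(j := xi w)))) w =
      ?e m * (?e i * ?H i m + ?H j m * ?x i) + ((?e i * ?H i j + ?H j j * ?x i) * ?x m
        + partial_deriv i (partial_deriv m xi) w * partial_deriv j f ?w)"
    if im: "i < N" "m < N" for i m
  proof -
    have "partial_deriv i (partial_deriv m (\<lambda>w. f (w(j := xi w)))) w =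
        partial_deriv i (\<lambda>w. ?e m * partial_deriv m f (w(j := xi w)) +
          partial_deriv j f (w(j := xi w)) * partial_deriv m xi w) w"
      by (rule partial_deriv_cong_opn[OF W _ w im(1)])
         (use partial_deriv_subst[OF f x _ im(2)] in auto)
    also have "\<dots> = ?e m * (?e i * ?H i m + ?H j m * ?x i) + ((?e i * ?H i j + ?H j j * ?x i) * ?x m
        + partial_deriv i (partial_deriv m xi) w * partial_deriv j f ?w)"
    proof (rule partial_deriv_eqI, rule DERIV_add, rule DERIV_cmult)
      show "((\<lambda>s. partial_deriv m f ((w(i := s))(j := xi (w(i := s))))) has_real_derivative
          ?e i * ?H i m + ?H j m * ?x i) (at (w i))"
        using DERIV_subst[OF p[OF im(2)] x1 w im(1)] by (cases "i = j") simp_all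
      have 1: "((\<lambda>s. partial_deriv j f ((w(i := s))(j := xi (w(i := s))))) has_real_derivative
          ?e i * ?H i j + ?H j j * ?x i) (at (w i))"
        using DERIV_subst[OF p[OF j] x1 w im(1)] by (cases "i = j") simp_all
      show "((\<lambda>s. partial_deriv j f ((w(i := s))(j := xi (w(i := s)))) * partial_deriv m xi (w(i := s)))
        has_real_derivative (?e i * ?H i j + ?H j j * ?x i) * ?x m
        + partial_deriv i (partial_deriv m xi) w * partial_deriv j f ?w) (at (w i))"
        using DERIV_mult[OF 1 Ck_DERIV'[OF px[OF im(2)] im(1) opn_Rn[OF W] w]] by simp
    qed
    finally show ?thesis .
  qed
  define D where "D = (\<Sum>i<N. ?x i * v i)"
  define u where "u i = ?e i * v i" for i
  have uv: "(v(j := D)) i = u i + (if i = j then D else 0)" for i by (simp add: u_def)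
  have delta: "(\<Sum>i<N. h i * (if i = j then D else 0)) = h j * D" for h :: "nat \<Rightarrow> real"
    using j by (simp add: if_distrib[of "(*) _"] sum.delta cong: if_cong)
  have "hess N f ?w (v(j := D)) = (\<Sum>i<N. \<Sum>m<N. ?H i m * u i * u m) + (\<Sum>m<N. ?H j m * u m) * D
      + (\<Sum>i<N. ?H i j * u i) * D + ?H j j * D * D"
  proof -
    have "hess N f ?w (v(j := D)) = (\<Sum>i<N. \<Sum>m<N. ?H i m * u i * u m
        + ?H i m * u m * (if i = j then D else 0) + ?H i m * u i * (if m = j then D else 0)
        + ?H i m * (if i = j then D else 0) * (if m = j then D else 0))"
      unfolding hess_def uv by (intro sum.cong refl) (simp add: algebra_simps)
    also have "\<dots> = (\<Sum>i<N. \<Sum>m<N. ?H i m * u i * u m)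
        + (\<Sum>i<N. (\<Sum>m<N. ?H i m * u m) * (if i = j then D else 0))
        + (\<Sum>i<N. ?H i j * u i * D)
        + (\<Sum>i<N. ?H i j * D * (if i = j then D else 0))"
      unfolding sum.distrib delta sum_distrib_right[symmetric]
      by (simp add: delta mult_ac sum_distrib_right)
    finally show ?thesis unfolding delta by (simp add: sum_distrib_right)
  qed
  moreover have "hess N (\<lambda>w. f (w(j := xi w))) w v =
      (\<Sum>i<N. \<Sum>m<N. ?H i m * u i * u m + (?H j m * u m) * (?x i * v i)
        + (?H i j * u i) * (?x m * v m) + ?H j j * (?x i * v i) * (?x m * v m)
        + partial_deriv j f ?w * (partial_deriv i (partial_deriv m xi) w * v i * v m))"
    unfolding hess_def u_def by (intro sum.cong refl) (simp add: d2 algebra_simps)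
  moreover have "\<dots> = (\<Sum>i<N. \<Sum>m<N. ?H i m * u i * u m) + (\<Sum>m<N. ?H j m * u m) * D
      + (\<Sum>i<N. ?H i j * u i) * D + ?H j j * D * D + partial_deriv j f ?w * hess N xi w v"
    unfolding sum.distrib hess_def D_def sum_distrib_left[symmetric] sum_distrib_right[symmetric] by (simp add: mult_ac)
  ultimately show ?thesis by (simp add: D_def)
qed

end

subsection \<open>The implicit function theorem in one coordinate\<close>

lemma upd_recentre:
  "w \<in> cube N w0 d \<Longrightarrow> j < N \<Longrightarrow> d \<le> d' \<Longrightarrow> \<bar>t - s\<bar> < d' \<Longrightarrow> w(j := t) \<in> cube N (w0(j := s)) d'"
  by (fastforce simp: cube_def Rn_def)

text \<open>Along coordinate \<open>j\<close> the function increases strictly and, for all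
  \<open>w\<close> near \<open>w0\<close>, changes sign between two fixed endpoints;
  \<open>xi w\<close> is the unique zero. Continuity follows from the sign of \<open>f\<close> on
  either side of the zero, the derivative from a mean value identity, and smoothness by
  bootstrapping.\<close>

lemma implicit_function_pos:
  fixes f :: "(nat \<Rightarrow> real) \<Rightarrow> real"
  assumes e: "e > 0" and w0: "w0 \<in> Rn N" and j: "j < N"
    and sm: "\<And>k. Ck_on N k (cube N w0 e) f" and f0: "f w0 = 0"
    and pos: "\<And>w. w \<in> cube N w0 e \<Longrightarrow> 0 < partial_deriv j f w"
  obtains xi d where "0 < d" "d \<le> e" "\<And>w t. xi (w(j := t)) = xi w"
    "\<And>w. w \<in> cube N w0 d \<Longrightarrow> w(j := xi w) \<in> cube N w0 e \<and> f (w(j := xi w)) = 0"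
    "\<And>k. Ck_on N k (cube N w0 d) xi" "xi w0 = w0 j"
proof -
  let ?C = "cube N w0 e"
  note C = opn_cube[of N w0 e]
  note CR = cube_Rn[of N w0 e]
  have fder: "((\<lambda>s. f (w(i := s))) has_real_derivative partial_deriv i f (w(i := t))) (at t)"
    if "i < N" "w(i := t) \<in> ?C" for w i t
    by (rule Ck_DERIV[OF sm[of "Suc 0"] that(1) CR that(2)])
  have fcont: "continuous_on ?C f" by (rule Ck_continuous[OF sm[of 0] CR])
  have pcont: "continuous_on ?C (partial_deriv i f)" if "i < N" for i
    by (rule Ck_continuous[OF Ck_partial[OF sm[of "Suc 0"] that CR] CR])
  define \<delta> where "\<delta> = e / 2"
  have \<delta>: "0 < \<delta>" "\<delta> < e" using e by (auto simp: \<delta>_def)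
  have inC: "w(j := t) \<in> ?C" if "w \<in> ?C" "\<bar>t - w0 j\<bar> \<le> \<delta>" for w t
    by (rule upd_in_cube) (use that j \<delta> in auto)
  have incr: "f (w(j := s)) < f (w(j := t))"
    if "w \<in> ?C" "s < t" "\<bar>s - w0 j\<bar> \<le> \<delta>" "\<bar>t - w0 j\<bar> \<le> \<delta>" for w s t
  proof (rule DERIV_pos_imp_increasing[OF that(2)])
    fix r assume r: "s \<le> r" "r \<le> t"
    then have "w(j := r) \<in> ?C" using that by (intro inC) auto
    then show "\<exists>y. ((\<lambda>s. f (w(j := s))) has_real_derivative y) (at r) \<and> 0 < y"
      using fder[OF j] pos by blast
  qed
  have w0C: "w0 \<in> ?C" using centre_in_cube[OF w0 e] .
  let ?p = "w0(j := w0 j + \<delta>)" and ?m = "w0(j := w0 j - \<delta>)"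
  have pm: "?p \<in> ?C" "?m \<in> ?C" using inC[OF w0C] \<delta> by auto
  have "f (w0(j := w0 j)) < f ?p" by (rule incr[OF w0C]) (use \<delta> in auto)
  then have fp: "f ?p > 0" using f0 by simp
  have "f ?m < f (w0(j := w0 j))" by (rule incr[OF w0C]) (use \<delta> in auto)
  then have fm: "f ?m < 0" using f0 by simp
  obtain d1 where d1: "d1 > 0" "\<And>y. y \<in> cube N ?p d1 \<Longrightarrow> \<bar>f y - f ?p\<bar> < f ?p"
    using continuous_on_cubeD[OF fcont C pm(1) fp] by metis
  obtain d2 where d2: "d2 > 0" "\<And>y. y \<in> cube N ?m d2 \<Longrightarrow> \<bar>f y - f ?m\<bar> < - f ?m"
    using continuous_on_cubeD[OF fcont C pm(2), of "- f ?m"] fm by (metis neg_0_less_iff_less)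
  define d where "d = min e (min d1 d2)"
  have d: "0 < d" "d \<le> e" "d \<le> d1" "d \<le> d2" using e d1 d2 by (auto simp: d_def)
  let ?D = "cube N w0 d"
  have DC: "?D \<subseteq> ?C" by (rule cube_mono) (rule d)
  note DR = cube_Rn[of N w0 d]
  \<comment> \<open>The interval is centred at \<open>w0 j\<close> and not at \<open>w j\<close>, so
    \<open>xi\<close> is independent of coordinate \<open>j\<close> by construction.\<close>
  define xi where "xi w = (THE t. \<bar>t - w0 j\<bar> < \<delta> \<and> f (w(j := t)) = 0)" for w
  have xi_upd: "xi (w(j := t)) = xi w" for w t by (simp add: xi_def)
  have ends: "f (w(j := w0 j + \<delta>)) > 0" "f (w(j := w0 j - \<delta>)) < 0" if w: "w \<in> ?D" for w
  proof -
    have "w(j := w0 j + \<delta>) \<in> cube N ?p d1" by (rule upd_recentre[OF w j d(3)]) (use d1 in auto)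
    from d1(2)[OF this] show "f (w(j := w0 j + \<delta>)) > 0" by linarith
    have "w(j := w0 j - \<delta>) \<in> cube N ?m d2" by (rule upd_recentre[OF w j d(4)]) (use d2 in auto)
    from d2(2)[OF this] show "f (w(j := w0 j - \<delta>)) < 0" by linarith
  qed
  have root: "\<bar>xi w - w0 j\<bar> < \<delta> \<and> f (w(j := xi w)) = 0" if w: "w \<in> ?D" for w
  proof -
    have wC: "w \<in> ?C" using w DC by blast
    have "\<exists>t. w0 j - \<delta> \<le> t \<and> t \<le> w0 j + \<delta> \<and> f (w(j := t)) = 0"
    proof (rule IVT)
      show "\<forall>t. w0 j - \<delta> \<le> t \<and> t \<le> w0 j + \<delta> \<longrightarrow> isCont (\<lambda>t. f (w(j := t))) t"
      proof (intro allI impI)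
        fix t assume "w0 j - \<delta> \<le> t \<and> t \<le> w0 j + \<delta>"
        then have "w(j := t) \<in> ?C" by (intro inC[OF wC]) auto
        from DERIV_isCont[OF fder[OF j this]] show "isCont (\<lambda>t. f (w(j := t))) t" .
      qed
    qed (use ends[OF w] \<delta> in auto)
    then obtain t where t: "w0 j - \<delta> \<le> t" "t \<le> w0 j + \<delta>" "f (w(j := t)) = 0" by blast
    have "t \<noteq> w0 j - \<delta>" "t \<noteq> w0 j + \<delta>" using ends[OF w] t(3) by auto
    then have t': "\<bar>t - w0 j\<bar> < \<delta>" using t by linarith
    show ?thesis unfolding xi_def
    proof (rule theI[of _ t])
      fix s assume s: "\<bar>s - w0 j\<bar> < \<delta> \<and> f (w(j := s)) = 0"
      show "s = t"
        using incr[OF wC, of s t] incr[OF wC, of t s] s t' t(3) by (cases s t rule: linorder_cases) auto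
    qed (use t t' in auto)
  qed
  have above: "f (w(j := t)) > 0 \<longleftrightarrow> xi w < t" and below: "f (w(j := t)) < 0 \<longleftrightarrow> t < xi w"
    if w: "w \<in> ?D" and t: "\<bar>t - w0 j\<bar> \<le> \<delta>" for w t
  proof -
    have wC: "w \<in> ?C" using w DC by blast
    have "xi w < t \<Longrightarrow> f (w(j := t)) > 0" "t < xi w \<Longrightarrow> f (w(j := t)) < 0" "xi w = t \<Longrightarrow> f (w(j := t)) = 0"
      using incr[OF wC, of t "xi w"] incr[OF wC, of "xi w" t] root[OF w] t by auto
    then show "f (w(j := t)) > 0 \<longleftrightarrow> xi w < t" "f (w(j := t)) < 0 \<longleftrightarrow> t < xi w"
      by (cases "xi w" t rule: linorder_cases; fastforce)+
  qed
  have hatC: "w(j := xi w) \<in> ?C" if "w \<in> ?D" for w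
    using root[OF that] that DC by (intro inC) auto
  have xicont: "continuous_on ?D xi"
  proof (rule continuous_on_cubeI[OF _ DR])
    fix w1 and \<epsilon> :: real assume w1: "w1 \<in> ?D" and \<epsilon>: "\<epsilon> > 0"
    \<comment> \<open>Small enough for both \<open>xi w1 + \<eta>\<close> and
      \<open>xi w1 - \<eta>\<close> to stay in the interval, where the sign of \<open>f\<close>
      tells on which side of the zero a point lies.\<close>
    define \<eta> where "\<eta> = min \<epsilon> (\<delta> - \<bar>xi w1 - w0 j\<bar>) / 2"
    have \<eta>: "0 < \<eta>" "\<eta> < \<epsilon>" "\<bar>xi w1 + \<eta> - w0 j\<bar> \<le> \<delta>" "\<bar>xi w1 - \<eta> - w0 j\<bar> \<le> \<delta>"
    proof -
      have r: "\<bar>xi w1 - w0 j\<bar> < \<delta>" using root[OF w1] by blast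
      then show "0 < \<eta>" "\<eta> < \<epsilon>" using \<epsilon> by (auto simp: \<eta>_def min_def)
      have "\<eta> \<le> (\<delta> - \<bar>xi w1 - w0 j\<bar>) / 2" by (simp add: \<eta>_def)
      moreover have "\<bar>r + \<eta>\<bar> \<le> \<delta> \<and> \<bar>r - \<eta>\<bar> \<le> \<delta>" if "\<eta> \<le> (\<delta> - \<bar>r\<bar>) / 2" "\<bar>r\<bar> < \<delta>" for r
        using that \<open>0 < \<eta>\<close> by (auto simp: abs_if split: if_splits)
      ultimately have "\<bar>(xi w1 - w0 j) + \<eta>\<bar> \<le> \<delta> \<and> \<bar>(xi w1 - w0 j) - \<eta>\<bar> \<le> \<delta>"
        using r by blast
      then show "\<bar>xi w1 + \<eta> - w0 j\<bar> \<le> \<delta>" "\<bar>xi w1 - \<eta> - w0 j\<bar> \<le> \<delta>"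
        by (simp_all add: algebra_simps)
    qed
    have w1C: "w1 \<in> ?C" using w1 DC by blast
    let ?P = "w1(j := xi w1 + \<eta>)" and ?M = "w1(j := xi w1 - \<eta>)"
    have P: "f ?P > 0" using above[OF w1 \<eta>(3)] \<eta> by simp
    have M: "- f ?M > 0" using below[OF w1 \<eta>(4)] \<eta> by simp
    obtain a1 where a1: "a1 > 0" "\<And>y. y \<in> cube N ?P a1 \<Longrightarrow> \<bar>f y - f ?P\<bar> < f ?P"
      using continuous_on_cubeD[OF fcont C inC[OF w1C \<eta>(3)] P] by metis
    obtain a2 where a2: "a2 > 0" "\<And>y. y \<in> cube N ?M a2 \<Longrightarrow> \<bar>f y - f ?M\<bar> < - f ?M"
      using continuous_on_cubeD[OF fcont C inC[OF w1C \<eta>(4)] M] by metis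
    show "\<exists>a>0. \<forall>y\<in>cube N w1 a \<inter> ?D. \<bar>xi y - xi w1\<bar> < \<epsilon>"
    proof (intro exI[of _ "min a1 a2"] conjI ballI)
      fix y assume y: "y \<in> cube N w1 (min a1 a2) \<inter> ?D"
      have "y(j := xi w1 + \<eta>) \<in> cube N ?P a1" by (rule upd_recentre[of _ _ _ "min a1 a2"]) (use y j a1 in auto)
      from a1(2)[OF this] have "f (y(j := xi w1 + \<eta>)) > 0" by linarith
      then have 1: "xi y < xi w1 + \<eta>" using above[of y, OF _ \<eta>(3)] y by blast
      have "y(j := xi w1 - \<eta>) \<in> cube N ?M a2" by (rule upd_recentre[of _ _ _ "min a1 a2"]) (use y j a2 in auto)
      from a2(2)[OF this] have "f (y(j := xi w1 - \<eta>)) < 0" by linarith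
      then have "xi w1 - \<eta> < xi y" using below[of y, OF _ \<eta>(4)] y by blast
      with 1 \<eta> show "\<bar>xi y - xi w1\<bar> < \<epsilon>" by linarith
    qed (use a1 a2 in auto)
  qed
  have xider: "((\<lambda>t. xi (w(i := t))) has_real_derivative
      (if i = j then 0 else - partial_deriv i f (w(j := xi w)) * inverse (partial_deriv j f (w(j := xi w))))) (at (w i))"
    if w: "w \<in> ?D" and i: "i < N" for w i
  proof (cases "i = j")
    case True
    then show ?thesis by (simp add: xi_upd)
  next
    case False
    let ?h = "w(j := xi w)" and ?t0 = "w i"
    let ?P = "partial_deriv i f ?h" and ?Q = "partial_deriv j f ?h"
    define u where "u t = xi (w(i := t))" for t
    \<comment> \<open>Only coordinate \<open>i\<close> moves here, while coordinate \<open>j\<close>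
      stays at the old zero. The mean value theorem in coordinate \<open>j\<close> gives
      \<open>- B t\<close> as the increment of \<open>u\<close> times a derivative
      \<open>q t\<close>, so the difference quotient of \<open>u\<close> is that of
      \<open>- B\<close> divided by \<open>q\<close>.\<close>
    define B where "B t = f ((w(i := t))(j := xi w))" for t
    have u0: "u ?t0 = xi w" by (simp add: u_def)
    have hC: "?h \<in> ?C" by (rule hatC[OF w])
    have "?h(i := ?h i) \<in> ?C" using hC by (simp only: fun_upd_triv)
    from fder[OF i this] have "((\<lambda>s. f (?h(i := s))) has_real_derivative ?P) (at (?h i))"
      by (simp only: fun_upd_triv)
    moreover have "(\<lambda>s. f (?h(i := s))) = B" using False by (auto simp: B_def fun_upd_twist)
    moreover have "?h i = ?t0" using False by simp
    ultimately have Bder: "(B has_real_derivative ?P) (at ?t0)" by simp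
    have B0: "B ?t0 = 0" using root[OF w] by (simp add: B_def)
    have evD: "\<forall>\<^sub>F t in at ?t0. w(i := t) \<in> ?D"
      using eventually_upd[OF opn_cube w i] by (rule eventually_mono[OF eventually_at_filter[THEN iffD2, OF eventually_mono]]) auto
    have evu: "\<forall>\<^sub>F t in at ?t0. \<bar>u t - u ?t0\<bar> < a" if a: "a > 0" for a
    proof -
      obtain b where b: "b > 0" "\<And>y. y \<in> cube N w b \<Longrightarrow> \<bar>xi y - xi w\<bar> < a"
        using continuous_on_cubeD[OF xicont opn_cube w a] by metis
      have "\<forall>\<^sub>F t in nhds ?t0. w(i := t) \<in> cube N w b"
        by (rule eventually_upd[OF opn_cube centre_in_cube i]) (use w DR b in auto)
      then have "\<forall>\<^sub>F t in nhds ?t0. \<bar>u t - u ?t0\<bar> < a"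
        by (rule eventually_mono) (unfold u0, unfold u_def, rule b(2))
      then show ?thesis by (auto simp: eventually_at_filter elim: eventually_mono)
    qed
    have "\<exists>s. w(i := t) \<in> ?D \<longrightarrow> s \<in> closed_segment (xi w) (u t) \<and>
        - B t = (u t - xi w) * partial_deriv j f ((w(i := t))(j := s))" for t
    proof (cases "w(i := t) \<in> ?D")
      case True
      have seg: "(w(i := t))(j := s) \<in> ?C" if s: "s \<in> closed_segment (xi w) (u t)" for s
      proof (rule inC)
        show "w(i := t) \<in> ?C" using True DC by blast
        show "\<bar>s - w0 j\<bar> \<le> \<delta>" using s root[OF w] root[OF True]
          by (auto simp: closed_segment_eq_real_ivl u_def split: if_splits)
      qed
      obtain s where "s \<in> closed_segment (xi w) (u t)"
        "f ((w(i := t))(j := u t)) - f ((w(i := t))(j := xi w)) = (u t - xi w) * partial_deriv j f ((w(i := t))(j := s))"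
        by (rule MVT_segment[of "xi w" "u t" "\<lambda>s. f ((w(i := t))(j := s))" "\<lambda>s. partial_deriv j f ((w(i := t))(j := s))"])
           (use fder[OF j] seg in blast)+
      moreover have "f ((w(i := t))(j := u t)) = 0" using root[OF True] by (simp add: u_def)
      ultimately show ?thesis unfolding B_def by auto
    qed auto
    then obtain \<theta> where \<theta>: "\<And>t. w(i := t) \<in> ?D \<Longrightarrow> \<theta> t \<in> closed_segment (xi w) (u t)"
      "\<And>t. w(i := t) \<in> ?D \<Longrightarrow> - B t = (u t - xi w) * partial_deriv j f ((w(i := t))(j := \<theta> t))"
      by metis
    define q where "q t = partial_deriv j f ((w(i := t))(j := \<theta> t))" for t
    have Qpos: "?Q > 0" using pos hC by blast
    have qlim: "(q \<longlongrightarrow> ?Q) (at ?t0)"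
    proof (rule tendstoI)
      fix a :: real assume a: "a > 0"
      obtain b where b: "b > 0" "\<And>y. y \<in> cube N ?h b \<Longrightarrow> \<bar>partial_deriv j f y - ?Q\<bar> < a"
        using continuous_on_cubeD[OF pcont[OF j] C hC a] by metis
      have "\<forall>\<^sub>F t in nhds ?t0. w(i := t) \<in> cube N w b"
        by (rule eventually_upd[OF opn_cube centre_in_cube i]) (use w DR b in auto)
      then have "\<forall>\<^sub>F t in at ?t0. w(i := t) \<in> cube N w b" by (auto simp: eventually_at_filter elim: eventually_mono)
      with evD evu[OF b(1)] show "\<forall>\<^sub>F t in at ?t0. dist (q t) ?Q < a"
      proof eventually_elim
        case (elim t)
        have "\<bar>\<theta> t - xi w\<bar> \<le> \<bar>u t - xi w\<bar>"
          using \<theta>(1)[OF elim(1)] by (auto simp: closed_segment_eq_real_ivl split: if_splits)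
        then have "\<bar>\<theta> t - xi w\<bar> < b" using elim(2) u0 by simp
        then have "(w(i := t))(j := \<theta> t) \<in> cube N ?h b"
          by (intro upd_recentre[OF elim(3) j]) auto
        then show ?case using b(2) unfolding q_def dist_real_def by blast
      qed
    qed
    have "((\<lambda>t. - ((B t - B ?t0) / (t - ?t0)) * inverse (q t)) \<longlongrightarrow> - ?P * inverse ?Q) (at ?t0)"
      using Bder Qpos by (intro tendsto_mult tendsto_minus tendsto_inverse qlim) (auto simp: has_field_derivative_iff)
    moreover have "\<forall>\<^sub>F t in at ?t0. - ((B t - B ?t0) / (t - ?t0)) * inverse (q t) = (u t - u ?t0) / (t - ?t0)"
    proof -
      have "\<forall>\<^sub>F t in at ?t0. q t > 0" by (rule order_tendstoD(1)[OF qlim Qpos])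
      with evD show ?thesis
      proof eventually_elim
        case (elim t)
        have "- B t = (u t - xi w) * q t" using \<theta>(2)[OF elim(1)] unfolding q_def .
        then have "- B t * inverse (q t) = u t - xi w" using elim(2) by (simp add: field_simps)
        then have "(u t - u ?t0) / (t - ?t0) = (- B t * inverse (q t)) / (t - ?t0)" by (simp only: u0)
        then show ?case using B0 by simp
      qed
    qed
    ultimately have "((\<lambda>t. (u t - u ?t0) / (t - ?t0)) \<longlongrightarrow> - ?P * inverse ?Q) (at ?t0)"
      by (rule Lim_transform_eventually)
    then have "(u has_real_derivative - ?P * inverse ?Q) (at ?t0)" by (simp only: has_field_derivative_iff)
    with False show ?thesis unfolding u_def by simp
  qed
  \<comment> \<open>Bootstrapping: the formula for the derivatives of \<open>xi\<close> contains
    \<open>xi\<close> only substituted into derivatives of \<open>f\<close>, so class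
    \<open>k\<close> of \<open>xi\<close> gives class \<open>k + 1\<close>.\<close>
  have sm_xi: "Ck_on N k ?D xi" for k
  proof (induction k)
    case 0
    show ?case using xicont DR by (simp only: Ck_0)
  next
    case (Suc k)
    have T: "Ck_on N k ?D (\<lambda>w. g (w(j := xi w)))" if "Ck_on N k ?C g" for g
      by (rule Ck_subst[OF C opn_cube j hatC xi_upd that Suc.IH])
    have p: "Ck_on N k ?C (partial_deriv i f)" if "i < N" for i
      by (rule Ck_partial[OF sm that CR])
    show ?case
    proof (rule Ck_SucI[OF opn_cube xicont xider])
      fix i assume i: "i < N"
      have "Ck_on N k ?D (\<lambda>w. (-1) * partial_deriv i f (w(j := xi w)) * inverse (partial_deriv j f (w(j := xi w))))"
        using pos hatC by (intro Ck_mult Ck_cmult Ck_inverse opn_cube T p i j) (auto simp: less_imp_neq[symmetric])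
      then show "Ck_on N k ?D (\<lambda>w. if i = j then 0 else - partial_deriv i f (w(j := xi w)) * inverse (partial_deriv j f (w(j := xi w))))"
        using Ck_const[OF opn_cube, of N k w0 d 0] by (cases "i = j") (simp_all only: if_True if_False simp_thms mult_minus1)
    qed
  qed
  have w0D: "w0 \<in> ?D" by (rule centre_in_cube[OF w0 d(1)])
  have "xi w0 = w0 j"
    using above[OF w0D, of "w0 j"] below[OF w0D, of "w0 j"] f0 \<delta> by simp
  with d(1,2) xi_upd hatC root sm_xi show ?thesis by (intro that[of d xi]) auto
qed

text \<open>Multiplying by the sign of the derivative at \<open>w0\<close> and shrinking the cube
  makes the derivative positive throughout.\<close>

lemma implicit_function:
  fixes f :: "(nat \<Rightarrow> real) \<Rightarrow> real"
  assumes e: "e > 0" and w0: "w0 \<in> Rn N" and j: "j < N"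
    and sm: "\<And>k. Ck_on N k (cube N w0 e) f" and f0: "f w0 = 0" and nz: "partial_deriv j f w0 \<noteq> 0"
  obtains xi d where "0 < d" "d \<le> e" "\<And>w t. xi (w(j := t)) = xi w"
    "\<And>w. w \<in> cube N w0 d \<Longrightarrow> w(j := xi w) \<in> cube N w0 e \<and> f (w(j := xi w)) = 0"
    "\<And>k. Ck_on N k (cube N w0 d) xi" "xi w0 = w0 j"
proof -
  define c where "c = sgn (partial_deriv j f w0)"
  have c: "c \<noteq> 0" using nz by (simp add: c_def sgn_zero_iff)
  let ?C = "cube N w0 e"
  have w0C: "w0 \<in> ?C" by (rule centre_in_cube[OF w0 e])
  have pd: "partial_deriv j (\<lambda>w. c * f w) w = c * partial_deriv j f w" if "w \<in> ?C" for w
    by (rule partial_deriv_eqI) (rule DERIV_cmult, rule Ck_DERIV'[OF sm[of "Suc 0"] j cube_Rn that])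
  have cont: "continuous_on ?C (partial_deriv j (\<lambda>w. c * f w))"
    by (rule Ck_continuous[OF Ck_partial[OF Ck_cmult[OF opn_cube sm[of "Suc 0"]] j cube_Rn] cube_Rn])
  have p0: "partial_deriv j (\<lambda>w. c * f w) w0 > 0"
    using nz by (subst pd[OF w0C]) (simp add: c_def sgn_if)
  obtain b where b: "b > 0" "cube N w0 b \<subseteq> ?C"
    "\<And>y. y \<in> cube N w0 b \<Longrightarrow> \<bar>partial_deriv j (\<lambda>w. c * f w) y - partial_deriv j (\<lambda>w. c * f w) w0\<bar>
       < partial_deriv j (\<lambda>w. c * f w) w0"
    using continuous_on_cubeD[OF cont opn_cube w0C p0] by metis
  define e' where "e' = min b e"
  have e': "e' > 0" "cube N w0 e' \<subseteq> ?C" "cube N w0 e' \<subseteq> cube N w0 b" "e' \<le> e"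
    using b e by (auto simp: e'_def intro!: cube_mono)
  obtain xi d where xi: "0 < d" "d \<le> e'" "\<And>w t. xi (w(j := t)) = xi w"
    "\<And>w. w \<in> cube N w0 d \<Longrightarrow> w(j := xi w) \<in> cube N w0 e' \<and> c * f (w(j := xi w)) = 0"
    "\<And>k. Ck_on N k (cube N w0 d) xi" "xi w0 = w0 j"
  proof (rule implicit_function_pos[OF e'(1) w0 j, of "\<lambda>w. c * f w"])
    show "Ck_on N k (cube N w0 e') (\<lambda>w. c * f w)" for k
      by (rule Ck_cmult[OF opn_cube Ck_subset[OF e'(2) cube_Rn sm]])
    show "0 < partial_deriv j (\<lambda>w. c * f w) w" if "w \<in> cube N w0 e'" for w
      using b(3)[of w] that e'(3) by fastforce
  qed (use f0 in auto)
  show ?thesis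
    by (rule that[OF xi(1) order_trans[OF xi(2) e'(4)] xi(3) _ xi(5,6)]) (use xi(4) e'(2) c in auto)
qed


subsection \<open>Partial minimization\<close>

text \<open>The implicit function theorem for the derivative of \<open>f\<close> in coordinate
  \<open>j\<close> yields the critical point, and strict convexity in this coordinate on a small
  cube makes it a minimum.\<close>

lemma partial_minimization_step:
  fixes f :: "(nat \<Rightarrow> real) \<Rightarrow> real"
  assumes e: "e > 0" and w0: "w0 \<in> Rn N" and j: "j < N"
    and sm: "\<And>k. Ck_on N k (cube N w0 e) f" and crit: "partial_deriv j f w0 = 0"
    and convex: "partial_deriv j (partial_deriv j f) w0 > 0"
  obtains xi d where "0 < d" "d \<le> e" "\<And>w t. xi (w(j := t)) = xi w"
    "\<And>w. w \<in> cube N w0 d \<Longrightarrow> w(j := xi w) \<in> cube N w0 e"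
    "\<And>k. Ck_on N k (cube N w0 d) xi" "xi w0 = w0 j"
    "\<And>w. w \<in> cube N w0 d \<Longrightarrow> f (w(j := xi w)) \<le> f w"
    "\<And>w. w \<in> cube N w0 d \<Longrightarrow> partial_deriv j f (w(j := xi w)) = 0"
proof -
  let ?C = "cube N w0 e"
  note CR = cube_Rn[of N w0 e]
  have sp: "Ck_on N k ?C (partial_deriv i f)" if "i < N" for i k
    by (rule Ck_partial[OF sm that CR])
  have w0C: "w0 \<in> ?C" by (rule centre_in_cube[OF w0 e])
  have cont: "continuous_on ?C (partial_deriv j (partial_deriv j f))"
    by (rule Ck_continuous[OF Ck_partial[OF sp[OF j, of "Suc 0"] j CR] CR])
  obtain b where b: "b > 0" "cube N w0 b \<subseteq> ?C"
    "\<And>y. y \<in> cube N w0 b \<Longrightarrow> \<bar>partial_deriv j (partial_deriv j f) y - partial_deriv j (partial_deriv j f) w0\<bar>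
       < partial_deriv j (partial_deriv j f) w0"
    using continuous_on_cubeD[OF cont opn_cube w0C convex] by metis
  define e' where "e' = min b e"
  have e': "e' > 0" "cube N w0 e' \<subseteq> ?C" "cube N w0 e' \<subseteq> cube N w0 b" "e' \<le> e"
    using b e by (auto simp: e'_def intro!: cube_mono)
  let ?C' = "cube N w0 e'"
  have pos: "0 < partial_deriv j (partial_deriv j f) w" if "w \<in> ?C'" for w
    using b(3)[of w] that e'(3) by fastforce
  obtain xi d where xi: "0 < d" "d \<le> e'" "\<And>w t. xi (w(j := t)) = xi w"
    "\<And>w. w \<in> cube N w0 d \<Longrightarrow> w(j := xi w) \<in> ?C' \<and> partial_deriv j f (w(j := xi w)) = 0"
    "\<And>k. Ck_on N k (cube N w0 d) xi" "xi w0 = w0 j"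
    using implicit_function_pos[OF e'(1) w0 j Ck_subset[OF e'(2) CR sp[OF j]] crit pos] by metis
  have min: "f (w(j := xi w)) \<le> f w" if w: "w \<in> cube N w0 d" for w
  proof -
    have wC: "w \<in> ?C'" using w cube_mono[OF xi(2)] by blast
    have hC: "w(j := xi w) \<in> ?C'" and h0: "partial_deriv j f (w(j := xi w)) = 0" using xi(4)[OF w] by auto
    have seg: "w(j := t) \<in> ?C'" if "t \<in> closed_segment (xi w) (w j)" for t
    proof (rule upd_in_cube[OF wC j])
      have "\<bar>xi w - w0 j\<bar> < e'" using cubeD[OF hC j] by simp
      moreover have "\<bar>w j - w0 j\<bar> < e'" using cubeD[OF wC j] .
      ultimately show "\<bar>t - w0 j\<bar> < e'"
        using that by (auto simp: closed_segment_eq_real_ivl split: if_splits)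
    qed
    have D1: "((\<lambda>t. f (w(j := t))) has_real_derivative partial_deriv j f (w(j := t))) (at t)"
      if "t \<in> closed_segment (xi w) (w j)" for t
      by (rule Ck_DERIV[OF sm[of "Suc 0"] j CR]) (use seg[OF that] e'(2) in blast)
    have D2: "((\<lambda>t. partial_deriv j f (w(j := t))) has_real_derivative partial_deriv j (partial_deriv j f) (w(j := t))) (at t)"
      if "t \<in> closed_segment (xi w) (w j)" for t
      by (rule Ck_DERIV[OF sp[OF j, of "Suc 0"] j CR]) (use seg[OF that] e'(2) in blast)
    \<comment> \<open>Two mean value steps: one for \<open>f\<close> between \<open>xi w\<close> and
      \<open>w j\<close>, one for its derivative between the critical value \<open>xi w\<close> and
      \<open>s\<close>. As \<open>s\<close> lies in between, \<open>w j - xi w\<close> and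
      \<open>s - xi w\<close> have the same sign.\<close>
    obtain s where s: "s \<in> closed_segment (xi w) (w j)"
      "f (w(j := w j)) - f (w(j := xi w)) = (w j - xi w) * partial_deriv j f (w(j := s))"
      by (rule MVT_segment[of "xi w" "w j" "\<lambda>t. f (w(j := t))" "\<lambda>t. partial_deriv j f (w(j := t))"])
         (use D1 in blast)+
    have sub: "t \<in> closed_segment (xi w) (w j)" if "t \<in> closed_segment (xi w) s" for t
      using that s(1) by (auto simp: closed_segment_eq_real_ivl split: if_splits)
    obtain r where r: "r \<in> closed_segment (xi w) s"
      "partial_deriv j f (w(j := s)) - partial_deriv j f (w(j := xi w)) =
        (s - xi w) * partial_deriv j (partial_deriv j f) (w(j := r))"
      by (rule MVT_segment[of "xi w" s "\<lambda>t. partial_deriv j f (w(j := t))"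
            "\<lambda>t. partial_deriv j (partial_deriv j f) (w(j := t))"])
         (use D2 sub in blast)+
    have "partial_deriv j (partial_deriv j f) (w(j := r)) > 0" by (rule pos[OF seg[OF sub[OF r(1)]]])
    moreover have "(w j - xi w) * (s - xi w) \<ge> 0"
      using s(1) by (auto simp: closed_segment_eq_real_ivl zero_le_mult_iff split: if_splits)
    moreover have "f w - f (w(j := xi w)) = ((w j - xi w) * (s - xi w)) * partial_deriv j (partial_deriv j f) (w(j := r))"
      using s(2) r(2) h0 by (simp only: fun_upd_triv diff_zero mult.assoc)
    ultimately have "f w - f (w(j := xi w)) \<ge> 0" by simp
    then show ?thesis by simp
  qed
  have 4: "w(j := xi w) \<in> ?C" if "w \<in> cube N w0 d" for w using xi(4)[OF that] e'(2) by blast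
  have 8: "partial_deriv j f (w(j := xi w)) = 0" if "w \<in> cube N w0 d" for w using xi(4)[OF that] by blast
  show ?thesis by (rule that[OF xi(1) order_trans[OF xi(2) e'(4)] xi(3) 4 xi(5,6) min 8])
qed

text \<open>
  The set \<open>V\<close> collects the directions in which the Hessian is controlled; eliminating the
  coordinates in \<open>J\<close> leaves the directions vanishing on \<open>J\<close>.
\<close>

lemma partial_minimization:
  fixes f :: "(nat \<Rightarrow> real) \<Rightarrow> real" and V :: "(nat \<Rightarrow> real) \<Rightarrow> bool"
  assumes "finite J" and e: "e > 0" and w0: "w0 \<in> Rn N" and J: "J \<subseteq> {..<N}"
    and sm: "\<And>k. Ck_on N k (cube N w0 e) f" and crit: "\<And>j. j \<in> J \<Longrightarrow> partial_deriv j f w0 = 0"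
    and V: "\<And>v j t. V v \<Longrightarrow> j \<in> J \<Longrightarrow> V (v(j := t))" "V 0"
    and pos: "\<And>v. V v \<Longrightarrow> v \<in> Rn N \<Longrightarrow> v \<noteq> 0 \<Longrightarrow> hess N f w0 v > 0"
  shows "\<exists>d m z. 0 < d \<and> d \<le> e \<and> (\<forall>k. Ck_on N k (cube N w0 d) m) \<and>
    (\<forall>w\<in>cube N w0 d. z w \<in> cube N w0 e \<and> (\<forall>i. i \<notin> J \<longrightarrow> z w i = w i) \<and> m w = f (z w)) \<and>
    (\<forall>w\<in>cube N w0 d. \<forall>w'\<in>cube N w0 d. (\<forall>i. i \<notin> J \<longrightarrow> w i = w' i) \<longrightarrow> m w \<le> f w') \<and>
    m w0 = f w0 \<and> (\<forall>i<N. i \<notin> J \<longrightarrow> partial_deriv i m w0 = partial_deriv i f w0) \<and>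
    (\<forall>v. V v \<longrightarrow> v \<in> Rn N \<longrightarrow> v \<noteq> 0 \<longrightarrow> (\<forall>j\<in>J. v j = 0) \<longrightarrow> hess N m w0 v > 0)"
  using assms(1) J crit V(1)
proof (induction J rule: finite_induct)
  case empty
  have L: "f w \<le> f w'" if "\<forall>i. i \<notin> {} \<longrightarrow> w i = w' i" for w w'
  proof -
    have "w = w'" using that by (auto intro: ext)
    then show ?thesis by simp
  qed
  show ?case
    by (intro exI[of _ e] exI[of _ f] exI[of _ "\<lambda>w. w"] conjI ballI allI impI)
       ((rule e order_refl sm refl; fail) | (assumption) | (rule refl) | (erule L) | (rule pos, assumption+))+
next
  case (insert j J)
  have jN: "j < N" using insert.prems by auto
  have "\<exists>d m z. 0 < d \<and> d \<le> e \<and> (\<forall>k. Ck_on N k (cube N w0 d) m) \<and>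
    (\<forall>w\<in>cube N w0 d. z w \<in> cube N w0 e \<and> (\<forall>i. i \<notin> J \<longrightarrow> z w i = w i) \<and> m w = f (z w)) \<and>
    (\<forall>w\<in>cube N w0 d. \<forall>w'\<in>cube N w0 d. (\<forall>i. i \<notin> J \<longrightarrow> w i = w' i) \<longrightarrow> m w \<le> f w') \<and>
    m w0 = f w0 \<and> (\<forall>i<N. i \<notin> J \<longrightarrow> partial_deriv i m w0 = partial_deriv i f w0) \<and>
    (\<forall>v. V v \<longrightarrow> v \<in> Rn N \<longrightarrow> v \<noteq> 0 \<longrightarrow> (\<forall>j\<in>J. v j = 0) \<longrightarrow> hess N m w0 v > 0)"
    by (rule insert.IH) (use insert.prems in auto)
  then obtain d m z where o: "0 < d" "d \<le> e" "\<forall>k. Ck_on N k (cube N w0 d) m"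
    "\<forall>w\<in>cube N w0 d. z w \<in> cube N w0 e \<and> (\<forall>i. i \<notin> J \<longrightarrow> z w i = w i) \<and> m w = f (z w)"
    "\<forall>w\<in>cube N w0 d. \<forall>w'\<in>cube N w0 d. (\<forall>i. i \<notin> J \<longrightarrow> w i = w' i) \<longrightarrow> m w \<le> f w'"
    "m w0 = f w0" "\<forall>i<N. i \<notin> J \<longrightarrow> partial_deriv i m w0 = partial_deriv i f w0"
    "\<forall>v. V v \<longrightarrow> v \<in> Rn N \<longrightarrow> v \<noteq> 0 \<longrightarrow> (\<forall>j\<in>J. v j = 0) \<longrightarrow> hess N m w0 v > 0"
    by (elim exE conjE)
  note IH = o(1,2) spec[OF o(3)] bspec[OF o(4)] bspec[OF bspec[OF o(5)], THEN mp] o(6)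
    spec[OF o(7), THEN mp, THEN mp] spec[OF o(8), THEN mp, THEN mp, THEN mp, THEN mp]
  have critm: "partial_deriv j m w0 = 0" using IH(7)[OF jN] insert.hyps insert.prems by simp
  have convex: "partial_deriv j (partial_deriv j m) w0 > 0"
  proof -
    \<comment> \<open>The unit vector of coordinate \<open>j\<close> is a controlled direction
      because \<open>V\<close> contains 0 and allows changes in \<open>j\<close>. It vanishes on the
      coordinates already eliminated.\<close>
    let ?v = "(0 :: nat \<Rightarrow> real)(j := 1)"
    have "hess N m w0 ?v > 0"
    proof (rule IH(8))
      show "V ?v" by (rule insert.prems(3)[OF V(2)]) simp
      show "?v \<noteq> 0" by (auto simp: fun_eq_iff)
    qed (use jN insert.hyps in \<open>auto simp: Rn_def\<close>)
    moreover have "hess N m w0 ?v = (\<Sum>i<N. \<Sum>l<N. if i = j \<and> l = j then partial_deriv j (partial_deriv j m) w0 else 0)"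
      unfolding hess_def by (intro sum.cong refl) auto
    moreover have "\<dots> = (\<Sum>i<N. if i = j then partial_deriv j (partial_deriv j m) w0 else 0)"
      using jN by (intro sum.cong refl) (auto simp: sum.delta)
    ultimately show ?thesis using jN by (simp add: sum.delta)
  qed
  obtain xi d' where xi: "0 < d'" "d' \<le> d" "\<And>w t. xi (w(j := t)) = xi w"
    "\<And>w. w \<in> cube N w0 d' \<Longrightarrow> w(j := xi w) \<in> cube N w0 d"
    "\<And>k. Ck_on N k (cube N w0 d') xi" "xi w0 = w0 j"
    "\<And>w. w \<in> cube N w0 d' \<Longrightarrow> m (w(j := xi w)) \<le> m w"
    "\<And>w. w \<in> cube N w0 d' \<Longrightarrow> partial_deriv j m (w(j := xi w)) = 0"
    using partial_minimization_step[OF IH(1) w0 jN IH(3) critm convex] by metis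
  let ?m = "\<lambda>w. m (w(j := xi w))" and ?z = "\<lambda>w. z (w(j := xi w))"
  note sub = Ck_subst[OF opn_cube opn_cube jN xi(4,3) IH(3) xi(5)]
  have w0d: "w0 \<in> cube N w0 d'" by (rule centre_in_cube[OF w0 xi(1)])
  have hat0: "w0(j := xi w0) = w0" by (simp add: xi(6))
  show ?case
  proof (intro exI[of _ d'] exI[of _ ?m] exI[of _ ?z] conjI ballI allI impI)
    show "0 < d'" "d' \<le> e" using xi IH by auto
    show "Ck_on N k (cube N w0 d') ?m" for k by (rule sub)
    fix w assume w: "w \<in> cube N w0 d'"
    show "?z w \<in> cube N w0 e" "?m w = f (?z w)" using IH(4)[OF xi(4)[OF w]] by auto
    show "?z w i = w i" if "i \<notin> insert j J" for i using IH(4)[OF xi(4)[OF w]] that by auto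
    fix w' assume w': "w' \<in> cube N w0 d'" and eq: "\<forall>i. i \<notin> insert j J \<longrightarrow> w i = w' i"
    \<comment> \<open>Borrowing coordinate \<open>j\<close> from \<open>w'\<close> gives a point
      that agrees with \<open>w'\<close> off \<open>J\<close>, as the induction hypothesis requires;
      \<open>?m\<close> does not see this change.\<close>
    let ?w = "w(j := w' j)"
    have w'': "?w \<in> cube N w0 d'" by (rule upd_in_cube[OF w jN cubeD[OF w' jN]])
    have "?m w = ?m ?w" by (simp only: xi(3) fun_upd_upd)
    also have "\<dots> \<le> m ?w" by (rule xi(7)[OF w''])
    also have "\<dots> \<le> f w'"
      by (rule IH(5)) (use w'' w' cube_mono[OF xi(2)] eq in auto)
    finally show "?m w \<le> f w'" .
  next
    show "?m w0 = f w0" by (simp only: hat0 IH(6))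
    show "partial_deriv i ?m w0 = partial_deriv i f w0" if i: "i < N" "i \<notin> insert j J" for i
      using partial_deriv_subst[OF opn_cube opn_cube jN xi(4,3) IH(3)[of "Suc 0"] xi(5)[of "Suc 0"] w0d i(1)]
        i IH(7)[of i] critm unfolding hat0 by simp
    fix v assume v: "V v" "v \<in> Rn N" "v \<noteq> 0" "\<forall>j\<in>insert j J. v j = 0"
    let ?v = "v(j := \<Sum>i<N. partial_deriv i xi w0 * v i)"
    \<comment> \<open>At the critical point the Hessian of \<open>xi\<close> drops out of
      \<open>hess_subst\<close>.\<close>
    have "hess N ?m w0 v = hess N m w0 ?v"
      using hess_subst[OF opn_cube opn_cube jN xi(4,3) IH(3)[of "Suc (Suc 0)"] xi(5)[of "Suc (Suc 0)"] w0d, of v]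
      unfolding hat0 critm by simp
    moreover have "hess N m w0 ?v > 0"
    proof (rule IH(8))
      show "V ?v" by (rule insert.prems(3)[OF v(1)]) simp
      show "?v \<in> Rn N" using v(2) jN by (rule upd_in_Rn)
      obtain i where "v i \<noteq> 0" using v(3) by (auto simp: fun_eq_iff)
      then have "?v i \<noteq> 0" using v(4) by auto
      then show "?v \<noteq> 0" by (metis zero_fun_apply)
      show "\<forall>j\<in>J. ?v j = 0" using v(4) insert.hyps by auto
    qed
    ultimately show "hess N ?m w0 v > 0" by simp
  qed
qed

subsection \<open>Minkowski sums of smooth bodies\<close>

text \<open>The local condition of \<open>smooth_convex_bodies\<close> in coordinates: a cube as the
  open set, and the bare Hessian on the tangent space in place of the second fundamental form, which
  differs from it by the positive factor 1 / |grad f|.\<close>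

definition regular_at :: "nat \<Rightarrow> (nat \<Rightarrow> real) set \<Rightarrow> (nat \<Rightarrow> real) \<Rightarrow> real \<Rightarrow> ((nat \<Rightarrow> real) \<Rightarrow> real) \<Rightarrow> bool"
  where "regular_at n K x e f \<longleftrightarrow> 0 < e \<and> (\<forall>k. Ck_on n k (cube n x e) f) \<and>
    K \<inter> cube n x e = {y \<in> cube n x e. f y \<le> 0} \<and> (\<exists>i<n. partial_deriv i f x \<noteq> 0) \<and>
    (\<forall>v\<in>Rn n. v \<noteq> 0 \<longrightarrow> (\<Sum>i<n. partial_deriv i f x * v i) = 0 \<longrightarrow> 0 < hess n f x v)"

lemma gradient_norm_zero_iff: "gradient_norm n f x = 0 \<longleftrightarrow> (\<forall>i<n. partial_deriv i f x = 0)"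
  unfolding gradient_norm_def by (simp add: sum_nonneg_eq_0_iff) auto

lemma gradient_norm_nonneg: "0 \<le> gradient_norm n f x"
  by (simp add: gradient_norm_def sum_nonneg)

lemma frontier_body_iff:
  assumes "convex_body n K"
  shows "x \<in> Euclidean_space n frontier_of K \<longleftrightarrow> x \<in> K \<and> \<not> (\<exists>e>0. cube n x e \<subseteq> K)"
proof -
  have "closedin (Euclidean_space n) K"
    using compact_imp_closed[OF body_compact[OF assms]] body_Rn[OF assms]
    by (simp add: Euclidean_space_Rn closed_subset)
  then have "Euclidean_space n closure_of K = K" by (rule closure_of_closedin)
  moreover have "x \<in> Euclidean_space n interior_of K \<longleftrightarrow> (\<exists>e>0. cube n x e \<subseteq> K) \<and> x \<in> K"
  proof
    assume "x \<in> Euclidean_space n interior_of K"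
    then obtain T where T: "opn n T" "x \<in> T" "T \<subseteq> K" by (auto simp: interior_of_def)
    obtain e where "e > 0" "cube n x e \<subseteq> T" using opn_contains_cube[OF T(1,2)] .
    then show "(\<exists>e>0. cube n x e \<subseteq> K) \<and> x \<in> K" using T by (intro conjI exI[of _ e]) auto
  next
    assume "(\<exists>e>0. cube n x e \<subseteq> K) \<and> x \<in> K"
    then obtain e where e: "e > 0" "cube n x e \<subseteq> K" "x \<in> K" by (elim conjE exE)
    then have "x \<in> cube n x e" using body_Rn[OF assms] by (intro centre_in_cube) auto
    with e(2) show "x \<in> Euclidean_space n interior_of K"
      unfolding interior_of_def mem_Collect_eq by (intro exI[of _ "cube n x e"] conjI opn_cube)
  qed
  ultimately show ?thesis unfolding frontier_of_def by auto
qed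

lemma smooth_convex_bodies_iff:
  "K \<in> smooth_convex_bodies n \<longleftrightarrow> convex_body n K \<and>
    (\<forall>x\<in>K. \<not> (\<exists>e>0. cube n x e \<subseteq> K) \<longrightarrow> (\<exists>e f. regular_at n K x e f))"
proof -
  have curv: "(\<forall>v\<in>level_tangent_space n f x. v \<noteq> 0 \<longrightarrow> 0 < second_fundamental_form n f x v v) \<longleftrightarrow>
     (\<forall>v\<in>Rn n. v \<noteq> 0 \<longrightarrow> (\<Sum>i<n. partial_deriv i f x * v i) = 0 \<longrightarrow> 0 < hess n f x v)"
    if "gradient_norm n f x \<noteq> 0" for f x
  proof -
    have "gradient_norm n f x > 0" using that gradient_norm_nonneg[of n f x] by simp
    then have "0 < second_fundamental_form n f x v v \<longleftrightarrow> 0 < hess n f x v" for v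
      unfolding second_fundamental_form_def hess_def by (simp add: zero_less_divide_iff)
    then show ?thesis unfolding level_tangent_space_def by auto
  qed
  have "(\<exists>U f. opn n U \<and> x \<in> U \<and> smooth_on n U f \<and> K \<inter> U = {y \<in> U. f y \<le> 0} \<and>
           gradient_norm n f x \<noteq> 0 \<and>
           (\<forall>v \<in> level_tangent_space n f x. v \<noteq> 0 \<longrightarrow> second_fundamental_form n f x v v > 0)) \<longleftrightarrow>
        (\<exists>e f. regular_at n K x e f)" (is "?L \<longleftrightarrow> ?R") if x: "x \<in> Rn n" for x
  proof
    assume ?L
    then obtain U f where U: "opn n U" "x \<in> U" "smooth_on n U f" "K \<inter> U = {y \<in> U. f y \<le> 0}"
      "gradient_norm n f x \<noteq> 0"
      "\<forall>v \<in> level_tangent_space n f x. v \<noteq> 0 \<longrightarrow> second_fundamental_form n f x v v > 0" by blast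
    obtain e where e: "e > 0" "cube n x e \<subseteq> U" using opn_contains_cube[OF U(1,2)] by blast
    have "regular_at n K x e f" unfolding regular_at_def
    proof (intro conjI allI)
      show "0 < e" by (rule e(1))
      show "Ck_on n k (cube n x e) f" for k
        by (rule Ck_subset[OF e(2) opn_Rn[OF U(1)]]) (use U(3) in \<open>simp add: smooth_on_def\<close>)
      show "K \<inter> cube n x e = {y \<in> cube n x e. f y \<le> 0}" using U(4) e(2) by blast
      show "\<exists>i<n. partial_deriv i f x \<noteq> 0" using U(5) gradient_norm_zero_iff[of n f x] by blast
      from curv[OF U(5)] U(6)
      show "\<forall>v\<in>Rn n. v \<noteq> 0 \<longrightarrow> (\<Sum>i<n. partial_deriv i f x * v i) = 0 \<longrightarrow> 0 < hess n f x v"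
        by (rule iffD1)
    qed
    then show ?R by blast
  next
    assume ?R
    then obtain e f where r: "regular_at n K x e f" by blast
    have g: "gradient_norm n f x \<noteq> 0" using r gradient_norm_zero_iff[of n f x] unfolding regular_at_def by blast
    show ?L
    proof (intro exI[of _ "cube n x e"] exI[of _ f] conjI)
      show "opn n (cube n x e)" by (rule opn_cube)
      show "x \<in> cube n x e" by (rule centre_in_cube[OF x]) (use r in \<open>simp add: regular_at_def\<close>)
      show "smooth_on n (cube n x e) f" using r by (simp add: regular_at_def smooth_on_def)
      show "K \<inter> cube n x e = {y \<in> cube n x e. f y \<le> 0}" using r by (simp only: regular_at_def)
      show "gradient_norm n f x \<noteq> 0" by (rule g)
      have "\<forall>v\<in>Rn n. v \<noteq> 0 \<longrightarrow> (\<Sum>i<n. partial_deriv i f x * v i) = 0 \<longrightarrow> 0 < hess n f x v"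
        using r unfolding regular_at_def by (elim conjE)
      with curv[OF g]
      show "\<forall>v \<in> level_tangent_space n f x. v \<noteq> 0 \<longrightarrow> second_fundamental_form n f x v v > 0"
        by (rule iffD2)
    qed
  qed
  note loc = this
  show ?thesis
  proof (cases "convex_body n K")
    case True
    have "K \<in> smooth_convex_bodies n \<longleftrightarrow>
        (\<forall>x \<in> Euclidean_space n frontier_of K. \<exists>e f. regular_at n K x e f)"
      unfolding smooth_convex_bodies_def mem_Collect_eq
    proof (rule iffI)
      assume a: "convex_body n K \<and> (\<forall>x \<in> Euclidean_space n frontier_of K. \<exists>U f.
           opn n U \<and> x \<in> U \<and> smooth_on n U f \<and> K \<inter> U = {y \<in> U. f y \<le> 0} \<and>
           gradient_norm n f x \<noteq> 0 \<and>
           (\<forall>v \<in> level_tangent_space n f x. v \<noteq> 0 \<longrightarrow> second_fundamental_form n f x v v > 0))"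
      show "\<forall>x \<in> Euclidean_space n frontier_of K. \<exists>e f. regular_at n K x e f"
      proof
        fix x assume x: "x \<in> Euclidean_space n frontier_of K"
        then have "x \<in> Rn n" using frontier_body_iff[OF True] body_Rn[OF True] by blast
        from loc[OF this] show "\<exists>e f. regular_at n K x e f" using bspec[OF conjunct2[OF a] x] by (rule iffD1)
      qed
    next
      assume a: "\<forall>x \<in> Euclidean_space n frontier_of K. \<exists>e f. regular_at n K x e f"
      show "convex_body n K \<and> (\<forall>x \<in> Euclidean_space n frontier_of K. \<exists>U f.
           opn n U \<and> x \<in> U \<and> smooth_on n U f \<and> K \<inter> U = {y \<in> U. f y \<le> 0} \<and>
           gradient_norm n f x \<noteq> 0 \<and>
           (\<forall>v \<in> level_tangent_space n f x. v \<noteq> 0 \<longrightarrow> second_fundamental_form n f x v v > 0))"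
      proof (rule conjI[OF True], rule ballI)
        fix x assume x: "x \<in> Euclidean_space n frontier_of K"
        then have "x \<in> Rn n" using frontier_body_iff[OF True] body_Rn[OF True] by blast
        from loc[OF this] show "\<exists>U f.
           opn n U \<and> x \<in> U \<and> smooth_on n U f \<and> K \<inter> U = {y \<in> U. f y \<le> 0} \<and>
           gradient_norm n f x \<noteq> 0 \<and>
           (\<forall>v \<in> level_tangent_space n f x. v \<noteq> 0 \<longrightarrow> second_fundamental_form n f x v v > 0)"
          using bspec[OF a x] by (rule iffD2)
      qed
    qed
    also have "\<dots> \<longleftrightarrow> (\<forall>x\<in>K. \<not> (\<exists>e>0. cube n x e \<subseteq> K) \<longrightarrow> (\<exists>e f. regular_at n K x e f))"
      unfolding frontier_body_iff[OF True, THEN eq_reflection] Ball_def by (rule iff_allI) (rule imp_conjL)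
    finally show ?thesis using True by (simp only: simp_thms)
  qed (simp add: smooth_convex_bodies_def)
qed

lemma smooth_body: "K \<in> smooth_convex_bodies n \<Longrightarrow> convex_body n K"
  by (simp add: smooth_convex_bodies_def)

context
  fixes n :: nat and K :: "(nat \<Rightarrow> real) set" and x :: "nat \<Rightarrow> real" and e :: real and f :: "(nat \<Rightarrow> real) \<Rightarrow> real"
  assumes K: "convex_body n K" and r: "regular_at n K x e f"
    and x: "x \<in> K" and bd: "\<not> (\<exists>e>0. cube n x e \<subseteq> K)"
begin

lemma reg: "0 < e" "\<And>k. Ck_on n k (cube n x e) f" "K \<inter> cube n x e = {y \<in> cube n x e. f y \<le> 0}"
  "\<exists>i<n. partial_deriv i f x \<noteq> 0"
  "\<And>v. v \<in> Rn n \<Longrightarrow> v \<noteq> 0 \<Longrightarrow> (\<Sum>i<n. partial_deriv i f x * v i) = 0 \<Longrightarrow> 0 < hess n f x v"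
  using r unfolding regular_at_def by auto

lemma x_in_cube: "x \<in> cube n x e"
  using centre_in_cube reg(1) x body_Rn[OF K] by blast

lemma negative_interior:
  assumes "y \<in> cube n x e" "f y < 0"
  shows "\<exists>d>0. cube n y d \<subseteq> K"
proof -
  have "continuous_on (cube n x e) f" by (rule Ck_continuous[OF reg(2) cube_Rn])
  then obtain d where d: "d > 0" "cube n y d \<subseteq> cube n x e" "\<And>z. z \<in> cube n y d \<Longrightarrow> \<bar>f z - f y\<bar> < - f y"
    using continuous_on_cubeD[OF _ opn_cube assms(1), of f "- f y"] assms(2) by (metis neg_0_less_iff_less)
  have "z \<in> K" if "z \<in> cube n y d" for z
  proof -
    have "f z \<le> 0" using d(3)[OF that] by linarith
    then show ?thesis using that d(2) reg(3) by blast
  qed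
  with d(1) show ?thesis by blast
qed

lemma boundary_zero: "f x = 0"
proof -
  have "f x \<le> 0" using reg(3) x x_in_cube by blast
  then show ?thesis using negative_interior[OF x_in_cube] bd by fastforce
qed

lemma line_in_Rn: "v \<in> Rn n \<Longrightarrow> x + t *\<^sub>R v \<in> Rn n"
  using x body_Rn[OF K] by (intro Rn_add Rn_scale) auto

lemma line_DERIV:
  assumes v: "v \<in> Rn n" and t: "x + t *\<^sub>R v \<in> cube n x e" and g: "Ck_on n (Suc k) (cube n x e) g"
  shows "((\<lambda>t. g (x + t *\<^sub>R v)) has_real_derivative (\<Sum>i<n. partial_deriv i g (x + t *\<^sub>R v) * v i)) (at t)"
proof (rule chain_rule_curve[where g = "\<lambda>t. x + t *\<^sub>R v" and ?t0.0 = t, OF opn_cube g t])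
  fix i
  have "((\<lambda>t. x i + t * v i) has_real_derivative v i) (at t)" by (auto intro!: derivative_eq_intros)
  then show "((\<lambda>t. (x + t *\<^sub>R v) i) has_real_derivative v i) (at t)" by (simp add: scaleR_fun_apply)
qed (rule line_in_Rn[OF v])

lemma line_in_cube:
  assumes v: "v \<in> Rn n"
  obtains \<delta> where "\<delta> > 0" "\<And>t. \<bar>t\<bar> < \<delta> \<Longrightarrow> x + t *\<^sub>R v \<in> cube n x e"
proof -
  define M where "M = 1 + (\<Sum>i<n. \<bar>v i\<bar>)"
  have M: "M > 0" unfolding M_def by (smt (verit) sum_nonneg abs_ge_zero)
  have Mi: "\<bar>v i\<bar> \<le> M" if "i < n" for i
    unfolding M_def using member_le_sum[of i "{..<n}" "\<lambda>i. \<bar>v i\<bar>"] that by auto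
  show ?thesis
  proof (rule that[of "e / M"])
    show "0 < e / M" using M reg(1) by simp
    fix t :: real assume t: "\<bar>t\<bar> < e / M"
    have "\<bar>t * v i\<bar> < e" if "i < n" for i
    proof -
      have "\<bar>t * v i\<bar> \<le> \<bar>t\<bar> * M" unfolding abs_mult by (intro mult_left_mono Mi that) simp
      also have "\<dots> < e" using t M by (simp add: field_simps)
      finally show ?thesis .
    qed
    then show "x + t *\<^sub>R v \<in> cube n x e"
      using line_in_Rn[OF v] by (simp add: cube_def scaleR_fun_apply)
  qed
qed

text \<open>If the gradient had a positive product with \<open>y - x\<close>, then \<open>f\<close>
  would become positive on the segment from \<open>x\<close> to \<open>y\<close>, which lies in
  \<open>K\<close>.\<close>

lemma support_normal:
  assumes y: "y \<in> K" shows "(\<Sum>i<n. partial_deriv i f x * (y i - x i)) \<le> 0"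
proof (rule ccontr)
  assume pos: "\<not> ?thesis"
  let ?v = "y - x"
  have v: "?v \<in> Rn n" using x y body_Rn[OF K] by (intro Rn_diff) auto
  obtain \<delta> where \<delta>: "\<delta> > 0" "\<And>t. \<bar>t\<bar> < \<delta> \<Longrightarrow> x + t *\<^sub>R ?v \<in> cube n x e" using line_in_cube[OF v] by metis
  have "((\<lambda>t. f (x + t *\<^sub>R ?v)) has_real_derivative (\<Sum>i<n. partial_deriv i f (x + 0 *\<^sub>R ?v) * ?v i)) (at 0)"
    by (rule line_DERIV[OF v _ reg(2)[of "Suc 0"]]) (simp add: x_in_cube)
  moreover have "(\<Sum>i<n. partial_deriv i f (x + 0 *\<^sub>R ?v) * ?v i) > 0" using pos by simp
  ultimately have "\<exists>h>0. \<forall>t>0. t < h \<longrightarrow> f (x + 0 *\<^sub>R ?v) < f (x + (0 + t) *\<^sub>R ?v)"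
    by (rule DERIV_pos_inc_right)
  then obtain h where h: "h > 0" "\<And>t. t > 0 \<Longrightarrow> t < h \<Longrightarrow> f (x + 0 *\<^sub>R ?v) < f (x + (0 + t) *\<^sub>R ?v)"
    by blast
  define t where "t = min (min h \<delta>) 1 / 2"
  have t: "0 < t" "t < h" "\<bar>t\<bar> < \<delta>" "t \<le> 1" using h(1) \<delta>(1) by (auto simp: t_def)
  have "x + t *\<^sub>R ?v = (1 - t) *\<^sub>R x + t *\<^sub>R y" by (simp add: algebra_simps)
  moreover have "(1 - t) *\<^sub>R x + t *\<^sub>R y \<in> K" by (rule convexD[OF body_convex[OF K] x y]) (use t in auto)
  ultimately have "x + t *\<^sub>R ?v \<in> K" by simp
  then have "f (x + t *\<^sub>R ?v) \<le> 0" using \<delta>(2)[OF t(3)] reg(3) by blast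
  moreover have "f (x + 0 *\<^sub>R ?v) = 0" using boundary_zero by simp
  ultimately show False using h(2)[OF t(1,2)] by simp
qed

text \<open>Otherwise \<open>y - x\<close> is a nonzero tangent direction. Positive curvature makes
  \<open>f\<close> positive just after \<open>x\<close>, although the segment stays in
  \<open>K\<close>.\<close>

lemma support_strict:
  assumes y: "y \<in> K" and tan: "(\<Sum>i<n. partial_deriv i f x * (y i - x i)) = 0"
  shows "y = x"
proof (rule ccontr)
  assume ne: "y \<noteq> x"
  let ?v = "y - x"
  have v: "?v \<in> Rn n" using x y body_Rn[OF K] by (intro Rn_diff) auto
  let ?D = "\<lambda>t. \<Sum>i<n. partial_deriv i f (x + t *\<^sub>R ?v) * ?v i"
  obtain \<delta> where \<delta>: "\<delta> > 0" "\<And>t. \<bar>t\<bar> < \<delta> \<Longrightarrow> x + t *\<^sub>R ?v \<in> cube n x e" using line_in_cube[OF v] by metis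
  have x0: "x + 0 *\<^sub>R ?v = x" by simp
  have D1: "((\<lambda>t. f (x + t *\<^sub>R ?v)) has_real_derivative ?D t) (at t)" if "\<bar>t\<bar> < \<delta>" for t
    by (rule line_DERIV[OF v \<delta>(2)[OF that] reg(2)[of "Suc 0"]])
  have D2: "(?D has_real_derivative (\<Sum>j<n. (\<Sum>i<n. partial_deriv i (partial_deriv j f) (x + 0 *\<^sub>R ?v) * ?v i) * ?v j)) (at 0)"
    by (intro DERIV_sum DERIV_cmult_right line_DERIV[OF v _ Ck_partial[OF reg(2)[of "Suc (Suc 0)"] _ cube_Rn]])
       (simp_all add: x_in_cube)
  have "(\<Sum>j<n. (\<Sum>i<n. partial_deriv i (partial_deriv j f) x * ?v i) * ?v j) = hess n f x ?v"
    unfolding hess_def by (subst sum.swap) (simp add: sum_distrib_right)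
  moreover have "hess n f x ?v > 0"
    by (rule reg(5)[OF v]) (use ne tan in auto)
  ultimately have pos: "(\<Sum>j<n. (\<Sum>i<n. partial_deriv i (partial_deriv j f) (x + 0 *\<^sub>R ?v) * ?v i) * ?v j) > 0"
    unfolding x0 by simp
  have D0: "?D 0 = 0" unfolding x0 using tan by simp
  obtain h where h: "h > 0" "\<And>t. t > 0 \<Longrightarrow> t < h \<Longrightarrow> ?D 0 < ?D (0 + t)"
    using DERIV_pos_inc_right[OF D2 pos] by blast
  define t where "t = min (min h \<delta>) 1 / 2"
  have t: "0 < t" "t < h" "\<bar>t\<bar> < \<delta>" "t \<le> 1" using h(1) \<delta>(1) by (auto simp: t_def)
  have "\<exists>s>0. s < t \<and> f (x + t *\<^sub>R ?v) - f (x + 0 *\<^sub>R ?v) = (t - 0) * ?D s"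
    by (rule MVT2[OF t(1)]) (rule D1, use t in simp)
  then obtain s where s: "0 < s" "s < t" "f (x + t *\<^sub>R ?v) - f (x + 0 *\<^sub>R ?v) = (t - 0) * ?D s"
    by blast
  have "?D s > 0" using h(2)[of s] s(1,2) t(2) D0 by simp
  then have "f (x + t *\<^sub>R ?v) > 0" using s(3) t(1) boundary_zero x0 by simp
  moreover have "x + t *\<^sub>R ?v = (1 - t) *\<^sub>R x + t *\<^sub>R y" by (simp add: algebra_simps)
  moreover have "(1 - t) *\<^sub>R x + t *\<^sub>R y \<in> K" by (rule convexD[OF body_convex[OF K] x y]) (use t in auto)
  ultimately show False using \<delta>(2)[OF t(3)] reg(3) by force
qed

lemma inward_points:
  assumes v: "v \<in> Rn n" and neg: "(\<Sum>i<n. partial_deriv i f x * v i) < 0"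
  obtains \<tau> where "\<tau> > 0" "\<And>t. 0 < t \<Longrightarrow> t < \<tau> \<Longrightarrow> \<exists>d>0. cube n (x + t *\<^sub>R v) d \<subseteq> K"
proof -
  obtain \<delta> where \<delta>: "\<delta> > 0" "\<And>t. \<bar>t\<bar> < \<delta> \<Longrightarrow> x + t *\<^sub>R v \<in> cube n x e" using line_in_cube[OF v] by metis
  have x0: "x + 0 *\<^sub>R v = x" by simp
  have "((\<lambda>t. f (x + t *\<^sub>R v)) has_real_derivative (\<Sum>i<n. partial_deriv i f (x + 0 *\<^sub>R v) * v i)) (at 0)"
    by (rule line_DERIV[OF v _ reg(2)[of "Suc 0"]]) (simp add: x_in_cube)
  moreover have "(\<Sum>i<n. partial_deriv i f (x + 0 *\<^sub>R v) * v i) < 0" using neg by simp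
  ultimately have "\<exists>h>0. \<forall>t>0. t < h \<longrightarrow> f (x + 0 *\<^sub>R v) > f (x + (0 + t) *\<^sub>R v)"
    by (rule DERIV_neg_dec_right)
  then obtain h where h: "h > 0" "\<And>t. t > 0 \<Longrightarrow> t < h \<Longrightarrow> f (x + 0 *\<^sub>R v) > f (x + (0 + t) *\<^sub>R v)"
    by blast
  show ?thesis
  proof (rule that[of "min h \<delta>"])
    show "0 < min h \<delta>" using h \<delta> by simp
    fix t assume t: "0 < t" "t < min h \<delta>"
    then have "f (x + t *\<^sub>R v) < 0" using h(2)[of t] boundary_zero x0 by simp
    then show "\<exists>d>0. cube n (x + t *\<^sub>R v) d \<subseteq> K"
      by (intro negative_interior \<delta>(2)) (use t in auto)
  qed
qed

end

text \<open>Let \<open>w\<close> be the part of \<open>b\<close> orthogonal to \<open>a\<close>. If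
  it is nonzero, tilting it slightly towards \<open>- a\<close> gives a direction negative for
  \<open>a\<close> and positive for \<open>b\<close>. So \<open>b\<close> is a multiple of
  \<open>a\<close>, and the direction \<open>- a\<close> decides the sign.\<close>

lemma parallel_of_no_separation:
  fixes a b :: "nat \<Rightarrow> real"
  assumes a: "\<exists>i<n. a i \<noteq> 0" and b: "\<exists>i<n. b i \<noteq> 0"
    and sep: "\<And>v. v \<in> Rn n \<Longrightarrow> (\<Sum>i<n. a i * v i) < 0 \<Longrightarrow> (\<Sum>i<n. b i * v i) \<le> 0"
  obtains c where "c > 0" "\<forall>i<n. b i = c * a i"
proof -
  let ?aa = "\<Sum>i<n. a i * a i" and ?ab = "\<Sum>i<n. a i * b i"
  have aa: "?aa > 0"
  proof -
    obtain i where "i < n" "a i \<noteq> 0" using a by blast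
    then show ?thesis by (intro sum_pos2[of _ i]) (auto simp: zero_less_mult_iff)
  qed
  define c where "c = ?ab / ?aa"
  define w where "w i = (if i < n then b i - c * a i else 0)" for i
  have aw: "(\<Sum>i<n. a i * w i) = 0"
  proof -
    have "(\<Sum>i<n. a i * w i) = ?ab - c * ?aa"
      by (simp add: w_def right_diff_distrib sum_subtractf sum_distrib_left mult_ac)
    then show ?thesis using aa by (simp add: c_def)
  qed
  have bw: "(\<Sum>i<n. b i * w i) = (\<Sum>i<n. w i * w i)"
  proof -
    have "(\<Sum>i<n. w i * w i) = (\<Sum>i<n. b i * w i) - c * (\<Sum>i<n. a i * w i)"
      unfolding sum_distrib_left sum_subtractf[symmetric] by (intro sum.cong) (auto simp: w_def algebra_simps)
    then show ?thesis using aw by simp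
  qed
  have "(\<Sum>i<n. w i * w i) \<le> 0"
  proof (rule ccontr)
    assume ww: "\<not> (\<Sum>i<n. w i * w i) \<le> 0"
    \<comment> \<open>The tilt is so small that it costs at most half of |w|^2 in the product with
      \<open>b\<close>; the 1 excludes division by zero.\<close>
    define s where "s = (\<Sum>i<n. w i * w i) / (2 * (\<bar>?ab\<bar> + 1))"
    have s: "s > 0" unfolding s_def using ww by (intro divide_pos_pos) auto
    define v where "v i = (if i < n then w i - s * a i else 0)" for i
    have "(\<Sum>i<n. a i * v i) = (\<Sum>i<n. a i * w i) - s * ?aa"
      by (simp add: v_def right_diff_distrib sum_subtractf sum_distrib_left mult_ac)
    then have "(\<Sum>i<n. a i * v i) < 0" using aw aa s by simp
    then have "(\<Sum>i<n. b i * v i) \<le> 0" by (intro sep) (auto simp: v_def Rn_def)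
    moreover have "(\<Sum>i<n. b i * v i) = (\<Sum>i<n. b i * w i) - s * ?ab"
      by (simp add: v_def right_diff_distrib sum_subtractf sum_distrib_left mult_ac)
    ultimately have 1: "(\<Sum>i<n. w i * w i) \<le> s * ?ab" using bw by simp
    have "s * ?ab \<le> s * (\<bar>?ab\<bar> + 1)" using s by (intro mult_left_mono) auto
    also have "\<dots> = (\<Sum>i<n. w i * w i) / 2"
    proof -
      have "\<bar>?ab\<bar> + 1 \<noteq> 0" by linarith
      then show ?thesis unfolding s_def by (simp add: field_simps)
    qed
    finally show False using 1 ww by linarith
  qed
  then have ww0: "(\<Sum>i<n. w i * w i) = 0" by (intro antisym sum_nonneg) auto
  have bi: "b i = c * a i" if "i < n" for i
  proof -
    have "\<forall>i\<in>{..<n}. w i * w i = 0" using ww0 by (subst (asm) sum_nonneg_eq_0_iff) auto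
    then show ?thesis using that by (simp add: w_def)
  qed
  define v where "v i = (if i < n then - a i else 0)" for i
  have "(\<Sum>i<n. a i * v i) = - ?aa" by (simp add: v_def sum_negf)
  then have "(\<Sum>i<n. b i * v i) \<le> 0" using aa by (intro sep) (auto simp: v_def Rn_def)
  then have "?ab \<ge> 0" by (simp add: v_def sum_negf mult.commute)
  then have "c \<ge> 0" using aa by (simp add: c_def)
  moreover have "c \<noteq> 0" using b bi by force
  ultimately show ?thesis using bi by (intro that[of c]) auto
qed

section \<open>Local equation of a Minkowski sum in the space of pairs (z, x)\<close>

definition first_block :: "nat \<Rightarrow> (nat \<Rightarrow> real) \<Rightarrow> nat \<Rightarrow> real"
  where "first_block n w = (\<lambda>l. if l < n then w l else 0)"

definition snd_block :: "nat \<Rightarrow> (nat \<Rightarrow> real) \<Rightarrow> nat \<Rightarrow> real"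
  where "snd_block n w = (\<lambda>l. if l < n then w (n + l) else 0)"

definition diff_block :: "nat \<Rightarrow> (nat \<Rightarrow> real) \<Rightarrow> nat \<Rightarrow> real"
  where "diff_block n w = (\<lambda>l. if l < n then w l - w (n + l) else 0)"

text \<open>A point of the doubled space is a pair (z, x), with \<open>z\<close> a point of the sum
  and \<open>x\<close> its first summand. \<open>Bx\<close> and \<open>By\<close> are the matrices
  of (z, x) \<mapsto> x and of (z, x) \<mapsto> z - x, the second summand.\<close>

abbreviation Bx :: "nat \<Rightarrow> nat \<Rightarrow> nat \<Rightarrow> real"
  where "Bx n \<equiv> \<lambda>l k. if l < n \<and> k = n + l then 1 else 0"

abbreviation By :: "nat \<Rightarrow> nat \<Rightarrow> nat \<Rightarrow> real"
  where "By n \<equiv> \<lambda>l k. if l < n then (if k = l then 1 else if k = n + l then -1 else 0) else 0"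

lemma Bx_sum: "(\<Sum>k<n + n. Bx n l k * v k) = snd_block n v l"
proof (cases "l < n")
  case True
  then have "(\<Sum>k<n + n. Bx n l k * v k) = (\<Sum>k<n + n. if k = n + l then v k else 0)"
    by (intro sum.cong) auto
  then show ?thesis using True by (simp add: snd_block_def)
qed (simp add: snd_block_def)

lemma By_sum: "(\<Sum>k<n + n. By n l k * v k) = diff_block n v l"
proof (cases "l < n")
  case True
  then have "(\<Sum>k<n + n. By n l k * v k) = (\<Sum>k<n + n. (if k = l then v k else 0) - (if k = n + l then v k else 0))"
    by (intro sum.cong) auto
  also have "\<dots> = (\<Sum>k<n + n. if k = l then v k else 0) - (\<Sum>k<n + n. if k = n + l then v k else 0)"
    by (rule sum_subtractf)
  finally show ?thesis using True by (simp add: diff_block_def)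
qed (simp add: diff_block_def)

lemma affine_Bx: "affine_map (n + n) n (\<lambda>_. 0) (Bx n) w = snd_block n w"
  unfolding affine_map_def Bx_sum by (auto simp: snd_block_def)

lemma affine_By: "affine_map (n + n) n (\<lambda>_. 0) (By n) w = diff_block n w"
  unfolding affine_map_def By_sum by (auto simp: diff_block_def)

lemma dot_Bx: "k < n + n \<Longrightarrow> (\<Sum>l<n. a l * Bx n l k) = (if n \<le> k then a (k - n) else 0)"
proof -
  assume "k < n + n"
  then have "(\<Sum>l<n. a l * Bx n l k) = (\<Sum>l<n. if l = k - n then (if n \<le> k then a l else 0) else 0)"
    by (intro sum.cong) auto
  also have "\<dots> = (if n \<le> k then a (k - n) else 0)" using \<open>k < n + n\<close> by auto
  finally show ?thesis .
qed

lemma dot_By: "k < n + n \<Longrightarrow> (\<Sum>l<n. a l * By n l k) = (if n \<le> k then - a (k - n) else a k)"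
proof -
  assume k: "k < n + n"
  show ?thesis
  proof (cases "n \<le> k")
    case True
    then have "(\<Sum>l<n. a l * By n l k) = (\<Sum>l<n. if l = k - n then - a l else 0)"
      by (intro sum.cong) auto
    then show ?thesis using True k by auto
  next
    case False
    then have "(\<Sum>l<n. a l * By n l k) = (\<Sum>l<n. if l = k then a l else 0)"
      by (intro sum.cong) auto
    then show ?thesis using False by auto
  qed
qed


lemma compact_minus_cube:
  assumes "compact K" "K \<subseteq> Rn n" shows "compact (K - cube n x e)"
proof -
  have "K - cube n x e = K \<inter> - {y. \<forall>i<n. \<bar>y i - x i\<bar> < e}" using assms(2) by (auto simp: cube_def)
  moreover have "closed (- {y. \<forall>i<n. \<bar>y i - x i\<bar> < e})" using open_cube by (simp add: closed_def)
  ultimately show ?thesis using compact_Int_closed[OF assms(1)] by simp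
qed

text \<open>A neighbourhood of \<open>x\<close> in \<open>K\<close>, translated by \<open>y\<close>,
  is a neighbourhood of \<open>x + y\<close> in the sum.\<close>

lemma smooth_boundary_summand:
  assumes K: "K \<in> smooth_convex_bodies n" and L: "convex_body n L" and x: "x \<in> K" and y: "y \<in> L"
    and bd: "\<not> (\<exists>e>0. cube n (x + y) e \<subseteq> K + L)"
  shows "\<not> (\<exists>e>0. cube n x e \<subseteq> K)"
proof
  assume "\<exists>e>0. cube n x e \<subseteq> K"
  then obtain e where e: "e > 0" "cube n x e \<subseteq> K" by (elim exE conjE)
  have "cube n (x + y) e \<subseteq> K + L"
  proof
    fix z assume z: "z \<in> cube n (x + y) e"
    have "z - y \<in> cube n x e"
      using z y body_Rn[OF L] Rn_diff[of z n y] by (auto simp: cube_def algebra_simps)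
    then have "z - y \<in> K" using e by blast
    then have "(z - y) + y \<in> K + L" using y by (rule set_plus_intro)
    then show "z \<in> K + L" by simp
  qed
  with e(1) bd show False by blast
qed

locale sum_at_boundary =
  fixes n :: nat and K L :: "(nat \<Rightarrow> real) set" and x0 y0 :: "nat \<Rightarrow> real"
    and e1 e2 :: real and f g :: "(nat \<Rightarrow> real) \<Rightarrow> real"
  assumes K: "convex_body n K" and L: "convex_body n L"
    and x0: "x0 \<in> K" "\<not> (\<exists>e>0. cube n x0 e \<subseteq> K)" "regular_at n K x0 e1 f"
    and y0: "y0 \<in> L" "\<not> (\<exists>e>0. cube n y0 e \<subseteq> L)" "regular_at n L y0 e2 g"
    and bd: "\<not> (\<exists>e>0. cube n (x0 + y0) e \<subseteq> K + L)"
begin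

abbreviation "z0 \<equiv> x0 + y0"
abbreviation "a i \<equiv> partial_deriv i f x0"
abbreviation "b i \<equiv> partial_deriv i g y0"

lemmas regf = reg[OF K x0(3,1,2)]
lemmas regg = reg[OF L y0(3,1,2)]

lemma x0R: "x0 \<in> Rn n" and y0R: "y0 \<in> Rn n"
  using x0 y0 body_Rn[OF K] body_Rn[OF L] by auto

text \<open>If a direction \<open>v\<close> entered \<open>K\<close> at \<open>x0\<close> while
  \<open>- v\<close> entered \<open>L\<close> at \<open>y0\<close>, then writing \<open>z0\<close>
  as the sum of x0 + t v and y0 - t v would make it an interior point of the sum.\<close>

lemma normals_parallel: obtains c where "c > 0" "\<forall>i<n. b i = c * a i"
proof (rule parallel_of_no_separation[of n a b])
  show "\<exists>i<n. a i \<noteq> 0" by (rule regf(4))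
  show "\<exists>i<n. b i \<noteq> 0" by (rule regg(4))
  fix v assume v: "v \<in> Rn n" "(\<Sum>i<n. a i * v i) < 0"
  show "(\<Sum>i<n. b i * v i) \<le> 0"
  proof (rule ccontr)
    assume pos: "\<not> (\<Sum>i<n. b i * v i) \<le> 0"
    have neg: "(\<Sum>i<n. b i * (- v) i) < 0" using pos by (simp add: sum_negf)
    obtain t1 where t1: "t1 > 0" "\<And>t. 0 < t \<Longrightarrow> t < t1 \<Longrightarrow> \<exists>d>0. cube n (x0 + t *\<^sub>R v) d \<subseteq> K"
      using inward_points[OF K x0(3,1,2) v] by metis
    obtain t2 where t2: "t2 > 0" "\<And>t. 0 < t \<Longrightarrow> t < t2 \<Longrightarrow> \<exists>d>0. cube n (y0 + t *\<^sub>R (- v)) d \<subseteq> L"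
      using inward_points[OF L y0(3,1,2) Rn_minus[OF v(1)] neg] by metis
    define t where "t = min t1 t2 / 2"
    have t: "0 < t" "t < t1" "t < t2" using t1(1) t2(1) by (auto simp: t_def)
    obtain d where d: "d > 0" "cube n (x0 + t *\<^sub>R v) d \<subseteq> K" using t1(2)[OF t(1,2)] by (elim exE conjE)
    obtain d' where d': "d' > 0" "cube n (y0 + t *\<^sub>R (- v)) d' \<subseteq> L" using t2(2)[OF t(1,3)] by (elim exE conjE)
    have y': "y0 + t *\<^sub>R (- v) \<in> L"
      using d'(2) centre_in_cube[OF Rn_add[OF y0R Rn_scale[OF Rn_minus[OF v(1)]]] d'(1)] by blast
    have "cube n z0 d \<subseteq> K + L"
    proof
      fix z assume z: "z \<in> cube n z0 d"
      have zR: "z - (y0 + t *\<^sub>R (- v)) \<in> Rn n"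
        using z cube_Rn by (intro Rn_diff Rn_add Rn_scale Rn_minus y0R v) auto
      have "z - (y0 + t *\<^sub>R (- v)) \<in> cube n (x0 + t *\<^sub>R v) d"
        using z zR by (auto simp: cube_def scaleR_fun_apply algebra_simps)
      then have "(z - (y0 + t *\<^sub>R (- v))) + (y0 + t *\<^sub>R (- v)) \<in> K + L"
        using d(2) y' by (intro set_plus_intro) auto
      then show "z \<in> K + L" by (simp only: diff_add_cancel)
    qed
    with d(1) bd show False by blast
  qed
qed

text \<open>If z0 = x + y, then x - x0 and y - y0 are opposite. With parallel normals the two
  support inequalities force x - x0 to be tangent, hence x = x0 by strict convexity. Compactness of
  \<open>?T\<close> extends this to points near \<open>z0\<close>.\<close>

lemma decomposition_close:
  assumes "\<epsilon> > 0"
  obtains r where "r > 0" "\<And>x y. x \<in> K \<Longrightarrow> y \<in> L \<Longrightarrow> x + y \<in> cube n z0 r \<Longrightarrow> x \<in> cube n x0 \<epsilon>"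
proof -
  let ?T = "(K - cube n x0 \<epsilon>) + L"
  obtain c where "c > 0" "\<forall>i<n. b i = c * a i" by (rule normals_parallel)
  then have c: "c > 0" "\<And>i. i < n \<Longrightarrow> b i = c * a i" by auto
  have T: "compact ?T"
    by (intro compact_fun_plus compact_minus_cube body_compact[OF K] body_Rn[OF K] body_compact[OF L])
  have "z0 \<notin> ?T"
  proof
    assume "z0 \<in> ?T"
    then obtain x y where xy: "x \<in> K" "x \<notin> cube n x0 \<epsilon>" "y \<in> L" "z0 = x + y" by (auto simp: set_plus_def)
    have yi: "y i - y0 i = - (x i - x0 i)" for i using fun_cong[OF xy(4), of i] by simp
    have "(\<Sum>i<n. b i * (y i - y0 i)) = - c * (\<Sum>i<n. a i * (x i - x0 i))"
      unfolding sum_distrib_left by (intro sum.cong refl)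
        (simp only: c(2) yi mult_minus_right mult_minus_left mult.assoc lessThan_iff)
    moreover have "(\<Sum>i<n. b i * (y i - y0 i)) \<le> 0" by (rule support_normal[OF L y0(3,1,2) xy(3)])
    ultimately have "(\<Sum>i<n. a i * (x i - x0 i)) \<ge> 0" using c(1) by (simp add: zero_le_mult_iff)
    moreover have "(\<Sum>i<n. a i * (x i - x0 i)) \<le> 0" by (rule support_normal[OF K x0(3,1,2) xy(1)])
    ultimately have "(\<Sum>i<n. a i * (x i - x0 i)) = 0" by simp
    then have "x = x0" by (rule support_strict[OF K x0(3,1,2) xy(1)])
    then show False using xy(2) centre_in_cube[OF x0R assms] by simp
  qed
  moreover have "opn n (Rn n - ?T)"
    unfolding Euclidean_space_Rn using compact_imp_closed[OF T]
    by (simp add: Diff_eq openin_open_Int open_Compl)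
  moreover have "z0 \<in> Rn n" by (intro Rn_add x0R y0R)
  ultimately obtain r where r: "r > 0" "cube n z0 r \<subseteq> Rn n - ?T"
    using opn_contains_cube[of n "Rn n - ?T" z0] by blast
  show ?thesis
  proof (rule that[OF r(1)], rule ccontr)
    fix x y assume "x \<in> K" "y \<in> L" and xy: "x + y \<in> cube n z0 r" "x \<notin> cube n x0 \<epsilon>"
    then have "x + y \<in> ?T" by (intro set_plus_intro) auto
    with xy(1) r(2) show False by blast
  qed
qed

text \<open>
  Near the boundary point \<open>z0 = x0 + y0\<close> the sum is the set \<open>h z \<le> 0\<close>, where \<open>h z\<close> is the minimum of
  \<open>g (z - x)\<close> over the boundary points \<open>x\<close> of \<open>K\<close> near \<open>x0\<close>. One coordinate of \<open>x\<close> is eliminated by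
  solving \<open>f x = 0\<close>, and the others by partial minimization. The Hessian of the function to be minimized
  involves a Lagrange multiplier, which is positive because \<open>f\<close> and \<open>g\<close> have parallel gradients.
\<close>

lemma regular_at_sum: "\<exists>r h. regular_at n (K + L) z0 r h"
proof -
  let ?N = "n + n"
  obtain c where "c > 0" "\<forall>i<n. b i = c * a i" by (rule normals_parallel)
  then have c: "c > 0" "\<And>i. i < n \<Longrightarrow> b i = c * a i" by auto
  obtain i0 where i0: "i0 < n" "a i0 \<noteq> 0" using regf(4) by (elim exE conjE)
  have ab: "a i0 * b i0 > 0"
  proof -
    have "a i0 * b i0 = c * (a i0)\<^sup>2" by (simp add: c(2)[OF i0(1)] power2_eq_square)
    then show ?thesis using c(1) i0(2) by simp
  qed
  \<comment> \<open>The first \<open>n\<close> coordinates of the doubled space belong to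
    \<open>z\<close>, the others to \<open>x\<close>. So \<open>j0\<close> is a coordinate of
    \<open>x\<close> in which the gradient of \<open>f\<close> does not vanish.\<close>
  define j0 where "j0 = n + i0"
  have j0: "j0 < ?N" "n \<le> j0" "j0 - n = i0" using i0 by (auto simp: j0_def)
  have x0c: "x0 \<in> cube n x0 e1" by (rule centre_in_cube[OF x0R regf(1)])
  have y0c: "y0 \<in> cube n y0 e2" by (rule centre_in_cube[OF y0R regg(1)])
  have pc: "continuous_on (cube n x0 e1) (partial_deriv i0 f)" "continuous_on (cube n y0 e2) (partial_deriv i0 g)"
    by (rule Ck_continuous[OF Ck_partial[OF regf(2)[of "Suc 0"] i0(1) cube_Rn] cube_Rn])
       (rule Ck_continuous[OF Ck_partial[OF regg(2)[of "Suc 0"] i0(1) cube_Rn] cube_Rn])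
  \<comment> \<open>On the cubes of radius \<open>s1\<close> and \<open>s2\<close> the derivatives
    of \<open>f\<close> and \<open>g\<close> in coordinate \<open>i0\<close> keep the signs of
    \<open>a i0\<close> and \<open>b i0\<close>, which agree by \<open>ab\<close>.\<close>
  obtain s1 where s1: "s1 > 0" "cube n x0 s1 \<subseteq> cube n x0 e1"
    "\<And>y. y \<in> cube n x0 s1 \<Longrightarrow> \<bar>partial_deriv i0 f y - a i0\<bar> < \<bar>a i0\<bar>"
    using continuous_on_cubeD[OF pc(1) opn_cube x0c, of "\<bar>a i0\<bar>"] i0(2) by (metis zero_less_abs_iff)
  have "b i0 \<noteq> 0" using ab by auto
  then obtain s2 where s2: "s2 > 0" "cube n y0 s2 \<subseteq> cube n y0 e2"
    "\<And>y. y \<in> cube n y0 s2 \<Longrightarrow> \<bar>partial_deriv i0 g y - b i0\<bar> < \<bar>b i0\<bar>"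
    using continuous_on_cubeD[OF pc(2) opn_cube y0c, of "\<bar>b i0\<bar>"] by (metis zero_less_abs_iff)
  \<comment> \<open>The half is due to y = z - x, which may vary by twice the radius of the
    cube.\<close>
  define e where "e = min s1 (s2 / 2)"
  have e: "e > 0" using s1 s2 by (simp add: e_def)
  let ?w0 = "app n z0 x0"
  have w0R: "?w0 \<in> Rn ?N" by (intro app_Rn Rn_add x0R y0R)
  have sb: "snd_block n w \<in> cube n x0 s1" and db: "diff_block n w \<in> cube n y0 s2" if w: "w \<in> cube ?N ?w0 e" for w
  proof -
    have 1: "\<bar>w (n + i) - x0 i\<bar> < e" if "i < n" for i
      using cubeD[OF w, of "n + i"] that by (simp add: app_def)
    have 2: "\<bar>w i - (x0 i + y0 i)\<bar> < e" if "i < n" for i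
      using cubeD[OF w, of i] that by (simp add: app_def)
    have ee: "e \<le> s1" "2 * e \<le> s2" by (auto simp: e_def)
    show "snd_block n w \<in> cube n x0 s1"
      using 1 ee(1) by (fastforce simp: cube_def snd_block_def Rn_def)
    have "\<bar>w i - w (n + i) - y0 i\<bar> < s2" if "i < n" for i
      using 1[OF that] 2[OF that] ee(2) by (simp add: abs_less_iff)
    then show "diff_block n w \<in> cube n y0 s2" by (simp add: cube_def diff_block_def Rn_def)
  qed
  have sb': "snd_block n w \<in> cube n x0 e1" and db': "diff_block n w \<in> cube n y0 e2"
    if "w \<in> cube ?N ?w0 e" for w
    using sb[OF that] db[OF that] s1(2) s2(2) by auto
  have sb0: "snd_block n ?w0 = x0" using x0R by (auto simp: snd_block_def app_def Rn_def)
  have db0: "diff_block n ?w0 = y0" using y0R by (auto simp: diff_block_def app_def Rn_def)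
  define F where "F = (\<lambda>w. f (snd_block n w))"
  define G where "G = (\<lambda>w. g (diff_block n w))"
  note affF = opn_cube[of n x0 e1] opn_cube[of ?N ?w0 e] sb'[folded affine_Bx]
  note affG = opn_cube[of n y0 e2] opn_cube[of ?N ?w0 e] db'[folded affine_By]
  have smF: "Ck_on ?N k (cube ?N ?w0 e) F" for k
    using Ck_affine[OF affF regf(2)[of k]] unfolding affine_Bx F_def .
  have smG: "Ck_on ?N k (cube ?N ?w0 e) G" for k
    using Ck_affine[OF affG regg(2)[of k]] unfolding affine_By G_def .
  have pF: "partial_deriv k F w = (if n \<le> k then partial_deriv (k - n) f (snd_block n w) else 0)"
    if "w \<in> cube ?N ?w0 e" "k < ?N" for w k
    using partial_deriv_affine[OF affF regf(2)[of "Suc 0"] that] unfolding affine_Bx F_def dot_Bx[OF that(2)] .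
  have pG: "partial_deriv k G w = (if n \<le> k then - partial_deriv (k - n) g (diff_block n w) else partial_deriv k g (diff_block n w))"
    if "w \<in> cube ?N ?w0 e" "k < ?N" for w k
    using partial_deriv_affine[OF affG regg(2)[of "Suc 0"] that] unfolding affine_By G_def dot_By[OF that(2)] .
  have w0e: "?w0 \<in> cube ?N ?w0 e" by (rule centre_in_cube[OF w0R e])
  have hF: "hess ?N F ?w0 v = hess n f x0 (snd_block n v)" for v
    using hess_affine[OF affF regf(2)[of "Suc (Suc 0)"] w0e, of v] unfolding affine_Bx F_def Bx_sum sb0 .
  have hG: "hess ?N G ?w0 v = hess n g y0 (diff_block n v)" for v
    using hess_affine[OF affG regg(2)[of "Suc (Suc 0)"] w0e, of v] unfolding affine_By G_def By_sum db0 .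
  have F0: "F ?w0 = 0" unfolding F_def sb0 by (rule boundary_zero[OF K x0(3,1,2)])
  have pF0: "partial_deriv k F ?w0 = (if n \<le> k then a (k - n) else 0)" if "k < ?N" for k
    unfolding pF[OF w0e that] sb0 ..
  have pG0: "partial_deriv k G ?w0 = (if n \<le> k then - b (k - n) else b k)" if "k < ?N" for k
    unfolding pG[OF w0e that] db0 ..
  have nz: "partial_deriv j0 F ?w0 \<noteq> 0" using pF0[OF j0(1)] j0 i0(2) by simp
  obtain xi d where xi: "0 < d" "d \<le> e" "\<And>w t. xi (w(j0 := t)) = xi w"
    "\<And>w. w \<in> cube ?N ?w0 d \<Longrightarrow> w(j0 := xi w) \<in> cube ?N ?w0 e \<and> F (w(j0 := xi w)) = 0"
    "\<And>k. Ck_on ?N k (cube ?N ?w0 d) xi" "xi ?w0 = ?w0 j0"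
    using implicit_function[OF e w0R j0(1) smF F0 nz] by metis
  have hat: "w(j0 := xi w) \<in> cube ?N ?w0 e" and Fhat: "F (w(j0 := xi w)) = 0" if "w \<in> cube ?N ?w0 d" for w
    using xi(4)[OF that] by auto
  have w0d: "?w0 \<in> cube ?N ?w0 d" by (rule centre_in_cube[OF w0R xi(1)])
  have hat0: "?w0(j0 := xi ?w0) = ?w0" by (simp only: xi(6) fun_upd_triv)
  \<comment> \<open>The value of \<open>g\<close> at z - x, with \<open>x\<close> restricted to the
    boundary f x = 0 and parametrized by its other coordinates.\<close>
  let ?P = "\<lambda>w. G (w(j0 := xi w))"
  note subst = opn_cube[of ?N ?w0 e] opn_cube[of ?N ?w0 d] j0(1) hat xi(3)
  have smP: "Ck_on ?N k (cube ?N ?w0 d) ?P" for k by (rule Ck_subst[OF subst smG xi(5)])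
  have zero: "partial_deriv i (\<lambda>w. F (w(j0 := xi w))) w = 0" if "w \<in> cube ?N ?w0 d" "i < ?N" for i w
  proof -
    have "partial_deriv i (\<lambda>w. F (w(j0 := xi w))) w = partial_deriv i (\<lambda>_. 0) w"
      by (rule partial_deriv_cong_opn[OF opn_cube _ that]) (rule Fhat)
    also have "\<dots> = 0" by (rule partial_deriv_eqI) simp
    finally show ?thesis .
  qed
  \<comment> \<open>The identity F = 0 along the parametrized hypersurface, differentiated at
    \<open>?w0\<close>.\<close>
  have tangent: "(if k = j0 then 0 else partial_deriv k F ?w0) + a i0 * partial_deriv k xi ?w0 = 0" if k: "k < ?N" for k
    using partial_deriv_subst[OF subst smF[of "Suc 0"] xi(5)[of "Suc 0"] w0d k]
    unfolding zero[OF w0d k] hat0 using pF0[OF j0(1)] j0 by simp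
  have pP: "partial_deriv k ?P ?w0 = (if k = j0 then 0 else partial_deriv k G ?w0) - b i0 * partial_deriv k xi ?w0"
    if k: "k < ?N" for k
    using partial_deriv_subst[OF subst smG[of "Suc 0"] xi(5)[of "Suc 0"] w0d k]
    unfolding hat0 using pG0[OF j0(1)] j0 by simp
  \<comment> \<open>The constraint has vanishing Hessian along its own zero set. Adding
    \<open>c\<close> times it cancels the Hessian of \<open>xi\<close>, because
    \<open>b i0 = c * a i0\<close>; thus \<open>c\<close> is the Lagrange multiplier.\<close>
  have hessP: "hess ?N ?P ?w0 v = hess n g y0 (diff_block n u) + c * hess n f x0 (snd_block n u)"
    if u: "u = v(j0 := \<Sum>i<?N. partial_deriv i xi ?w0 * v i)" for u v
  proof -
    have "hess ?N (\<lambda>w. F (w(j0 := xi w))) ?w0 v = 0"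
    proof -
      have "partial_deriv i (partial_deriv j (\<lambda>w. F (w(j0 := xi w)))) ?w0 = 0" if "i < ?N" "j < ?N" for i j
      proof -
        have "partial_deriv i (partial_deriv j (\<lambda>w. F (w(j0 := xi w)))) ?w0 = partial_deriv i (\<lambda>_. 0) ?w0"
          by (rule partial_deriv_cong_opn[OF opn_cube _ w0d that(1)]) (rule zero[OF _ that(2)])
        also have "\<dots> = 0" by (rule partial_deriv_eqI) simp
        finally show ?thesis .
      qed
      then show ?thesis by (simp add: hess_def)
    qed
    then have 0: "hess n f x0 (snd_block n u) + a i0 * hess ?N xi ?w0 v = 0"
      using hess_subst[OF subst smF[of "Suc (Suc 0)"] xi(5)[of "Suc (Suc 0)"] w0d, of v]
      unfolding hat0 u[symmetric] hF using pF0[OF j0(1)] j0 by simp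
    have "hess ?N ?P ?w0 v = hess n g y0 (diff_block n u) - b i0 * hess ?N xi ?w0 v"
      using hess_subst[OF subst smG[of "Suc (Suc 0)"] xi(5)[of "Suc (Suc 0)"] w0d, of v]
      unfolding hat0 u[symmetric] hG using pG0[OF j0(1)] j0 by simp
    moreover have "b i0 * hess ?N xi ?w0 v = - c * hess n f x0 (snd_block n u)"
      using 0 unfolding c(2)[OF i0(1)] mult.assoc by (simp add: add_eq_0_iff2)
    ultimately show ?thesis by simp
  qed
  \<comment> \<open>\<open>?J\<close> consists of the remaining coordinates of \<open>x\<close>.
    \<open>?V\<close> fixes the coordinate \<open>j0\<close>, which \<open>?P\<close> ignores, and
    requires the \<open>z\<close>-part to be tangent to the sum. The Hessian can be positive only on
    such directions.\<close>
  let ?J = "{n..<?N} - {j0}"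
  let ?V = "\<lambda>v. v j0 = 0 \<and> (\<Sum>i<n. b i * v i) = 0"
  have "\<exists>d' m z. 0 < d' \<and> d' \<le> d \<and> (\<forall>k. Ck_on ?N k (cube ?N ?w0 d') m) \<and>
    (\<forall>w\<in>cube ?N ?w0 d'. z w \<in> cube ?N ?w0 d \<and> (\<forall>i. i \<notin> ?J \<longrightarrow> z w i = w i) \<and> m w = ?P (z w)) \<and>
    (\<forall>w\<in>cube ?N ?w0 d'. \<forall>w'\<in>cube ?N ?w0 d'. (\<forall>i. i \<notin> ?J \<longrightarrow> w i = w' i) \<longrightarrow> m w \<le> ?P w') \<and>
    m ?w0 = ?P ?w0 \<and> (\<forall>i<?N. i \<notin> ?J \<longrightarrow> partial_deriv i m ?w0 = partial_deriv i ?P ?w0) \<and>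
    (\<forall>v. ?V v \<longrightarrow> v \<in> Rn ?N \<longrightarrow> v \<noteq> 0 \<longrightarrow> (\<forall>j\<in>?J. v j = 0) \<longrightarrow> hess ?N m ?w0 v > 0)"
  proof (rule partial_minimization[OF _ xi(1) w0R _ smP])
    fix j assume j: "j \<in> ?J"
    then have jN: "j < ?N" "n \<le> j" "j \<noteq> j0" "j - n < n" by auto
    \<comment> \<open>By parallelism of the gradients this is \<open>- c\<close> times the relation
      \<open>tangent\<close>, so \<open>?w0\<close> is critical in all coordinates to be
      eliminated.\<close>
    have "partial_deriv j ?P ?w0 = - c * (a (j - n) + a i0 * partial_deriv j xi ?w0)"
      unfolding pP[OF jN(1)] pG0[OF jN(1)] c(2)[OF i0(1)] using jN c(2)[OF jN(4)] by (simp add: algebra_simps)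
    also have "a (j - n) + a i0 * partial_deriv j xi ?w0 = 0"
      using tangent[OF jN(1)] pF0[OF jN(1)] jN by simp
    finally show "partial_deriv j ?P ?w0 = 0" by (simp only: mult_zero_right)
  next
    fix v j t assume v: "?V v" and j: "j \<in> ?J"
    have "(\<Sum>i<n. b i * (v(j := t)) i) = (\<Sum>i<n. b i * v i)"
      using j by (intro sum.cong) auto
    then show "?V (v(j := t))" using v j by auto
  next
    fix v assume v: "?V v" "v \<in> Rn ?N" "v \<noteq> 0"
    \<comment> \<open>The lift of \<open>v\<close> to a tangent vector of the hypersurface F = 0.
      Hence its \<open>x\<close>-part is tangent to \<open>K\<close>, and its part in z - x will be
      tangent to \<open>L\<close>.\<close>
    define u where "u = v(j0 := \<Sum>i<?N. partial_deriv i xi ?w0 * v i)"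
    have uv: "u i = v i" if "i \<noteq> j0" for i using that by (simp add: u_def)
    have au: "(\<Sum>i<n. a i * snd_block n u i) = 0"
    proof -
      let ?D = "\<Sum>k<?N. partial_deriv k xi ?w0 * v k"
      have "0 = (\<Sum>k<?N. ((if k = j0 then 0 else partial_deriv k F ?w0) + a i0 * partial_deriv k xi ?w0) * v k)"
        using tangent by simp
      also have "\<dots> = (\<Sum>k<?N. (if k = j0 then 0 else partial_deriv k F ?w0) * v k) + a i0 * ?D"
        by (simp add: distrib_right sum.distrib sum_distrib_left mult.assoc)
      also have "(\<Sum>k<?N. (if k = j0 then 0 else partial_deriv k F ?w0) * v k) =
          (\<Sum>k\<in>{..<?N} - {j0}. partial_deriv k F ?w0 * u k)"
        by (subst sum.remove[of _ j0]) (use j0 uv in \<open>auto intro!: sum.cong\<close>)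
      also have "(\<Sum>k\<in>{..<?N} - {j0}. partial_deriv k F ?w0 * u k) + a i0 * ?D = (\<Sum>k<?N. partial_deriv k F ?w0 * u k)"
        by (subst sum.remove[of "{..<?N}" j0]) (use j0 pF0[OF j0(1)] in \<open>auto simp: u_def\<close>)
      also have "\<dots> = (\<Sum>k\<in>{n..<?N}. a (k - n) * u k)"
        using pF0 by (intro sum.mono_neutral_cong_right) auto
      also have "\<dots> = (\<Sum>i<n. a i * u (n + i))"
        by (rule sum.reindex_bij_witness[of _ "\<lambda>i. n + i" "\<lambda>k. k - n"]) auto
      also have "\<dots> = (\<Sum>i<n. a i * snd_block n u i)" by (intro sum.cong) (auto simp: snd_block_def)
      finally show ?thesis by simp
    qed
    \<comment> \<open>The \<open>z\<close>-part of \<open>u\<close> is orthogonal to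
      \<open>b\<close> by \<open>?V\<close>, and its \<open>x\<close>-part by \<open>au\<close>,
      since \<open>b\<close> is a multiple of \<open>a\<close>.\<close>
    have bu: "(\<Sum>i<n. b i * diff_block n u i) = 0"
    proof -
      have "(\<Sum>i<n. b i * diff_block n u i) = (\<Sum>i<n. b i * v i) - c * (\<Sum>i<n. a i * snd_block n u i)"
        unfolding sum_distrib_left sum_subtractf[symmetric]
        using c(2) uv j0 by (intro sum.cong) (auto simp: diff_block_def snd_block_def algebra_simps)
      then show ?thesis using v au by simp
    qed
    have R: "snd_block n u \<in> Rn n" "diff_block n u \<in> Rn n" by (auto simp: snd_block_def diff_block_def Rn_def)
    have H1: "snd_block n u \<noteq> 0 \<Longrightarrow> hess n f x0 (snd_block n u) > 0" by (rule regf(5)[OF R(1) _ au])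
    have H2: "diff_block n u \<noteq> 0 \<Longrightarrow> hess n g y0 (diff_block n u) > 0" by (rule regg(5)[OF R(2) _ bu])
    have z: "hess n h y 0 = 0" for h y by (simp add: hess_def)
    have "snd_block n u \<noteq> 0 \<or> diff_block n u \<noteq> 0"
    proof (rule ccontr)
      assume "\<not> ?thesis"
      then have s: "snd_block n u i = 0" and dd: "diff_block n u i = 0" for i by auto
      have x: "u (n + i) = 0" if "i < n" for i using s[of i] that by (simp add: snd_block_def)
      have y: "u i = 0" if "i < n" for i using dd[of i] x[OF that] that by (simp add: diff_block_def)
      have "v i = 0" for i
      proof -
        consider "i = j0" | "i \<noteq> j0" "i < n" | "i \<noteq> j0" "n \<le> i" "i < ?N" | "?N \<le> i" by linarith
        then show ?thesis
        proof cases
          case 3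
          then show ?thesis using x[of "i - n"] uv[of i] by simp
        qed (use v y[of i] uv[of i] in \<open>auto simp: Rn_def\<close>)
      qed
      then show False using v(3) by (auto simp: fun_eq_iff)
    qed
    then have "hess n g y0 (diff_block n u) + c * hess n f x0 (snd_block n u) > 0"
      using H1 H2 c(1) z by (cases "snd_block n u = 0"; cases "diff_block n u = 0") (auto simp: add_pos_pos)
    then show "hess ?N ?P ?w0 v > 0" using hessP[OF u_def] by simp
  qed (use w0R in auto)
  then obtain d' m zz where o: "0 < d'" "d' \<le> d" "\<forall>k. Ck_on ?N k (cube ?N ?w0 d') m"
    "\<forall>w\<in>cube ?N ?w0 d'. zz w \<in> cube ?N ?w0 d \<and> (\<forall>i. i \<notin> ?J \<longrightarrow> zz w i = w i) \<and> m w = ?P (zz w)"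
    "\<forall>w\<in>cube ?N ?w0 d'. \<forall>w'\<in>cube ?N ?w0 d'. (\<forall>i. i \<notin> ?J \<longrightarrow> w i = w' i) \<longrightarrow> m w \<le> ?P w'"
    "m ?w0 = ?P ?w0" "\<forall>i<?N. i \<notin> ?J \<longrightarrow> partial_deriv i m ?w0 = partial_deriv i ?P ?w0"
    "\<forall>v. ?V v \<longrightarrow> v \<in> Rn ?N \<longrightarrow> v \<noteq> 0 \<longrightarrow> (\<forall>j\<in>?J. v j = 0) \<longrightarrow> hess ?N m ?w0 v > 0"
    by (elim exE conjE)
  note m = o(1,2) spec[OF o(3)] bspec[OF o(4)] bspec[OF bspec[OF o(5)], THEN mp] o(6)
    spec[OF o(7), THEN mp, THEN mp] spec[OF o(8), THEN mp, THEN mp, THEN mp, THEN mp]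
  \<comment> \<open>The affine embedding of the \<open>z\<close>-space with \<open>x\<close> frozen
    at \<open>x0\<close>, along which \<open>m\<close> becomes a function of \<open>z\<close>
    alone.\<close>
  define E where "E = (\<lambda>l k. if l < n \<and> k = l then 1 else 0 :: real)"
  define A where "A = app n (0 :: nat \<Rightarrow> real) x0"
  have embs: "(\<Sum>k<n. E l k * z k) = (if l < n then z l else 0)" for l z
  proof (cases "l < n")
    case True
    then have "(\<Sum>k<n. E l k * z k) = (\<Sum>k<n. if k = l then z k else 0)" by (intro sum.cong) (auto simp: E_def)
    then show ?thesis using True by simp
  qed (simp add: E_def)
  have emb: "affine_map n ?N A E z = app n z x0" for z
  proof
    fix l
    show "affine_map n ?N A E z l = app n z x0 l"
      unfolding affine_map_def embs using x0R by (auto simp: A_def app_def Rn_def)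
  qed
  have emb_cube: "app n z x \<in> cube ?N ?w0 q" if "z \<in> cube n z0 q" "x \<in> cube n x0 q" for z x q
    using that by (auto simp: cube_def Rn_def app_def)
  obtain r where r: "r > 0" "\<And>x y. x \<in> K \<Longrightarrow> y \<in> L \<Longrightarrow> x + y \<in> cube n z0 r \<Longrightarrow> x \<in> cube n x0 d'"
    using decomposition_close[OF m(1)] by metis
  define \<rho> where "\<rho> = min r d'"
  have \<rho>: "\<rho> > 0" "\<rho> \<le> r" "\<rho> \<le> d'" using r m(1) by (auto simp: \<rho>_def)
  define h where "h = (\<lambda>z. m (app n z x0))"
  have x0d: "x0 \<in> cube n x0 d'" by (rule centre_in_cube[OF x0R m(1)])
  have z0R: "z0 \<in> Rn n" by (intro Rn_add x0R y0R)
  have z0\<rho>: "z0 \<in> cube n z0 \<rho>" by (rule centre_in_cube[OF z0R \<rho>(1)])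
  have ec: "affine_map n ?N A E z \<in> cube ?N ?w0 d'" if "z \<in> cube n z0 \<rho>" for z
    unfolding emb using that cube_mono[OF \<rho>(3), of n z0] x0d by (intro emb_cube) auto
  note affh = opn_cube[of ?N ?w0 d'] opn_cube[of n z0 \<rho>] ec
  have smh: "Ck_on n k (cube n z0 \<rho>) h" for k
    using Ck_affine[OF affh m(3)[of k]] unfolding emb h_def .
  \<comment> \<open>In the directions of \<open>z\<close> only \<open>G\<close> contributes:
    \<open>F\<close> does not involve \<open>z\<close>, so the derivatives of \<open>xi\<close>
    vanish there. The sum thus has the same normal at \<open>z0\<close> as the summands.\<close>
  have ph: "partial_deriv i h z0 = b i" if i: "i < n" for i
  proof -
    have iN: "i < ?N" "i \<notin> ?J" "\<not> n \<le> i" "i \<noteq> j0" using i j0 by auto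
    have "partial_deriv i h z0 = (\<Sum>l<?N. partial_deriv l m ?w0 * E l i)"
      using partial_deriv_affine[OF affh m(3)[of "Suc 0"] z0\<rho> i] unfolding emb h_def .
    also have "\<dots> = (\<Sum>l<?N. if l = i then partial_deriv i m ?w0 else 0)"
      by (intro sum.cong) (use i in \<open>auto simp: E_def\<close>)
    also have "\<dots> = partial_deriv i m ?w0" using i by simp
    also have "\<dots> = partial_deriv i ?P ?w0" by (rule m(7)[OF iN(1,2)])
    also have "\<dots> = b i - b i0 * partial_deriv i xi ?w0" unfolding pP[OF iN(1)] pG0[OF iN(1)] using iN by simp
    also have "partial_deriv i xi ?w0 = 0" using tangent[OF iN(1)] pF0[OF iN(1)] iN i0(2) by simp
    finally show ?thesis by (simp only: mult_zero_right diff_zero)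
  qed
  have "regular_at n (K + L) z0 \<rho> h" unfolding regular_at_def
  proof (intro conjI allI ballI impI)
    show "0 < \<rho>" by fact
    show "Ck_on n k (cube n z0 \<rho>) h" for k by (rule smh)
    show "\<exists>i<n. partial_deriv i h z0 \<noteq> 0" using regg(4) ph by auto
    fix v assume v: "v \<in> Rn n" "v \<noteq> 0" "(\<Sum>i<n. partial_deriv i h z0 * v i) = 0"
    have "hess n h z0 v = hess ?N m ?w0 (\<lambda>l. \<Sum>k<n. E l k * v k)"
      using hess_affine[OF affh m(3)[of "Suc (Suc 0)"] z0\<rho>, of v] unfolding emb h_def .
    also have "(\<lambda>l. \<Sum>k<n. E l k * v k) = v" unfolding embs using v(1) by (auto simp: Rn_def)
    finally have "hess n h z0 v = hess ?N m ?w0 v" .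
    moreover have "hess ?N m ?w0 v > 0"
    proof (rule m(8))
      have "(\<Sum>i<n. b i * v i) = (\<Sum>i<n. partial_deriv i h z0 * v i)" using ph by (intro sum.cong) auto
      then show "?V v" using v j0 by (auto simp: Rn_def)
    qed (use v in \<open>auto simp: Rn_def\<close>)
    ultimately show "0 < hess n h z0 v" by simp
  next
    have inF: "x \<in> K \<longleftrightarrow> f x \<le> 0" if "x \<in> cube n x0 e1" for x using regf(3) that by blast
    have inG: "y \<in> L \<longleftrightarrow> g y \<le> 0" if "y \<in> cube n y0 e2" for y using regg(3) that by blast
    have "z \<in> K + L \<longleftrightarrow> h z \<le> 0" if z: "z \<in> cube n z0 \<rho>" for z
    proof
      assume "z \<in> K + L"
      then obtain x y where xy: "x \<in> K" "y \<in> L" "z = x + y" by (auto simp: set_plus_def)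
      have xc: "x \<in> cube n x0 d'" using r(2)[OF xy(1,2)] z cube_mono[OF \<rho>(2), of n z0] xy(3) by blast
      have zc: "z \<in> cube n z0 d'" using z cube_mono[OF \<rho>(3), of n z0] by blast
      let ?om = "app n z x"
      have w': "?om \<in> cube ?N ?w0 d'" by (rule emb_cube[OF zc xc])
      then have wd: "?om \<in> cube ?N ?w0 d" using cube_mono[OF m(2)] by blast
      then have we: "?om \<in> cube ?N ?w0 e" using cube_mono[OF xi(2)] by blast
      have xR: "x \<in> Rn n" and yR: "y \<in> Rn n" using xy body_Rn[OF K] body_Rn[OF L] by auto
      have sbw: "snd_block n ?om = x"
        by (rule ext) (use xR in \<open>auto simp: snd_block_def app_def Rn_def\<close>)
      have dbw: "diff_block n ?om = y"
        by (rule ext) (use yR xy(3) in \<open>auto simp: diff_block_def app_def Rn_def\<close>)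
      have fx: "f x \<le> 0" using xy(1) inF sb'[OF we] sbw by simp
      have gy: "g y \<le> 0" using xy(2) inG db'[OF we] dbw by simp
      \<comment> \<open>The minimality of \<open>m\<close> compares points that agree off
        \<open>?J\<close>, and \<open>j0\<close> is not in \<open>?J\<close>. Resetting this
        coordinate is harmless because \<open>?P\<close> ignores it.\<close>
      let ?W = "?om(j0 := ?w0 j0)"
      have W': "?W \<in> cube ?N ?w0 d'" by (rule upd_in_cube[OF w' j0(1)]) (use m(1) in simp)
      have "h z \<le> ?P ?W" unfolding h_def
      proof (rule m(5))
        show "app n z x0 \<in> cube ?N ?w0 d'" by (rule emb_cube[OF zc x0d])
        show "\<forall>i. i \<notin> ?J \<longrightarrow> app n z x0 i = ?W i"
          using j0 x0R xR by (auto simp: app_def Rn_def)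
      qed (rule W')
      also have "?P ?W = ?P ?om" by (simp only: xi(3) fun_upd_upd)
      \<comment> \<open>The point \<open>x\<close> may be interior to \<open>K\<close>. Sliding its
        coordinate \<open>i0\<close> until f = 0 raises \<open>f\<close>. As the derivatives of
        \<open>f\<close> and \<open>g\<close> in this coordinate have the same sign and z - x moves
        the opposite way, \<open>g\<close> does not increase.\<close>
      also have "\<dots> \<le> G ?om"
      proof -
        define t where "t = xi ?om"
        have seg: "?om(j0 := s) \<in> cube ?N ?w0 e" if "s \<in> closed_segment (?om j0) t" for s
        proof (rule upd_in_cube[OF we j0(1)])
          have "\<bar>t - ?w0 j0\<bar> < e" using cubeD[OF hat[OF wd] j0(1)] by (simp add: t_def)
          then show "\<bar>s - ?w0 j0\<bar> < e" using cubeD[OF we j0(1)] that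
            by (auto simp: closed_segment_eq_real_ivl split: if_splits)
        qed
        obtain s where s: "s \<in> closed_segment (?om j0) t"
          "F (?om(j0 := t)) - F (?om(j0 := ?om j0)) = (t - ?om j0) * partial_deriv j0 F (?om(j0 := s))"
          by (rule MVT_segment[of "?om j0" t "\<lambda>s. F (?om(j0 := s))" "\<lambda>s. partial_deriv j0 F (?om(j0 := s))"])
             (use Ck_DERIV[OF smF[of "Suc 0"] j0(1) cube_Rn] seg in blast)+
        obtain s' where s': "s' \<in> closed_segment (?om j0) t"
          "G (?om(j0 := t)) - G (?om(j0 := ?om j0)) = (t - ?om j0) * partial_deriv j0 G (?om(j0 := s'))"
          by (rule MVT_segment[of "?om j0" t "\<lambda>s. G (?om(j0 := s))" "\<lambda>s. partial_deriv j0 G (?om(j0 := s))"])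
             (use Ck_DERIV[OF smG[of "Suc 0"] j0(1) cube_Rn] seg in blast)+
        let ?p = "partial_deriv i0 f (snd_block n (?om(j0 := s)))" and ?q = "partial_deriv i0 g (diff_block n (?om(j0 := s')))"
        have p: "\<bar>?p - a i0\<bar> < \<bar>a i0\<bar>" by (rule s1(3)[OF sb[OF seg[OF s(1)]]])
        have q: "\<bar>?q - b i0\<bar> < \<bar>b i0\<bar>" by (rule s2(3)[OF db[OF seg[OF s'(1)]]])
        have Fw: "F (?om(j0 := ?om j0)) \<le> 0" unfolding fun_upd_triv F_def sbw by (rule fx)
        have Ft: "F (?om(j0 := t)) = 0" unfolding t_def by (rule Fhat[OF wd])
        have 1: "(t - ?om j0) * ?p \<ge> 0"
          using s(2) Fw Ft pF[OF seg[OF s(1)] j0(1)] j0 by simp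
        have 2: "(t - ?om j0) * ?q \<ge> 0"
        proof -
          have "(0 < ?p \<and> 0 < ?q) \<or> (?p < 0 \<and> ?q < 0)"
            using p q ab by (auto simp: zero_less_mult_iff abs_if split: if_splits)
          then show ?thesis using 1 by (auto simp: zero_le_mult_iff)
        qed
        have "G (?om(j0 := t)) - G (?om(j0 := ?om j0)) = - ((t - ?om j0) * ?q)"
          using s'(2) pG[OF seg[OF s'(1)] j0(1)] j0 by simp
        then have "G (?om(j0 := t)) \<le> G (?om(j0 := ?om j0))" using 2 by linarith
        then show ?thesis unfolding t_def fun_upd_triv .
      qed
      also have "G ?om \<le> 0" unfolding G_def dbw by (rule gy)
      finally show "h z \<le> 0" .
    next
      assume hz: "h z \<le> 0"
      have zc: "z \<in> cube n z0 d'" using z cube_mono[OF \<rho>(3), of n z0] by blast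
      let ?om = "app n z x0"
      have w': "?om \<in> cube ?N ?w0 d'" by (rule emb_cube[OF zc x0d])
      have zw: "zz ?om \<in> cube ?N ?w0 d" "m ?om = ?P (zz ?om)" "\<forall>i. i \<notin> ?J \<longrightarrow> zz ?om i = ?om i"
        using m(4)[OF w'] by auto
      \<comment> \<open>The minimizer, completed by \<open>xi\<close> to a boundary point
        \<open>x\<close> of \<open>K\<close>; the value of \<open>g\<close> at z - x is
        \<open>h z\<close>, so z - x lies in \<open>L\<close>.\<close>
      let ?u = "(zz ?om)(j0 := xi (zz ?om))"
      have u: "?u \<in> cube ?N ?w0 e" by (rule hat[OF zw(1)])
      have "f (snd_block n ?u) = 0" using Fhat[OF zw(1)] unfolding F_def .
      then have xK: "snd_block n ?u \<in> K" using inF[OF sb'[OF u]] by simp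
      have "g (diff_block n ?u) \<le> 0" using hz zw(2) unfolding h_def G_def by simp
      then have yL: "diff_block n ?u \<in> L" using inG[OF db'[OF u]] by simp
      have "z = snd_block n ?u + diff_block n ?u"
      proof
        fix i
        show "z i = (snd_block n ?u + diff_block n ?u) i"
        proof (cases "i < n")
          case True
          then have "?u i = z i" using zw(3) j0 by (auto simp: app_def)
          then show ?thesis using True by (simp add: snd_block_def diff_block_def del: fun_upd_apply)
        next
          case False
          then show ?thesis using z by (simp add: snd_block_def diff_block_def cube_def Rn_def)
        qed
      qed
      then show "z \<in> K + L" using xK yL by (metis set_plus_intro)
    qed
    then show "(K + L) \<inter> cube n z0 \<rho> = {z \<in> cube n z0 \<rho>. h z \<le> 0}" by blast
  qed
  then show ?thesis by blast
qed

end

theorem smooth_body_plus: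
  assumes K: "K \<in> smooth_convex_bodies n" and L: "L \<in> smooth_convex_bodies n"
  shows "K + L \<in> smooth_convex_bodies n"
proof -
  note bK = smooth_body[OF K] and bL = smooth_body[OF L]
  have "\<exists>r h. regular_at n (K + L) z r h"
    if z: "z \<in> K + L" and bd: "\<not> (\<exists>e>0. cube n z e \<subseteq> K + L)" for z
  proof -
    obtain x y where xy: "x \<in> K" "y \<in> L" "z = x + y" using z by (auto simp: set_plus_def)
    have bx: "\<not> (\<exists>e>0. cube n x e \<subseteq> K)"
      by (rule smooth_boundary_summand[OF K bL xy(1,2)]) (use bd xy(3) in simp)
    have by': "\<not> (\<exists>e>0. cube n y e \<subseteq> L)"
      by (rule smooth_boundary_summand[OF L bK xy(2,1)]) (use bd xy(3) in \<open>simp add: add.commute\<close>)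
    obtain e1 f where f: "regular_at n K x e1 f"
      using K xy(1) bx unfolding smooth_convex_bodies_iff by blast
    obtain e2 g where g: "regular_at n L y e2 g"
      using L xy(2) by' unfolding smooth_convex_bodies_iff by blast
    interpret sum_at_boundary n K L x y e1 e2 f g
      by unfold_locales (use bK bL xy bx by' f g bd in auto)
    show ?thesis using regular_at_sum xy(3) by simp
  qed
  then show ?thesis using body_plus[OF bK bL] unfolding smooth_convex_bodies_iff by blast
qed


text \<open>The local equation at x / s is pulled back along y \<mapsto> y / s. This rescales
  gradient and Hessian by positive factors, and the cube grows from radius e to s e.\<close>

theorem smooth_body_dil:
  assumes K: "K \<in> smooth_convex_bodies n" and s: "s > 0"
  shows "dil s K \<in> smooth_convex_bodies n"
proof -
  note bK = smooth_body[OF K]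
  have mem: "y \<in> dil s K \<longleftrightarrow> (1 / s) *\<^sub>R y \<in> K" for y
  proof
    assume "(1 / s) *\<^sub>R y \<in> K"
    then have "s *\<^sub>R ((1 / s) *\<^sub>R y) \<in> dil s K" unfolding dil_def by (rule imageI)
    then show "y \<in> dil s K" using s by simp
  qed (use s in \<open>auto simp: dil_def\<close>)
  have cube: "(1 / s) *\<^sub>R y \<in> cube n ((1 / s) *\<^sub>R x) e \<longleftrightarrow> y \<in> cube n x (s * e)" if "y \<in> Rn n" for x y e
  proof -
    have "\<bar>1 / s * y i - 1 / s * x i\<bar> < e \<longleftrightarrow> \<bar>y i - x i\<bar> < s * e" for i
    proof -
      have "\<bar>1 / s * y i - 1 / s * x i\<bar> = \<bar>y i - x i\<bar> / s"
        using s by (simp add: diff_divide_distrib[symmetric])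
      then show ?thesis using s by (simp add: field_simps)
    qed
    then show ?thesis using that Rn_scale[OF that] by (simp add: cube_def scaleR_fun_apply)
  qed
  have "\<exists>r h. regular_at n (dil s K) x r h"
    if x: "x \<in> dil s K" and bd: "\<not> (\<exists>e>0. cube n x e \<subseteq> dil s K)" for x
  proof -
    let ?x = "(1 / s) *\<^sub>R x"
    have xR: "x \<in> Rn n" using x Rn_dil[OF body_Rn[OF bK]] by blast
    have xK: "?x \<in> K" using x mem by simp
    have "\<not> (\<exists>e>0. cube n ?x e \<subseteq> K)"
    proof
      assume "\<exists>e>0. cube n ?x e \<subseteq> K"
      then obtain e where e: "e > 0" "cube n ?x e \<subseteq> K" by (elim exE conjE)
      have "cube n x (s * e) \<subseteq> dil s K"
      proof
        fix y assume y: "y \<in> cube n x (s * e)"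
        then have "(1 / s) *\<^sub>R y \<in> cube n ?x e" using cube[of y x e] cube_Rn by blast
        then show "y \<in> dil s K" using e mem by blast
      qed
      moreover have "s * e > 0" using s e by simp
      ultimately show False using bd by blast
    qed
    then obtain e f where r: "regular_at n K ?x e f"
      using K xK unfolding smooth_convex_bodies_iff by blast
    let ?B = "\<lambda>l k. if l < n \<and> k = l then 1 / s else 0 :: real"
    let ?h = "\<lambda>y. f ((1 / s) *\<^sub>R y)"
    have Bs: "(\<Sum>k<n. ?B l k * v k) = (if l < n then v l / s else 0)" for l v
    proof (cases "l < n")
      case True
      then have "(\<Sum>k<n. ?B l k * v k) = (\<Sum>k<n. if k = l then v k / s else 0)" by (intro sum.cong) auto
      then show ?thesis using True by simp
    qed simp
    have aff: "affine_map n n (\<lambda>_. 0) ?B y = (1 / s) *\<^sub>R y" if "y \<in> Rn n" for y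
      unfolding affine_map_def Bs using that by (auto simp: Rn_def scaleR_fun_apply)
    have e: "e > 0" and sm: "\<And>k. Ck_on n k (cube n ?x e) f" using r unfolding regular_at_def by auto
    have WU: "affine_map n n (\<lambda>_. 0) ?B w \<in> cube n ?x e" if "w \<in> cube n x (s * e)" for w
    proof -
      have wR: "w \<in> Rn n" using that cube_Rn by blast
      show ?thesis unfolding aff[OF wR] using cube[OF wR] that by simp
    qed
    note A = opn_cube[of n ?x e] opn_cube[of n x "s * e"] WU
    have c: "f (affine_map n n (\<lambda>_. 0) ?B y) = ?h y" if "y \<in> cube n x (s * e)" for y
      using aff[of y] that cube_Rn by fastforce
    have xc: "x \<in> cube n x (s * e)" using centre_in_cube[OF xR] s e by simp
    have p1: "partial_deriv i ?h y = partial_deriv i (\<lambda>y. f (affine_map n n (\<lambda>_. 0) ?B y)) y"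
      if "y \<in> cube n x (s * e)" "i < n" for i y
      by (rule partial_deriv_cong_opn[OF opn_cube c[symmetric] that])
    have p: "partial_deriv i ?h x = partial_deriv i f ?x / s" if i: "i < n" for i
    proof -
      have "partial_deriv i ?h x = (\<Sum>l<n. partial_deriv l f (affine_map n n (\<lambda>_. 0) ?B x) * ?B l i)"
        unfolding p1[OF xc i] by (rule partial_deriv_affine[OF A sm[of "Suc 0"] xc i])
      also have "\<dots> = (\<Sum>l<n. if l = i then partial_deriv i f ?x / s else 0)"
        unfolding aff[OF xR] by (intro sum.cong) auto
      finally show ?thesis using i by simp
    qed
    have "hess n ?h x v = hess n (\<lambda>y. f (affine_map n n (\<lambda>_. 0) ?B y)) x v" for v
    proof -
      have "partial_deriv i (partial_deriv j ?h) x = partial_deriv i (partial_deriv j (\<lambda>y. f (affine_map n n (\<lambda>_. 0) ?B y))) x"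
        if "i < n" "j < n" for i j
        by (rule partial_deriv_cong_opn[OF opn_cube p1 xc that(1)]) (use that in auto)
      then show ?thesis by (simp add: hess_def)
    qed
    then have h: "hess n ?h x v = hess n f ?x (\<lambda>l. if l < n then v l / s else 0)" for v
      using hess_affine[OF A sm[of "Suc (Suc 0)"] xc, of v] unfolding Bs aff[OF xR] by simp
    have "regular_at n (dil s K) x (s * e) ?h" unfolding regular_at_def
    proof (intro conjI allI ballI impI)
      show "0 < s * e" using s e by simp
      show "Ck_on n k (cube n x (s * e)) ?h" for k
        by (rule Ck_cong[OF opn_cube c Ck_affine[OF A sm]])
      obtain i where "i < n" "partial_deriv i f ?x \<noteq> 0" using r unfolding regular_at_def by blast
      then show "\<exists>i<n. partial_deriv i ?h x \<noteq> 0" using p s by (intro exI[of _ i]) simp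
      have Kf: "K \<inter> cube n ?x e = {y \<in> cube n ?x e. f y \<le> 0}" using r unfolding regular_at_def by (elim conjE)
      have "y \<in> dil s K \<longleftrightarrow> ?h y \<le> 0" if "y \<in> cube n x (s * e)" for y
      proof -
        have yR: "y \<in> Rn n" using that cube_Rn by blast
        have "(1 / s) *\<^sub>R y \<in> cube n ?x e" using cube[OF yR, of x e] that by simp
        then have "(1 / s) *\<^sub>R y \<in> K \<longleftrightarrow> ?h y \<le> 0" using Kf by (metis (no_types, lifting) IntD1 IntI mem_Collect_eq)
        then show ?thesis unfolding mem .
      qed
      then show "dil s K \<inter> cube n x (s * e) = {y \<in> cube n x (s * e). ?h y \<le> 0}" by blast
    next
      fix v assume v: "v \<in> Rn n" "v \<noteq> 0" "(\<Sum>i<n. partial_deriv i ?h x * v i) = 0"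
      let ?v = "\<lambda>l. if l < n then v l / s else 0"
      have "(\<Sum>i<n. partial_deriv i f ?x * ?v i) = (\<Sum>i<n. partial_deriv i ?h x * v i)"
        using p by (intro sum.cong) auto
      moreover have "?v \<noteq> 0"
      proof -
        obtain i where i: "v i \<noteq> 0" using v(2) by (auto simp: fun_eq_iff)
        then have "i < n" using v(1) by (auto simp: Rn_def linorder_not_le[symmetric])
        then have vi: "?v i \<noteq> 0" using i s by simp
        show ?thesis
        proof
          assume "?v = 0"
          then have "?v i = 0 i" by (rule fun_cong)
          with vi show False by simp
        qed
      qed
      moreover have "?v \<in> Rn n" by (simp add: Rn_def)
      moreover have "\<forall>v\<in>Rn n. v \<noteq> 0 \<longrightarrow> (\<Sum>i<n. partial_deriv i f ?x * v i) = 0 \<longrightarrow> 0 < hess n f ?x v"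
        using r unfolding regular_at_def by (elim conjE)
      ultimately show "0 < hess n ?h x v" unfolding h using v(3) by simp
    qed
    then show ?thesis by blast
  qed
  then show ?thesis using body_dil[OF bK] unfolding smooth_convex_bodies_iff by blast
qed

subsection \<open>Approximation by smooth bodies\<close>

definition lin :: "nat \<Rightarrow> (nat \<Rightarrow> real) \<times> real \<Rightarrow> (nat \<Rightarrow> real) \<Rightarrow> real"
  where "lin n p x = (\<Sum>i<n. fst p i * x i) - snd p"

lemma lin_upd: "i < n \<Longrightarrow> lin n p (x(i := t)) = lin n p x + fst p i * (t - x i)"
proof -
  assume i: "i < n"
  have "(\<Sum>j<n. fst p j * (x(i := t)) j) = fst p i * t + (\<Sum>j\<in>{..<n} - {i}. fst p j * x j)"
    by (subst sum.remove[of _ i]) (use i in \<open>auto intro!: sum.cong\<close>)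
  moreover have "(\<Sum>j<n. fst p j * x j) = fst p i * x i + (\<Sum>j\<in>{..<n} - {i}. fst p j * x j)"
    by (subst sum.remove[of _ i]) (use i in auto)
  ultimately show ?thesis by (simp add: lin_def algebra_simps)
qed

lemma continuous_lin: "continuous_on S (lin n p)"
  unfolding lin_def[abs_def]
  by (intro continuous_on_diff continuous_on_sum continuous_on_mult continuous_on_const continuous_coord)

text \<open>With \<open>k0\<close> the Euclidean nearest point of \<open>K\<close>, the hyperplane
  orthogonal to x - k0 through the midpoint of \<open>k0\<close> and \<open>x\<close> separates
  strictly.\<close>

lemma separate_point:
  assumes K: "convex_body n K" and x: "x \<in> Rn n" "x \<notin> K"
  obtains p where "\<And>k. k \<in> K \<Longrightarrow> lin n p k < 0" "lin n p x > 0"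
proof -
  let ?q = "\<lambda>k. \<Sum>i<n. (x i - k i)\<^sup>2"
  have "continuous_on K ?q"
    by (intro continuous_on_sum continuous_on_power continuous_on_diff continuous_on_const continuous_coord)
  then obtain k0 where k0: "k0 \<in> K" "\<And>k. k \<in> K \<Longrightarrow> ?q k0 \<le> ?q k"
    using continuous_attains_inf[OF body_compact[OF K] body_ne[OF K], of ?q] by blast
  define u where "u i = x i - k0 i" for i
  have uu: "(\<Sum>i<n. (u i)\<^sup>2) > 0"
  proof (rule ccontr)
    assume "\<not> ?thesis"
    then have "(\<Sum>i<n. (u i)\<^sup>2) = 0" by (simp add: antisym sum_nonneg not_less)
    then have "\<forall>i\<in>{..<n}. (u i)\<^sup>2 = 0" by (subst (asm) sum_nonneg_eq_0_iff) auto
    then have "x i = k0 i" for i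
      using x(1) k0(1) body_Rn[OF K] by (cases "i < n") (auto simp: u_def Rn_def)
    then have "x = k0" by (rule ext)
    with k0(1) x(2) show False by simp
  qed
  have w: "(\<Sum>i<n. u i * (k i - k0 i)) \<le> 0" if k: "k \<in> K" for k
  proof (rule ccontr)
    let ?a = "\<Sum>i<n. u i * (k i - k0 i)" and ?b = "\<Sum>i<n. (k i - k0 i)\<^sup>2"
    assume a: "\<not> ?a \<le> 0"
    have b: "?b \<ge> 0" by (intro sum_nonneg) auto
    \<comment> \<open>Minimality of \<open>k0\<close> along the segment to \<open>k\<close> gives 2
      a \<le> t b for the sums \<open>?a\<close> and \<open>?b\<close>, while this step length
      ensures t b \<le> a.\<close>
    define t where "t = min 1 (?a / (?b + 1))"
    have t: "0 < t" "t \<le> 1" using a b by (auto simp: t_def)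
    have "t \<le> ?a / (?b + 1)" by (simp add: t_def)
    then have tb: "t * (?b + 1) \<le> ?a" using b by (simp add: field_simps)
    have "(1 - t) *\<^sub>R k0 + t *\<^sub>R k \<in> K" by (rule convexD[OF body_convex[OF K] k0(1) k]) (use t in auto)
    from k0(2)[OF this] have "(\<Sum>i<n. (u i)\<^sup>2) \<le> (\<Sum>i<n. (u i - t * (k i - k0 i))\<^sup>2)"
      by (simp add: u_def scaleR_fun_apply algebra_simps)
    also have "\<dots> = (\<Sum>i<n. (u i)\<^sup>2) - 2 * t * ?a + t\<^sup>2 * ?b"
      unfolding sum_distrib_left sum_subtractf[symmetric] sum.distrib[symmetric]
      by (intro sum.cong refl) (simp add: power2_eq_square algebra_simps)
    finally have "2 * t * ?a \<le> t * (t * ?b)" by (simp add: power2_eq_square mult_ac)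
    then have "2 * ?a \<le> t * ?b" using t(1) by (simp add: mult.assoc mult.left_commute[of 2])
    moreover have "t * ?b \<le> t * (?b + 1)" using t(1) by (intro mult_left_mono) auto
    ultimately show False using tb a by linarith
  qed
  let ?c = "(\<Sum>i<n. u i * k0 i) + (\<Sum>i<n. (u i)\<^sup>2) / 2"
  have l: "lin n (u, ?c) k = (\<Sum>i<n. u i * (k i - k0 i)) - (\<Sum>i<n. (u i)\<^sup>2) / 2" for k
    by (simp add: lin_def right_diff_distrib sum_subtractf)
  show ?thesis
  proof (rule that[of "(u, ?c)"])
    show "lin n (u, ?c) k < 0" if "k \<in> K" for k unfolding l using w[OF that] uu by linarith
    have "(\<Sum>i<n. u i * (x i - k0 i)) = (\<Sum>i<n. (u i)\<^sup>2)" by (simp add: u_def power2_eq_square)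
    then show "lin n (u, ?c) x > 0" unfolding l using uu by linarith
  qed
qed

text \<open>
  For a polytope \<open>{x. \<forall>p\<in>F. lin n p x \<le> 0}\<close>, large \<open>m\<close> and small \<open>c\<close>, the sublevel sets at \<open>0\<close> of these
  functions approximate the polytope; the quadratic term makes them strictly convex.
\<close>

definition smoothing :: "nat \<Rightarrow> ((nat \<Rightarrow> real) \<times> real) set \<Rightarrow> real \<Rightarrow> real \<Rightarrow> (nat \<Rightarrow> real) \<Rightarrow> real"
  where "smoothing n F m c x = (\<Sum>p\<in>F. exp (m * lin n p x)) + c * (\<Sum>i<n. (x i)\<^sup>2) - 1"

context
  fixes n :: nat and F :: "((nat \<Rightarrow> real) \<times> real) set" and m c :: real
  assumes F: "finite F" and c: "c > 0"
begin

abbreviation "sf \<equiv> smoothing n F m c"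

lemma DERIV_exp_lin:
  assumes "i < n"
  shows "((\<lambda>t. exp (m * lin n p (x(i := t)))) has_real_derivative m * fst p i * exp (m * lin n p x)) (at (x i))"
proof -
  have "((\<lambda>t. exp (m * (lin n p x + fst p i * (t - x i)))) has_real_derivative m * fst p i * exp (m * lin n p x)) (at (x i))"
    by (auto intro!: derivative_eq_intros)
  moreover have "(\<lambda>t. exp (m * lin n p (x(i := t)))) = (\<lambda>t. exp (m * (lin n p x + fst p i * (t - x i))))"
    by (rule ext) (simp only: lin_upd[OF assms])
  ultimately show ?thesis by simp
qed

lemma DERIV_squares:
  assumes "i < n"
  shows "((\<lambda>t. \<Sum>j<n. ((x(i := t)) j)\<^sup>2) has_real_derivative 2 * x i) (at (x i))"
proof -
  have "(\<lambda>t. \<Sum>j<n. ((x(i := t)) j)\<^sup>2) = (\<lambda>t. t\<^sup>2 + (\<Sum>j\<in>{..<n} - {i}. (x j)\<^sup>2))"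
    by (rule ext, subst sum.remove[of _ i]) (use assms in \<open>auto intro!: sum.cong\<close>)
  then show ?thesis by (auto intro!: derivative_eq_intros)
qed

lemma partial_smoothing:
  assumes "i < n"
  shows "partial_deriv i sf x = (\<Sum>p\<in>F. m * fst p i * exp (m * lin n p x)) + c * (2 * x i)"
  unfolding smoothing_def[abs_def]
  by (rule partial_deriv_eqI, rule DERIV_cong,
      rule DERIV_diff[OF DERIV_add[OF DERIV_sum[OF DERIV_exp_lin[OF assms]] DERIV_cmult[OF DERIV_squares[OF assms]]] DERIV_const])
     simp

lemma partial2_smoothing:
  assumes ij: "i < n" "j < n"
  shows "partial_deriv i (partial_deriv j sf) x =
    (\<Sum>p\<in>F. m * fst p j * (m * fst p i * exp (m * lin n p x))) + c * (2 * (if i = j then 1 else 0))"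
proof -
  have "partial_deriv j sf = (\<lambda>x. (\<Sum>p\<in>F. m * fst p j * exp (m * lin n p x)) + c * (2 * x j))"
    by (rule ext) (rule partial_smoothing[OF ij(2)])
  moreover have "((\<lambda>t. (x(i := t)) j) has_real_derivative (if i = j then 1 else 0)) (at (x i))"
    by (cases "i = j") auto
  ultimately show ?thesis
    by (simp only:) (rule partial_deriv_eqI, rule DERIV_add[OF DERIV_sum[OF DERIV_cmult[OF DERIV_exp_lin[OF ij(1)]]] DERIV_cmult[OF DERIV_cmult]])
qed

text \<open>The exponentials contribute a sum of squares, and the quadratic term makes the form
  definite in every direction, not only in tangent ones.\<close>

lemma hess_smoothing_pos:
  assumes "v \<in> Rn n" "v \<noteq> 0"
  shows "0 < hess n sf x v"
proof -
  have "hess n sf x v = (\<Sum>i<n. \<Sum>j<n. (\<Sum>p\<in>F. m * fst p j * (m * fst p i * exp (m * lin n p x))) * v i * v j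
      + c * (2 * (if i = j then 1 else 0)) * v i * v j)"
    unfolding hess_def by (intro sum.cong refl) (simp add: partial2_smoothing distrib_right)
  also have "\<dots> = (\<Sum>i<n. \<Sum>j<n. \<Sum>p\<in>F. exp (m * lin n p x) * (m * fst p i * v i) * (m * fst p j * v j))
      + (\<Sum>i<n. \<Sum>j<n. if i = j then 2 * c * (v i)\<^sup>2 else 0)"
    unfolding sum.distrib by (intro arg_cong2[of _ _ _ _ "(+)"] sum.cong refl)
      (auto simp: sum_distrib_right sum_distrib_left mult_ac power2_eq_square)
  also have "(\<Sum>i<n. \<Sum>j<n. if i = j then 2 * c * (v i)\<^sup>2 else 0) = 2 * c * (\<Sum>i<n. (v i)\<^sup>2)"
    by (simp add: sum_distrib_left)
  also have "(\<Sum>i<n. \<Sum>j<n. \<Sum>p\<in>F. exp (m * lin n p x) * (m * fst p i * v i) * (m * fst p j * v j)) =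
     (\<Sum>p\<in>F. exp (m * lin n p x) * (\<Sum>i<n. m * fst p i * v i)\<^sup>2)"
  proof -
    have "(\<Sum>i<n. \<Sum>j<n. \<Sum>p\<in>F. exp (m * lin n p x) * (m * fst p i * v i) * (m * fst p j * v j)) =
        (\<Sum>i<n. \<Sum>p\<in>F. \<Sum>j<n. exp (m * lin n p x) * (m * fst p i * v i) * (m * fst p j * v j))"
      by (rule sum.cong[OF refl], rule sum.swap)
    also have "\<dots> = (\<Sum>p\<in>F. \<Sum>i<n. \<Sum>j<n. exp (m * lin n p x) * (m * fst p i * v i) * (m * fst p j * v j))"
      by (rule sum.swap)
    also have "\<dots> = (\<Sum>p\<in>F. exp (m * lin n p x) * (\<Sum>i<n. m * fst p i * v i)\<^sup>2)"
      by (simp add: power2_eq_square sum_product sum_distrib_left mult_ac)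
    finally show ?thesis .
  qed
  finally have e: "hess n sf x v = (\<Sum>p\<in>F. exp (m * lin n p x) * (\<Sum>i<n. m * fst p i * v i)\<^sup>2) + 2 * c * (\<Sum>i<n. (v i)\<^sup>2)" .
  obtain i where i: "v i \<noteq> 0" using assms(2) by (auto simp: fun_eq_iff)
  then have "i < n" using assms(1) by (auto simp: Rn_def linorder_not_le[symmetric])
  then have "(\<Sum>i<n. (v i)\<^sup>2) > 0" using i by (intro sum_pos2[of _ i]) auto
  moreover have "(\<Sum>p\<in>F. exp (m * lin n p x) * (\<Sum>i<n. m * fst p i * v i)\<^sup>2) \<ge> 0" by (intro sum_nonneg) auto
  ultimately show ?thesis unfolding e using c by (intro add_nonneg_pos) auto
qed

lemma opn_whole: "opn n (Rn n)"
  using openin_topspace[of "Euclidean_space n"] by simp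

lemma Ck_exp_lin: "Ck_on n k (Rn n) (\<lambda>x. exp (m * lin n p x))"
proof (induction k)
  case 0
  show ?case unfolding Ck_0[OF order_refl]
    by (intro continuous_on_exp continuous_on_mult continuous_on_const continuous_lin)
next
  case (Suc k)
  show ?case
  proof (rule Ck_SucI[OF opn_whole _ DERIV_exp_lin])
    show "continuous_on (Rn n) (\<lambda>x. exp (m * lin n p x))"
      by (intro continuous_on_exp continuous_on_mult continuous_on_const continuous_lin)
    show "Ck_on n k (Rn n) (\<lambda>x. m * fst p i * exp (m * lin n p x))" for i
      by (rule Ck_cmult[OF opn_whole Suc.IH])
  qed
qed

lemma Ck_smoothing: "Ck_on n k (Rn n) sf"
proof -
  have "Ck_on n k (Rn n) (\<lambda>x. (\<Sum>p\<in>F. exp (m * lin n p x)) + c * (\<Sum>i<n. x i * x i) + (-1))"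
    by (intro Ck_add Ck_sum Ck_cmult Ck_mult Ck_coord Ck_const Ck_exp_lin opn_whole)
  then show ?thesis by (simp add: smoothing_def[abs_def] power2_eq_square)
qed

text \<open>Convexity as a tangent inequality, added up from those of exp and of the square. It
  yields the convexity of the sublevel set as well as the regularity of its boundary.\<close>

lemma smoothing_tangent:
  "sf x + (\<Sum>i<n. partial_deriv i sf x * (y i - x i)) \<le> sf y"
proof -
  have l: "lin n p y - lin n p x = (\<Sum>i<n. fst p i * (y i - x i))" for p
    by (simp add: lin_def right_diff_distrib sum_subtractf)
  have "(\<Sum>i<n. partial_deriv i sf x * (y i - x i)) =
      (\<Sum>i<n. (\<Sum>p\<in>F. exp (m * lin n p x) * (m * (fst p i * (y i - x i)))) + c * (2 * x i * (y i - x i)))"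
    by (intro sum.cong refl) (simp add: partial_smoothing sum_distrib_left sum_distrib_right algebra_simps)
  also have "\<dots> = (\<Sum>p\<in>F. exp (m * lin n p x) * (m * (lin n p y - lin n p x))) + c * (\<Sum>i<n. 2 * x i * (y i - x i))"
    unfolding sum.distrib l sum_distrib_left by (subst sum.swap) simp
  finally have e: "(\<Sum>i<n. partial_deriv i sf x * (y i - x i)) =
     (\<Sum>p\<in>F. exp (m * lin n p x) * (m * (lin n p y - lin n p x))) + c * (\<Sum>i<n. 2 * x i * (y i - x i))" .
  have "exp a + exp a * (b - a) \<le> exp b" for a b :: real
  proof -
    have "exp a * (1 + (b - a)) \<le> exp a * exp (b - a)" by (intro mult_left_mono exp_ge_add_one_self) simp
    then show ?thesis by (simp add: exp_add[symmetric] distrib_left)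
  qed
  from this[of "m * lin n _ x" "m * lin n _ y"]
  have 1: "(\<Sum>p\<in>F. exp (m * lin n p x)) + (\<Sum>p\<in>F. exp (m * lin n p x) * (m * (lin n p y - lin n p x))) \<le> (\<Sum>p\<in>F. exp (m * lin n p y))"
    unfolding sum.distrib[symmetric] by (intro sum_mono) (simp add: right_diff_distrib)
  have "a\<^sup>2 + 2 * a * (b - a) \<le> b\<^sup>2" for a b :: real
    using zero_le_power2[of "b - a"] by (simp add: power2_eq_square algebra_simps)
  then have "(\<Sum>i<n. (x i)\<^sup>2) + (\<Sum>i<n. 2 * x i * (y i - x i)) \<le> (\<Sum>i<n. (y i)\<^sup>2)"
    unfolding sum.distrib[symmetric] by (intro sum_mono)
  then have "c * ((\<Sum>i<n. (x i)\<^sup>2) + (\<Sum>i<n. 2 * x i * (y i - x i))) \<le> c * (\<Sum>i<n. (y i)\<^sup>2)"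
    using c by (intro mult_left_mono) auto
  then show ?thesis using 1 unfolding e smoothing_def by (simp add: distrib_left)
qed

lemma smooth_sublevel:
  assumes neg: "k \<in> Rn n" "sf k < 0" and cpt: "compact {x \<in> Rn n. sf x \<le> 0}"
  shows "{x \<in> Rn n. sf x \<le> 0} \<in> smooth_convex_bodies n"
proof -
  let ?S = "{x \<in> Rn n. sf x \<le> 0}"
  have conv: "convex ?S"
  proof (rule convexI)
    fix x y and u v :: real assume a: "x \<in> ?S" "y \<in> ?S" "0 \<le> u" "0 \<le> v" "u + v = 1"
    let ?z = "u *\<^sub>R x + v *\<^sub>R y"
    have zR: "?z \<in> Rn n" using a by (intro Rn_add Rn_scale) auto
    let ?P = "\<lambda>i. partial_deriv i sf ?z"
    have g: "u * (Z + (\<Sum>i<n. p i * a i)) + v * (Z + (\<Sum>i<n. p i * b i)) =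
        (u + v) * Z + (\<Sum>i<n. p i * (u * a i + v * b i))" for Z :: real and p a b :: "nat \<Rightarrow> real"
      by (simp add: distrib_left distrib_right sum.distrib sum_distrib_left mult_ac)
    have "u * (sf ?z + (\<Sum>i<n. ?P i * (x i - ?z i))) + v * (sf ?z + (\<Sum>i<n. ?P i * (y i - ?z i))) \<le> u * sf x + v * sf y"
      by (intro add_mono mult_left_mono smoothing_tangent a)
    also have "\<dots> \<le> 0" using a by (intro add_nonpos_nonpos mult_nonneg_nonpos) auto
    also have "u * (sf ?z + (\<Sum>i<n. ?P i * (x i - ?z i))) + v * (sf ?z + (\<Sum>i<n. ?P i * (y i - ?z i))) =
       (u + v) * sf ?z + (\<Sum>i<n. ?P i * (u * (x i - ?z i) + v * (y i - ?z i)))"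
      by (rule g)
    also have "\<dots> = sf ?z"
    proof -
      have "u * (x i - ?z i) + v * (y i - ?z i) = ?z i - (u + v) * ?z i" for i
        by (simp add: scaleR_fun_apply algebra_simps)
      then show ?thesis using a(5) by simp
    qed
    finally show "?z \<in> ?S" using zR by simp
  qed
  have body: "convex_body n ?S" unfolding convex_body_iff using neg conv cpt by auto
  have "\<exists>e f. regular_at n ?S x e f" if x: "x \<in> ?S" and bd: "\<not> (\<exists>e>0. cube n x e \<subseteq> ?S)" for x
  proof -
    have xR: "x \<in> Rn n" using x by simp
    have "sf x = 0"
    proof (rule ccontr)
      assume "sf x \<noteq> 0"
      then have "- sf x > 0" using x by simp
      then obtain d where d: "d > 0" "\<And>y. y \<in> cube n x d \<Longrightarrow> \<bar>sf y - sf x\<bar> < - sf x"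
        using continuous_on_cubeD[OF Ck_continuous[OF Ck_smoothing[of 0] order_refl] opn_whole xR] by metis
      have "y \<in> ?S" if "y \<in> cube n x d" for y
      proof -
        have "sf y \<le> 0" using d(2)[OF that] by linarith
        then show ?thesis using that cube_Rn by blast
      qed
      then show False using d(1) bd by blast
    qed
    \<comment> \<open>At a critical boundary point the tangent inequality would give 0 \<le>
      \<open>sf k\<close>, against the choice of \<open>k\<close>.\<close>
    have "\<exists>i<n. partial_deriv i sf x \<noteq> 0"
    proof (rule ccontr)
      assume "\<not> ?thesis"
      then have "(\<Sum>i<n. partial_deriv i sf x * (k i - x i)) = 0" by (intro sum.neutral) auto
      then show False using smoothing_tangent[of x k] neg(2) \<open>sf x = 0\<close> by simp
    qed
    then have "regular_at n ?S x 1 sf" unfolding regular_at_def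
      using Ck_subset[OF cube_Rn order_refl Ck_smoothing] hess_smoothing_pos cube_Rn[of n x 1] by auto
    then show ?thesis by blast
  qed
  with body show ?thesis unfolding smooth_convex_bodies_iff by blast
qed

end

text \<open>The part of a large cube that stays away from \<open>K\<close> by \<open>r\<close> is
  compact, so finitely many half-spaces missing \<open>K\<close> cover it. Together with the faces
  of the cube they cut out a polytope between \<open>K\<close> and its neighbourhood, which is then
  smoothed from inside without losing \<open>K\<close>.\<close>

theorem smooth_approx:
  assumes K: "convex_body n K" and r: "r > 0"
  obtains S where "S \<in> smooth_convex_bodies n" "K \<subseteq> S" "S \<subseteq> K + Box n r"
proof -
  obtain R where R: "R > 0" "K \<subseteq> Box n R" using compact_subset_Box[OF body_compact[OF K] body_Rn[OF K]] .
  let ?V = "\<lambda>k. {y. \<forall>i<n. \<bar>y i - k i\<bar> < r}"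
  let ?C = "Box n (R + 1) \<inter> - (\<Union>k\<in>K. ?V k)"
  have C: "compact ?C"
    by (intro compact_Int_closed compact_Box) (auto simp: closed_def intro!: open_UN open_cube)
  define sep where "sep = {p. \<forall>k\<in>K. lin n p k < 0}"
  have op: "open {y. lin n p y > 0}" for p
    by (intro open_Collect_less continuous_on_const continuous_lin)
  have cov: "?C \<subseteq> (\<Union>p\<in>sep. {y. lin n p y > 0})"
  proof
    fix x assume x: "x \<in> ?C"
    then have "x \<in> Rn n" "x \<notin> K" using r Box_subset by auto
    then obtain p where "\<And>k. k \<in> K \<Longrightarrow> lin n p k < 0" "lin n p x > 0" using separate_point[OF K] by metis
    then show "x \<in> (\<Union>p\<in>sep. {y. lin n p y > 0})" by (intro UN_I[of p]) (simp_all add: sep_def)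
  qed
  obtain F1 where F1: "F1 \<subseteq> sep" "finite F1" "?C \<subseteq> (\<Union>p\<in>F1. {y. lin n p y > 0})"
    by (rule compactE_image[OF C op cov])
  \<comment> \<open>The faces of the cube of radius \<open>R + 1\<close>; they keep the sublevel set
    bounded.\<close>
  define F2 where "F2 = (\<lambda>(i, s). (\<lambda>j. if j = i then s else 0, R + 1)) ` ({..<n} \<times> {1, -1 :: real})"
  have lin2: "lin n (\<lambda>j. if j = i then s else 0, R + 1) x = s * x i - (R + 1)" if "i < n" for i s x
  proof -
    have "(\<Sum>j<n. (if j = i then s else 0) * x j) = (\<Sum>j<n. if j = i then s * x i else 0)" by (intro sum.cong) auto
    then show ?thesis using that by (simp add: lin_def)
  qed
  have F2s: "F2 \<subseteq> sep"
  proof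
    fix p assume "p \<in> F2"
    then obtain i s where p: "i < n" "s \<in> {1, -1 :: real}" "p = (\<lambda>j. if j = i then s else 0, R + 1)"
      by (auto simp: F2_def)
    have "lin n p k < 0" if "k \<in> K" for k
      using R that p(2) unfolding p(3) lin2[OF p(1)] using p(1) by (force simp: Box_def abs_le_iff)
    then show "p \<in> sep" by (simp add: sep_def)
  qed
  define F where "F = F1 \<union> F2"
  have F: "finite F" "F \<subseteq> sep" using F1 F2s by (auto simp: F_def F2_def)
  have "\<exists>d>0. \<forall>k\<in>K. lin n p k \<le> - d" if "p \<in> F" for p
  proof -
    obtain k0 where "k0 \<in> K" "\<And>k. k \<in> K \<Longrightarrow> lin n p k \<le> lin n p k0"
      using continuous_attains_sup[OF body_compact[OF K] body_ne[OF K] continuous_lin] by blast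
    then show ?thesis using that F(2) by (intro exI[of _ "- lin n p k0"]) (auto simp: sep_def)
  qed
  then obtain d where d: "\<And>p. p \<in> F \<Longrightarrow> d p > 0" "\<And>p k. p \<in> F \<Longrightarrow> k \<in> K \<Longrightarrow> lin n p k \<le> - d p" by metis
  define D where "D = Min (insert 1 (d ` F))"
  have D: "D > 0" "\<And>p. p \<in> F \<Longrightarrow> D \<le> d p" using F(1) d(1) by (auto simp: D_def)
  \<comment> \<open>On \<open>K\<close> every functional is at most \<open>- D\<close>. As m D = 2
    (card F + 1) and exp y exceeds y, the exponentials add up to less than 1/2 there.\<close>
  define m where "m = 2 * (real (card F) + 1) / D"
  have m: "m > 0" using D(1) by (simp add: m_def)
  \<comment> \<open>Keeps the quadratic term below 1/4 on \<open>K\<close>, which lies in the cube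
    of radius \<open>R\<close>; so the smoothing is negative on \<open>K\<close>.\<close>
  define c where "c = 1 / (4 * (real n * R\<^sup>2 + 1))"
  have c: "c > 0" by (simp add: c_def add_nonneg_pos)
  let ?f = "smoothing n F m c"
  have neg: "?f k < 0" if k: "k \<in> K" for k
  proof -
    have "(\<Sum>p\<in>F. exp (m * lin n p k)) \<le> (\<Sum>p\<in>F. exp (- (m * D)))"
    proof (rule sum_mono)
      fix p assume p: "p \<in> F"
      have "m * lin n p k \<le> m * (- D)" using d(2)[OF p k] D(2)[OF p] m by (intro mult_left_mono) auto
      then show "exp (m * lin n p k) \<le> exp (- (m * D))" by simp
    qed
    also have "\<dots> = real (card F) / exp (m * D)" by (simp add: exp_minus field_simps)
    also have "\<dots> \<le> real (card F) / (2 * (real (card F) + 1))"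
    proof (rule divide_left_mono)
      have "m * D = 2 * (real (card F) + 1)" using D(1) by (simp add: m_def)
      then show "2 * (real (card F) + 1) \<le> exp (m * D)" using exp_ge_add_one_self[of "m * D"] by linarith
    qed auto
    also have "\<dots> < 1 / 2" by (simp add: field_simps)
    finally have 1: "(\<Sum>p\<in>F. exp (m * lin n p k)) < 1 / 2" .
    have "(\<Sum>i<n. (k i)\<^sup>2) \<le> (\<Sum>i<n. R\<^sup>2)"
    proof (rule sum_mono)
      fix i assume "i \<in> {..<n}"
      then have "\<bar>k i\<bar> \<le> R" using R k by (auto simp: Box_def)
      then show "(k i)\<^sup>2 \<le> R\<^sup>2" using R(1) by (simp add: abs_le_square_iff[symmetric])
    qed
    then have "c * (\<Sum>i<n. (k i)\<^sup>2) \<le> c * (real n * R\<^sup>2)" using c by (intro mult_left_mono) auto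
    also have "\<dots> \<le> c * (real n * R\<^sup>2 + 1)" using c by (intro mult_left_mono) auto
    also have "\<dots> = 1 / 4"
    proof -
      have "real n * R\<^sup>2 + 1 \<noteq> 0" by (smt (verit) mult_nonneg_nonneg of_nat_0_le_iff zero_le_power2)
      then show ?thesis by (simp add: c_def)
    qed
    finally have "c * (\<Sum>i<n. (k i)\<^sup>2) \<le> 1 / 4" .
    with 1 show ?thesis by (simp add: smoothing_def)
  qed
  let ?S = "{x \<in> Rn n. ?f x \<le> 0}"
  \<comment> \<open>A single exponential is at most 1 on the sublevel set, which already forces its
    functional to be nonpositive; so the sublevel set lies in the polytope.\<close>
  have lin_le: "lin n p x \<le> 0" if "x \<in> ?S" "p \<in> F" for x p
  proof -
    have "exp (m * lin n p x) \<le> (\<Sum>p\<in>F. exp (m * lin n p x))"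
      by (rule member_le_sum) (use that F in auto)
    also have "\<dots> \<le> 1 - c * (\<Sum>i<n. (x i)\<^sup>2)" using that(1) by (simp add: smoothing_def)
    also have "\<dots> \<le> 1" using c by (simp add: sum_nonneg)
    finally have "m * lin n p x \<le> 0" by simp
    then show ?thesis using m by (simp add: mult_le_0_iff)
  qed
  have SB: "?S \<subseteq> Box n (R + 1)"
  proof
    fix x assume x: "x \<in> ?S"
    have "\<bar>x i\<bar> \<le> R + 1" if i: "i < n" for i
    proof -
      have "(\<lambda>j. if j = i then s else 0, R + 1) \<in> F" if "s \<in> {1, -1}" for s :: real
        using i that by (force simp: F_def F2_def)
      from lin_le[OF x this[of 1]] lin_le[OF x this[of "-1"]] show ?thesis
        unfolding lin2[OF i] by (simp add: abs_le_iff)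
    qed
    with x show "x \<in> Box n (R + 1)" by (simp add: Box_def)
  qed
  have sub: "?S \<subseteq> K + Box n r"
  proof
    fix x assume x: "x \<in> ?S"
    have "x \<notin> ?C"
    proof
      assume "x \<in> ?C"
      then obtain p where "p \<in> F1" "lin n p x > 0" using F1(3) by blast
      then show False using lin_le[OF x, of p] by (simp add: F_def)
    qed
    then obtain k where k: "k \<in> K" "\<forall>i<n. \<bar>x i - k i\<bar> < r" using SB x by blast
    have "x - k \<in> Box n r"
      using k x body_Rn[OF K] by (auto simp: Box_def less_imp_le intro!: Rn_diff)
    then have "k + (x - k) \<in> K + Box n r" using k(1) by (intro set_plus_intro)
    then show "x \<in> K + Box n r" by simp
  qed
  have fc: "continuous_on UNIV ?f" unfolding smoothing_def[abs_def]
    by (intro continuous_on_diff continuous_on_add continuous_on_sum continuous_on_exp continuous_on_mult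
        continuous_on_power continuous_on_const continuous_coord continuous_lin)
  have "closed (Rn n \<inter> {x. ?f x \<le> 0})"
    by (intro closed_Int closed_Rn closed_Collect_le fc continuous_on_const)
  moreover have "?S = Box n (R + 1) \<inter> (Rn n \<inter> {x. ?f x \<le> 0})" using SB by blast
  ultimately have cpt: "compact ?S" using compact_Int_closed[OF compact_Box] by metis
  obtain k where k: "k \<in> K" using body_ne[OF K] by blast
  have "?S \<in> smooth_convex_bodies n"
    by (rule smooth_sublevel[OF F(1) c _ neg[OF k] cpt]) (use k body_Rn[OF K] in blast)
  moreover have "K \<subseteq> ?S" using neg body_Rn[OF K] by (auto intro: less_imp_le)
  ultimately show ?thesis using sub by (rule that)
qed

subsection \<open>Steiner polynomials\<close>

text \<open>Pairs of exponents carry the value \<open>undefined\<close> off {0, 1}, because the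
  multi-indices in \<open>mindex\<close> are extensional functions.\<close>

lemma sum_mindex_2:
  "(\<Sum>a\<in>mindex 2 d. h a) = (\<Sum>x\<le>d. \<Sum>y\<le>d. h ((\<lambda>_. undefined)(0 := x, 1 := y)))"
  by (simp only: numeral_2_eq_2 One_nat_def sum_PiE_Suc lessThan_0 PiE_empty_domain
      sum.insert[OF finite.emptyI] empty_iff not_False_eq_True sum.empty add_0_right)

lemma mixed_volume_two:
  assumes L: "convex_body n L" and M: "convex_body n M" and d: "n \<le> d" and j: "j \<le> n"
  defines "K \<equiv> \<lambda>i::nat. if i = 0 then L else M"
  shows "real (n choose j) * mixed_volume n (replicate (n - j) L @ replicate j M) =
    mcoeff d 2 (mvol n 2 K) ((\<lambda>_. undefined)(0 := n - j, 1 := j))"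
proof -
  let ?blk = "\<lambda>i. if i < n - j then 0 else 1 :: nat"
  have K: "convex_body n (K i)" for i using L M by (simp add: K_def)
  have k: "restrict (\<lambda>i. card {l. l < n \<and> ?blk l = i}) {..<2} = (\<lambda>_. undefined)(0 := n - j, 1 := j)"
  proof
    fix i :: nat
    have 0: "{l. l < n \<and> ?blk l = 0} = {..<n - j}" by auto
    have 1: "{l. l < n \<and> ?blk l = 1} = {n - j..<n}" by auto
    consider "i = 0" | "i = 1" | "i \<ge> 2" by linarith
    then show "restrict (\<lambda>i. card {l. l < n \<and> ?blk l = i}) {..<2} i = ((\<lambda>_. undefined)(0 := n - j, 1 := j)) i"
    proof cases
      case 1
      then show ?thesis by (simp only: restrict_apply 0) simp
    next
      case 2
      then show ?thesis using j by (simp only: restrict_apply 1) simp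
    qed simp
  qed
  have "mixed_volume n (replicate (n - j) L @ replicate j M) =
      mcoeff d 2 (mvol n 2 K) (restrict (\<lambda>i. card {l. l < n \<and> ?blk l = i}) {..<2}) *
      (\<Prod>i<2. fact ((restrict (\<lambda>i. card {l. l < n \<and> ?blk l = i}) {..<2}) i)) / fact n"
    by (rule mixed_volume_mcoeff[OF K d]) (auto simp: K_def nth_append)
  then have "mixed_volume n (replicate (n - j) L @ replicate j M) =
      mcoeff d 2 (mvol n 2 K) ((\<lambda>_. undefined)(0 := n - j, 1 := j)) * (fact (n - j) * fact j) / fact n"
    unfolding k by (simp add: numeral_2_eq_2)
  then show ?thesis using j by (simp add: binomial_fact field_simps)
qed

lemma steiner:
  assumes L: "convex_body n L" and M: "convex_body n M" and s: "s \<ge> 0"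
  shows "vol n (L + dil s M) =
    (\<Sum>j\<le>n. real (n choose j) * mixed_volume n (replicate (n - j) L @ replicate j M) * s ^ j)"
proof -
  let ?K = "\<lambda>i::nat. if i = 0 then L else M"
  let ?c = "\<lambda>i::nat. if i = 0 then 1 else s"
  let ?h = "\<lambda>x y. mcoeff n 2 (mvol n 2 ?K) ((\<lambda>_. undefined)(0 := x, 1 := y))"
  have K: "convex_body n (?K i)" for i using L M by simp
  have "vol n (L + dil s M) = mvol n 2 ?K ?c"
    by (simp add: mvol_def numeral_2_eq_2)
  also have "\<dots> = (\<Sum>a\<in>mindex 2 n. mcoeff n 2 (mvol n 2 ?K) a * (\<Prod>j<2. ?c j ^ a j))"
    by (rule mvol_expand[OF K order_refl]) (use s in auto)
  also have "\<dots> = (\<Sum>x\<le>n. \<Sum>y\<le>n. ?h x y * s ^ y)"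
    unfolding sum_mindex_2 by (simp add: numeral_2_eq_2)
  also have "\<dots> = (\<Sum>y\<le>n. \<Sum>x\<le>n. ?h x y * s ^ y)" by (rule sum.swap)
  also have "\<dots> = (\<Sum>y\<le>n. ?h (n - y) y * s ^ y)"
  proof (rule sum.cong[OF refl])
    fix y assume y: "y \<in> {..n}"
    have "?h x y = 0" if "x \<le> n" "x \<noteq> n - y" for x
    proof (rule mvol_homogeneous[OF K order_refl])
      show "(\<lambda>_. undefined)(0 := x, 1 := y) \<in> mindex 2 n"
        using that y by (auto simp: PiE_iff extensional_def numeral_2_eq_2 less_Suc_eq)
      show "(\<Sum>j<(2::nat). ((\<lambda>_. undefined)(0 := x, 1 := y)) j) \<noteq> n"
        using that y by (auto simp: numeral_2_eq_2)
    qed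
    then have "(\<Sum>x\<le>n. ?h x y * s ^ y) = (\<Sum>x\<le>n. if x = n - y then ?h (n - y) y * s ^ y else 0)"
      by (intro sum.cong) auto
    then show "(\<Sum>x\<le>n. ?h x y * s ^ y) = ?h (n - y) y * s ^ y" by simp
  qed
  also have "\<dots> = (\<Sum>j\<le>n. real (n choose j) * mixed_volume n (replicate (n - j) L @ replicate j M) * s ^ j)"
    by (intro sum.cong refl) (simp add: mixed_volume_two[OF L M order_refl])
  finally show ?thesis .
qed

text \<open>Interpolation of the Steiner polynomial expresses a mixed volume by volumes of sums with
  positive dilates of \<open>M\<close>, to which the prescribed product applies. Any interpolation
  degree from \<open>n\<close> on is admissible; a larger one is used for the product.\<close>

lemma steiner_coefficient:
  assumes L: "convex_body n L" and M: "convex_body n M" and d: "n \<le> d" and j: "j \<le> n"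
  shows "real (n choose j) * mixed_volume n (replicate (n - j) L @ replicate j M) =
    (\<Sum>g\<le>d. coeff (lag d g) j * vol n (L + dil (real g + 1) M))"
proof -
  let ?c = "\<lambda>j. real (n choose j) * mixed_volume n (replicate (n - j) L @ replicate j M)"
  define q where "q = (\<Sum>j\<le>n. monom (?c j) j)"
  have q: "poly q s = vol n (L + dil s M)" if "s \<ge> 0" for s
    unfolding steiner[OF L M that] by (simp add: q_def poly_sum poly_monom)
  have cq: "coeff q j = ?c j" using j by (simp add: q_def coeff_sum)
  have "degree q \<le> n" unfolding q_def by (rule degree_sum_le) (auto intro: order_trans[OF degree_monom_le])
  then have "q = (\<Sum>g\<le>d. smult (poly q (real g + 1)) (lag d g))" using d by (intro poly_lagrange) auto
  then have "coeff q j = coeff (\<Sum>g\<le>d. smult (poly q (real g + 1)) (lag d g)) j" by (rule arg_cong)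
  also have "\<dots> = (\<Sum>g\<le>d. coeff (lag d g) j * poly q (real g + 1))" by (simp add: coeff_sum mult.commute)
  also have "\<dots> = (\<Sum>g\<le>d. coeff (lag d g) j * vol n (L + dil (real g + 1) M))" by (simp add: q)
  finally show ?thesis unfolding cq .
qed

text \<open>The top Steiner coefficient for \<open>L = {0}\<close>, where the polynomial is the
  single monomial s^n vol K.\<close>

lemma mixed_volume_self:
  assumes K: "convex_body n K" shows "mixed_volume n (replicate n K) = vol n K"
proof -
  have Z: "convex_body n {0}" by (rule body_sing) simp
  have "vol n ({0} + dil s K) = s ^ n * vol n K" if "s > 0" for s
    using vol_dil[OF K that] by (simp add: set_zero[symmetric] del: set_zero)
  then have "real (n choose n) * mixed_volume n (replicate (n - n) {0} @ replicate n K) =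
      (\<Sum>g\<le>n. coeff (lag n g) n * (real g + 1) ^ n) * vol n K"
    unfolding steiner_coefficient[OF Z K order_refl order_refl] sum_distrib_right by (intro sum.cong refl) simp
  then show ?thesis by (simp add: lag_biorthogonal)
qed

subsection \<open>Smooth valuations as combinations of volumes of sums\<close>

interpretation VS: vector_space scale_val
  by (rule vector_space_scale_val)

text \<open>The valuations on which the product is prescribed; for smooth \<open>M\<close> they span
  all smooth valuations.\<close>

definition vol_sum :: "nat \<Rightarrow> (nat \<Rightarrow> real) set \<Rightarrow> (nat \<Rightarrow> real) set \<Rightarrow> complex"
  where "vol_sum n M = on_bodies n (\<lambda>L. complex_of_real (vol n (L + M)))"

lemma vol_sum_body: "convex_body n L \<Longrightarrow> vol_sum n M L = complex_of_real (vol n (L + M))"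
  by (simp add: vol_sum_def on_bodies_def)

lemma vol_sum_nonbody: "\<not> convex_body n L \<Longrightarrow> vol_sum n M L = 0"
  by (simp add: vol_sum_def on_bodies_def)

lemma mixed_valuation_body:
  "convex_body n L \<Longrightarrow> mixed_valuation n k Ks L = complex_of_real (mixed_volume n (replicate k L @ Ks))"
  by (simp add: mixed_valuation_def on_bodies_def)

lemma mixed_valuation_nonbody: "\<not> convex_body n L \<Longrightarrow> mixed_valuation n k Ks L = 0"
  by (simp add: mixed_valuation_def on_bodies_def)

lemma sum_scale_val_apply: "(\<Sum>a\<in>A. scale_val (c a) (f a)) L = (\<Sum>a\<in>A. c a * f a L)"
  by (induction A rule: infinite_finite_induct) (auto simp: scale_val_def)

lemma on_bodies_eqI:
  assumes "\<And>L. convex_body n L \<Longrightarrow> \<phi> L = \<psi> L" "\<And>L. \<not> convex_body n L \<Longrightarrow> \<phi> L = 0"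
    "\<And>L. \<not> convex_body n L \<Longrightarrow> \<psi> L = 0"
  shows "\<phi> = \<psi>"
  using assms by (metis ext)

text \<open>Steiner's formula at s = 1.\<close>

lemma vol_sum_in_smooth_valuations:
  assumes M: "M \<in> smooth_convex_bodies n"
  shows "vol_sum n M \<in> smooth_valuations n"
proof -
  let ?f = "\<lambda>j. mixed_valuation n (n - j) (replicate j M)"
  have "vol_sum n M = (\<Sum>j\<in>{..n}. scale_val (of_real (real (n choose j))) (?f j))"
  proof (rule on_bodies_eqI[of n])
    fix L assume L: "convex_body n L"
    show "vol_sum n M L = (\<Sum>j\<in>{..n}. scale_val (of_real (real (n choose j))) (?f j)) L"
      using steiner[OF L smooth_body[OF M], of 1]
      by (simp add: sum_scale_val_apply vol_sum_body[OF L] mixed_valuation_body[OF L])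
  qed (auto simp: vol_sum_nonbody sum_scale_val_apply mixed_valuation_nonbody)
  also have "\<dots> \<in> smooth_valuations n"
    unfolding smooth_valuations_def
  proof (intro VS.span_sum VS.span_scale VS.span_base CollectI exI conjI)
    fix j assume "j \<in> {..n}"
    then show "n - j \<le> n" "length (replicate j M) = n - (n - j)" by auto
    show "set (replicate j M) \<subseteq> smooth_convex_bodies n" using M by auto
  qed (rule refl)
  finally show ?thesis .
qed

lemma mixed_valuation_replicate:
  assumes M: "convex_body n M" and j: "j \<le> n" and d: "n \<le> d"
  shows "mixed_valuation n (n - j) (replicate j M) =
    (\<Sum>g\<in>{..d}. scale_val (of_real (coeff (lag d g) j / real (n choose j))) (vol_sum n (dil (real g + 1) M)))"
proof (rule on_bodies_eqI[of n])
  fix L assume L: "convex_body n L"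
  have "real (n choose j) \<noteq> 0" using j by simp
  then have "mixed_volume n (replicate (n - j) L @ replicate j M) =
      (\<Sum>g\<le>d. coeff (lag d g) j * vol n (L + dil (real g + 1) M)) / real (n choose j)"
    using steiner_coefficient[OF L M d j] by (simp add: field_simps)
  then show "mixed_valuation n (n - j) (replicate j M) L =
    (\<Sum>g\<in>{..d}. scale_val (of_real (coeff (lag d g) j / real (n choose j))) (vol_sum n (dil (real g + 1) M))) L"
    by (simp add: sum_scale_val_apply vol_sum_body[OF L] mixed_valuation_body[OF L] sum_divide_distrib)
qed (auto simp: vol_sum_nonbody sum_scale_val_apply mixed_valuation_nonbody)

lemma smooth_body_sum:
  "finite I \<Longrightarrow> I \<noteq> {} \<Longrightarrow> (\<And>i. i \<in> I \<Longrightarrow> A i \<in> smooth_convex_bodies n) \<Longrightarrow>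
    (\<Sum>i\<in>I. A i) \<in> smooth_convex_bodies n"
  by (induction I rule: finite_ne_induct) (auto intro: smooth_body_plus)

lemma exists_smooth_body:
  obtains K where "K \<in> smooth_convex_bodies n" "vol n K > 0"
proof -
  obtain K where K: "K \<in> smooth_convex_bodies n" "Box n 1 \<subseteq> K"
    using smooth_approx[OF body_Box, of 1 1 n] by (metis zero_less_one zero_le_one)
  have "vol n (Box n 1) \<le> vol n K" by (rule vol_mono_body[OF body_Box smooth_body[OF K(1)] K(2)]) simp
  moreover have "vol n (Box n 1) > 0" by (simp add: vol_Box)
  ultimately show ?thesis using that[OF K(1)] by linarith
qed

text \<open>
  By polarization, a mixed volume is a combination of volumes of \<open>a L + M\<close> with \<open>a > 0\<close>, which
  homogeneity reduces to \<open>L + M / a\<close>. Only the degrees \<open>0\<close> and \<open>n\<close> need a separate argument.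
\<close>

lemma smooth_valuations_subset:
  "smooth_valuations n \<subseteq> VS.span (vol_sum n ` smooth_convex_bodies n)"
  unfolding smooth_valuations_def
proof (rule VS.span_minimal[OF _ VS.subspace_span], rule subsetI)
  fix \<phi> assume "\<phi> \<in> {mixed_valuation n k Ks |k Ks. k \<le> n \<and> length Ks = n - k \<and> set Ks \<subseteq> smooth_convex_bodies n}"
  then obtain k Ks where \<phi>: "\<phi> = mixed_valuation n k Ks" "k \<le> n" "length Ks = n - k" "set Ks \<subseteq> smooth_convex_bodies n"
    by blast
  let ?S = "VS.span (vol_sum n ` smooth_convex_bodies n)"
  obtain K where K: "K \<in> smooth_convex_bodies n" "vol n K > 0" by (rule exists_smooth_body)
  have rep: "mixed_valuation n (n - j) (replicate j K) \<in> ?S" if "j \<le> n" for j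
    unfolding mixed_valuation_replicate[OF smooth_body[OF K(1)] that order_refl]
    by (intro VS.span_sum VS.span_scale VS.span_base imageI smooth_body_dil K) simp
  show "\<phi> \<in> ?S"
  proof (cases "k = 0 \<or> k = n")
    case True
    show ?thesis
    proof (cases "k = n")
      case True
      then have "Ks = []" using \<phi> by simp
      then show ?thesis using rep[of 0] \<phi>(1) True by simp
    next
      case False
      then have k: "k = 0" using \<open>k = 0 \<or> k = n\<close> by simp
      \<comment> \<open>In degree 0 the body \<open>L\<close> does not occur, so the valuation is
        constant on bodies. Such constants are multiples of the mixed volume of \<open>n\<close>
        copies of \<open>K\<close>, which is \<open>vol n K > 0\<close>.\<close>
      let ?c = "of_real (mixed_volume n Ks / vol n K)"
      have "\<phi> = scale_val ?c (mixed_valuation n (n - n) (replicate n K))"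
      proof (rule on_bodies_eqI[of n])
        fix L assume L: "convex_body n L"
        show "\<phi> L = scale_val ?c (mixed_valuation n (n - n) (replicate n K)) L"
          using K(2) unfolding \<phi>(1) scale_val_def mixed_valuation_body[OF L]
          by (simp add: k mixed_volume_self[OF smooth_body[OF K(1)]])
      qed (simp_all add: \<phi>(1) scale_val_def mixed_valuation_nonbody)
      then show ?thesis using VS.span_scale[OF rep[of n]] by simp
    qed
  next
    case False
    then have k: "0 < k" "k < n" using \<phi>(2) by auto
    let ?Ks = "\<lambda>L. replicate k L @ Ks"
    \<comment> \<open>At the grid point \<open>g\<close>, the \<open>k\<close> copies of
      \<open>L\<close> merge into one dilate with factor \<open>a g\<close>, and the fixed bodies
      into \<open>M g\<close>. Here \<open>0 < k\<close> makes the factor positive, and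
      \<open>k < n\<close> makes \<open>M g\<close> a nonempty sum of smooth bodies.\<close>
    define a where "a g = (\<Sum>j<k. real (g j) + 1)" for g :: "nat \<Rightarrow> nat"
    define M where "M g = (\<Sum>j\<in>{k..<n}. dil (real (g j) + 1) (Ks ! (j - k)))" for g :: "nat \<Rightarrow> nat"
    have a: "a g > 0" for g unfolding a_def using k by (intro sum_pos) auto
    have Ksj: "Ks ! (j - k) \<in> smooth_convex_bodies n" if "j \<in> {k..<n}" for j
      using \<phi>(3,4) that by (metis nth_mem subsetD diff_less_mono atLeastLessThan_iff)
    have M: "M g \<in> smooth_convex_bodies n" for g
      unfolding M_def using k by (intro smooth_body_sum smooth_body_dil Ksj) auto
    let ?c = "\<lambda>g. (\<Prod>j<n. coeff (lag n (g j)) 1) * a g ^ n / fact n"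
    have "\<phi> = (\<Sum>g\<in>mindex n n. scale_val (of_real (?c g)) (vol_sum n (dil (1 / a g) (M g))))"
    proof (rule on_bodies_eqI[of n])
      fix L assume L: "convex_body n L"
      have Kb: "convex_body n (?Ks L ! j)" if "j < n" for j
      proof (cases "j < k")
        case False
        then show ?thesis using smooth_body[OF Ksj[of j]] that by (simp add: nth_append)
      qed (use L in \<open>simp add: nth_append\<close>)
      \<comment> \<open>Each list position is its own block, so the coefficient in question belongs
        to the exponents (1, ..., 1).\<close>
      have ones: "restrict (\<lambda>j. card {i. i < n \<and> i = j}) {..<n} = restrict (\<lambda>_. 1) {..<n}"
      proof
        fix j
        have "{i. i < n \<and> i = j} = (if j < n then {j} else {})" by auto
        then show "restrict (\<lambda>j. card {i. i < n \<and> i = j}) {..<n} j = restrict (\<lambda>_. 1) {..<n} j" by simp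
      qed
      have v: "mvol n n (\<lambda>j. ?Ks L ! j) (nodes g) = a g ^ n * vol n (L + dil (1 / a g) (M g))" for g
      proof -
        have s: "{..<n} = {..<k} \<union> {k..<n}" using k by auto
        have "(\<Sum>j<n. dil (nodes g j) (?Ks L ! j)) =
            (\<Sum>j<k. dil (nodes g j) (?Ks L ! j)) + (\<Sum>j\<in>{k..<n}. dil (nodes g j) (?Ks L ! j))"
          unfolding s by (rule sum.union_disjoint) auto
        also have "(\<Sum>j\<in>{k..<n}. dil (nodes g j) (?Ks L ! j)) = M g"
          unfolding M_def by (intro sum.cong) (auto simp: nth_append nodes_def)
        also have "(\<Sum>j<k. dil (nodes g j) (?Ks L ! j)) = (\<Sum>j<k. dil (real (g j) + 1) L)"
          by (intro sum.cong) (auto simp: nth_append nodes_def)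
        also have "\<dots> = dil (a g) L"
        proof -
          have "(\<Sum>j<m. dil (real (g j) + 1) L) = dil (\<Sum>j<m. real (g j) + 1) L" for m
          proof (induction m)
            case 0
            then show ?case using dil_0[OF body_ne[OF L]] by simp
          next
            case (Suc m)
            have "0 \<le> (\<Sum>j<m. real (g j) + 1)" by (intro sum_nonneg) auto
            then show ?case using Suc dil_add[OF body_convex[OF L], of "\<Sum>j<m. real (g j) + 1" "real (g m) + 1"]
              by (simp del: sum.distrib)
          qed
          then show ?thesis by (simp add: a_def)
        qed
        also have "dil (a g) L + M g = dil (a g) (L + dil (1 / a g) (M g))"
          using a[of g] by (simp add: dil_set_plus dil_dil)
        finally show ?thesis
          unfolding mvol_def using vol_dil[OF body_plus[OF L body_dil[OF smooth_body[OF M[of g]]]] a[of g], of "1 / a g"] by simp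
      qed
      have "mixed_volume n (?Ks L) = mcoeff n n (mvol n n (\<lambda>j. ?Ks L ! j)) (restrict (\<lambda>j. card {i. i < n \<and> i = j}) {..<n}) *
          (\<Prod>j<n. fact (restrict (\<lambda>j. card {i. i < n \<and> i = j}) {..<n} j)) / fact n"
        by (rule mixed_volume_mcoeff[OF Kb order_refl]) auto
      then have "mixed_volume n (?Ks L) = mcoeff n n (mvol n n (\<lambda>j. ?Ks L ! j)) (restrict (\<lambda>_. 1) {..<n}) / fact n"
        unfolding ones by simp
      also have "\<dots> = (\<Sum>g\<in>mindex n n. ?c g * vol n (L + dil (1 / a g) (M g)))"
        by (simp add: mcoeff_def v sum_divide_distrib mult_ac)
      finally show "\<phi> L = (\<Sum>g\<in>mindex n n. scale_val (of_real (?c g)) (vol_sum n (dil (1 / a g) (M g)))) L"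
        unfolding \<phi>(1) by (simp add: sum_scale_val_apply vol_sum_body[OF L] mixed_valuation_body[OF L])
    qed (simp_all add: \<phi>(1) vol_sum_nonbody sum_scale_val_apply mixed_valuation_nonbody)
    also have "\<dots> \<in> ?S"
      using a by (intro VS.span_sum VS.span_scale VS.span_base imageI smooth_body_dil M) simp
    finally show ?thesis .
  qed
qed

text \<open>Indexing the combination by bodies instead of valuations makes the bodies available for
  Fubini's theorem.\<close>

lemma smooth_valuation_representation:
  assumes "\<phi> \<in> smooth_valuations n"
  obtains t c where "finite t" "t \<subseteq> smooth_convex_bodies n" "\<phi> = (\<Sum>M\<in>t. scale_val (c M) (vol_sum n M))"
proof -
  have "\<phi> \<in> VS.span (vol_sum n ` smooth_convex_bodies n)" using assms smooth_valuations_subset by blast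
  then obtain s r where s: "finite s" "s \<subseteq> vol_sum n ` smooth_convex_bodies n" "\<phi> = (\<Sum>a\<in>s. scale_val (r a) a)"
    unfolding VS.span_explicit by blast
  obtain t where t: "t \<subseteq> smooth_convex_bodies n" "inj_on (vol_sum n) t" "s = vol_sum n ` t"
    using s(2) subset_image_inj[of s "vol_sum n" "smooth_convex_bodies n"] by blast
  have "\<phi> = (\<Sum>M\<in>t. scale_val (r (vol_sum n M)) (vol_sum n M))"
    unfolding s(3) t(3) by (simp add: sum.reindex[OF t(2)])
  moreover have "finite t" using s(1) t(2,3) finite_imageD by blast
  ultimately show ?thesis using that[of t "\<lambda>M. r (vol_sum n M)"] t(1) by blast
qed

subsection \<open>Sums of a diagonal body and bodies in the factors\<close>

definition blk :: "nat \<Rightarrow> nat \<Rightarrow> (nat \<Rightarrow> real) \<Rightarrow> nat \<Rightarrow> real"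
  where "blk n j w = (\<lambda>i. if i < n then w ((j - 1) * n + i) else 0)"

text \<open>The sum of the diagonal copy of \<open>L\<close> and the product of the bodies
  \<open>M 1\<close>, ..., \<open>M p\<close>. Its volume as a function of \<open>L\<close> will be
  the product of the valuations \<open>vol_sum n (M j)\<close>.\<close>

definition diag_sum :: "nat \<Rightarrow> nat \<Rightarrow> (nat \<Rightarrow> real) set \<Rightarrow> (nat \<Rightarrow> (nat \<Rightarrow> real) set) \<Rightarrow> (nat \<Rightarrow> real) set"
  where "diag_sum n p L M = diag_embed n p ` L + (\<Sum>j\<in>{1..p}. factor_incl n j ` M j)"

lemma sum_fun_apply: "(\<Sum>j\<in>A. f j) (x :: nat) = (\<Sum>j\<in>A. f j x :: real)"
  by (induction A rule: infinite_finite_induct) auto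

lemma linear_diag_embed: "linear (diag_embed n p)"
  by (rule linearI) (auto simp: diag_embed_def scaleR_fun_apply fun_eq_iff)

lemma linear_factor_incl: "linear (factor_incl n j)"
  by (rule linearI) (auto simp: factor_incl_def scaleR_fun_apply fun_eq_iff)

lemma linear_uminus_fun: "linear (uminus :: (nat \<Rightarrow> real) \<Rightarrow> _)"
  by (rule linearI) (simp_all only: minus_add_distrib scaleR_minus_right)

lemma continuous_diag_embed: "continuous_on S (diag_embed n p)"
  unfolding continuous_on_fun_iff diag_embed_def
  by (intro allI; rename_tac i; case_tac "i < p * n"; simp)

lemma continuous_factor_incl: "continuous_on S (factor_incl n j)"
  unfolding continuous_on_fun_iff factor_incl_def
proof
  fix i
  show "continuous_on S (\<lambda>x. if (j - 1) * n \<le> i \<and> i < j * n then x (i - (j - 1) * n) else (0::real))"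
    by (cases "(j - 1) * n \<le> i \<and> i < j * n") (simp_all only: if_True if_False continuous_coord continuous_on_const simp_thms)
qed

lemma diag_embed_Rn: "diag_embed n p x \<in> Rn (p * n)"
  by (simp add: diag_embed_def Rn_def)

lemma factor_incl_Rn: "j \<le> p \<Longrightarrow> factor_incl n j x \<in> Rn (p * n)"
proof -
  assume "j \<le> p"
  then have "j * n \<le> p * n" by simp
  then have "\<not> i < j * n" if "p * n \<le> i" for i using that by linarith
  then show ?thesis by (simp add: factor_incl_def Rn_def)
qed

lemma body_image:
  assumes "convex_body n K" "linear f" "continuous_on K f" "f ` K \<subseteq> Rn m"
  shows "convex_body m (f ` K)"
  using assms unfolding convex_body_iff
  by (auto intro: convex_linear_image compact_continuous_image)

lemma body_diag: "convex_body n K \<Longrightarrow> convex_body (p * n) (diag_embed n p ` K)"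
  by (rule body_image[OF _ linear_diag_embed continuous_diag_embed]) (auto simp: diag_embed_Rn)

lemma body_factor: "convex_body n K \<Longrightarrow> j \<le> p \<Longrightarrow> convex_body (p * n) (factor_incl n j ` K)"
  by (rule body_image[OF _ linear_factor_incl continuous_factor_incl]) (auto simp: factor_incl_Rn)

lemma body_uminus: "convex_body n K \<Longrightarrow> convex_body n (uminus ` K)"
proof (rule body_image[OF _ linear_uminus_fun])
  assume K: "convex_body n K"
  show "continuous_on K uminus" by (rule continuous_on_fun_minus) (rule continuous_on_id)
  show "uminus ` K \<subseteq> Rn n" using body_Rn[OF K] Rn_minus by blast
qed

lemma linear_image_dil: "linear f \<Longrightarrow> f ` dil c K = dil c (f ` K)"
  unfolding dil_def image_image by (simp only: linear_scale)

lemma linear_image_plus: "linear f \<Longrightarrow> f ` (A + B) = f ` A + f ` B"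
  by (force simp: set_plus_def linear_add)

lemma factor_incl_alt:
  assumes "n > 0" "j \<ge> 1"
  shows "factor_incl n j x i = (if i div n = j - 1 then x (i mod n) else 0)"
proof -
  have "(j - 1) * n \<le> i \<and> i < j * n \<longleftrightarrow> i div n = j - 1"
  proof
    assume a: "(j - 1) * n \<le> i \<and> i < j * n"
    have "j - 1 \<le> i div n" using a assms by (simp add: less_eq_div_iff_mult_less_eq)
    moreover have "i div n < j" using a assms by (simp add: less_mult_imp_div_less)
    ultimately show "i div n = j - 1" by simp
  next
    assume a: "i div n = j - 1"
    have "(i div n) * n + i mod n = i" by (rule div_mult_mod_eq)
    then have "(j - 1) * n + i mod n = i" unfolding a .
    moreover have "i mod n < n" using assms by simp
    moreover have "j * n = (j - 1) * n + n" using assms by (metis Suc_diff_1 Suc_le_lessD add.commute mult_Suc One_nat_def)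
    ultimately show "(j - 1) * n \<le> i \<and> i < j * n" by linarith
  qed
  moreover have "i - (j - 1) * n = i mod n" if "i div n = j - 1"
    using that by (metis minus_div_mult_eq_mod)
  ultimately show ?thesis by (simp add: factor_incl_def)
qed

lemma sum_factor_incl:
  assumes "n > 0"
  shows "(\<Sum>j\<in>{1..p}. factor_incl n j (m j)) i = (if i < p * n then m (i div n + 1) (i mod n) else 0)"
proof -
  have "(\<Sum>j\<in>{1..p}. factor_incl n j (m j)) i = (\<Sum>j\<in>{1..p}. if j = i div n + 1 then m (i div n + 1) (i mod n) else 0)"
    unfolding sum_fun_apply by (intro sum.cong) (auto simp: factor_incl_alt[OF assms])
  also have "\<dots> = (if i div n < p then m (i div n + 1) (i mod n) else 0)" by auto
  also have "i div n < p \<longleftrightarrow> i < p * n" using assms by (simp add: div_less_iff_less_mult)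
  finally show ?thesis .
qed

lemma block_index: "i < n \<Longrightarrow> 1 \<le> j \<Longrightarrow> j \<le> p \<Longrightarrow> (j - 1) * n + i < p * (n :: nat)"
proof -
  assume a: "i < n" "1 \<le> j" "j \<le> p"
  have "(j - 1) * n + i < (j - 1) * n + n" using a by simp
  also have "\<dots> = j * n" using a by (metis Suc_diff_1 Suc_le_lessD add.commute mult_Suc One_nat_def)
  also have "\<dots> \<le> p * n" using a by simp
  finally show ?thesis .
qed

lemma mem_diag_sum:
  assumes n: "n > 0" and L: "L \<subseteq> Rn n" and M: "\<And>j. j \<in> {1..p} \<Longrightarrow> M j \<subseteq> Rn n"
  shows "w \<in> diag_sum n p L M \<longleftrightarrow> w \<in> Rn (p * n) \<and> (\<exists>l\<in>L. \<forall>j\<in>{1..p}. blk n j w - l \<in> M j)"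
proof
  assume "w \<in> diag_sum n p L M"
  then obtain l a where l: "l \<in> L" "a \<in> (\<Sum>j\<in>{1..p}. factor_incl n j ` M j)" "w = diag_embed n p l + a"
    unfolding diag_sum_def by (auto elim!: set_plus_elim)
  then obtain s where s: "\<forall>j\<in>{1..p}. s j \<in> factor_incl n j ` M j" "a = (\<Sum>j\<in>{1..p}. s j)"
    by (auto simp: set_sum_alt)
  then have "\<forall>j. \<exists>m. j \<in> {1..p} \<longrightarrow> m \<in> M j \<and> s j = factor_incl n j m" by blast
  then obtain m where m: "\<And>j. j \<in> {1..p} \<Longrightarrow> m j \<in> M j" "\<And>j. j \<in> {1..p} \<Longrightarrow> s j = factor_incl n j (m j)" by metis
  have a: "a i = (if i < p * n then m (i div n + 1) (i mod n) else 0)" for i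
    using sum_factor_incl[OF n, where m = m and p = p and i = i] m(2) s(2) by simp
  have "blk n j w - l = m j" if j: "j \<in> {1..p}" for j
  proof
    fix i
    show "(blk n j w - l) i = m j i"
    proof (cases "i < n")
      case True
      have "(j - 1) * n + i < p * n" using block_index[OF True] j by simp
      moreover have "((j - 1) * n + i) mod n = i" "((j - 1) * n + i) div n = j - 1" using True n by auto
      ultimately show ?thesis using True j by (simp add: blk_def l(3) a diag_embed_def)
    next
      case False
      have "l \<in> Rn n" "m j \<in> Rn n" using l(1) L M[OF j] m(1)[OF j] by auto
      then show ?thesis using False by (simp add: blk_def Rn_def)
    qed
  qed
  moreover have "w \<in> Rn (p * n)" unfolding l(3) by (rule Rn_add[OF diag_embed_Rn]) (simp add: Rn_def a)
  ultimately show "w \<in> Rn (p * n) \<and> (\<exists>l\<in>L. \<forall>j\<in>{1..p}. blk n j w - l \<in> M j)"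
    using l(1) m(1) by (intro conjI bexI[of _ l] ballI) (simp_all only:)
next
  assume "w \<in> Rn (p * n) \<and> (\<exists>l\<in>L. \<forall>j\<in>{1..p}. blk n j w - l \<in> M j)"
  then obtain l where l: "w \<in> Rn (p * n)" "l \<in> L" "\<And>j. j \<in> {1..p} \<Longrightarrow> blk n j w - l \<in> M j" by blast
  let ?m = "\<lambda>j. blk n j w - l"
  have "w = diag_embed n p l + (\<Sum>j\<in>{1..p}. factor_incl n j (?m j))"
  proof
    fix i
    show "w i = (diag_embed n p l + (\<Sum>j\<in>{1..p}. factor_incl n j (?m j))) i"
    proof (cases "i < p * n")
      case True
      have "i = (i div n) * n + i mod n" by simp
      moreover have "i mod n < n" using n by simp
      ultimately have "blk n (i div n + 1) w (i mod n) = w i" by (simp add: blk_def)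
      then show ?thesis using True by (simp only: plus_fun_apply sum_factor_incl[OF n]) (simp add: diag_embed_def)
    next
      case False
      then show ?thesis using l(1) by (simp only: plus_fun_apply sum_factor_incl[OF n]) (simp add: diag_embed_def Rn_def)
    qed
  qed
  moreover have "(\<Sum>j\<in>{1..p}. factor_incl n j (?m j)) \<in> (\<Sum>j\<in>{1..p}. factor_incl n j ` M j)"
    unfolding set_sum_alt[OF finite_atLeastAtMost]
    by (intro CollectI exI[of _ "\<lambda>j. factor_incl n j (?m j)"] conjI refl ballI imageI l(3))
  then have "diag_embed n p l + (\<Sum>j\<in>{1..p}. factor_incl n j (?m j)) \<in> diag_sum n p L M"
    unfolding diag_sum_def by (intro set_plus_intro imageI l(2))
  ultimately show "w \<in> diag_sum n p L M" by (simp only:)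
qed

lemma diag_sum_empty: "diag_sum n p {} M = {}"
  by (simp add: diag_sum_def)

lemma body_diag_sum:
  assumes "convex_body n L" "\<And>j. j \<in> {1..p} \<Longrightarrow> convex_body n (M j)"
  shows "convex_body (p * n) (diag_sum n p L M)"
  unfolding diag_sum_def
  by (intro body_plus body_diag body_sum body_factor assms) auto

lemma diag_sum_1: "L \<subseteq> Rn n \<Longrightarrow> M 1 \<subseteq> Rn n \<Longrightarrow> diag_sum n 1 L M = L + M 1"
proof -
  assume a: "L \<subseteq> Rn n" "M 1 \<subseteq> Rn n"
  show ?thesis
  proof (cases "n = 0")
    case True
    then have z: "x = 0" if "x \<in> L \<or> x \<in> M 1" for x using a that by (auto simp: Rn_def fun_eq_iff)
    have "diag_embed n 1 ` L = L" using True z by (force simp: diag_embed_def image_iff zero_fun_def)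
    moreover have "factor_incl n 1 ` M 1 = M 1" using True z by (force simp: factor_incl_def image_iff zero_fun_def)
    ultimately show ?thesis by (simp add: diag_sum_def)
  next
    case False
    have "diag_embed n 1 x = x" if "x \<in> Rn n" for x
      using that by (auto simp: diag_embed_def Rn_def fun_eq_iff)
    then have 1: "diag_embed n 1 ` L = L" using a by (force simp: image_iff)
    have "factor_incl n 1 x = x" if "x \<in> Rn n" for x
      using that by (auto simp: factor_incl_def Rn_def fun_eq_iff)
    then have "factor_incl n 1 ` M 1 = M 1" using a by (force simp: image_iff)
    with 1 show ?thesis by (simp add: diag_sum_def)
  qed
qed

lemma diag_sum_cong: "(\<And>j. j \<in> {1..p} \<Longrightarrow> M j = M' j) \<Longrightarrow> diag_sum n p L M = diag_sum n p L M'"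
  unfolding diag_sum_def by (intro arg_cong2[of _ _ _ _ "(+)"] sum.cong) auto

text \<open>The intersection of \<open>L\<close> with the reflected translate y - N. It is again
  convex, so valuations can be evaluated on it.\<close>

definition sect :: "(nat \<Rightarrow> real) set \<Rightarrow> (nat \<Rightarrow> real) set \<Rightarrow> (nat \<Rightarrow> real) \<Rightarrow> (nat \<Rightarrow> real) set"
  where "sect L N y = L \<inter> {l. y - l \<in> N}"

lemma body_sect:
  assumes L: "convex_body n L" and N: "convex_body n N" and ne: "sect L N y \<noteq> {}"
  shows "convex_body n (sect L N y)"
proof -
  have "closed ((\<lambda>l. y - l) -` N)"
  proof (rule closed_vimage)
    show "closed N" by (rule compact_imp_closed[OF body_compact[OF N]])
    show "continuous_on UNIV (\<lambda>l. y - l)"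
      by (rule continuous_on_fun_diff) (rule continuous_on_const, rule continuous_on_id)
  qed
  then have c: "compact (sect L N y)"
    unfolding sect_def using compact_Int_closed[OF body_compact[OF L]] by (simp add: vimage_def)
  have "convex (sect L N y)"
  proof (rule convexI)
    fix a b and u v :: real assume h: "a \<in> sect L N y" "b \<in> sect L N y" "0 \<le> u" "0 \<le> v" "u + v = 1"
    have "u *\<^sub>R a + v *\<^sub>R b \<in> L" by (rule convexD[OF body_convex[OF L]]) (use h in \<open>auto simp: sect_def\<close>)
    moreover have "u *\<^sub>R (y - a) + v *\<^sub>R (y - b) \<in> N"
      by (rule convexD[OF body_convex[OF N]]) (use h in \<open>auto simp: sect_def\<close>)
    moreover have "u *\<^sub>R (y - a) + v *\<^sub>R (y - b) = y - (u *\<^sub>R a + v *\<^sub>R b)"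
    proof -
      have "u *\<^sub>R (y - a) + v *\<^sub>R (y - b) = (u + v) *\<^sub>R y - (u *\<^sub>R a + v *\<^sub>R b)" by (simp only: algebra_simps)
      then show ?thesis using h(5) by simp
    qed
    ultimately show "u *\<^sub>R a + v *\<^sub>R b \<in> sect L N y" unfolding sect_def by simp
  qed
  moreover have "sect L N y \<subseteq> Rn n" using body_Rn[OF L] by (auto simp: sect_def)
  ultimately show ?thesis using c ne by (simp add: convex_body_iff)
qed

text \<open>Fixing the last block at \<open>y\<close> puts the condition y - l \<in> M (p + 1) on
  the diagonal point \<open>l\<close> shared by all blocks. This only shrinks the body on the
  diagonal.\<close>

lemma diag_sum_slice:
  assumes n: "n > 0" and L: "L \<subseteq> Rn n" and M: "\<And>j. j \<in> {1..Suc p} \<Longrightarrow> M j \<subseteq> Rn n" and y: "y \<in> Rn n"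
  shows "{x \<in> Rn (p * n). app (p * n) x y \<in> diag_sum n (Suc p) L M} = diag_sum n p (sect L (M (Suc p)) y) M"
proof (rule set_eqI)
  fix x
  have s: "sect L (M (Suc p)) y \<subseteq> Rn n" using L by (auto simp: sect_def)
  have b1: "blk n j (app (p * n) x y) = blk n j x" if "j \<in> {1..p}" for j
    using block_index[of _ n j p] that by (auto simp: blk_def app_def fun_eq_iff)
  have b2: "blk n (Suc p) (app (p * n) x y) = y"
    using y by (auto simp: blk_def app_def Rn_def fun_eq_iff)
  have r: "app (p * n) x y \<in> Rn (Suc p * n)" if "x \<in> Rn (p * n)"
    using app_Rn[OF that y] by (simp add: add.commute)
  have "{1..Suc p} = insert (Suc p) {1..p}" by auto
  then have "(\<forall>j\<in>{1..Suc p}. blk n j (app (p * n) x y) - l \<in> M j) \<longleftrightarrow>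
      y - l \<in> M (Suc p) \<and> (\<forall>j\<in>{1..p}. blk n j x - l \<in> M j)" for l
    using b1 b2 by auto
  then show "x \<in> {x \<in> Rn (p * n). app (p * n) x y \<in> diag_sum n (Suc p) L M} \<longleftrightarrow>
      x \<in> diag_sum n p (sect L (M (Suc p)) y) M"
    using r mem_diag_sum[OF n L M] mem_diag_sum[OF n s, of p M x] M by (auto simp: sect_def)
qed

lemma diag_sum_integral:
  assumes n: "n > 0" and L: "convex_body n L" and M: "\<And>j. j \<in> {1..Suc p} \<Longrightarrow> convex_body n (M j)"
  shows "has_bochner_integral (lm n)
    (\<lambda>y. indicator (Rn n) y * vol (p * n) (diag_sum n p (sect L (M (Suc p)) y) M)) (vol (Suc p * n) (diag_sum n (Suc p) L M))"
proof -
  have B: "convex_body (p * n + n) (diag_sum n (Suc p) L M)"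
    using body_diag_sum[of n L "Suc p" M, OF L M] by (simp add: add.commute)
  have eq: "indicator (Rn n) y * vol (p * n) {x \<in> Rn (p * n). app (p * n) x y \<in> diag_sum n (Suc p) L M} =
      indicator (Rn n) y * vol (p * n) (diag_sum n p (sect L (M (Suc p)) y) M)" for y
  proof (cases "y \<in> Rn n")
    case True
    then show ?thesis using diag_sum_slice[OF n body_Rn[OF L] body_Rn[OF M] True] by simp
  qed simp
  have "has_bochner_integral (lm n)
    (\<lambda>y. indicator (Rn n) y * vol (p * n) {x \<in> Rn (p * n). app (p * n) x y \<in> diag_sum n (Suc p) L M})
    (vol (p * n + n) (diag_sum n (Suc p) L M))"
    by (rule has_integral_slices[OF body_compact[OF B] body_Rn[OF B]])
  then show ?thesis unfolding eq by (simp add: add.commute)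
qed

subsection \<open>Iterated Alesker products\<close>

definition iprod :: "('a \<Rightarrow> 'a \<Rightarrow> 'a) \<Rightarrow> (nat \<Rightarrow> 'a) \<Rightarrow> nat \<Rightarrow> 'a"
  where "iprod P f p = foldl P (f 0) (map f [1..<Suc p])"

lemma iprod_0: "iprod P f 0 = f 0"
  by (simp add: iprod_def)

lemma iprod_Suc: "iprod P f (Suc p) = P (iprod P f p) (f (Suc p))"
  by (simp add: iprod_def)

lemma iprod_cong: "(\<And>i. i \<le> p \<Longrightarrow> f i = g i) \<Longrightarrow> iprod P f p = iprod P g p"
  by (induction p) (auto simp: iprod_0 iprod_Suc)

locale alesker =
  fixes n :: nat and P :: "((nat \<Rightarrow> real) set \<Rightarrow> complex) \<Rightarrow> ((nat \<Rightarrow> real) set \<Rightarrow> complex) \<Rightarrow>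
    ((nat \<Rightarrow> real) set \<Rightarrow> complex)"
  assumes n: "n > 0" and P: "is_alesker_product n P"
begin

abbreviation "Val \<equiv> smooth_valuations n"

lemma P_closed: "\<phi> \<in> Val \<Longrightarrow> \<psi> \<in> Val \<Longrightarrow> P \<phi> \<psi> \<in> Val"
  using P unfolding is_alesker_product_def by blast

lemma P_add_left: "\<phi> \<in> Val \<Longrightarrow> \<phi>' \<in> Val \<Longrightarrow> \<psi> \<in> Val \<Longrightarrow> P (\<phi> + \<phi>') \<psi> = P \<phi> \<psi> + P \<phi>' \<psi>"
  and P_add_right: "\<phi> \<in> Val \<Longrightarrow> \<phi>' \<in> Val \<Longrightarrow> \<psi> \<in> Val \<Longrightarrow> P \<psi> (\<phi> + \<phi>') = P \<psi> \<phi> + P \<psi> \<phi>'"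
  using P unfolding is_alesker_product_def by blast+

lemma P_scale_left: "\<phi> \<in> Val \<Longrightarrow> \<psi> \<in> Val \<Longrightarrow> P (scale_val c \<phi>) \<psi> = scale_val c (P \<phi> \<psi>)"
  and P_scale_right: "\<phi> \<in> Val \<Longrightarrow> \<psi> \<in> Val \<Longrightarrow> P \<phi> (scale_val c \<psi>) = scale_val c (P \<phi> \<psi>)"
  using P unfolding is_alesker_product_def by blast+

lemma P_vol:
  assumes "K1 \<in> smooth_convex_bodies n" "K2 \<in> smooth_convex_bodies n"
  shows "P (vol_sum n K1) (vol_sum n K2) =
    on_bodies n (\<lambda>K. complex_of_real (vol (2 * n) (diag_embed n 2 ` K + body_product n K1 K2)))"
  using P assms unfolding is_alesker_product_def vol_sum_def by blast

lemma Val_scale: "\<phi> \<in> Val \<Longrightarrow> scale_val c \<phi> \<in> Val"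
  unfolding smooth_valuations_def by (rule VS.span_scale)

lemma Val_sum: "(\<And>a. a \<in> A \<Longrightarrow> f a \<in> Val) \<Longrightarrow> (\<Sum>a\<in>A. f a) \<in> Val"
  unfolding smooth_valuations_def by (rule VS.span_sum)

lemma Val_zero: "0 \<in> Val"
  unfolding smooth_valuations_def by (rule VS.span_zero)

lemma P_zero_left: "\<psi> \<in> Val \<Longrightarrow> P 0 \<psi> = 0"
  using P_scale_left[OF Val_zero, of \<psi> 0] by (simp add: VS.scale_zero_left)

lemma P_zero_right: "\<psi> \<in> Val \<Longrightarrow> P \<psi> 0 = 0"
  using P_scale_right[OF _ Val_zero, of \<psi> 0] by (simp add: VS.scale_zero_left)

lemma P_sum_left:
  assumes "\<psi> \<in> Val" "\<And>a. a \<in> A \<Longrightarrow> f a \<in> Val"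
  shows "P (\<Sum>a\<in>A. scale_val (c a) (f a)) \<psi> = (\<Sum>a\<in>A. scale_val (c a) (P (f a) \<psi>))"
  using assms(2)
proof (induction A rule: infinite_finite_induct)
  case (insert a A)
  then show ?case
    using P_add_left[OF Val_scale Val_sum assms(1), of "f a" A "\<lambda>a. scale_val (c a) (f a)" "c a"] assms(1)
    by (simp add: P_scale_left Val_scale del: plus_fun_apply)
qed (simp_all only: sum.infinite sum.empty not_False_eq_True P_zero_left[OF assms(1)])

lemma P_sum_right:
  assumes "\<psi> \<in> Val" "\<And>a. a \<in> A \<Longrightarrow> f a \<in> Val"
  shows "P \<psi> (\<Sum>a\<in>A. scale_val (c a) (f a)) = (\<Sum>a\<in>A. scale_val (c a) (P \<psi> (f a)))"
  using assms(2)
proof (induction A rule: infinite_finite_induct)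
  case (insert a A)
  then show ?case
    using P_add_right[OF Val_scale Val_sum assms(1), of "f a" A "\<lambda>a. scale_val (c a) (f a)" "c a"] assms(1)
    by (simp add: P_scale_right Val_scale del: plus_fun_apply)
qed (simp_all only: sum.infinite sum.empty not_False_eq_True P_zero_right[OF assms(1)])

text \<open>
  Write \<open>\<phi>\<close> as a combination of the valuations \<open>vol_sum n A\<close>. By Fubini, both sides are integrals
  over \<open>y\<close> of the value of \<open>\<phi>\<close> on the convex body \<open>L \<inter> (y - M (p + 1))\<close>.
\<close>

lemma product_step:
  assumes \<phi>: "\<phi> \<in> Val" "\<And>L. convex_body n L \<Longrightarrow> \<phi> L = of_real (vol (p * n) (diag_sum n p L M))"
    and M: "\<And>j. j \<in> {1..Suc p} \<Longrightarrow> convex_body n (M j)" and N: "M (Suc p) \<in> smooth_convex_bodies n"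
    and L: "convex_body n L"
  shows "P \<phi> (vol_sum n (M (Suc p))) L = of_real (vol (Suc p * n) (diag_sum n (Suc p) L M))"
proof -
  let ?N = "M (Suc p)"
  note bN = smooth_body[OF N]
  obtain t c where t: "finite t" "t \<subseteq> smooth_convex_bodies n" "\<phi> = (\<Sum>A\<in>t. scale_val (c A) (vol_sum n A))"
    using smooth_valuation_representation[OF \<phi>(1)] .
  \<comment> \<open>Presents the pair of bodies in the product rule as a \<open>diag_sum\<close>
    with two factors, so that both sides of the claim are sliced by the same lemma.\<close>
  let ?M2 = "\<lambda>A j. if j = 1 then A else ?N"
  have two: "P (vol_sum n A) (vol_sum n ?N) L = of_real (vol (Suc 1 * n) (diag_sum n (Suc 1) L (?M2 A)))" if A: "A \<in> t" for A
  proof -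
    have "body_product n A ?N = factor_incl n 1 ` A + factor_incl n 2 ` ?N"
      by (auto simp: body_product_def set_plus_def)
    moreover have "{1..Suc 1} = {1, 2::nat}" by auto
    ultimately have "diag_embed n 2 ` L + body_product n A ?N = diag_sum n (Suc 1) L (?M2 A)"
      by (simp add: diag_sum_def numeral_2_eq_2)
    then show ?thesis
      using P_vol[of A ?N] t(2) A N L by (auto simp: on_bodies_def numeral_2_eq_2)
  qed
  have "has_bochner_integral (lm n)
     (\<lambda>y. \<Sum>A\<in>t. c A * of_real (indicator (Rn n) y * vol (1 * n) (diag_sum n 1 (sect L ?N y) (?M2 A))))
     (\<Sum>A\<in>t. c A * of_real (vol (Suc 1 * n) (diag_sum n (Suc 1) L (?M2 A))))"
  proof (rule has_bochner_integral_sum, rule has_bochner_integral_mult_right)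
    fix A assume A: "A \<in> t"
    have "has_bochner_integral (lm n)
      (\<lambda>y. indicator (Rn n) y * vol (1 * n) (diag_sum n 1 (sect L (?M2 A (Suc 1)) y) (?M2 A)))
      (vol (Suc 1 * n) (diag_sum n (Suc 1) L (?M2 A)))"
      by (rule diag_sum_integral[OF n L]) (use A t(2) smooth_body bN in auto)
    moreover have "?M2 A (Suc 1) = ?N" by simp
    ultimately have "has_bochner_integral (lm n)
      (\<lambda>y. indicator (Rn n) y * vol (1 * n) (diag_sum n 1 (sect L ?N y) (?M2 A)))
      (vol (Suc 1 * n) (diag_sum n (Suc 1) L (?M2 A)))" by (simp only:)
    then show "has_bochner_integral (lm n)
      (\<lambda>y. complex_of_real (indicator (Rn n) y * vol (1 * n) (diag_sum n 1 (sect L ?N y) (?M2 A))))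
      (complex_of_real (vol (Suc 1 * n) (diag_sum n (Suc 1) L (?M2 A))))"
      by (rule has_bochner_integral_bounded_linear[OF bounded_linear_of_real])
  qed
  \<comment> \<open>For a nonempty section the combination of slice volumes is the value of \<phi>
    at this body, to which the assumed formula for \<phi> applies. For an empty section both sides
    are zero.\<close>
  moreover have "(\<Sum>A\<in>t. c A * of_real (indicator (Rn n) y * vol (1 * n) (diag_sum n 1 (sect L ?N y) (?M2 A)))) =
      of_real (indicator (Rn n) y * vol (p * n) (diag_sum n p (sect L ?N y) M))" for y
  proof (cases "sect L ?N y = {}")
    case True
    then show ?thesis by (simp add: diag_sum_empty)
  next
    case False
    note b = body_sect[OF L bN False]
    have "(\<Sum>A\<in>t. c A * of_real (vol (1 * n) (diag_sum n 1 (sect L ?N y) (?M2 A)))) = (\<Sum>A\<in>t. c A * vol_sum n A (sect L ?N y))"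
    proof (rule sum.cong[OF refl])
      fix A assume "A \<in> t"
      then have "A \<subseteq> Rn n" using t(2) smooth_body body_Rn by blast
      then show "c A * of_real (vol (1 * n) (diag_sum n 1 (sect L ?N y) (?M2 A))) = c A * vol_sum n A (sect L ?N y)"
        using diag_sum_1[of "sect L ?N y" n "?M2 A"] body_Rn[OF b] by (simp add: vol_sum_body[OF b])
    qed
    also have "\<dots> = \<phi> (sect L ?N y)" unfolding t(3) by (simp only: sum_scale_val_apply)
    also have "\<dots> = of_real (vol (p * n) (diag_sum n p (sect L ?N y) M))" by (rule \<phi>(2)[OF b])
    finally have "of_real (indicator (Rn n) y) * (\<Sum>A\<in>t. c A * of_real (vol (1 * n) (diag_sum n 1 (sect L ?N y) (?M2 A)))) =
      of_real (indicator (Rn n) y * vol (p * n) (diag_sum n p (sect L ?N y) M))" by simp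
    then show ?thesis by (simp add: sum_distrib_left mult_ac)
  qed
  ultimately have "has_bochner_integral (lm n)
     (\<lambda>y. complex_of_real (indicator (Rn n) y * vol (p * n) (diag_sum n p (sect L ?N y) M)))
     (\<Sum>A\<in>t. c A * of_real (vol (Suc 1 * n) (diag_sum n (Suc 1) L (?M2 A))))" by simp
  moreover have "has_bochner_integral (lm n)
     (\<lambda>y. complex_of_real (indicator (Rn n) y * vol (p * n) (diag_sum n p (sect L ?N y) M)))
     (of_real (vol (Suc p * n) (diag_sum n (Suc p) L M)))"
    using has_bochner_integral_bounded_linear[OF bounded_linear_of_real diag_sum_integral[OF n L M]] .
  ultimately have "(\<Sum>A\<in>t. c A * of_real (vol (Suc 1 * n) (diag_sum n (Suc 1) L (?M2 A)))) =
      of_real (vol (Suc p * n) (diag_sum n (Suc p) L M))"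
    by (rule has_bochner_integral_eq)
  moreover have "P \<phi> (vol_sum n ?N) = (\<Sum>A\<in>t. scale_val (c A) (P (vol_sum n A) (vol_sum n ?N)))"
    unfolding t(3) by (rule P_sum_left) (use t(2) N vol_sum_in_smooth_valuations in auto)
  ultimately show ?thesis by (simp add: sum_scale_val_apply two)
qed

text \<open>The shift \<open>j - 1\<close> reconciles the valuations, numbered from 0, with the
  factors of \<open>diag_sum\<close>, numbered from 1.\<close>

lemma iprod_vol_sum:
  assumes M: "\<And>i. i \<le> p \<Longrightarrow> M i \<in> smooth_convex_bodies n"
  shows "iprod P (\<lambda>i. vol_sum n (M i)) p \<in> Val \<and>
    (\<forall>L. convex_body n L \<longrightarrow> iprod P (\<lambda>i. vol_sum n (M i)) p L =
      of_real (vol (Suc p * n) (diag_sum n (Suc p) L (\<lambda>j. M (j - 1)))))"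
  using M
proof (induction p)
  case 0
  have "diag_sum n 1 L (\<lambda>j. M (j - 1)) = L + M 0" if "convex_body n L" for L
    using diag_sum_1[of L n "\<lambda>j. M (j - 1)"] body_Rn[OF that] body_Rn[OF smooth_body[OF 0[of 0]]] by simp
  then show ?case using 0[of 0] by (auto simp: iprod_0 vol_sum_body vol_sum_in_smooth_valuations)
next
  case (Suc p)
  note IH = Suc.IH[OF Suc.prems]
  have v: "vol_sum n (M (Suc p)) \<in> Val" by (rule vol_sum_in_smooth_valuations) (use Suc.prems in auto)
  let ?\<phi> = "iprod P (\<lambda>i. vol_sum n (M i)) p"
  have \<phi>: "?\<phi> \<in> Val" using IH by simp
  have "P ?\<phi> (vol_sum n (M (Suc p))) L = of_real (vol (Suc (Suc p) * n) (diag_sum n (Suc (Suc p)) L (\<lambda>j. M (j - 1))))"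
    if L: "convex_body n L" for L
  proof -
    have "P ?\<phi> (vol_sum n ((\<lambda>j. M (j - 1)) (Suc (Suc p)))) L =
        of_real (vol (Suc (Suc p) * n) (diag_sum n (Suc (Suc p)) L (\<lambda>j. M (j - 1))))"
      by (rule product_step[OF \<phi> _ _ _ L]) (use IH Suc.prems smooth_body in auto)
    then show ?thesis by simp
  qed
  then show ?case using P_closed[OF \<phi> v] by (simp only: iprod_Suc) blast
qed

lemma iprod_Val: "(\<And>i. i \<le> p \<Longrightarrow> f i \<in> Val) \<Longrightarrow> iprod P f p \<in> Val"
  by (induction p) (auto simp: iprod_0 iprod_Suc intro: P_closed)

lemma iprod_multilinear:
  assumes "\<And>i g. i \<le> p \<Longrightarrow> g \<le> d \<Longrightarrow> v i g \<in> Val"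
  shows "iprod P (\<lambda>i. \<Sum>g\<in>{..d}. scale_val (c i g) (v i g)) p =
    (\<Sum>h\<in>mindex (Suc p) d. scale_val (\<Prod>i<Suc p. c i (h i)) (iprod P (\<lambda>i. v i (h i)) p))"
  using assms
proof (induction p)
  case 0
  show ?case
    by (simp only: iprod_0 sum_PiE_Suc lessThan_0 PiE_empty_domain sum.insert[OF finite.emptyI]
        empty_iff not_False_eq_True sum.empty add_0_right) simp
next
  case (Suc p)
  let ?I = "\<lambda>h. iprod P (\<lambda>i. v i (h i)) p"
  have I: "?I h \<in> Val" if "h \<in> mindex (Suc p) d" for h
  proof (rule iprod_Val)
    fix i assume i: "i \<le> p"
    then have "h i \<le> d" using PiE_mem[OF that, of i] by simp
    then show "v i (h i) \<in> Val" using Suc.prems i by simp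
  qed
  have V: "v (Suc p) x \<in> Val" if "x \<in> {..d}" for x using Suc.prems that by simp
  let ?R = "\<Sum>g\<in>{..d}. scale_val (c (Suc p) g) (v (Suc p) g)"
  have R: "?R \<in> Val" by (intro Val_sum Val_scale V)
  have "iprod P (\<lambda>i. \<Sum>g\<in>{..d}. scale_val (c i g) (v i g)) (Suc p) =
      P (\<Sum>h\<in>mindex (Suc p) d. scale_val (\<Prod>i<Suc p. c i (h i)) (?I h)) ?R"
    unfolding iprod_Suc by (subst Suc.IH) (use Suc.prems in auto)
  also have "\<dots> = (\<Sum>h\<in>mindex (Suc p) d. scale_val (\<Prod>i<Suc p. c i (h i)) (P (?I h) ?R))"
    by (rule P_sum_left[OF R I])
  also have "\<dots> = (\<Sum>h\<in>mindex (Suc p) d. \<Sum>x\<in>{..d}.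
      scale_val ((\<Prod>i<Suc p. c i (h i)) * c (Suc p) x) (P (?I h) (v (Suc p) x)))"
  proof (rule sum.cong[OF refl])
    fix h assume h: "h \<in> mindex (Suc p) d"
    have "scale_val e (P (?I h) ?R) = (\<Sum>x\<in>{..d}. scale_val (e * c (Suc p) x) (P (?I h) (v (Suc p) x)))" for e
    proof -
      have "P (?I h) ?R = (\<Sum>x\<in>{..d}. scale_val (c (Suc p) x) (P (?I h) (v (Suc p) x)))"
        by (rule P_sum_right[OF I[OF h] V])
      then show ?thesis by (simp only: VS.scale_sum_right VS.scale_scale)
    qed
    then show "scale_val (\<Prod>i<Suc p. c i (h i)) (P (?I h) ?R) = (\<Sum>x\<in>{..d}.
      scale_val ((\<Prod>i<Suc p. c i (h i)) * c (Suc p) x) (P (?I h) (v (Suc p) x)))" .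
  qed
  also have "\<dots> = (\<Sum>h\<in>mindex (Suc p) d. \<Sum>x\<in>{..d}.
      scale_val (\<Prod>i<Suc (Suc p). c i ((h(Suc p := x)) i)) (iprod P (\<lambda>i. v i ((h(Suc p := x)) i)) (Suc p)))"
  proof (intro sum.cong refl arg_cong2[of _ _ _ _ scale_val])
    fix h :: "nat \<Rightarrow> nat" and x
    show "(\<Prod>i<Suc p. c i (h i)) * c (Suc p) x = (\<Prod>i<Suc (Suc p). c i ((h(Suc p := x)) i))"
      by (simp add: prod.lessThan_Suc)
    show "P (?I h) (v (Suc p) x) = iprod P (\<lambda>i. v i ((h(Suc p := x)) i)) (Suc p)"
      unfolding iprod_Suc using iprod_cong[of p "\<lambda>i. v i ((h(Suc p := x)) i)" "\<lambda>i. v i (h i)" P] by simp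
  qed
  finally show ?case unfolding sum_PiE_Suc[of _ "Suc p"] .
qed

end

subsection \<open>The lowest order term of the product\<close>

text \<open>
  Subtracting the first block from the others turns the sum of \<open>\<Delta> L\<close> and \<open>K \<times> M\<^sub>1 \<times> \<dots> \<times> M\<^sub>p\<close> into a
  set whose fibre over \<open>y\<close> is \<open>L + C y\<close> with \<open>C y \<subseteq> K\<close>, and \<open>C y\<close> is nonempty precisely for \<open>y\<close>
  in \<open>- \<Delta> K + M\<^sub>1 \<times> \<dots> \<times> M\<^sub>p\<close>.
\<close>

definition unshear :: "nat \<Rightarrow> nat \<Rightarrow> (nat \<Rightarrow> real) \<Rightarrow> nat \<Rightarrow> real"
  where "unshear n p w = (\<lambda>i. if i < n then w i else if i < n + p * n then w i - w ((i - n) mod n) else 0)"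

lemma continuous_unshear: "continuous_on S (unshear n p)"
  unfolding continuous_on_fun_iff
proof
  fix i
  consider "i < n" | "\<not> i < n" "i < n + p * n" | "\<not> i < n" "\<not> i < n + p * n" by blast
  then show "continuous_on S (\<lambda>w. unshear n p w i)"
    by cases (simp_all add: unshear_def continuous_on_diff)
qed

lemma app_eq_iff:
  assumes "x \<in> Rn m" "x' \<in> Rn m" shows "app m x y = app m x' y' \<longleftrightarrow> x = x' \<and> y = y'"
proof
  assume a: "app m x y = app m x' y'"
  have "x i = x' i" for i using fun_cong[OF a, of i] assms by (cases "i < m") (auto simp: app_def Rn_def)
  moreover have "y i = y' i" for i using fun_cong[OF a, of "m + i"] by (simp add: app_def)
  ultimately show "x = x' \<and> y = y'" by auto
qed simp

lemma unshear_app: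
  assumes "n > 0" "x \<in> Rn n" "y \<in> Rn (p * n)"
  shows "unshear n p (app n x y) = app n x (y - diag_embed n p x)"
proof
  fix i
  have "(i - n) mod n < n" using assms(1) by simp
  then show "unshear n p (app n x y) i = app n x (y - diag_embed n p x) i"
    using assms(3) by (auto simp: unshear_def app_def diag_embed_def Rn_def)
qed

lemma Rn_split:
  assumes "w \<in> Rn (n + m)" obtains x y where "x \<in> Rn n" "y \<in> Rn m" "w = app n x y"
proof (rule that)
  show "(\<lambda>i. if i < n then w i else 0) \<in> Rn n" by (simp add: Rn_def)
  show "(\<lambda>i. w (n + i)) \<in> Rn m" using assms by (simp add: Rn_def)
  show "w = app n (\<lambda>i. if i < n then w i else 0) (\<lambda>i. w (n + i))" by (auto simp: app_def)
qed

lemma mem_unshear: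
  assumes n: "n > 0" and S: "S \<subseteq> Rn (n + p * n)" and x: "x \<in> Rn n" and y: "y \<in> Rn (p * n)"
  shows "app n x y \<in> unshear n p ` S \<longleftrightarrow> app n x (y + diag_embed n p x) \<in> S"
proof
  assume "app n x y \<in> unshear n p ` S"
  then obtain w where w: "w \<in> S" "app n x y = unshear n p w" by blast
  obtain u v where uv: "u \<in> Rn n" "v \<in> Rn (p * n)" "w = app n u v" using Rn_split w(1) S by blast
  have "app n x y = app n u (v - diag_embed n p u)" using w(2) unshear_app[OF n uv(1,2)] uv(3) by simp
  then have "x = u" "y = v - diag_embed n p u" using app_eq_iff[OF x uv(1)] by simp_all
  then have "v = y + diag_embed n p x" by (simp only: diff_add_cancel)
  then show "app n x (y + diag_embed n p x) \<in> S" using w(1) uv(3) \<open>x = u\<close> by (simp only:)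
next
  assume a: "app n x (y + diag_embed n p x) \<in> S"
  have "unshear n p (app n x (y + diag_embed n p x)) = app n x (y + diag_embed n p x - diag_embed n p x)"
    by (rule unshear_app[OF n x Rn_add[OF y diag_embed_Rn]])
  then show "app n x y \<in> unshear n p ` S" using a by (metis add_diff_cancel_right' imageI)
qed

text \<open>For a fixed first block \<open>x\<close> the slice is only translated, by the diagonal
  image of \<open>x\<close>.\<close>

lemma vol_unshear:
  assumes n: "n > 0" and S: "compact S" "S \<subseteq> Rn (n + p * n)"
  shows "vol (n + p * n) (unshear n p ` S) = vol (n + p * n) S"
proof -
  have c: "compact (unshear n p ` S)" by (rule compact_continuous_image[OF continuous_unshear S(1)])
  have r: "unshear n p ` S \<subseteq> Rn (n + p * n)" by (auto simp: unshear_def Rn_def)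
  have eq: "vol (p * n) {y \<in> Rn (p * n). app n x y \<in> unshear n p ` S} = vol (p * n) {y \<in> Rn (p * n). app n x y \<in> S}"
    if x: "x \<in> Rn n" for x
  proof -
    let ?d = "diag_embed n p x"
    let ?A = "{y \<in> Rn (p * n). app n x y \<in> unshear n p ` S}"
    have d: "?d \<in> Rn (p * n)" by (rule diag_embed_Rn)
    have "{y \<in> Rn (p * n). app n x y \<in> S} = trl ?d ?A"
    proof (intro equalityI subsetI)
      fix y assume y: "y \<in> {y \<in> Rn (p * n). app n x y \<in> S}"
      have m: "y - ?d \<in> Rn (p * n)" using y by (intro Rn_diff d) simp
      have "app n x (y - ?d + ?d) \<in> S" using y by (simp only: diff_add_cancel mem_Collect_eq)
      then have "y - ?d \<in> ?A" using mem_unshear[OF n S(2) x m] m by simp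
      moreover have "y = y - ?d + ?d" by (rule diff_add_cancel[symmetric])
      ultimately show "y \<in> trl ?d ?A" unfolding trl_def by (intro image_eqI[where x = "y - ?d"])
    next
      fix y assume "y \<in> trl ?d ?A"
      then obtain z where z: "z \<in> ?A" "y = z + ?d" unfolding trl_def by blast
      then have zR: "z \<in> Rn (p * n)" by simp
      show "y \<in> {y \<in> Rn (p * n). app n x y \<in> S}"
        unfolding z(2) using mem_unshear[OF n S(2) x zR] z(1) Rn_add[OF zR d] by blast
    qed
    moreover have "vol (p * n) (trl ?d ?A) = vol (p * n) ?A"
      by (rule vol_translate[OF compact_slice2[OF c r] _ d]) auto
    ultimately show ?thesis by simp
  qed
  have "ennreal (vol (n + p * n) (unshear n p ` S)) = ennreal (vol (n + p * n) S)"
    unfolding vol_slices1[OF c r] vol_slices1[OF S]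
    by (rule nn_integral_cong_AE, rule AE_mp[OF AE_in_Rn], rule AE_I2) (simp add: eq)
  then show ?thesis by (simp add: ennreal_inj)
qed

lemma diag_sum_volume_bounds:
  assumes n: "n > 0" and L: "convex_body n L" and K: "convex_body n K"
    and M: "\<And>j. j \<in> {1..p} \<Longrightarrow> convex_body n (M j)"
  defines "T \<equiv> diag_sum n p (uminus ` K) M" and "M' \<equiv> \<lambda>j. if j = 1 then K else M (j - 1)"
  shows "vol n L * vol (p * n) T \<le> vol (Suc p * n) (diag_sum n (Suc p) L M')"
    and "vol (Suc p * n) (diag_sum n (Suc p) L M') \<le> vol n (L + K) * vol (p * n) T"
proof -
  let ?S = "diag_sum n (Suc p) L M'"
  have M': "convex_body n (M' j)" if "j \<in> {1..Suc p}" for j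
  proof (cases "j = 1")
    case False
    then have "j - 1 \<in> {1..p}" using that by auto
    then show ?thesis using M[of "j - 1"] False by (simp add: M'_def)
  qed (simp add: M'_def K)
  have S: "compact ?S" "?S \<subseteq> Rn (n + p * n)"
    using body_diag_sum[of n L "Suc p" M', OF L M'] by (simp_all add: convex_body_iff)
  have c: "compact (unshear n p ` ?S)" by (rule compact_continuous_image[OF continuous_unshear S(1)])
  have r: "unshear n p ` ?S \<subseteq> Rn (n + p * n)" by (auto simp: unshear_def Rn_def)
  have T: "convex_body (p * n) T" unfolding T_def by (rule body_diag_sum[OF body_uminus[OF K] M])
  let ?sl = "\<lambda>y. {x \<in> Rn n. app n x y \<in> unshear n p ` ?S}"
  \<comment> \<open>The possible differences a = x - l between the first block and the diagonal
    point. In the sheared coordinates block \<open>j\<close> of the original point is that of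
    \<open>y\<close> plus \<open>x\<close>, hence the condition on
    \<open>blk n j y + a\<close>.\<close>
  define C where "C y = {a \<in> K. \<forall>j\<in>{1..p}. blk n j y + a \<in> M j}" for y
  have s: "{1..Suc p} = insert 1 {Suc 1..Suc p}" by auto
  have sh: "(\<forall>j\<in>{Suc 1..Suc p}. Q j) \<longleftrightarrow> (\<forall>j\<in>{1..p}. Q (Suc j))" for Q
    by (metis One_nat_def Suc_le_mono atLeastAtMost_iff not0_implies_Suc not_less_eq_eq le0 Suc_n_not_le_n)
  have sl: "?sl y = L + C y" if y: "y \<in> Rn (p * n)" for y
  proof -
    have "app n x y \<in> unshear n p ` ?S \<longleftrightarrow> (\<exists>l\<in>L. x - l \<in> C y)" if x: "x \<in> Rn n" for x
    proof -
      let ?w = "app n x (y + diag_embed n p x)"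
      have w: "?w \<in> Rn (Suc p * n)" using app_Rn[OF x Rn_add[OF y diag_embed_Rn]] by simp
      have b1: "blk n 1 ?w = x" using x by (auto simp: blk_def app_def Rn_def fun_eq_iff)
      have b2: "blk n (Suc j) ?w = blk n j y + x" if "j \<in> {1..p}" for j
      proof
        fix i
        show "blk n (Suc j) ?w i = (blk n j y + x) i"
        proof (cases "i < n")
          case True
          have "(j - 1) * n + i < p * n" using block_index[OF True] that by simp
          moreover have "j * n = (j - 1) * n + n" using that by (cases j) auto
          ultimately show ?thesis using True by (simp add: blk_def app_def diag_embed_def)
        next
          case False
          then show ?thesis using x by (simp add: blk_def Rn_def)
        qed
      qed
      have b3: "blk n j y + x - l = blk n j y + (x - l)" for j l by (rule add_diff_eq[symmetric])
      have "app n x y \<in> unshear n p ` ?S \<longleftrightarrow> (\<exists>l\<in>L. \<forall>j\<in>{1..Suc p}. blk n j ?w - l \<in> M' j)"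
        using mem_unshear[OF n S(2) x y] mem_diag_sum[of n L "Suc p" M' ?w, OF n body_Rn[OF L] body_Rn[OF M']] w by blast
      also have "\<dots> \<longleftrightarrow> (\<exists>l\<in>L. x - l \<in> K \<and> (\<forall>j\<in>{1..p}. blk n j y + (x - l) \<in> M j))"
      proof (rule bex_cong[OF refl])
        fix l
        have "blk n (Suc j) ?w - l \<in> M' (Suc j) \<longleftrightarrow> blk n j y + (x - l) \<in> M j" if "j \<in> {1..p}" for j
          unfolding b2[OF that] b3 using that by (simp add: M'_def)
        moreover have "blk n 1 ?w - l \<in> M' 1 \<longleftrightarrow> x - l \<in> K" unfolding b1 by (simp add: M'_def)
        ultimately show "(\<forall>j\<in>{1..Suc p}. blk n j ?w - l \<in> M' j) \<longleftrightarrow>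
            x - l \<in> K \<and> (\<forall>j\<in>{1..p}. blk n j y + (x - l) \<in> M j)"
          unfolding s ball_simps(7) sh by blast
      qed
      finally show ?thesis by (simp only: C_def mem_Collect_eq)
    qed
    moreover have "x \<in> L + C y \<longleftrightarrow> x \<in> Rn n \<and> (\<exists>l\<in>L. x - l \<in> C y)" for x
    proof
      assume "x \<in> L + C y"
      then obtain l a where la: "l \<in> L" "a \<in> C y" "x = l + a" by (rule set_plus_elim)
      then have "x - l = a" by (simp only: add_diff_cancel_left')
      moreover have "x \<in> Rn n" using la body_Rn[OF L] body_Rn[OF K] unfolding la(3) C_def by (intro Rn_add) auto
      ultimately show "x \<in> Rn n \<and> (\<exists>l\<in>L. x - l \<in> C y)"
        using la(1,2) by (intro conjI bexI[of _ l]) (simp_all only:)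
    next
      assume "x \<in> Rn n \<and> (\<exists>l\<in>L. x - l \<in> C y)"
      then obtain l where "l \<in> L" "x - l \<in> C y" by blast
      then have "l + (x - l) \<in> L + C y" by (rule set_plus_intro)
      then show "x \<in> L + C y" by (simp only: add_diff_cancel_left' add_diff_eq)
    qed
    ultimately show ?thesis by blast
  qed
  have Ce: "C y \<noteq> {} \<longleftrightarrow> y \<in> T" if y: "y \<in> Rn (p * n)" for y
  proof -
    have "y \<in> T \<longleftrightarrow> (\<exists>l\<in>uminus ` K. \<forall>j\<in>{1..p}. blk n j y - l \<in> M j)"
      unfolding T_def using mem_diag_sum[of n "uminus ` K" p M y, OF n body_Rn[OF body_uminus[OF K]] body_Rn[OF M]] y by blast
    also have "\<dots> \<longleftrightarrow> (\<exists>a\<in>K. \<forall>j\<in>{1..p}. blk n j y + a \<in> M j)"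
      by (simp only: bex_simps(7) image_iff diff_minus_eq_add)
    finally show ?thesis by (auto simp: C_def)
  qed
  \<comment> \<open>Over \<open>T\<close> the fibre contains the translate of \<open>L\<close> by a
    point of \<open>C y\<close> and is contained in \<open>L + K\<close>; elsewhere it is empty.
    Integration over \<open>y\<close> gives both bounds.\<close>
  have vs: "ennreal (vol n L) * indicator T y \<le> ennreal (vol n (?sl y)) \<and>
      ennreal (vol n (?sl y)) \<le> ennreal (vol n (L + K)) * indicator T y" if y: "y \<in> Rn (p * n)" for y
  proof (cases "y \<in> T")
    case True
    then obtain a where a: "a \<in> C y" using Ce[OF y] by blast
    then have aR: "a \<in> Rn n" using body_Rn[OF K] by (auto simp: C_def)
    have cs: "compact (?sl y)" by (rule compact_slice1[OF c r])
    have LK: "convex_body n (L + K)" by (rule body_plus[OF L K])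
    have "L + {a} \<subseteq> ?sl y" unfolding sl[OF y] using a by (intro set_plus_mono2) auto
    moreover have "compact (L + {a})" using body_plus[OF L body_sing[OF aR]] by (simp add: convex_body_iff)
    ultimately have "vol n (L + {a}) \<le> vol n (?sl y)" by (intro vol_mono cs) auto
    moreover have "?sl y \<subseteq> L + K" unfolding sl[OF y] by (intro set_plus_mono2) (auto simp: C_def)
    then have "vol n (?sl y) \<le> vol n (L + K)" using cs LK by (intro vol_mono) (auto simp: convex_body_iff)
    ultimately show ?thesis using True by (simp add: vol_trl_body[OF L aR] ennreal_leI)
  next
    case False
    then have "?sl y = {}" using Ce[OF y] sl[OF y] by (simp add: set_plus_def)
    then show ?thesis using False by (simp only: vol_empty) simp
  qed
  have T': "emeasure (lm (p * n)) T = ennreal (vol (p * n) T)" "T \<in> sets (lm (p * n))"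
    using emeasure_vol[OF body_compact[OF T] body_Rn[OF T]] body_compact[OF T] by (simp_all add: borel_compact)
  have i: "(\<integral>\<^sup>+ y. ennreal v * indicator T y \<partial>lm (p * n)) = ennreal (v * vol (p * n) T)" if "v \<ge> 0" for v
    using T' that by (simp add: nn_integral_cmult_indicator ennreal_mult vol_nonneg)
  have e: "ennreal (vol (Suc p * n) ?S) = (\<integral>\<^sup>+ y. ennreal (vol n (?sl y)) \<partial>lm (p * n))"
    using vol_unshear[OF n S] vol_slices2[OF c r] by simp
  have "ennreal (vol n L * vol (p * n) T) \<le> ennreal (vol (Suc p * n) ?S)"
    unfolding e i[OF vol_nonneg, symmetric]
    by (rule nn_integral_mono_AE, rule AE_mp[OF AE_in_Rn], rule AE_I2) (use vs in blast)
  then show "vol n L * vol (p * n) T \<le> vol (Suc p * n) ?S" by (simp add: ennreal_le_iff vol_nonneg)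
  have "ennreal (vol (Suc p * n) ?S) \<le> ennreal (vol n (L + K) * vol (p * n) T)"
    unfolding e i[OF vol_nonneg, symmetric]
    by (rule nn_integral_mono_AE, rule AE_mp[OF AE_in_Rn], rule AE_I2) (use vs in blast)
  then show "vol (Suc p * n) ?S \<le> vol n (L + K) * vol (p * n) T" by (simp add: ennreal_le_iff vol_nonneg)
qed

text \<open>For m > 0 a finite limit forces the polynomial to vanish at 0, and division by s lowers
  m.\<close>

lemma coeff_of_limit:
  assumes "((\<lambda>s. poly F s / s ^ m) \<longlongrightarrow> c) (at_right (0::real))"
  shows "coeff F m = c"
  using assms
proof (induction m arbitrary: F)
  case 0
  have "((\<lambda>s. poly F s) \<longlongrightarrow> poly F 0) (at_right 0)" by (intro tendsto_intros)
  then show ?case using 0 tendsto_unique[of "at_right (0::real)"] by (auto simp: poly_0_coeff_0)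
next
  case (Suc m)
  obtain a G where F: "F = pCons a G" by (rule pCons_cases)
  have "((\<lambda>s. poly F s / s ^ Suc m * s ^ Suc m) \<longlongrightarrow> c * 0 ^ Suc m) (at_right 0)"
    by (rule tendsto_mult[OF Suc.prems]) (intro tendsto_intros)
  then have "((\<lambda>s. poly F s / s ^ Suc m * s ^ Suc m) \<longlongrightarrow> 0) (at_right 0)"
    by (simp only: power_0_Suc mult_zero_right)
  then have "((\<lambda>s. poly F s) \<longlongrightarrow> 0) (at_right 0)"
    by (rule Lim_transform_eventually[OF _ eventually_at_rightI[of 0 1]]) auto
  moreover have "((\<lambda>s. poly F s) \<longlongrightarrow> poly F 0) (at_right 0)" by (intro tendsto_intros)
  ultimately have "poly F 0 = 0" using tendsto_unique[of "at_right (0::real)"] by auto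
  then have a: "a = 0" by (simp add: F)
  have "((\<lambda>s. poly G s / s ^ m) \<longlongrightarrow> c) (at_right 0)"
    by (rule Lim_transform_eventually[OF Suc.prems eventually_at_rightI[of 0 1]]) (auto simp: F a)
  then show ?case using Suc.IH by (simp add: F)
qed

text \<open>Giving the reflected diagonal the index 0 puts all bodies of (B) into one family whose
  multiplicities match the \<open>p + 1\<close> factors of the product.\<close>

definition factor_body :: "nat \<Rightarrow> nat \<Rightarrow> (nat \<Rightarrow> real) set \<Rightarrow> nat \<Rightarrow> (nat \<Rightarrow> real) set"
  where "factor_body n p K j = (if j = 0 then uminus ` diag_embed n p ` K else factor_incl n j ` K)"

lemma body_factor_body: "convex_body n K \<Longrightarrow> j < Suc p \<Longrightarrow> convex_body (p * n) (factor_body n p K j)"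
  by (auto simp: factor_body_def intro: body_uminus body_diag body_factor)

lemma factor_body_combination:
  "diag_sum n p (uminus ` dil (c 0) K) (\<lambda>j. dil (c j) K) = (\<Sum>j<Suc p. dil (c j) (factor_body n p K j))"
proof -
  have "{..<Suc p} = insert 0 {1..p}" by auto
  moreover have "diag_embed n p ` uminus ` A = uminus ` diag_embed n p ` A" for A
    unfolding image_image by (intro image_cong refl) (auto simp: diag_embed_def)
  ultimately show ?thesis
    by (simp add: diag_sum_def factor_body_def linear_image_dil linear_uminus_fun linear_diag_embed linear_factor_incl)
qed

context
  fixes n p :: nat and L K :: "(nat \<Rightarrow> real) set"
  assumes n: "n > 0" and L: "convex_body n L" and K: "convex_body n K"
begin

abbreviation "prod_vol \<equiv> \<lambda>c. vol (Suc p * n) (diag_sum n (Suc p) L (\<lambda>j. dil (c (j - 1)) K))"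
abbreviation "fact_vol \<equiv> mvol (p * n) (Suc p) (factor_body n p K)"

text \<open>The general bounds with the first factor \<open>dil (c 0) K\<close> in the role of
  \<open>K\<close>; so the variable \<open>c 0\<close> of the product becomes the weight of the
  reflected diagonal.\<close>

lemma prod_vol_bounds:
  shows "vol n L * fact_vol c \<le> prod_vol c" and "prod_vol c \<le> vol n (L + dil (c 0) K) * fact_vol c"
proof -
  have eq: "diag_sum n (Suc p) L (\<lambda>j. if j = 1 then dil (c 0) K else dil (c (j - 1)) K) =
      diag_sum n (Suc p) L (\<lambda>j. dil (c (j - 1)) K)"
    by (rule diag_sum_cong) auto
  note b = diag_sum_volume_bounds[of n L "dil (c 0) K" p "\<lambda>j. dil (c j) K", OF n L body_dil[OF K] body_dil[OF K]]
  show "vol n L * fact_vol c \<le> prod_vol c" "prod_vol c \<le> vol n (L + dil (c 0) K) * fact_vol c"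
    using b unfolding eq mvol_def factor_body_combination by simp_all
qed

lemma prod_vol_expand:
  assumes c: "\<forall>i. 0 \<le> c i"
  shows "prod_vol c = (\<Sum>a\<in>mindex (Suc p) (Suc p * n). mcoeff (Suc p * n) (Suc p) prod_vol a * (\<Prod>j<Suc p. c j ^ a j))"
proof (rule multi_expand[OF _ c])
  fix c :: "nat \<Rightarrow> real" and j assume j: "j < Suc p" and c: "\<forall>i. 0 \<le> c i"
  \<comment> \<open>The diagonal body becomes one more summand, with its weight fixed at 1, so that
    \<open>prod_vol\<close> is a restriction of some \<open>mvol\<close> and hence polynomial in
    each variable.\<close>
  let ?B = "\<lambda>j. if j = Suc p then diag_embed n (Suc p) ` L else factor_incl n (Suc j) ` K"
  have B: "convex_body (Suc p * n) (?B j)" if "j < Suc (Suc p)" for j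
  proof (cases "j = Suc p")
    case True
    then show ?thesis using body_diag[OF L, of "Suc p"] by (simp only: if_True refl)
  next
    case False
    then have "Suc j \<le> Suc p" using that by simp
    then show ?thesis using body_factor[OF K, of "Suc j" "Suc p"] False by (simp only: if_False simp_thms)
  qed
  have e: "prod_vol c = mvol (Suc p * n) (Suc (Suc p)) ?B (c(Suc p := 1))" for c
  proof -
    have "(\<Sum>j\<in>{1..Suc p}. factor_incl n j ` dil (c (j - 1)) K) = (\<Sum>j\<in>{..<Suc p}. factor_incl n (Suc j) ` dil (c j) K)"
      by (rule sum.reindex_bij_witness[of _ Suc "\<lambda>j. j - 1"]) auto
    also have "\<dots> = (\<Sum>j<Suc p. dil ((c(Suc p := 1)) j) (?B j))"
      by (rule sum.cong) (auto simp: linear_image_dil linear_factor_incl)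
    finally show ?thesis unfolding mvol_def diag_sum_def sum.lessThan_Suc[of _ "Suc p"] by (simp add: add.commute del: sum.lessThan_Suc)
  qed
  have "pol (Suc p * n) (\<lambda>s. mvol (Suc p * n) (Suc (Suc p)) ?B ((c(Suc p := 1))(j := s)))"
    by (rule mvol_pol[OF B order_refl]) (use j c in auto)
  moreover have "(c(Suc p := 1))(j := s) = (c(j := s))(Suc p := 1)" for s using j by (auto simp: fun_eq_iff)
  ultimately show "pol (Suc p * n) (\<lambda>s. prod_vol (c(j := s)))" unfolding e by simp
next
  fix c c' :: "nat \<Rightarrow> real" assume "\<And>i. i < Suc p \<Longrightarrow> c i = c' i"
  then show "prod_vol c = prod_vol c'" by (intro arg_cong[of _ _ "vol (Suc p * n)"] diag_sum_cong) auto
qed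

text \<open>After division by s^(p n) the two bounds differ only in vol L against the volume of L +
  s c_0 K, which tends to vol L.\<close>

lemma fact_vol_limit:
  assumes c: "\<forall>i. 0 \<le> c i"
  shows "((\<lambda>s. prod_vol (\<lambda>i. s * c i) / s ^ (p * n)) \<longlongrightarrow> vol n L * fact_vol c) (at_right 0)"
proof -
  have V: "fact_vol (\<lambda>i. s * c i) = s ^ (p * n) * fact_vol c" if "s > 0" for s
    by (rule mvol_scale[OF body_factor_body[OF K] order_refl that])
  obtain q where q: "\<And>s. s \<ge> 0 \<Longrightarrow> vol n (L + dil s K) = poly q s"
    using vol_plus_dil_pol[OF L K] unfolding pol_def by blast
  have "vol n (L + dil (0 * c 0) K) = poly q (0 * c 0)" by (rule q) simp
  then have q0: "poly q (0 * c 0) = vol n L"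
    using dil_0[OF body_ne[OF K]] by (simp add: set_zero[symmetric] del: set_zero)
  have ev: "eventually (\<lambda>s::real. s > 0) (at_right 0)" by (rule eventually_at_right_less)
  show ?thesis
  proof (rule real_tendsto_sandwich)
    show "\<forall>\<^sub>F s in at_right 0. vol n L * fact_vol c \<le> prod_vol (\<lambda>i. s * c i) / s ^ (p * n)"
      using ev
    proof eventually_elim
      case (elim s)
      then show ?case using prod_vol_bounds(1)[of "\<lambda>i. s * c i"] V[OF elim] by (simp add: field_simps)
    qed
    show "\<forall>\<^sub>F s in at_right 0. prod_vol (\<lambda>i. s * c i) / s ^ (p * n) \<le> poly q (s * c 0) * fact_vol c"
      using ev
    proof eventually_elim
      case (elim s)
      have "vol n (L + dil (s * c 0) K) = poly q (s * c 0)" by (rule q) (use elim c in auto)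
      then show ?case using elim prod_vol_bounds(2)[of "\<lambda>i. s * c i"] V[OF elim] by (simp add: field_simps)
    qed
    have "((\<lambda>s. poly q (s * c 0) * fact_vol c) \<longlongrightarrow> poly q (0 * c 0) * fact_vol c) (at_right 0)"
      by (intro tendsto_intros)
    then show "((\<lambda>s. poly q (s * c 0) * fact_vol c) \<longlongrightarrow> vol n L * fact_vol c) (at_right 0)" unfolding q0 .
  qed (rule tendsto_const)
qed

text \<open>On the ray through a grid point the part of total degree p n collects in one coefficient
  of a polynomial in s, which the limit identifies. \<open>mcoeff_unique\<close> then separates the
  monomials of this degree by letting the grid point vary.\<close>

lemma mcoeff_prod_vol:
  assumes a: "a \<in> mindex (Suc p) (Suc p * n)" "(\<Sum>j<Suc p. a j) = p * n"
  shows "mcoeff (Suc p * n) (Suc p) prod_vol a = vol n L * mcoeff (Suc p * n) (Suc p) fact_vol a"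
proof -
  let ?q = "mcoeff (Suc p * n) (Suc p) prod_vol"
  have "mcoeff (Suc p * n) (Suc p) (\<lambda>c. vol n L * fact_vol c) a = (if (\<Sum>j<Suc p. a j) = p * n then ?q a else 0)"
  proof (rule mcoeff_unique[OF _ a(1)])
    fix g
    let ?F = "\<Sum>a\<in>mindex (Suc p) (Suc p * n). monom (?q a * (\<Prod>j<Suc p. nodes g j ^ a j)) (\<Sum>j<Suc p. a j)"
    have nn: "\<forall>i. 0 \<le> nodes g i" by (simp add: nodes_def)
    have F: "poly ?F s = prod_vol (\<lambda>i. s * nodes g i)" if "s > 0" for s
    proof -
      have "\<forall>i. 0 \<le> s * nodes g i" using that nn by simp
      then show ?thesis unfolding prod_vol_expand[OF \<open>\<forall>i. 0 \<le> s * nodes g i\<close>] poly_sum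
        by (intro sum.cong refl) (simp add: poly_monom power_mult_distrib prod.distrib power_sum mult_ac del: sum.lessThan_Suc prod.lessThan_Suc)
    qed
    have "((\<lambda>s. poly ?F s / s ^ (p * n)) \<longlongrightarrow> vol n L * fact_vol (nodes g)) (at_right 0)"
      by (rule Lim_transform_eventually[OF fact_vol_limit[OF nn] eventually_at_rightI[of 0 1]]) (simp_all only: F greaterThanLessThan_iff zero_less_one)
    then have "coeff ?F (p * n) = vol n L * fact_vol (nodes g)" by (rule coeff_of_limit)
    then show "vol n L * fact_vol (nodes g) = (\<Sum>a\<in>mindex (Suc p) (Suc p * n).
        (if (\<Sum>j<Suc p. a j) = p * n then ?q a else 0) * (\<Prod>j<Suc p. nodes g j ^ a j))"
      by (simp add: coeff_sum if_distrib if_distribR cong: if_cong del: sum.lessThan_Suc prod.lessThan_Suc)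
  qed
  then show ?thesis using a(2) by (simp add: mcoeff_def sum_distrib_left mult.assoc del: sum.lessThan_Suc)
qed

end

section \<open>Coefficients of the product as mixed volumes\<close>

lemma mcoeff_cong: "(\<And>j. j < q \<Longrightarrow> a j = b j) \<Longrightarrow> mcoeff d q Q a = mcoeff d q Q b"
  unfolding mcoeff_def by (intro sum.cong prod.cong refl arg_cong2[of _ _ _ _ "(*)"]) simp

lemma mixed_volume_blocks:
  assumes K: "\<And>j. j < q \<Longrightarrow> convex_body m (K j)" and s: "(\<Sum>j<q. \<alpha> j) = m" and d: "m \<le> d"
  shows "mixed_volume m (concat (map (\<lambda>j. replicate (\<alpha> j) (K j)) [0..<q])) =
    mcoeff d q (mvol m q K) \<alpha> * (\<Prod>j<q. fact (\<alpha> j)) / fact m"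
proof -
  \<comment> \<open>The index of the body at each list position. Blocks are formed by equal indices
    and not by equal sets, since distinct indices may carry the same body.\<close>
  define bl where "bl = concat (map (\<lambda>j. replicate (\<alpha> j) j) [0..<q])"
  have len: "length bl = m"
    unfolding bl_def s[symmetric] by (simp add: length_concat o_def interv_sum_list_conv_sum_set_nat atLeast0LessThan)
  have set: "set bl \<subseteq> {..<q}" by (auto simp: bl_def)
  have mp: "concat (map (\<lambda>j. replicate (\<alpha> j) (K j)) [0..<q]) = map K bl"
    by (simp add: bl_def map_concat o_def)
  have lf: "length (filter (\<lambda>y. y = j) (replicate k x)) = (if x = j then k else 0)" for j x :: nat and k
    by simp
  have cnt: "card {i. i < m \<and> bl ! i = j} = \<alpha> j" if "j < q" for j
  proof -
    have "card {i. i < m \<and> bl ! i = j} = length (filter (\<lambda>x. x = j) bl)"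
      by (simp add: length_filter_conv_card len)
    also have "\<dots> = (\<Sum>i<q. if i = j then \<alpha> j else 0)"
      unfolding bl_def filter_concat length_concat map_map o_def lf interv_sum_list_conv_sum_set_nat
      by (simp add: atLeast0LessThan cong: if_cong)
    finally show ?thesis using that by simp
  qed
  have "mixed_volume m (map K bl) =
      mcoeff d q (mvol m q K) (restrict (\<lambda>j. card {i. i < m \<and> bl ! i = j}) {..<q}) *
      (\<Prod>j<q. fact ((restrict (\<lambda>j. card {i. i < m \<and> bl ! i = j}) {..<q}) j)) / fact m"
  proof (rule mixed_volume_mcoeff[OF K d])
    fix i assume i: "i < m"
    then show "bl ! i < q" using set len by (metis lessThan_iff nth_mem subsetD)
    show "map K bl ! i = K (bl ! i)" using i len by simp
  qed
  also have "mcoeff d q (mvol m q K) (restrict (\<lambda>j. card {i. i < m \<and> bl ! i = j}) {..<q}) = mcoeff d q (mvol m q K) \<alpha>"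
    by (rule mcoeff_cong) (simp add: cnt)
  also have "(\<Prod>j<q. fact ((restrict (\<lambda>j. card {i. i < m \<and> bl ! i = j}) {..<q}) j)) = (\<Prod>j<q. fact (\<alpha> j) :: real)"
    by (rule prod.cong) (auto simp: cnt)
  finally show ?thesis unfolding mp .
qed

text \<open>The mixed volume in (B), with \<open>\<alpha> 0\<close> for k and
  \<open>\<alpha> j\<close> for n - k_j.\<close>

definition factor_volume :: "nat \<Rightarrow> nat \<Rightarrow> (nat \<Rightarrow> nat) \<Rightarrow> (nat \<Rightarrow> real) set \<Rightarrow> real"
  where "factor_volume n p \<alpha> K = mixed_volume (p * n) (concat (map (\<lambda>j. replicate (\<alpha> j) (factor_body n p K j)) [0..<Suc p]))"

text \<open>Each factor is an interpolation functional applied to the dilates of \<open>K\<close>.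
  By multilinearity the product is the tensor product of these functionals, that is
  \<open>mcoeff\<close>, applied to the volume of \<open>diag_sum\<close>. The condition on the sum
  of \<alpha> places this coefficient in degree p n.\<close>

lemma (in alesker) iprod_mixed_valuation:
  assumes K: "K \<in> smooth_convex_bodies n" and \<alpha>: "\<And>i. i \<le> p \<Longrightarrow> \<alpha> i \<le> n" and s: "(\<Sum>i<Suc p. \<alpha> i) = p * n"
    and L: "convex_body n L"
  shows "iprod P (\<lambda>i. mixed_valuation n (n - \<alpha> i) (replicate (\<alpha> i) K)) p L =
    of_real (vol n L * factor_volume n p \<alpha> K * fact (p * n) / (\<Prod>i<Suc p. fact (\<alpha> i) * real (n choose \<alpha> i)))"
proof -
  \<comment> \<open>The factors are interpolated with the degree bound of \<open>prod_vol\<close>,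
    not with their own degree n, since both have to use the same grid.\<close>
  let ?N = "Suc p * n"
  let ?c = "\<lambda>i g. of_real (coeff (lag ?N g) (\<alpha> i) / real (n choose \<alpha> i)) :: complex"
  let ?v = "\<lambda>g. vol_sum n (dil (real g + 1) K)"
  let ?Q = "\<lambda>c. vol ?N (diag_sum n (Suc p) L (\<lambda>j. dil (c (j - 1)) K))"
  have S: "dil (real g + 1) K \<in> smooth_convex_bodies n" for g by (rule smooth_body_dil[OF K]) simp
  note bK = smooth_body[OF K]
  have "iprod P (\<lambda>i. mixed_valuation n (n - \<alpha> i) (replicate (\<alpha> i) K)) p =
      iprod P (\<lambda>i. \<Sum>g\<in>{..?N}. scale_val (?c i g) (?v g)) p"
    by (rule iprod_cong) (rule mixed_valuation_replicate[OF bK \<alpha>], auto)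
  also have "\<dots> = (\<Sum>h\<in>mindex (Suc p) ?N. scale_val (\<Prod>i<Suc p. ?c i (h i)) (iprod P (\<lambda>i. ?v (h i)) p))"
    by (rule iprod_multilinear) (rule vol_sum_in_smooth_valuations[OF S])
  finally have "iprod P (\<lambda>i. mixed_valuation n (n - \<alpha> i) (replicate (\<alpha> i) K)) p L =
      (\<Sum>h\<in>mindex (Suc p) ?N. (\<Prod>i<Suc p. ?c i (h i)) * iprod P (\<lambda>i. ?v (h i)) p L)"
    by (simp only: sum_scale_val_apply)
  also have "\<dots> = (\<Sum>h\<in>mindex (Suc p) ?N. of_real (?Q (nodes h) * (\<Prod>i<Suc p. coeff (lag ?N (h i)) (\<alpha> i)) / (\<Prod>i<Suc p. real (n choose \<alpha> i))))"
  proof (rule sum.cong[OF refl])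
    fix h
    have "iprod P (\<lambda>i. ?v (h i)) p L = of_real (?Q (nodes h))"
      using iprod_vol_sum[of p "\<lambda>i. dil (real (h i) + 1) K", OF S] L by (simp add: nodes_def)
    then show "(\<Prod>i<Suc p. ?c i (h i)) * iprod P (\<lambda>i. ?v (h i)) p L =
        of_real (?Q (nodes h) * (\<Prod>i<Suc p. coeff (lag ?N (h i)) (\<alpha> i)) / (\<Prod>i<Suc p. real (n choose \<alpha> i)))"
      by (simp only: of_real_prod[symmetric] of_real_mult[symmetric] prod_dividef) (simp only: times_divide_eq_left times_divide_eq_right mult.commute)
  qed
  also have "\<dots> = of_real (mcoeff ?N (Suc p) ?Q \<alpha> / (\<Prod>i<Suc p. real (n choose \<alpha> i)))"
    by (simp only: mcoeff_def of_real_sum[symmetric] sum_divide_distrib)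
  also have "mcoeff ?N (Suc p) ?Q \<alpha> = mcoeff ?N (Suc p) ?Q (restrict \<alpha> {..<Suc p})"
    by (rule mcoeff_cong) simp
  also have "\<dots> = vol n L * mcoeff ?N (Suc p) (mvol (p * n) (Suc p) (factor_body n p K)) (restrict \<alpha> {..<Suc p})"
  proof (rule mcoeff_prod_vol[OF n L bK])
    have "\<alpha> i \<le> Suc p * n" if "i < Suc p" for i using \<alpha>[of i] that by simp
    then show "restrict \<alpha> {..<Suc p} \<in> mindex (Suc p) ?N" by auto
    show "(\<Sum>j<Suc p. restrict \<alpha> {..<Suc p} j) = p * n" unfolding s[symmetric] by (rule sum.cong) auto
  qed
  also have "mcoeff ?N (Suc p) (mvol (p * n) (Suc p) (factor_body n p K)) (restrict \<alpha> {..<Suc p}) =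
      mcoeff ?N (Suc p) (mvol (p * n) (Suc p) (factor_body n p K)) \<alpha>"
    by (rule mcoeff_cong) simp
  also have "\<dots> = factor_volume n p \<alpha> K * fact (p * n) / (\<Prod>i<Suc p. fact (\<alpha> i))"
  proof -
    have "factor_volume n p \<alpha> K =
        mcoeff ?N (Suc p) (mvol (p * n) (Suc p) (factor_body n p K)) \<alpha> * (\<Prod>j<Suc p. fact (\<alpha> j)) / fact (p * n)"
      unfolding factor_volume_def by (rule mixed_volume_blocks[OF body_factor_body[OF bK] s], assumption, rule mult_le_mono1) simp
    moreover have "(\<Prod>j<Suc p. fact (\<alpha> j)) \<noteq> (0 :: real)" by (simp del: prod.lessThan_Suc)
    ultimately show ?thesis by (simp del: prod.lessThan_Suc)
  qed
  finally show ?thesis by (simp add: prod.distrib mult_ac del: prod.lessThan_Suc)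
qed

subsection \<open>Continuity and approximation of the mixed volumes\<close>

lemma set_sum_mono: "finite I \<Longrightarrow> (\<And>i. i \<in> I \<Longrightarrow> A i \<subseteq> (B i :: 'a::comm_monoid_add set)) \<Longrightarrow> sum A I \<subseteq> sum B I"
proof (induction I rule: finite_induct)
  case (insert x F)
  have "A x + sum A F \<subseteq> B x + sum B F" by (intro set_plus_mono2 insert) auto
  then show ?case using insert by simp
qed simp

lemma sum_Box:
  "finite I \<Longrightarrow> (\<And>i. i \<in> I \<Longrightarrow> 0 \<le> r i) \<Longrightarrow> (\<Sum>i\<in>I. Box n (r i)) \<subseteq> Box n (\<Sum>i\<in>I. r i)"
proof (induction I rule: finite_induct)
  case empty
  then show ?case by (simp add: Box_def Rn_def)
next
  case (insert x F)
  have "Box n (r x) + (\<Sum>i\<in>F. Box n (r i)) \<subseteq> Box n (r x) + Box n (\<Sum>i\<in>F. r i)"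
    using insert by (intro set_plus_mono2) auto
  also have "\<dots> \<subseteq> Box n (r x + (\<Sum>i\<in>F. r i))" by (rule Box_plus)
  finally show ?case using insert by simp
qed

lemma factor_body_mono: "A \<subseteq> B \<Longrightarrow> factor_body n p A j \<subseteq> factor_body n p B j"
  by (auto simp: factor_body_def)

lemma factor_body_plus: "factor_body n p (A + B) j = factor_body n p A j + factor_body n p B j"
  by (simp add: factor_body_def linear_image_plus linear_uminus_fun linear_diag_embed linear_factor_incl)

lemma factor_body_Box:
  assumes "n > 0" "0 \<le> r" "j < Suc p" shows "factor_body n p (Box n r) j \<subseteq> Box (p * n) r"
proof
  fix x assume x: "x \<in> factor_body n p (Box n r) j"
  have "convex_body (p * n) (factor_body n p (Box n r) j)" by (rule body_factor_body[OF body_Box[OF assms(2)] assms(3)])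
  then have "x \<in> Rn (p * n)" using body_Rn x by blast
  moreover have "\<bar>x i\<bar> \<le> r" for i
  proof (cases "j = 0")
    case True
    have "i mod n < n" using assms(1) by simp
    then show ?thesis using x True assms(2) by (auto simp: factor_body_def diag_embed_def Box_def)
  next
    case False
    then have "j * n = (j - 1) * n + n" by (cases j) auto
    then have "i - (j - 1) * n < n" if "(j - 1) * n \<le> i" "i < j * n" using that by linarith
    then show ?thesis using x False assms(2) by (auto simp: factor_body_def factor_incl_def Box_def)
  qed
  ultimately show "x \<in> Box (p * n) r" by (simp add: Box_def)
qed

lemma factor_combination_approx:
  assumes n: "n > 0" and r: "0 \<le> r" and S: "S \<subseteq> K + Box n r" and c: "\<forall>i. 0 \<le> c i"
  shows "(\<Sum>j<Suc p. dil (c j) (factor_body n p S j)) \<subseteq>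
    (\<Sum>j<Suc p. dil (c j) (factor_body n p K j)) + Box (p * n) ((\<Sum>j<Suc p. c j) * r)"
proof -
  have "(\<Sum>j<Suc p. dil (c j) (factor_body n p S j)) \<subseteq> (\<Sum>j<Suc p. dil (c j) (factor_body n p K j) + Box (p * n) (c j * r))"
  proof (rule set_sum_mono[OF finite_lessThan])
    fix j assume j: "j \<in> {..<Suc p}"
    have "dil (c j) (factor_body n p S j) \<subseteq> dil (c j) (factor_body n p (K + Box n r) j)"
      by (intro dil_mono factor_body_mono S)
    also have "\<dots> = dil (c j) (factor_body n p K j) + dil (c j) (factor_body n p (Box n r) j)"
      by (simp only: factor_body_plus dil_set_plus)
    also have "\<dots> \<subseteq> dil (c j) (factor_body n p K j) + Box (p * n) (c j * r)"
    proof (rule set_plus_mono2[OF order_refl])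
      have "dil (c j) (factor_body n p (Box n r) j) \<subseteq> dil (c j) (Box (p * n) r)"
        by (rule dil_mono) (rule factor_body_Box[OF n r], use j in simp)
      also have "\<dots> \<subseteq> Box (p * n) (c j * r)" by (rule dil_Box) (use c r in auto)
      finally show "dil (c j) (factor_body n p (Box n r) j) \<subseteq> Box (p * n) (c j * r)" .
    qed
    finally show "dil (c j) (factor_body n p S j) \<subseteq> dil (c j) (factor_body n p K j) + Box (p * n) (c j * r)" .
  qed
  also have "\<dots> = (\<Sum>j<Suc p. dil (c j) (factor_body n p K j)) + (\<Sum>j<Suc p. Box (p * n) (c j * r))"
    by (rule sum.distrib)
  also have "\<dots> \<subseteq> (\<Sum>j<Suc p. dil (c j) (factor_body n p K j)) + Box (p * n) (\<Sum>j<Suc p. c j * r)"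
    by (rule set_plus_mono2[OF order_refl sum_Box]) (use c r in auto)
  finally show ?thesis by (simp only: sum_distrib_right)
qed

lemma factor_volume_mcoeff:
  assumes "convex_body n K" "(\<Sum>j<Suc p. \<alpha> j) = p * n"
  shows "factor_volume n p \<alpha> K =
    mcoeff (p * n) (Suc p) (mvol (p * n) (Suc p) (factor_body n p K)) \<alpha> * (\<Prod>j<Suc p. fact (\<alpha> j)) / fact (p * n)"
  unfolding factor_volume_def by (rule mixed_volume_blocks[OF body_factor_body[OF assms(1)] assms(2) order_refl])

text \<open>As \<open>mcoeff\<close> involves only finitely many values of \<open>mvol\<close>,
  convergence of volumes of Minkowski combinations is enough, and these are squeezed by an outer
  approximation.\<close>

lemma factor_volume_tendsto:
  assumes n: "n > 0" and K: "convex_body n K" and S: "\<And>i. convex_body n (S i)" "\<And>i. K \<subseteq> S i"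
    "\<And>i. S i \<subseteq> K + Box n (1 / real (Suc i))" and s: "(\<Sum>j<Suc p. \<alpha> j) = p * n"
  shows "(\<lambda>i. factor_volume n p \<alpha> (S i)) \<longlonglongrightarrow> factor_volume n p \<alpha> K"
proof -
  have "(\<lambda>i. mvol (p * n) (Suc p) (factor_body n p (S i)) c) \<longlonglongrightarrow> mvol (p * n) (Suc p) (factor_body n p K) c"
    if c: "\<forall>i. 0 \<le> c i" for c
  proof -
    let ?T = "\<lambda>A. \<Sum>j<Suc p. dil (c j) (factor_body n p A j)"
    let ?C = "\<Sum>j<Suc p. c j"
    have T: "convex_body (p * n) (?T A)" if "convex_body n A" for A
      by (rule body_combination[OF body_factor_body[OF that]])
    have C: "?C \<ge> 0" using c by (intro sum_nonneg) auto
    have "?T (S i) \<subseteq> ?T K + Box (p * n) (?C / real (Suc i))" for i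
      using factor_combination_approx[OF n _ S(3) c, of i p] by simp
    then have u: "vol (p * n) (?T (S i)) \<le> vol (p * n) (?T K + Box (p * n) (?C / real (Suc i)))" for i
      by (intro vol_mono_body T S(1) body_plus K body_Box) (use C in auto)
    have l: "vol (p * n) (?T K) \<le> vol (p * n) (?T (S i))" for i
      by (intro vol_mono_body T S(1) K set_sum_mono dil_mono factor_body_mono S(2)) auto
    show ?thesis unfolding mvol_def
      by (rule real_tendsto_sandwich[OF _ _ tendsto_const vol_plus_Box_tendsto[OF body_compact[OF T[OF K]] body_Rn[OF T[OF K]] C]])
        (intro always_eventually allI l u)+
  qed
  then have "(\<lambda>i. mcoeff (p * n) (Suc p) (mvol (p * n) (Suc p) (factor_body n p (S i))) \<alpha>) \<longlonglongrightarrow>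
      mcoeff (p * n) (Suc p) (mvol (p * n) (Suc p) (factor_body n p K)) \<alpha>"
    unfolding mcoeff_def by (intro tendsto_sum tendsto_mult tendsto_const) (auto simp: nodes_def)
  then show ?thesis
    unfolding factor_volume_mcoeff[OF S(1) s] factor_volume_mcoeff[OF K s] by (intro tendsto_intros) auto
qed

lemma factor_volume_le_approx:
  assumes n: "n > 0" and K: "convex_body n K" and s: "(\<Sum>j<Suc p. \<alpha> j) = p * n"
    and le: "\<And>S. S \<in> smooth_convex_bodies n \<Longrightarrow> factor_volume n p \<alpha> S \<le> C * vol n S ^ p"
  shows "factor_volume n p \<alpha> K \<le> C * vol n K ^ p"
proof -
  have "\<exists>S. S \<in> smooth_convex_bodies n \<and> K \<subseteq> S \<and> S \<subseteq> K + Box n (1 / real (Suc i))" for i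
    using smooth_approx[OF K, of "1 / real (Suc i)"] by (metis of_nat_0_less_iff zero_less_Suc zero_less_divide_1_iff)
  then obtain S where S: "\<And>i. S i \<in> smooth_convex_bodies n" "\<And>i. K \<subseteq> S i" "\<And>i. S i \<subseteq> K + Box n (1 / real (Suc i))"
    by metis
  note b = smooth_body[OF S(1)]
  have "(\<lambda>i. vol n (S i)) \<longlonglongrightarrow> vol n K"
  proof (rule real_tendsto_sandwich[OF _ _ tendsto_const])
    show "\<forall>\<^sub>F i in sequentially. vol n K \<le> vol n (S i)"
      by (intro always_eventually allI vol_mono_body K b S)
    show "\<forall>\<^sub>F i in sequentially. vol n (S i) \<le> vol n (K + Box n (1 / real (Suc i)))"
      by (intro always_eventually allI vol_mono_body K b S body_plus body_Box) simp
    show "(\<lambda>i. vol n (K + Box n (1 / real (Suc i)))) \<longlonglongrightarrow> vol n K"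
      by (rule vol_plus_Box_tendsto[OF body_compact[OF K] body_Rn[OF K]]) simp
  qed
  then have "(\<lambda>i. C * vol n (S i) ^ p) \<longlonglongrightarrow> C * vol n K ^ p" by (intro tendsto_intros)
  moreover have "(\<lambda>i. factor_volume n p \<alpha> (S i)) \<longlonglongrightarrow> factor_volume n p \<alpha> K"
    by (rule factor_volume_tendsto[OF n K b S(2,3) s])
  ultimately show ?thesis using le[OF S(1)] by (intro LIMSEQ_le) auto
qed

subsection \<open>The equivalence\<close>

lemma sum_complement:
  assumes "\<And>i. i \<le> p \<Longrightarrow> k i \<le> n" "(\<Sum>i\<le>p. k i) = n" shows "(\<Sum>i<Suc p. n - k i) = p * (n :: nat)"
proof -
  have "(\<Sum>i\<le>p. n - k i) + (\<Sum>i\<le>p. k i) = (\<Sum>i\<le>p. n)"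
    unfolding sum.distrib[symmetric] by (rule sum.cong) (use assms(1) in auto)
  then show ?thesis using assms(2) by (simp add: lessThan_Suc_atMost)
qed

lemma summand_le: "(\<Sum>i\<le>p. k i) = n \<Longrightarrow> i \<le> (p :: nat) \<Longrightarrow> k i \<le> (n :: nat)"
  using member_le_sum[of i "{..p}" k] by auto

text \<open>Both sides are multiples of \<open>vol n L\<close>, and some body has positive volume,
  so the inequality between functions is one between their factors.\<close>

lemma (in alesker) product_le_iff:
  assumes K: "K \<in> smooth_convex_bodies n" and k: "(\<Sum>i\<le>p. k i) = n"
  shows "(\<forall>L. convex_body n L \<longrightarrow> iprod P (\<lambda>i. mixed_valuation n (k i) (replicate (n - k i) K)) p L
      \<le> complex_of_real (vol n K ^ p * vol n L)) \<longleftrightarrow>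
    factor_volume n p (\<lambda>i. n - k i) K \<le> fact n ^ Suc p / (fact (p * n) * (\<Prod>i\<le>p. fact (k i))) * vol n K ^ p"
    (is "?A \<longleftrightarrow> ?B")
proof -
  note kn = summand_le[OF k]
  let ?V = "factor_volume n p (\<lambda>i. n - k i) K"
  let ?D = "fact n ^ Suc p / (\<Prod>i\<le>p. fact (k i)) :: real"
  have D: "?D > 0" by (simp add: prod_pos)
  \<comment> \<open>Each factor is n! / k_i!, as (n - k)! times \<open>n choose (n - k)\<close>
    cancels all but k! in the denominator.\<close>
  have den: "(\<Prod>i<Suc p. fact (n - k i) * real (n choose (n - k i))) = ?D"
  proof -
    have "(\<Prod>i<Suc p. fact (n - k i) * real (n choose (n - k i))) = (\<Prod>i\<le>p. fact n / fact (k i))"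
      unfolding lessThan_Suc_atMost by (rule prod.cong) (use kn in \<open>auto simp: binomial_fact\<close>)
    then show ?thesis by (simp only: prod_dividef prod_constant card_atMost)
  qed
  have e: "iprod P (\<lambda>i. mixed_valuation n (k i) (replicate (n - k i) K)) p L = of_real (vol n L * ?V * fact (p * n) / ?D)"
    if L: "convex_body n L" for L
  proof -
    have "iprod P (\<lambda>i. mixed_valuation n (n - (n - k i)) (replicate (n - k i) K)) p L =
        of_real (vol n L * ?V * fact (p * n) / (\<Prod>i<Suc p. fact (n - k i) * real (n choose (n - k i))))"
      by (rule iprod_mixed_valuation[OF K _ sum_complement[OF kn k] L]) auto
    moreover have "iprod P (\<lambda>i. mixed_valuation n (n - (n - k i)) (replicate (n - k i) K)) p =
        iprod P (\<lambda>i. mixed_valuation n (k i) (replicate (n - k i) K)) p"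
      by (rule iprod_cong) (use kn in auto)
    ultimately show ?thesis unfolding den by simp
  qed
  \<comment> \<open>The order on complex numbers compares real parts and requires equal imaginary
    parts, which are 0 on both sides.\<close>
  have "?A \<longleftrightarrow> (\<forall>L. convex_body n L \<longrightarrow> vol n L * ?V * fact (p * n) / ?D \<le> vol n K ^ p * vol n L)"
    by (intro all_cong imp_cong refl) (simp only: e less_eq_complex_def Re_complex_of_real Im_complex_of_real simp_thms)
  also have "\<dots> \<longleftrightarrow> ?V * fact (p * n) / ?D \<le> vol n K ^ p"
  proof
    assume a: "\<forall>L. convex_body n L \<longrightarrow> vol n L * ?V * fact (p * n) / ?D \<le> vol n K ^ p * vol n L"
    obtain L where L: "L \<in> smooth_convex_bodies n" "vol n L > 0" by (rule exists_smooth_body)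
    have "vol n L * (?V * fact (p * n) / ?D) \<le> vol n L * vol n K ^ p"
      using a smooth_body[OF L(1)] by (simp add: mult_ac)
    then show "?V * fact (p * n) / ?D \<le> vol n K ^ p" using L(2) by (simp only: mult_le_cancel_left_pos)
  next
    assume a: "?V * fact (p * n) / ?D \<le> vol n K ^ p"
    show "\<forall>L. convex_body n L \<longrightarrow> vol n L * ?V * fact (p * n) / ?D \<le> vol n K ^ p * vol n L"
      using mult_left_mono[OF a vol_nonneg] by (simp add: mult_ac)
  qed
  also have "\<dots> \<longleftrightarrow> ?V \<le> ?D / fact (p * n) * vol n K ^ p"
  proof -
    have "v * f / d \<le> x \<longleftrightarrow> v \<le> d / f * x" if "d > 0" "f > 0" for v f d x :: real
      using that by (simp add: field_simps)
    from this[OF D fact_gt_zero] show ?thesis .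
  qed
  finally show ?thesis by (simp add: mult_ac del: power_Suc)
qed

lemma factor_volume_eq:
  assumes "\<And>i. i \<in> {1..p} \<Longrightarrow> \<alpha> i = n - ks i" "\<alpha> 0 = k"
  shows "factor_volume n p \<alpha> K = mixed_volume (p * n)
    (replicate k (uminus ` diag_embed n p ` K) @ concat (map (\<lambda>j. replicate (n - ks j) (factor_incl n j ` K)) [1..<Suc p]))"
proof -
  have "[0..<Suc p] = 0 # [1..<Suc p]" by (simp add: upt_conv_Cons)
  moreover have "map (\<lambda>j. replicate (\<alpha> j) (factor_body n p K j)) [1..<Suc p] =
      map (\<lambda>j. replicate (n - ks j) (factor_incl n j ` K)) [1..<Suc p]"
    by (rule map_cong) (use assms(1) in \<open>auto simp: factor_body_def\<close>)
  moreover have "factor_body n p K 0 = uminus ` diag_embed n p ` K" by (simp add: factor_body_def)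
  ultimately show ?thesis unfolding factor_volume_def by (simp only: list.map concat.simps assms(2))
qed

text \<open>The multinomial coefficient contributes k!, and \<open>n choose k\<close> times k! is n!
  / (n - k)!; its denominator is the factorial missing from the product over 1, ..., p.\<close>

lemma constants_eq:
  assumes "k \<le> n"
  shows "real (n choose k) * (fact k / (\<Prod>i=1..p. fact (ks i))) * (fact n ^ p / fact (p * n)) =
    fact n ^ Suc p / (fact (p * n) * (\<Prod>i\<le>p. fact ((ks(0 := n - k)) i)))"
proof -
  have "{..p} = insert 0 {1..p}" by auto
  then have "(\<Prod>i\<le>p. fact ((ks(0 := n - k)) i)) = fact (n - k) * (\<Prod>i\<in>{1..p}. fact ((ks(0 := n - k)) i) :: real)" by simp
  also have "(\<Prod>i\<in>{1..p}. fact ((ks(0 := n - k)) i)) = (\<Prod>i=1..p. fact (ks i) :: real)" by (rule prod.cong) auto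
  finally show ?thesis using assms by (simp add: binomial_fact)
qed

theorem proposition5p1:
  fixes P :: "nat \<Rightarrow> ((nat \<Rightarrow> real) set \<Rightarrow> complex) \<Rightarrow> ((nat \<Rightarrow> real) set \<Rightarrow> complex) \<Rightarrow>
    ((nat \<Rightarrow> real) set \<Rightarrow> complex)"
  assumes P: "\<And>n. n \<ge> 2 \<Longrightarrow> is_alesker_product n (P n)"
  shows
    "(\<forall>n\<ge>2. \<forall>K \<in> smooth_convex_bodies n. \<forall>p\<ge>1. \<forall>k :: nat \<Rightarrow> nat. (\<Sum>i\<le>p. k i) = n \<longrightarrow>
        (let \<phi> = (\<lambda>i. mixed_valuation n (k i) (replicate (n - k i) K)) in
          \<forall>L. convex_body n L \<longrightarrow>
            foldl (P n) (\<phi> 0) (map \<phi> [1..<Suc p]) L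
              \<le> complex_of_real (vol n K ^ p * vol n L)))
     \<longleftrightarrow>
     (\<forall>n\<ge>2. \<forall>K. convex_body n K \<longrightarrow> (\<forall>p\<ge>1. \<forall>k. \<forall>ks :: nat \<Rightarrow> nat.
        k \<le> n \<and> (\<forall>i\<in>{1..p}. ks i \<le> n) \<and> (\<Sum>i=1..p. ks i) = k \<longrightarrow>
          mixed_volume (p * n)
            (replicate k (uminus ` diag_embed n p ` K) @
             concat (map (\<lambda>j. replicate (n - ks j) (factor_incl n j ` K)) [1..<Suc p]))
          \<le> real (n choose k) * (fact k / (\<Prod>i=1..p. fact (ks i))) *
             (fact n ^ p / fact (p * n)) * vol n K ^ p))"
    (is "?A \<longleftrightarrow> ?B")
proof -
  \<comment> \<open>The common form of both statements: (A) asserts it for smooth bodies, (B) for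
    all convex bodies.\<close>
  define bound where "bound n p k K \<longleftrightarrow>
    factor_volume n p (\<lambda>i. n - k i) K \<le> fact n ^ Suc p / (fact (p * n) * (\<Prod>i\<le>p. fact (k i))) * vol n K ^ p"
    for n p and k :: "nat \<Rightarrow> nat" and K
  have A: "?A \<longleftrightarrow> (\<forall>n\<ge>2. \<forall>K \<in> smooth_convex_bodies n. \<forall>p\<ge>1. \<forall>k. (\<Sum>i\<le>p. k i) = n \<longrightarrow> bound n p k K)"
    unfolding Let_def iprod_def[symmetric] bound_def
  proof (intro all_cong ball_cong refl)
    fix n K p and k :: "nat \<Rightarrow> nat" assume h: "2 \<le> n" "K \<in> smooth_convex_bodies n" "(\<Sum>i\<le>p. k i) = n"
    interpret alesker n "P n" using h(1) P[OF h(1)] by unfold_locales auto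
    show "(\<forall>L. convex_body n L \<longrightarrow> iprod (P n) (\<lambda>i. mixed_valuation n (k i) (replicate (n - k i) K)) p L
        \<le> complex_of_real (vol n K ^ p * vol n L)) \<longleftrightarrow>
      factor_volume n p (\<lambda>i. n - k i) K \<le> fact n ^ Suc p / (fact (p * n) * (\<Prod>i\<le>p. fact (k i))) * vol n K ^ p"
      by (rule product_le_iff[OF h(2,3)])
  qed
  \<comment> \<open>The exponent with index 0 is absent from (B) and recovered as n - k, whatever
    value \<open>ks 0\<close> has.\<close>
  have B: "mixed_volume (p * n) (replicate k (uminus ` diag_embed n p ` K) @
       concat (map (\<lambda>j. replicate (n - ks j) (factor_incl n j ` K)) [1..<Suc p]))
     \<le> real (n choose k) * (fact k / (\<Prod>i=1..p. fact (ks i))) * (fact n ^ p / fact (p * n)) * vol n K ^ p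
     \<longleftrightarrow> bound n p (ks(0 := n - k)) K" if "k \<le> n" for n p k K and ks :: "nat \<Rightarrow> nat"
    unfolding bound_def constants_eq[OF that]
    using factor_volume_eq[of p "\<lambda>i. n - (ks(0 := n - k)) i" n ks k K] that by simp
  have s0: "(\<Sum>i\<le>p. f i) = f 0 + (\<Sum>i=1..p. f i)" for f :: "nat \<Rightarrow> nat" and p
  proof -
    have "{..p} = insert 0 {1..p}" by auto
    then show ?thesis by simp
  qed
  show ?thesis
    unfolding A
  proof (intro iffI allI impI ballI)
    fix n K p k and ks :: "nat \<Rightarrow> nat"
    assume a: "\<forall>n\<ge>2. \<forall>K \<in> smooth_convex_bodies n. \<forall>p\<ge>1. \<forall>k. (\<Sum>i\<le>p. k i) = n \<longrightarrow> bound n p k K"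
      and h: "2 \<le> n" "convex_body n K" "1 \<le> p" "k \<le> n \<and> (\<forall>i\<in>{1..p}. ks i \<le> n) \<and> (\<Sum>i=1..p. ks i) = k"
    let ?k = "ks(0 := n - k)"
    have "(\<Sum>i=1..p. ?k i) = (\<Sum>i=1..p. ks i)" by (rule sum.cong) auto
    then have s: "(\<Sum>i\<le>p. ?k i) = n" unfolding s0 using h(4) by simp
    have "bound n p ?k K" unfolding bound_def
    proof (rule factor_volume_le_approx[OF _ h(2)])
      show "n > 0" using h(1) by simp
      show "(\<Sum>i<Suc p. n - ?k i) = p * n" by (rule sum_complement[OF summand_le[OF s] s])
      fix S assume "S \<in> smooth_convex_bodies n"
      then show "factor_volume n p (\<lambda>i. n - ?k i) S \<le> fact n ^ Suc p / (fact (p * n) * (\<Prod>i\<le>p. fact (?k i))) * vol n S ^ p"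
        using a h(1,3) s unfolding bound_def by blast
    qed
    then show "mixed_volume (p * n) (replicate k (uminus ` diag_embed n p ` K) @
       concat (map (\<lambda>j. replicate (n - ks j) (factor_incl n j ` K)) [1..<Suc p]))
     \<le> real (n choose k) * (fact k / (\<Prod>i=1..p. fact (ks i))) * (fact n ^ p / fact (p * n)) * vol n K ^ p"
      using B h(4) by blast
  next
    fix n K p and k :: "nat \<Rightarrow> nat"
    assume b: ?B and h: "2 \<le> n" "K \<in> smooth_convex_bodies n" "1 \<le> p" "(\<Sum>i\<le>p. k i) = n"
    note kn = summand_le[OF h(4)]
    have s: "(\<Sum>i=1..p. k i) = n - k 0" using h(4) unfolding s0 by simp
    have c: "n - k 0 \<le> n \<and> (\<forall>i\<in>{1..p}. k i \<le> n) \<and> (\<Sum>i=1..p. k i) = n - k 0" using kn s by simp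
    have "k(0 := n - (n - k 0)) = k" using kn[of 0] by auto
    moreover have "bound n p (k(0 := n - (n - k 0))) K"
      using b[rule_format, OF h(1) smooth_body[OF h(2)] h(3) c] B[of "n - k 0" n] c by blast
    ultimately show "bound n p k K" by simp
  qed
qed

end
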